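(* Assume $X=(X_1,X_2)$ is affine with compact state space $E\subseteq\mathbb N^2$ whose affine span is $\mathbb R^2$, and that the coordinate projections $\pi_1,\pi_2$, $\pi_j(x)=x_j$, are normalized jump counters of $X$. Let $S$ be the set of possible jump sizes of $X$. Then $X$ is of one of the following three types: (i) Up to a further affine transformation (i.e. after replacing $X$, $E$, $S$ by those of $T(X)$ for some invertible affine map $T\colon\mathbb R^2\to\mathbb R^2$), $E$ has a layer structure in the sense that $E_0=\{x\in E\colon x_2=0\}$ is stochastically invariant and $\pi_2(u)\le0$ for every $u\in S$, so that there are no upward jumps. Thus there are at most $N=\max\{x_2\colon x\in E\}$ downward jumps, after which the process arrives in $E_0$ and stays there. Moreover, we have $$\{(-1,0)\}\subseteq S\subseteq\{(-1,0),(1,0)\}\cup\{(K,-1)\colon K\in\mathbb N\}.$$ (ii) $X_1$ and $X_2$ are independent affine processes, and $$\{(-1,0),(0,-1)\}\subseteq S\subseteq\{(-1,0),(0,-1),(1,0),(0,1)\}.$$ All normalized jump counters apart from $\pi_1$ and $\pi_2$ are of the form $N-\pi_1$ or $K-\pi_2$ for some $N,K\in\mathbb N$. (iii) The set of normalized jump counters is either $\{\pi_1,\pi_2\}$ or $\{\pi_0,\pi_1,\pi_2\}$, where $\pi_0=N-\pi_1-\pi_2$ for some $N\in\mathbb N$. The set $S$ satisfies $$S\subseteq\{(-1,0),(-1,1),(0,-1),(0,1),(1,-1),(1,0)\}.$$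
   Context: Setting. $(\Omega,\mathcal F)$ is a measurable space with a right-continuous filtration $(\mathcal F_t)_{t\ge0}$; $d\ge1$ (here $d=2$); $E\subseteq\mathbb R^d$ is nonempty and measurable (the state space); $X=(X_t)_{t\ge0}$ is a càdlàg adapted process with values in $E$, with the convention $X_{0-}=X_0$; $(\mathbb P_x)_{x\in E}$ is a family of probability measures on $\mathcal F$ such that for each $x\in E$, $X$ is a $\mathbb P_x$-semimartingale with $\mathbb P_x(X_0=x)=1$. Notation: $\mathbb N=\{0,1,2,\ldots\}$; $\mathbb S^d$ is the set of symmetric $d\times d$ matrices; $\mathfrak M^d_*$ is the vector space of all signed Radon measures on $\mathbb R^d\setminus\{0\}$, i.e. set functions $\mu_+-\mu_-$ with $\mu_\pm$ positive measures on $\mathbb R^d\setminus\{0\}$ that assign finite mass to compact subsets. Affine process. $X$ is affine with triplet $(b,c,F)$ if $b\colon\mathbb R^d\to\mathbb R^d$, $c\colon\mathbb R^d\to\mathbb S^d$, $F\colon\mathbb R^d\to\mathfrak M^d_*$ are affine maps such that for each $x\in E$: $c(x)$ is positive semidefinite, $F(x,d\xi)$ is a positive measure on $\mathbb R^d\setminus\{0\}$ with $\int(\|\xi\|^2\wedge1)F(x,d\xi)<\infty$, and the semimartingale characteristics $(B,C,\nu)$ of $X$ under $\mathbb P_x$ are $B_t=\int_0^tb(X_{s-})ds$, $C_t=\int_0^tc(X_{s-})ds$, $\nu(dt,d\xi)=F(X_{t-},d\xi)dt$ (the choice of truncation function is irrelevant). For an affine image $Y=f(X)$ of $X$, being an affine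 process is understood in the same sense: under every $\mathbb P_x$, $x\in E$, the characteristics of $Y$ are given by a triplet of affine maps evaluated at $Y_{t-}$, with state space $f(E)$. Jump counters. The set of possible jump sizes of $X$ is $S=\bigcup_{x\in E}\operatorname{supp}(F(x,\cdot))\setminus\{0\}$. A jump counter corresponding to $u\in S$ is an affine function $\psi_u\colon\mathbb R^d\to\mathbb R$, not identically zero, such that $\psi_u\ge0$ on $E$, and $x\in E$, $\psi_u(x)>0$ imply $x+u\in E$. It is normalized if $\psi_u(u)-\psi_u(0)=-1$. A normalized jump counter of $X$ is one corresponding to some $u\in S$. For an invertible affine map $T$, the transformed process $T(X)$ is affine with state space $T(E)$ and its set of possible jump sizes is $\{T(u)-T(0)\colon u\in S\}$. A set $E_0\subseteq E$ is stochastically invariant if for all $x\in E_0$, $X$ stays in $E_0$ for all times $\mathbb P_x$-a.s. *)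

theory Defs
  imports "HOL-Probability.Probability"
begin

section \<open>Stochastic bases, martingales, semimartingales\<close>

text \<open>
  Processes are functions \<open>real \<Rightarrow> 'w \<Rightarrow> _\<close>, filtrations are functions \<open>real \<Rightarrow> 'w measure\<close>; only times
  \<open>t \<ge> 0\<close> matter. As in Jacod and Shiryaev, the filtration need not be complete, and path
  properties of the auxiliary processes (martingale parts, finite variation parts) are
  required almost surely.
\<close>

definition right_cont_filtration :: "'w measure \<Rightarrow> (real \<Rightarrow> 'w measure) \<Rightarrow> bool" where
  "right_cont_filtration M Fi \<longleftrightarrow>
     (\<forall>t\<ge>0. subalgebra M (Fi t)) \<and>
     (\<forall>s t. 0 \<le> s \<and> s \<le> t \<longrightarrow> sets (Fi s) \<subseteq> sets (Fi t)) \<and>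
     (\<forall>t\<ge>0. sets (Fi t) = (\<Inter>s\<in>{t<..}. sets (Fi s)))"

definition adapted :: "(real \<Rightarrow> 'w measure) \<Rightarrow> (real \<Rightarrow> 'w \<Rightarrow> 'a::topological_space) \<Rightarrow> bool" where
  "adapted Fi X \<longleftrightarrow> (\<forall>t\<ge>0. X t \<in> borel_measurable (Fi t))"

definition cadlag :: "(real \<Rightarrow> 'a::topological_space) \<Rightarrow> bool" where
  "cadlag f \<longleftrightarrow> (\<forall>t\<ge>0. (f \<longlongrightarrow> f t) (at_right t)) \<and> (\<forall>t>0. \<exists>l. (f \<longlongrightarrow> l) (at_left t))"

definition left_lim :: "(real \<Rightarrow> 'a::t2_space) \<Rightarrow> real \<Rightarrow> 'a" where
  "left_lim f t = (if t \<le> 0 then f 0 else Lim (at_left t) f)"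

definition jump :: "(real \<Rightarrow> 'a::real_normed_vector) \<Rightarrow> real \<Rightarrow> 'a" where
  "jump f t = f t - left_lim f t"

definition martingale ::
  "'w measure \<Rightarrow> (real \<Rightarrow> 'w measure) \<Rightarrow> (real \<Rightarrow> 'w \<Rightarrow> real) \<Rightarrow> bool" where
  "martingale P Fi N \<longleftrightarrow>
     adapted Fi N \<and> (AE \<omega> in P. cadlag (\<lambda>t. N t \<omega>)) \<and> (\<forall>t\<ge>0. integrable P (N t)) \<and>
     (\<forall>s t. 0 \<le> s \<and> s \<le> t \<longrightarrow> (AE \<omega> in P. real_cond_exp P (Fi s) (N t) \<omega> = N s \<omega>))"

text \<open>
  Localizing sequences consist of finite stopping times, which is no restriction, since
  \<open>\<tau> n\<close> may be replaced by \<open>min (\<tau> n) n\<close>.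
\<close>
definition localizing_sequence ::
  "'w measure \<Rightarrow> (real \<Rightarrow> 'w measure) \<Rightarrow> (nat \<Rightarrow> 'w \<Rightarrow> real) \<Rightarrow> bool" where
  "localizing_sequence P Fi \<tau> \<longleftrightarrow>
     (\<forall>n. stopping_time Fi (\<tau> n) \<and> (\<forall>\<omega>. 0 \<le> \<tau> n \<omega>)) \<and>
     (AE \<omega> in P. incseq (\<lambda>n. \<tau> n \<omega>) \<and> filterlim (\<lambda>n. \<tau> n \<omega>) at_top sequentially)"

definition local_martingale ::
  "'w measure \<Rightarrow> (real \<Rightarrow> 'w measure) \<Rightarrow> (real \<Rightarrow> 'w \<Rightarrow> real) \<Rightarrow> bool" where
  "local_martingale P Fi N \<longleftrightarrow>
     adapted Fi N \<and> (AE \<omega> in P. cadlag (\<lambda>t. N t \<omega>)) \<and>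
     (\<exists>\<tau>. localizing_sequence P Fi \<tau> \<and> (\<forall>n. martingale P Fi (\<lambda>t \<omega>. N (min t (\<tau> n \<omega>)) \<omega>)))"

definition cont_local_martingale ::
  "'w measure \<Rightarrow> (real \<Rightarrow> 'w measure) \<Rightarrow> (real \<Rightarrow> 'w \<Rightarrow> real) \<Rightarrow> bool" where
  "cont_local_martingale P Fi N \<longleftrightarrow>
     local_martingale P Fi N \<and> (AE \<omega> in P. continuous_on {0..} (\<lambda>t. N t \<omega>))"

definition purely_disc_local_martingale ::
  "'w measure \<Rightarrow> (real \<Rightarrow> 'w measure) \<Rightarrow> (real \<Rightarrow> 'w \<Rightarrow> real) \<Rightarrow> bool" where
  "purely_disc_local_martingale P Fi N \<longleftrightarrow>
     local_martingale P Fi N \<and> (AE \<omega> in P. N 0 \<omega> = 0) \<and>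
     (\<forall>L. cont_local_martingale P Fi L \<longrightarrow> local_martingale P Fi (\<lambda>t \<omega>. N t \<omega> * L t \<omega>))"

definition finite_variation ::
  "'w measure \<Rightarrow> (real \<Rightarrow> 'w measure) \<Rightarrow> (real \<Rightarrow> 'w \<Rightarrow> real) \<Rightarrow> bool" where
  "finite_variation P Fi A \<longleftrightarrow>
     adapted Fi A \<and>
     (AE \<omega> in P. A 0 \<omega> = 0 \<and> cadlag (\<lambda>t. A t \<omega>) \<and>
        (\<exists>f g :: real \<Rightarrow> real. mono_on {0..} f \<and> mono_on {0..} g \<and> (\<forall>t\<ge>0. A t \<omega> = f t - g t)))"

definition semimartingale ::
  "'w measure \<Rightarrow> (real \<Rightarrow> 'w measure) \<Rightarrow> (real \<Rightarrow> 'w \<Rightarrow> real^'n) \<Rightarrow> bool" where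
  "semimartingale P Fi X \<longleftrightarrow>
     adapted Fi X \<and> (AE \<omega> in P. cadlag (\<lambda>t. X t \<omega>)) \<and>
     (\<forall>i. \<exists>N A. local_martingale P Fi N \<and> (AE \<omega> in P. N 0 \<omega> = 0) \<and> finite_variation P Fi A \<and>
        (AE \<omega> in P. \<forall>t\<ge>0. X t \<omega> $ i = X 0 \<omega> $ i + N t \<omega> + A t \<omega>))"

section \<open>Semimartingale characteristics\<close>

definition predictable_sigma :: "'w measure \<Rightarrow> (real \<Rightarrow> 'w measure) \<Rightarrow> ('w \<times> real) measure" where
  "predictable_sigma P Fi = sigma (space P \<times> {0..})
     ({A \<times> {0} | A. A \<in> sets (Fi 0)} \<union>
      {A \<times> {s<..t} | A s t. 0 \<le> s \<and> s < t \<and> A \<in> sets (Fi s)})"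

definition predictable ::
  "'w measure \<Rightarrow> (real \<Rightarrow> 'w measure) \<Rightarrow> (real \<Rightarrow> 'w \<Rightarrow> 'a::topological_space) \<Rightarrow> bool" where
  "predictable P Fi X \<longleftrightarrow> (\<lambda>(\<omega>, t). X t \<omega>) \<in> borel_measurable (predictable_sigma P Fi)"

definition jump_measure :: "(real \<Rightarrow> 'w \<Rightarrow> real^'n) \<Rightarrow> 'w \<Rightarrow> (real \<times> (real^'n)) measure" where
  "jump_measure X \<omega> =
     distr (count_space {s. 0 < s \<and> jump (\<lambda>t. X t \<omega>) s \<noteq> 0}) borel (\<lambda>s. (s, jump (\<lambda>t. X t \<omega>) s))"

text \<open>
  The predictable random measure \<open>\<nu>\<close> on \<open>[0,\<infinity>) \<times> \<real>\<^sup>d\<close> such that \<open>E[W * \<mu>\<^sup>X] = E[W * \<nu>]\<close> for all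
  nonnegative predictable functions \<open>W\<close> of \<open>((\<omega>, t), \<xi>)\<close>.
\<close>
definition is_compensator ::
  "'w measure \<Rightarrow> (real \<Rightarrow> 'w measure) \<Rightarrow> (real \<Rightarrow> 'w \<Rightarrow> real^'n) \<Rightarrow>
   ('w \<Rightarrow> (real \<times> (real^'n)) measure) \<Rightarrow> bool" where
  "is_compensator P Fi X \<nu> \<longleftrightarrow>
     (\<forall>\<omega>\<in>space P. sets (\<nu> \<omega>) = sets borel \<and> emeasure (\<nu> \<omega>) ({..<0} \<times> UNIV) = 0) \<and>
     (\<forall>W :: ('w \<times> real) \<times> (real^'n) \<Rightarrow> ennreal.
        W \<in> borel_measurable (predictable_sigma P Fi \<Otimes>\<^sub>M borel) \<longrightarrow>
          predictable P Fi (\<lambda>t \<omega>. \<integral>\<^sup>+z\<in>{0..t} \<times> UNIV. W ((\<omega>, fst z), snd z) \<partial>\<nu> \<omega>) \<and>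
          (\<integral>\<^sup>+\<omega>. (\<integral>\<^sup>+z\<in>{0..} \<times> UNIV. W ((\<omega>, fst z), snd z) \<partial>jump_measure X \<omega>) \<partial>P) =
          (\<integral>\<^sup>+\<omega>. (\<integral>\<^sup>+z\<in>{0..} \<times> UNIV. W ((\<omega>, fst z), snd z) \<partial>\<nu> \<omega>) \<partial>P))"

definition truncation_function :: "(real^'n \<Rightarrow> real^'n) \<Rightarrow> bool" where
  "truncation_function h \<longleftrightarrow>
     h \<in> borel_measurable borel \<and> bounded (range h) \<and> (\<exists>e>0. \<forall>\<xi>. norm \<xi> < e \<longrightarrow> h \<xi> = \<xi>)"

text \<open>
  \<open>big_jumps_removed h\<close> is the process \<open>X(h) = X - (\<Sum>s\<le>t. \<Delta>X\<^sub>s - h (\<Delta>X\<^sub>s))\<close>. On cadlag paths the index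
  set is finite, because \<open>h\<close> is the identity near 0.
\<close>
definition big_jumps_removed ::
  "(real^'n \<Rightarrow> real^'n) \<Rightarrow> (real \<Rightarrow> real^'n) \<Rightarrow> real \<Rightarrow> real^'n" where
  "big_jumps_removed h x t =
     x t - (\<Sum>s\<in>{s\<in>{0<..t}. jump x s \<noteq> h (jump x s)}. jump x s - h (jump x s))"

text \<open>
  \<open>(B, C, \<nu>)\<close> are the characteristics of \<open>X\<close> relative to \<open>h\<close>: \<open>B\<close> is the predictable finite variation
  part of the special semimartingale \<open>X(h)\<close>, \<open>C\<close> the predictable covariation of the continuous
  martingale part \<open>Xc\<close>, and \<open>\<nu>\<close> the compensator of the jump measure.
\<close>
definition has_characteristics ::
  "'w measure \<Rightarrow> (real \<Rightarrow> 'w measure) \<Rightarrow> (real^'n \<Rightarrow> real^'n) \<Rightarrow> (real \<Rightarrow> 'w \<Rightarrow> real^'n) \<Rightarrow>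
   (real \<Rightarrow> 'w \<Rightarrow> real^'n) \<Rightarrow> (real \<Rightarrow> 'w \<Rightarrow> real^'n^'n) \<Rightarrow> ('w \<Rightarrow> (real \<times> (real^'n)) measure) \<Rightarrow> bool"
where
  "has_characteristics P Fi h X B C \<nu> \<longleftrightarrow>
     (\<exists>Xc Xd :: 'n \<Rightarrow> real \<Rightarrow> 'w \<Rightarrow> real.
        (\<forall>i. predictable P Fi (\<lambda>t \<omega>. B t \<omega> $ i) \<and> finite_variation P Fi (\<lambda>t \<omega>. B t \<omega> $ i)) \<and>
        (\<forall>i. cont_local_martingale P Fi (Xc i) \<and> (AE \<omega> in P. Xc i 0 \<omega> = 0)) \<and>
        (\<forall>i. purely_disc_local_martingale P Fi (Xd i)) \<and>
        (AE \<omega> in P. \<forall>t\<ge>0. \<forall>i.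
           big_jumps_removed h (\<lambda>s. X s \<omega>) t $ i = X 0 \<omega> $ i + B t \<omega> $ i + Xc i t \<omega> + Xd i t \<omega>) \<and>
        (\<forall>i j. predictable P Fi (\<lambda>t \<omega>. C t \<omega> $ i $ j) \<and>
           finite_variation P Fi (\<lambda>t \<omega>. C t \<omega> $ i $ j) \<and>
           local_martingale P Fi (\<lambda>t \<omega>. Xc i t \<omega> * Xc j t \<omega> - C t \<omega> $ i $ j))) \<and>
     is_compensator P Fi X \<nu>"

section \<open>Affine processes\<close>

definition affine_map :: "('a::real_vector \<Rightarrow> 'b::real_vector) \<Rightarrow> bool" where
  "affine_map f \<longleftrightarrow> (\<forall>x y t. f ((1 - t) *\<^sub>R x + t *\<^sub>R y) = (1 - t) *\<^sub>R f x + t *\<^sub>R f y)"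

text \<open>
  Measures on \<open>\<real>\<^sup>d - {0}\<close> are encoded as Borel measures on \<open>\<real>\<^sup>d\<close> without mass at 0. A signed Radon
  measure on \<open>\<real>\<^sup>d - {0}\<close> may have infinite positive and infinite negative part; it is a set function on
  the Borel sets that are contained in a compact subset of \<open>\<real>\<^sup>d - {0}\<close>, extended by 0 to all other
  sets, so that the vector space operations are pointwise.
\<close>
definition punctured_bounded :: "(real^'n) set set" where
  "punctured_bounded = {A \<in> sets borel. \<exists>K. compact K \<and> 0 \<notin> K \<and> A \<subseteq> K}"

definition radon_measure :: "(real^'n) measure \<Rightarrow> bool" where
  "radon_measure \<mu> \<longleftrightarrow>
     sets \<mu> = sets borel \<and> emeasure \<mu> {0} = 0 \<and> (\<forall>K. compact K \<and> 0 \<notin> K \<longrightarrow> emeasure \<mu> K < \<infinity>)"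

definition set_function :: "(real^'n) measure \<Rightarrow> (real^'n) set \<Rightarrow> real" where
  "set_function \<mu> A = (if A \<in> punctured_bounded then measure \<mu> A else 0)"

definition signed_radon_measures :: "((real^'n) set \<Rightarrow> real) set" where
  "signed_radon_measures =
     {\<lambda>A. set_function \<mu> A - set_function \<mu>' A | \<mu> \<mu>'. radon_measure \<mu> \<and> radon_measure \<mu>'}"

definition is_positive :: "((real^'n) set \<Rightarrow> real) \<Rightarrow> bool" where
  "is_positive m \<longleftrightarrow> (\<exists>\<mu>. radon_measure \<mu> \<and> set_function \<mu> = m)"

text \<open>The positive measure represented by \<open>m\<close>; only meaningful if \<open>is_positive m\<close>.\<close>
definition measure_from :: "((real^'n) set \<Rightarrow> real) \<Rightarrow> (real^'n) measure" where
  "measure_from m = (THE \<mu>. radon_measure \<mu> \<and> set_function \<mu> = m)"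

definition affine_triplet ::
  "(real^'n) set \<Rightarrow> (real^'n \<Rightarrow> real^'n) \<Rightarrow> (real^'n \<Rightarrow> real^'n^'n) \<Rightarrow>
   (real^'n \<Rightarrow> (real^'n) set \<Rightarrow> real) \<Rightarrow> bool" where
  "affine_triplet E b c F \<longleftrightarrow>
     affine_map b \<and>
     affine_map c \<and> (\<forall>x. transpose (c x) = c x) \<and>
     (\<forall>x. F x \<in> signed_radon_measures) \<and> (\<forall>A. affine_map (\<lambda>x. F x A)) \<and>
     (\<forall>x\<in>E. (\<forall>v. 0 \<le> v \<bullet> (c x *v v)) \<and> is_positive (F x) \<and>
        (\<integral>\<^sup>+\<xi>. ennreal (min ((norm \<xi>)\<^sup>2) 1) \<partial>measure_from (F x)) < \<infinity>)"

text \<open>The random measure \<open>F(Y\<^sub>t\<^sub>-, d\<xi>) dt\<close>.\<close>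
definition kernel_measure ::
  "(real^'n \<Rightarrow> (real^'n) set \<Rightarrow> real) \<Rightarrow> (real \<Rightarrow> real^'n) \<Rightarrow> (real \<times> (real^'n)) measure" where
  "kernel_measure F y = measure_of UNIV (sets borel)
     (\<lambda>A. \<integral>\<^sup>+t\<in>{0..}. emeasure (measure_from (F (left_lim y t))) (Pair t -` A) \<partial>lborel)"

definition process_in ::
  "'w measure \<Rightarrow> (real \<Rightarrow> 'w measure) \<Rightarrow> (real^'n) set \<Rightarrow> (real \<Rightarrow> 'w \<Rightarrow> real^'n) \<Rightarrow> bool" where
  "process_in M Fi E Y \<longleftrightarrow>
     adapted Fi Y \<and> (\<forall>\<omega>\<in>space M. cadlag (\<lambda>t. Y t \<omega>) \<and> (\<forall>t\<ge>0. Y t \<omega> \<in> E))"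

text \<open>
  The process \<open>Y\<close> with state space \<open>D\<close> is affine with triplet \<open>(b, c, F)\<close> (the drift \<open>b\<close> being relative
  to the truncation function \<open>h\<close>) under every measure \<open>P x\<close>, \<open>x \<in> I\<close>. For the process \<open>X\<close> itself, \<open>I\<close>
  and \<open>D\<close> are both the state space \<open>E\<close>; for an affine image \<open>f(X)\<close>, \<open>I\<close> is \<open>E\<close> and \<open>D\<close> is \<open>f ` E\<close>.
\<close>
definition affine_process ::
  "'w measure \<Rightarrow> (real \<Rightarrow> 'w measure) \<Rightarrow> 'i set \<Rightarrow> ('i \<Rightarrow> 'w measure) \<Rightarrow> (real^'n \<Rightarrow> real^'n) \<Rightarrow>
   (real^'n) set \<Rightarrow> (real \<Rightarrow> 'w \<Rightarrow> real^'n) \<Rightarrow>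
   (real^'n \<Rightarrow> real^'n) \<Rightarrow> (real^'n \<Rightarrow> real^'n^'n) \<Rightarrow> (real^'n \<Rightarrow> (real^'n) set \<Rightarrow> real) \<Rightarrow> bool" where
  "affine_process M Fi I P h D Y b c F \<longleftrightarrow>
     process_in M Fi D Y \<and> affine_triplet D b c F \<and>
     (\<forall>x\<in>I. semimartingale (P x) Fi Y \<and>
        has_characteristics (P x) Fi h Y
          (\<lambda>t \<omega>. LBINT s:{0..t}. b (left_lim (\<lambda>r. Y r \<omega>) s))
          (\<lambda>t \<omega>. LBINT s:{0..t}. c (left_lim (\<lambda>r. Y r \<omega>) s))
          (\<lambda>\<omega>. kernel_measure F (\<lambda>r. Y r \<omega>)))"

definition semimartingale_family ::
  "'w measure \<Rightarrow> (real \<Rightarrow> 'w measure) \<Rightarrow> (real^'n) set \<Rightarrow> (real \<Rightarrow> 'w \<Rightarrow> real^'n) \<Rightarrow>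
   (real^'n \<Rightarrow> 'w measure) \<Rightarrow> bool" where
  "semimartingale_family M Fi E X P \<longleftrightarrow>
     right_cont_filtration M Fi \<and> E \<noteq> {} \<and> E \<in> sets borel \<and> process_in M Fi E X \<and>
     (\<forall>x\<in>E. prob_space (P x) \<and> sets (P x) = sets M \<and>
        semimartingale (P x) Fi X \<and> (AE \<omega> in P x. X 0 \<omega> = x))"

section \<open>Jump sizes, jump counters, invariance\<close>

definition measure_support :: "'a::topological_space measure \<Rightarrow> 'a set" where
  "measure_support \<mu> = {x. \<forall>U. open U \<and> x \<in> U \<longrightarrow> emeasure \<mu> U > 0}"

definition jump_sizes ::
  "(real^'n) set \<Rightarrow> (real^'n \<Rightarrow> (real^'n) set \<Rightarrow> real) \<Rightarrow> (real^'n) set" where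
  "jump_sizes E F = (\<Union>x\<in>E. measure_support (measure_from (F x))) - {0}"

definition jump_counter :: "(real^'n) set \<Rightarrow> real^'n \<Rightarrow> (real^'n \<Rightarrow> real) \<Rightarrow> bool" where
  "jump_counter E u \<psi> \<longleftrightarrow>
     affine_map \<psi> \<and> (\<exists>x. \<psi> x \<noteq> 0) \<and> (\<forall>x\<in>E. 0 \<le> \<psi> x) \<and> (\<forall>x\<in>E. 0 < \<psi> x \<longrightarrow> x + u \<in> E)"

definition normalized_jump_counters ::
  "(real^'n) set \<Rightarrow> (real^'n) set \<Rightarrow> (real^'n \<Rightarrow> real) set" where
  "normalized_jump_counters E S = {\<psi>. \<exists>u\<in>S. jump_counter E u \<psi> \<and> \<psi> u - \<psi> 0 = -1}"

definition stochastically_invariant ::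
  "(real^'n \<Rightarrow> 'w measure) \<Rightarrow> (real \<Rightarrow> 'w \<Rightarrow> real^'n) \<Rightarrow> (real^'n) set \<Rightarrow> bool" where
  "stochastically_invariant P X E\<^sub>0 \<longleftrightarrow> (\<forall>x\<in>E\<^sub>0. AE \<omega> in P x. \<forall>t\<ge>0. X t \<omega> \<in> E\<^sub>0)"

text \<open>
  The conjunct quantified over \<open>x \<in> E\<close> says that almost surely the second coordinate never jumps
  upwards, jumps downwards at most \<open>N = max {x $ 2 | x \<in> E}\<close> times, and that, from the last downward
  jump on (from time 0 on if there is none), the process is in \<open>E\<^sub>0\<close>.
\<close>
definition layer_structure ::
  "(real^2) set \<Rightarrow> (real^2) set \<Rightarrow> (real^2 \<Rightarrow> 'w measure) \<Rightarrow> (real \<Rightarrow> 'w \<Rightarrow> real^2) \<Rightarrow> bool" where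
  "layer_structure E S P X \<longleftrightarrow>
     (let E\<^sub>0 = {x\<in>E. x $ 2 = 0}; N = Max ((\<lambda>x. x $ 2) ` E) in
        stochastically_invariant P X E\<^sub>0 \<and>
        (\<forall>u\<in>S. u $ 2 \<le> 0) \<and>
        (\<forall>x\<in>E. AE \<omega> in P x.
           (\<forall>t>0. jump (\<lambda>s. X s \<omega>) t $ 2 \<le> 0) \<and>
           (let D = {t. 0 < t \<and> jump (\<lambda>s. X s \<omega>) t $ 2 < 0} in
              finite D \<and> real (card D) \<le> N \<and>
              (\<forall>t\<ge>0. (\<forall>s\<in>D. s \<le> t) \<longrightarrow> X t \<omega> \<in> E\<^sub>0))))"

definition coordinate :: "'n \<Rightarrow> real^'n \<Rightarrow> real^1" where
  "coordinate j x = vec (x $ j)"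

definition independent_processes ::
  "'w measure \<Rightarrow> (real \<Rightarrow> 'w \<Rightarrow> 'a::topological_space) \<Rightarrow> (real \<Rightarrow> 'w \<Rightarrow> 'a) \<Rightarrow> bool"
where
  "independent_processes P Y Z \<longleftrightarrow>
     prob_space.indep_var P
       (PiM {0..} (\<lambda>_. borel)) (\<lambda>\<omega>. \<lambda>t\<in>{0..}. Y t \<omega>)
       (PiM {0..} (\<lambda>_. borel)) (\<lambda>\<omega>. \<lambda>t\<in>{0..}. Z t \<omega>)"

abbreviation lattice_points :: "(real^'n) set" where
  "lattice_points \<equiv> {x. \<forall>i. x $ i \<in> \<nat>}"

end

theory Submission
  imports Defs
begin

text \<open>
  Since \<open>E\<close> is finite, \<open>X\<close> jumps by \<open>u\<close> with intensity \<open>F(X, {u})\<close>, an affine function of the current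
  state. For \<open>u \<in> S\<close> it is a positive multiple of a normalized jump counter \<open>\<psi>\<^sub>u\<close>, and walking from a
  point of \<open>E\<close> along \<open>u\<close> must end exactly where \<open>\<psi>\<^sub>u\<close> vanishes. Hence \<open>\<psi>\<^sub>u\<close> is unique and integer
  valued on \<open>E\<close>, and \<open>\<psi>\<^sub>v(u) - \<psi>\<^sub>v(0) \<in> \<nat>\<close> unless \<open>\<psi>\<^sub>v = \<psi>\<^sub>u\<close>. These integrality conditions, together
  with the fact that no linear function can grow along a cycle of admissible jumps, leave only the
  three types.

  In type (i) the level \<open>x\<^sub>2\<close> never increases and decreases at a rate that is proportional to it, so it
  vanishes eventually. In type (ii) every intensity depends on a single coordinate; the difference
  between the expectation of a product of functions of the coordinates and the product of the
  expectations then satisfies a Gronwall estimate. For the characteristics of a single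
  coordinate, the compensated sum \<open>N\<close> of its jumps has to be purely discontinuous, that is, \<open>N L\<close> is
  a local martingale for each continuous local martingale \<open>L\<close>: as \<open>N\<close> has finite variation, the
  Riemann sums of products of increments of \<open>N\<close> and \<open>L\<close> tend to 0.
\<close>

section \<open>Products with continuous local martingales\<close>

text \<open>A counter other than the projections has the form
  \<open>c - p x\<^sub>1 - q x\<^sub>2\<close>. Its own jump \<open>w\<close> satisfies
  \<open>p w\<^sub>1 + q w\<^sub>2 = 1\<close>, and the jumps of different counters must not lower
  it. The dividing question is whether the jumps that belong to one projection all keep the other
  coordinate. If they do, \<open>p\<close> and \<open>q\<close> are natural numbers and the unit
  relation makes \<open>w\<close> a unit vector. If neither projection has this property, a cycle of
  jumps shows that the foreign coordinate changes by at most 1 and that \<open>p = q\<close>. The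
  value \<open>p = 1\<close> gives the simplex; any other value is not a natural number, turns the
  jumps of the projections into \<open>(-1, 1)\<close> and \<open>(1, -1)\<close>, and makes the
  counter itself the level of a layer structure.

  On the probabilistic side, orthogonality is tested against arbitrary continuous local martingales,
  about which no integrability is known; hence the localization. The coordinates live on one given
  space and are not constructed separately, so their independence is derived from a closed finite
  linear system for the defect of independence, with initial value 0.\<close>

lemma cadlag_stop:
  assumes "cadlag f" "0 \<le> c"
  shows "cadlag (\<lambda>t. f (min t c))"
  unfolding cadlag_def
proof safe
  fix t :: real assume t: "0 \<le> t"
  show "((\<lambda>t. f (min t c)) \<longlongrightarrow> f (min t c)) (at_right t)"
  proof (cases "t < c")
    case True
    have "eventually (\<lambda>s. f s = f (min s c)) (at_right t)"
      using eventually_at_right_less[of t] eventually_at_right[OF True]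
      by (auto simp: eventually_at_right[OF True] intro!: exI[of _ c] True)
    moreover have "(f \<longlongrightarrow> f t) (at_right t)" using assms t by (simp add: cadlag_def)
    ultimately show ?thesis using True by (auto intro: Lim_transform_eventually)
  next
    case False
    have "eventually (\<lambda>s. f c = f (min s c)) (at_right t)"
      using False by (auto simp: eventually_at_right_field intro!: exI[of _ "t + 1"])
    then show ?thesis using False by (auto intro: Lim_transform_eventually[OF tendsto_const])
  qed
next
  fix t :: real assume t: "0 < t"
  show "\<exists>l. ((\<lambda>t. f (min t c)) \<longlongrightarrow> l) (at_left t)"
  proof (cases "t \<le> c")
    case True
    have "eventually (\<lambda>s. f s = f (min s c)) (at_left t)"
      using True by (auto simp: eventually_at_left_field intro!: exI[of _ "t - 1"])
    moreover obtain l where "(f \<longlongrightarrow> l) (at_left t)" using assms t by (auto simp: cadlag_def)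
    ultimately show ?thesis using True by (auto intro: Lim_transform_eventually)
  next
    case False
    have "eventually (\<lambda>s. f c = f (min s c)) (at_left t)"
      using False by (auto simp: eventually_at_left_field intro!: exI[of _ c])
    then show ?thesis using False by (auto intro: Lim_transform_eventually[OF tendsto_const])
  qed
qed

lemma cadlag_mult:
  fixes f g :: "real \<Rightarrow> real"
  assumes "cadlag f" "cadlag g"
  shows "cadlag (\<lambda>t. f t * g t)"
  using assms unfolding cadlag_def by (auto intro!: tendsto_mult) (metis tendsto_mult)

lemma cadlag_continuous:
  fixes f :: "real \<Rightarrow> real"
  assumes "continuous_on {0..} f"
  shows "cadlag f"
  unfolding cadlag_def
proof safe
  fix t :: real assume t: "0 \<le> t"
  then have "(f \<longlongrightarrow> f t) (at t within {0..})"
    using assms by (auto simp: continuous_on_def)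
  then show "(f \<longlongrightarrow> f t) (at_right t)"
    by (rule tendsto_within_subset) (use t in auto)
next
  fix t :: real assume t: "0 < t"
  then have "isCont f t"
    using assms continuous_on_interior[of "{0..}" f t] by (simp add: interior_real_atLeast)
  then show "\<exists>l. (f \<longlongrightarrow> l) (at_left t)"
    by (auto simp: isCont_def intro!: exI[of _ "f t"] filterlim_at_split[THEN iffD1, THEN conjunct1])
qed

section \<open>Martingales, stopping and optional stopping at countably many times\<close>

locale filtered_prob_space = prob_space P for P :: "'w measure" +
  fixes Fi :: "real \<Rightarrow> 'w measure"
  assumes subalg: "0 \<le> t \<Longrightarrow> subalgebra P (Fi t)"
    and filtration_mono: "0 \<le> s \<Longrightarrow> s \<le> t \<Longrightarrow> sets (Fi s) \<subseteq> sets (Fi t)"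
begin

lemma space_Fi: "0 \<le> t \<Longrightarrow> space (Fi t) = space P"
  using subalg by (simp add: subalgebra_def)

lemma sets_Fi: "0 \<le> t \<Longrightarrow> A \<in> sets (Fi t) \<Longrightarrow> A \<in> sets P"
  using subalg[of t] by (auto simp: subalgebra_def)

lemma measurable_Fi: "0 \<le> t \<Longrightarrow> f \<in> measurable (Fi t) N \<Longrightarrow> f \<in> measurable P N"
  using measurable_from_subalg subalg by blast

lemma measurable_Fi_mono:
  assumes "0 \<le> s" "s \<le> t" "f \<in> measurable (Fi s) N"
  shows "f \<in> measurable (Fi t) N"
proof -
  have "subalgebra (Fi t) (Fi s)"
    using assms filtration_mono space_Fi by (simp add: subalgebra_def)
  then show ?thesis using assms measurable_from_subalg by blast
qed

lemma adapted_measurable: "adapted Fi Z \<Longrightarrow> 0 \<le> t \<Longrightarrow> Z t \<in> borel_measurable P"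
  unfolding adapted_def using measurable_Fi by blast

lemma sigma_finite_Fi: "0 \<le> t \<Longrightarrow> sigma_finite_subalgebra P (Fi t)"
  by (intro finite_measure_subalgebra_is_sigma_finite)
     (simp add: finite_measure_subalgebra_def finite_measure_axioms finite_measure_subalgebra_axioms_def subalg)

text \<open>Reduces the conditional expectation to integrals over events of the past. Conditional
  expectations are handled only here and in \<open>martingale_mult\<close>.\<close>

lemma martingaleI:
  assumes "adapted Fi N" "AE \<omega> in P. cadlag (\<lambda>t. N t \<omega>)"
    and int: "\<And>t. 0 \<le> t \<Longrightarrow> integrable P (N t)"
    and eq: "\<And>s t A. 0 \<le> s \<Longrightarrow> s \<le> t \<Longrightarrow> A \<in> sets (Fi s) \<Longrightarrow>
      (\<integral>\<omega>. indicator A \<omega> * N t \<omega> \<partial>P) = (\<integral>\<omega>. indicator A \<omega> * N s \<omega> \<partial>P)"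
  shows "martingale P Fi N"
  unfolding martingale_def
proof (intro conjI allI impI)
  fix s t :: real assume st: "0 \<le> s \<and> s \<le> t"
  interpret sigma_finite_subalgebra P "Fi s" using sigma_finite_Fi st by simp
  show "AE \<omega> in P. real_cond_exp P (Fi s) (N t) \<omega> = N s \<omega>"
    by (rule real_cond_exp_charact)
       (use st int eq assms(1) in \<open>auto simp: set_lebesgue_integral_def adapted_def\<close>)
qed (use assms in auto)

text \<open>The pull-out property for a possibly unbounded factor \<open>Z\<close> of the past;
  integrability of the product is what it requires. In \<open>product_martingale\<close> the factor
  is the value of the other martingale on an event of the past.\<close>

lemma martingale_mult:
  assumes N: "martingale P Fi N" and st: "0 \<le> s" "s \<le> t"
    and Z: "Z \<in> borel_measurable (Fi s)" and int: "integrable P (\<lambda>\<omega>. Z \<omega> * N t \<omega>)"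
  shows "(\<integral>\<omega>. Z \<omega> * N t \<omega> \<partial>P) = (\<integral>\<omega>. Z \<omega> * N s \<omega> \<partial>P)"
proof -
  interpret F: sigma_finite_subalgebra P "Fi s" using sigma_finite_Fi st by simp
  have ad: "adapted Fi N" using N by (simp add: martingale_def)
  have [measurable]: "N t \<in> borel_measurable P" "N s \<in> borel_measurable P" "Z \<in> borel_measurable P"
    using adapted_measurable[OF ad] st Z measurable_Fi by auto
  have "(\<integral>\<omega>. Z \<omega> * N t \<omega> \<partial>P) = (\<integral>\<omega>. Z \<omega> * real_cond_exp P (Fi s) (N t) \<omega> \<partial>P)"
    by (rule F.real_cond_exp_intg(2)[symmetric]) (use int Z in auto)
  also have "\<dots> = (\<integral>\<omega>. Z \<omega> * N s \<omega> \<partial>P)"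
  proof (rule integral_cong_AE)
    show "AE \<omega> in P. Z \<omega> * real_cond_exp P (Fi s) (N t) \<omega> = Z \<omega> * N s \<omega>"
    proof -
      have "AE \<omega> in P. real_cond_exp P (Fi s) (N t) \<omega> = N s \<omega>"
        using N st by (simp add: martingale_def)
      then show ?thesis by auto
    qed
  qed (auto)
  finally show ?thesis .
qed

lemma martingale_indicator:
  assumes N: "martingale P Fi N" and st: "0 \<le> s" "s \<le> t" and A: "A \<in> sets (Fi s)"
  shows "(\<integral>\<omega>. indicator A \<omega> * N t \<omega> \<partial>P) = (\<integral>\<omega>. indicator A \<omega> * N s \<omega> \<partial>P)"
proof (rule martingale_mult[OF N st])
  show "indicator A \<in> borel_measurable (Fi s)" using A by simp
  show "integrable P (\<lambda>\<omega>. indicator A \<omega> * N t \<omega>)"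
    using N st A sets_Fi[of s A] integrable_mult_indicator[of A P "N t"]
    by (auto simp: martingale_def)
qed

lemma measurable_min_stopping_time:
  assumes "stopping_time Fi \<sigma>" "\<And>\<omega>. 0 \<le> \<sigma> \<omega>" "0 \<le> t"
  shows "(\<lambda>\<omega>. min t (\<sigma> \<omega>)) \<in> borel_measurable (Fi t)"
proof (rule borel_measurableI_le)
  fix a
  consider "a \<ge> t" | "a < 0" | "0 \<le> a" "a < t" by linarith
  then show "{\<omega>\<in>space (Fi t). min t (\<sigma> \<omega>) \<le> a} \<in> sets (Fi t)"
  proof cases
    case 1 then have "{\<omega>\<in>space (Fi t). min t (\<sigma> \<omega>) \<le> a} = space (Fi t)" by auto
    then show ?thesis by simp
  next
    case 2
    have "\<not> min t (\<sigma> \<omega>) \<le> a" for \<omega>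
      using assms(2)[of \<omega>] assms(3) 2 by auto
    then have "{\<omega>\<in>space (Fi t). min t (\<sigma> \<omega>) \<le> a} = {}" by blast
    then show ?thesis by (simp only: sets.empty_sets)
  next
    case 3
    then have "{\<omega>\<in>space (Fi t). min t (\<sigma> \<omega>) \<le> a} = {\<omega>\<in>space (Fi a). \<sigma> \<omega> \<le> a}"
      using space_Fi by auto
    also have "\<dots> \<in> sets (Fi a)"
      using assms(1) by (simp add: stopping_time_def pred_def)
    finally show ?thesis using filtration_mono[of a t] 3 by (auto simp only: subset_iff)
  qed
qed

text \<open>With countably many values of \<open>\<sigma>\<close> the stopped variable is a
  countable choice between the \<open>Z i\<close> with \<open>i \<le> t\<close>, each of which is
  measurable at time \<open>t\<close>.\<close>

lemma adapted_stop_countable: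
  fixes Z :: "real \<Rightarrow> 'w \<Rightarrow> 'b::topological_space"
  assumes Z: "adapted Fi Z" and \<sigma>: "stopping_time Fi \<sigma>" "\<And>\<omega>. 0 \<le> \<sigma> \<omega>"
    and R: "countable R" "\<And>\<omega>. \<sigma> \<omega> \<in> R"
  shows "adapted Fi (\<lambda>t \<omega>. Z (min t (\<sigma> \<omega>)) \<omega>)"
  unfolding adapted_def
proof (intro allI impI)
  fix t :: real assume t: "0 \<le> t"
  define I where "I = min t ` (R \<inter> {0..})"
  have g: "(\<lambda>\<omega>. min t (\<sigma> \<omega>)) \<in> borel_measurable (Fi t)"
    using measurable_min_stopping_time[OF \<sigma>] t by simp
  show "(\<lambda>\<omega>. Z (min t (\<sigma> \<omega>)) \<omega>) \<in> borel_measurable (Fi t)"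
  proof (rule measurable_compose_countable'[where I=I])
    show "countable I" using R by (simp add: I_def)
    show "Z i \<in> borel_measurable (Fi t)" if "i \<in> I" for i
      using that Z t measurable_Fi_mono[of i t "Z i"] by (auto simp: adapted_def I_def)
    show "(\<lambda>\<omega>. min t (\<sigma> \<omega>)) \<in> measurable (Fi t) (count_space I)"
    proof (subst measurable_count_space_eq_countable)
      show "countable I" by fact
      have "(\<lambda>\<omega>. min t (\<sigma> \<omega>)) -` {a} \<inter> space (Fi t) \<in> sets (Fi t)" for a
        by (rule measurable_sets[OF g]) auto
      then show "(\<lambda>\<omega>. min t (\<sigma> \<omega>)) \<in> space (Fi t) \<rightarrow> I \<and>
          (\<forall>a\<in>I. (\<lambda>\<omega>. min t (\<sigma> \<omega>)) -` {a} \<inter> space (Fi t) \<in> sets (Fi t))"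
        using R \<sigma>(2) by (auto simp: I_def)
    qed
  qed
qed

lemma stopping_time_eq_sets:
  assumes \<sigma>: "stopping_time Fi \<sigma>" "\<And>\<omega>. 0 \<le> \<sigma> \<omega>" and r: "0 \<le> r"
  shows "{\<omega>\<in>space P. \<sigma> \<omega> = r} \<in> sets (Fi r)" "{\<omega>\<in>space P. \<sigma> \<omega> > r} \<in> sets (Fi r)"
    "{\<omega>\<in>space P. \<sigma> \<omega> \<le> r} \<in> sets (Fi r)"
proof -
  show le: "{\<omega>\<in>space P. \<sigma> \<omega> \<le> r} \<in> sets (Fi r)"
  proof -
    have "{\<omega>\<in>space (Fi r). \<sigma> \<omega> \<le> r} \<in> sets (Fi r)"
      using \<sigma>(1) unfolding stopping_time_def pred_def by blast
    then show ?thesis using space_Fi[OF r] by simp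
  qed
  have "{\<omega>\<in>space P. \<sigma> \<omega> > r} = space (Fi r) - {\<omega>\<in>space P. \<sigma> \<omega> \<le> r}" using space_Fi[OF r] by auto
  then show "{\<omega>\<in>space P. \<sigma> \<omega> > r} \<in> sets (Fi r)" using le by auto
  have m: "(\<lambda>\<omega>. min r (\<sigma> \<omega>)) \<in> borel_measurable (Fi r)"
    using measurable_min_stopping_time[OF \<sigma>] r by simp
  have "{\<omega>\<in>space P. \<sigma> \<omega> = r} = {\<omega>\<in>space P. \<sigma> \<omega> \<le> r} \<inter> ((\<lambda>\<omega>. min r (\<sigma> \<omega>)) -` {r} \<inter> space (Fi r))"
    using space_Fi[OF r] by auto
  then show "{\<omega>\<in>space P. \<sigma> \<omega> = r} \<in> sets (Fi r)" using le measurable_sets[OF m] by auto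
qed

text \<open>On each set \<open>T = r\<close> with \<open>s < r\<close> the martingale identity
  between \<open>r\<close> and \<open>t\<close> replaces the stopped value by the value at time
  \<open>t\<close>. Countably many such pieces may be added because the bound \<open>D\<close> makes
  the stopped process integrable.\<close>

lemma martingale_stop_countable:
  assumes N: "martingale P Fi N" and T: "stopping_time Fi T" "\<And>\<omega>. 0 \<le> T \<omega>"
    and R: "countable R" "\<And>\<omega>. T \<omega> \<in> R"
    and D: "integrable P D" "AE \<omega> in P. \<forall>v\<ge>0. \<bar>N (min v (T \<omega>)) \<omega>\<bar> \<le> D \<omega>"
  shows "martingale P Fi (\<lambda>t \<omega>. N (min t (T \<omega>)) \<omega>)"
proof (rule martingaleI)
  have ad: "adapted Fi N" using N by (simp add: martingale_def)
  show ads: "adapted Fi (\<lambda>t \<omega>. N (min t (T \<omega>)) \<omega>)"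
    by (rule adapted_stop_countable[OF ad T R])
  show "AE \<omega> in P. cadlag (\<lambda>t. N (min t (T \<omega>)) \<omega>)"
    using N unfolding martingale_def by (auto intro!: cadlag_stop T)
  show int: "integrable P (\<lambda>\<omega>. N (min t (T \<omega>)) \<omega>)" if "0 \<le> t" for t
  proof (rule Bochner_Integration.integrable_bound[OF D(1)])
    show "AE \<omega> in P. norm (N (min t (T \<omega>)) \<omega>) \<le> norm (D \<omega>)"
      using D(2) by eventually_elim (use that in \<open>auto intro: order_trans[OF _ abs_ge_self]\<close>)
  qed (use that adapted_measurable[OF ads] in simp)
  have intN: "integrable P (N t)" if "0 \<le> t" for t using N that by (simp add: martingale_def)
  fix s t :: real and A assume st: "0 \<le> s" "s \<le> t" and A: "A \<in> sets (Fi s)"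
  have t: "0 \<le> t" using st by simp
  have seti: "set_integrable P B f" if "integrable P f" "B \<in> sets P" for f :: "'w \<Rightarrow> real" and B
    unfolding set_integrable_def using that by (intro integrable_mult_indicator)
  \<comment> \<open>Outside \<open>A1\<close> the process has already stopped at time
    \<open>s\<close>, so only the part of \<open>A\<close> with \<open>T > s\<close> needs the
    martingale property.\<close>
  define A1 where "A1 = A \<inter> {\<omega>\<in>space P. T \<omega> > s}"
  have A1: "A1 \<in> sets (Fi s)" "A1 \<in> sets P"
  proof -
    show "A1 \<in> sets (Fi s)" using A stopping_time_eq_sets(2)[OF T st(1)] by (simp add: A1_def)
    then show "A1 \<in> sets P" by (rule sets_Fi[OF st(1)])
  qed
  have AP: "A \<in> sets P" by (rule sets_Fi[OF st(1) A])
  \<comment> \<open>The pieces of \<open>A1\<close> by the value of \<open>T\<close>, numbered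
    through an enumeration of \<open>R\<close>; a number outside the range of the enumeration gives
    the empty set.\<close>
  define B where "B i = A1 \<inter> {\<omega>\<in>space P. to_nat_on R (T \<omega>) = i}" for i
  have B_alt: "B i = A1 \<inter> {\<omega>\<in>space P. T \<omega> = from_nat_into R i} \<or> B i = {}" for i
  proof (cases "i \<in> to_nat_on R ` R")
    case True
    then show ?thesis using R by (auto simp: B_def)
  next
    case False then show ?thesis using R by (auto simp: B_def)
  qed
  have r0: "A1 \<inter> {\<omega>\<in>space P. T \<omega> = r} \<in> sets P"
      "r > s \<Longrightarrow> A1 \<inter> {\<omega>\<in>space P. T \<omega> = r} \<in> sets (Fi r)"
      "r \<le> s \<Longrightarrow> A1 \<inter> {\<omega>\<in>space P. T \<omega> = r} = {}" for r
  proof -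
    show "r \<le> s \<Longrightarrow> A1 \<inter> {\<omega>\<in>space P. T \<omega> = r} = {}" by (auto simp: A1_def)
    show *: "A1 \<inter> {\<omega>\<in>space P. T \<omega> = r} \<in> sets (Fi r)" if r: "r > s"
      by (rule sets.Int[OF _ stopping_time_eq_sets(1)[OF T]])
         (use A1(1) filtration_mono[OF st(1), of r] r st in \<open>auto simp only: subset_iff\<close>)
    show "A1 \<inter> {\<omega>\<in>space P. T \<omega> = r} \<in> sets P"
    proof (cases "r > s")
      case True
      show ?thesis by (rule sets_Fi[OF _ *[OF True]]) (use True st in simp)
    next
      case False
      then have "A1 \<inter> {\<omega>\<in>space P. T \<omega> = r} = {}" by (auto simp: A1_def)
      then show ?thesis by (simp only: sets.empty_sets)
    qed
  qed
  have Bm: "B i \<in> sets P" for i using B_alt[of i] r0(1)[of "from_nat_into R i"] by (metis sets.empty_sets)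
  have Bd: "i \<noteq> j \<Longrightarrow> B i \<inter> B j = {}" for i j by (auto simp: B_def)
  have BU: "(\<Union>i. B i) = A1" by (auto simp: B_def A1_def)
  have eqB: "(LINT \<omega>:B i|P. N (min t (T \<omega>)) \<omega>) = (LINT \<omega>:B i|P. N t \<omega>)" for i
  proof (cases "B i = {}")
    case False
    define r where "r = from_nat_into R i"
    have Bi: "B i = A1 \<inter> {\<omega>\<in>space P. T \<omega> = r}" using B_alt[of i] False by (auto simp: r_def)
    have rs: "r > s" using False r0(3)[of r] Bi by (cases "r \<le> s") auto
    have "(LINT \<omega>:B i|P. N (min t (T \<omega>)) \<omega>) = (LINT \<omega>:B i|P. N (min t r) \<omega>)"
      unfolding set_lebesgue_integral_def by (rule Bochner_Integration.integral_cong) (auto simp: Bi indicator_def)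
    also have "\<dots> = (LINT \<omega>:B i|P. N t \<omega>)"
    proof (cases "r < t")
      case True
      then show ?thesis
        using martingale_indicator[OF N _ _ r0(2)[OF rs], of t] rs st Bi
        by (simp add: set_lebesgue_integral_def min_def)
    next
      case False then show ?thesis by (simp add: min_def)
    qed
    finally show ?thesis .
  qed (simp add: set_lebesgue_integral_def)
  have "(LINT \<omega>:A1|P. N (min t (T \<omega>)) \<omega>) = (\<Sum>i. (LINT \<omega>:B i|P. N (min t (T \<omega>)) \<omega>))"
    unfolding BU[symmetric]
    by (rule lebesgue_integral_countable_add)
       (use Bm Bd in \<open>auto simp only: BU intro: seti[OF int[OF t] A1(2)]\<close>)
  also have "\<dots> = (\<Sum>i. (LINT \<omega>:B i|P. N t \<omega>))" by (simp add: eqB)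
  also have "\<dots> = (LINT \<omega>:A1|P. N t \<omega>)"
    unfolding BU[symmetric]
    by (rule lebesgue_integral_countable_add[symmetric])
       (use Bm Bd in \<open>auto simp only: BU intro: seti[OF intN[OF t] A1(2)]\<close>)
  also have "\<dots> = (LINT \<omega>:A1|P. N s \<omega>)"
    using martingale_indicator[OF N st A1(1)] by (simp add: set_lebesgue_integral_def)
  also have "\<dots> = (LINT \<omega>:A1|P. N (min s (T \<omega>)) \<omega>)"
    unfolding set_lebesgue_integral_def
    by (rule Bochner_Integration.integral_cong) (auto simp: A1_def indicator_def)
  finally have 1: "(LINT \<omega>:A1|P. N (min t (T \<omega>)) \<omega>) = (LINT \<omega>:A1|P. N (min s (T \<omega>)) \<omega>)" .
  have split: "(\<integral>\<omega>. indicator A \<omega> * N (min u (T \<omega>)) \<omega> \<partial>P) =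
      (LINT \<omega>:A1|P. N (min u (T \<omega>)) \<omega>) + (LINT \<omega>:A - A1|P. N (min u (T \<omega>)) \<omega>)" if "0 \<le> u" for u
  proof -
    have "(LINT \<omega>:A1 \<union> (A - A1)|P. N (min u (T \<omega>)) \<omega>) =
        (LINT \<omega>:A1|P. N (min u (T \<omega>)) \<omega>) + (LINT \<omega>:A - A1|P. N (min u (T \<omega>)) \<omega>)"
      by (rule set_integral_Un)
         (use A1 AP int[OF that] in \<open>auto intro!: seti\<close>)
    moreover have "A1 \<union> (A - A1) = A" by (auto simp: A1_def)
    ultimately show ?thesis by (simp add: set_lebesgue_integral_def)
  qed
  have 2: "(LINT \<omega>:A - A1|P. N (min t (T \<omega>)) \<omega>) = (LINT \<omega>:A - A1|P. N (min s (T \<omega>)) \<omega>)"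
    unfolding set_lebesgue_integral_def
  proof (rule Bochner_Integration.integral_cong)
    fix \<omega> assume "\<omega> \<in> space P"
    moreover have "min t (T \<omega>) = min s (T \<omega>)" if "\<not> s < T \<omega>" using st that by auto
    ultimately show "indicat_real (A - A1) \<omega> *\<^sub>R N (min t (T \<omega>)) \<omega> = indicat_real (A - A1) \<omega> *\<^sub>R N (min s (T \<omega>)) \<omega>"
      by (cases "s < T \<omega>") (auto simp: A1_def indicator_def)
  qed simp
  show "(\<integral>\<omega>. indicator A \<omega> * N (min t (T \<omega>)) \<omega> \<partial>P) = (\<integral>\<omega>. indicator A \<omega> * N (min s (T \<omega>)) \<omega> \<partial>P)"
    using split[OF t] split[OF st(1)] 1 2 by simp
qed

end

section \<open>The product of a continuous martingale and one of dominated variation\<close>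

context filtered_prob_space begin

text \<open>For martingales the mixed terms vanish, so the increment of the product integrates like
  the sum of the products of increments over a partition. This sum is at most the variation of
  \<open>M1\<close>, controlled by \<open>G\<close>, times the largest increment of
  \<open>M2\<close>, which tends to 0 by uniform continuity; twice \<open>K * H\<close>
  dominates.\<close>

lemma product_martingale:
  fixes K H :: "'w \<Rightarrow> real"
  assumes M1: "martingale P Fi M1" and M2: "martingale P Fi M2"
    and cont: "AE \<omega> in P. continuous_on {0..} (\<lambda>t. M2 t \<omega>)"
    and var: "AE \<omega> in P. \<forall>v w. 0 \<le> v \<and> v \<le> w \<longrightarrow> \<bar>M1 w \<omega> - M1 v \<omega>\<bar> \<le> G w \<omega> - G v \<omega>"
    and G: "AE \<omega> in P. \<forall>t\<ge>0. G t \<omega> - G 0 \<omega> \<le> K \<omega>"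
    and H: "AE \<omega> in P. \<forall>t\<ge>0. \<bar>M2 t \<omega>\<bar> \<le> H \<omega>"
    and K: "AE \<omega> in P. \<forall>t\<ge>0. \<bar>M1 t \<omega>\<bar> \<le> K \<omega>"
    and KH: "integrable P (\<lambda>\<omega>. K \<omega> * H \<omega>)"
  shows "martingale P Fi (\<lambda>t \<omega>. M1 t \<omega> * M2 t \<omega>)"
proof (rule martingaleI)
  have ad: "adapted Fi M1" "adapted Fi M2" using M1 M2 by (simp_all add: martingale_def)
  show adp: "adapted Fi (\<lambda>t \<omega>. M1 t \<omega> * M2 t \<omega>)"
    using ad by (simp add: adapted_def borel_measurable_times)
  have c1: "AE \<omega> in P. cadlag (\<lambda>t. M1 t \<omega>)" using M1 by (simp add: martingale_def)
  show "AE \<omega> in P. cadlag (\<lambda>t. M1 t \<omega> * M2 t \<omega>)"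
    using c1 cont by eventually_elim (simp add: cadlag_mult cadlag_continuous)
  have dom: "AE \<omega> in P. \<forall>v\<ge>0. \<forall>w\<ge>0. \<bar>M1 v \<omega> * M2 w \<omega>\<bar> \<le> K \<omega> * H \<omega>"
    using H K
  proof eventually_elim
    case (elim \<omega>)
    show ?case
    proof (intro allI impI)
      fix v w :: real assume "0 \<le> v" "0 \<le> w"
      then have "\<bar>M1 v \<omega>\<bar> \<le> K \<omega>" "\<bar>M2 w \<omega>\<bar> \<le> H \<omega>" using elim by auto
      then show "\<bar>M1 v \<omega> * M2 w \<omega>\<bar> \<le> K \<omega> * H \<omega>"
        unfolding abs_mult by (intro mult_mono) auto
    qed
  qed
  have m[measurable]: "M1 v \<in> borel_measurable P" "M2 v \<in> borel_measurable P" if "0 \<le> v" for v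
    using ad adapted_measurable that by auto
  have int: "integrable P (\<lambda>\<omega>. M1 v \<omega> * M2 w \<omega>)" if "0 \<le> v" "0 \<le> w" for v w
  proof (rule Bochner_Integration.integrable_bound[OF KH])
    show "AE \<omega> in P. norm (M1 v \<omega> * M2 w \<omega>) \<le> norm (K \<omega> * H \<omega>)"
      using dom by eventually_elim (use that in \<open>auto intro: order_trans[OF _ abs_ge_self]\<close>)
  qed (use m that in auto)
  then show "integrable P (\<lambda>\<omega>. M1 t \<omega> * M2 t \<omega>)" if "0 \<le> t" for t using that by simp
  fix s t A assume st: "0 \<le> s" "s \<le> t" and A: "A \<in> sets (Fi s)"
  have AP: "A \<in> sets P" using A st sets_Fi by simp
  have intA: "integrable P (\<lambda>\<omega>. indicator A \<omega> * (M1 v \<omega> * M2 w \<omega>))" if "0 \<le> v" "0 \<le> w" for v w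
    using integrable_mult_indicator[OF AP int[OF that]] by simp
  define p where "p n i = s + (t - s) * real i / real n" for n i :: nat
  have p: "0 \<le> p n i" "s \<le> p n i" "p n i \<le> p n (Suc i)" for n i
    using st by (auto simp: p_def intro!: add_nonneg_nonneg divide_nonneg_nonneg mult_nonneg_nonneg divide_right_mono mult_left_mono)
  \<comment> \<open>\<open>A\<close> and the values at time \<open>v\<close> belong to the past of
    \<open>v\<close>, so next to \<open>M1 v\<close> the factor \<open>M2 w\<close> may be replaced
    by \<open>M2 v\<close>, and likewise with the roles exchanged.\<close>
  have step: "(\<integral>\<omega>. indicator A \<omega> * (M1 w \<omega> * M2 w \<omega>) \<partial>P) - (\<integral>\<omega>. indicator A \<omega> * (M1 v \<omega> * M2 v \<omega>) \<partial>P)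
     = (\<integral>\<omega>. indicator A \<omega> * ((M1 w \<omega> - M1 v \<omega>) * (M2 w \<omega> - M2 v \<omega>)) \<partial>P)"
    if vw: "s \<le> v" "v \<le> w" for v w
  proof -
    have v0: "0 \<le> v" "0 \<le> w" using st vw by auto
    have Av: "A \<in> sets (Fi v)" using A filtration_mono[OF st(1) vw(1)] by blast
    have 1: "(\<integral>\<omega>. (indicator A \<omega> * M1 v \<omega>) * M2 w \<omega> \<partial>P) = (\<integral>\<omega>. (indicator A \<omega> * M1 v \<omega>) * M2 v \<omega> \<partial>P)"
      by (rule martingale_mult[OF M2 v0(1) vw(2)])
         (use intA[of v w] v0 Av ad in \<open>simp_all add: adapted_def mult.assoc borel_measurable_times\<close>)
    have 2: "(\<integral>\<omega>. (indicator A \<omega> * M2 v \<omega>) * M1 w \<omega> \<partial>P) = (\<integral>\<omega>. (indicator A \<omega> * M2 v \<omega>) * M1 v \<omega> \<partial>P)"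
      by (rule martingale_mult[OF M1 v0(1) vw(2)])
         (use intA[of w v] v0 Av ad in \<open>simp_all add: adapted_def borel_measurable_times mult.assoc mult.commute mult.left_commute\<close>)
    have "(\<integral>\<omega>. indicator A \<omega> * ((M1 w \<omega> - M1 v \<omega>) * (M2 w \<omega> - M2 v \<omega>)) \<partial>P) =
      (\<integral>\<omega>. (indicator A \<omega> * (M1 w \<omega> * M2 w \<omega>) - indicator A \<omega> * (M1 w \<omega> * M2 v \<omega>)) -
           (indicator A \<omega> * (M1 v \<omega> * M2 w \<omega>) - indicator A \<omega> * (M1 v \<omega> * M2 v \<omega>)) \<partial>P)"
      by (rule Bochner_Integration.integral_cong) (auto simp: algebra_simps)
    also have "\<dots> = ((\<integral>\<omega>. indicator A \<omega> * (M1 w \<omega> * M2 w \<omega>) \<partial>P) - (\<integral>\<omega>. indicator A \<omega> * (M1 w \<omega> * M2 v \<omega>) \<partial>P))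
       - ((\<integral>\<omega>. indicator A \<omega> * (M1 v \<omega> * M2 w \<omega>) \<partial>P) - (\<integral>\<omega>. indicator A \<omega> * (M1 v \<omega> * M2 v \<omega>) \<partial>P))"
      using intA v0 by (simp add: Bochner_Integration.integral_diff)
    finally show ?thesis using 1 2 by (simp add: mult.assoc mult.commute mult.left_commute)
  qed
  define Rs where "Rs n \<omega> = (\<Sum>i<n. (M1 (p n (Suc i)) \<omega> - M1 (p n i) \<omega>) * (M2 (p n (Suc i)) \<omega> - M2 (p n i) \<omega>))" for n \<omega>
  have sum_eq: "(\<integral>\<omega>. indicator A \<omega> * (M1 t \<omega> * M2 t \<omega>) \<partial>P) - (\<integral>\<omega>. indicator A \<omega> * (M1 s \<omega> * M2 s \<omega>) \<partial>P)
     = (\<integral>\<omega>. indicator A \<omega> * Rs n \<omega> \<partial>P)" if n: "n > 0" for n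
  proof -
    have ints: "integrable P (\<lambda>\<omega>. indicator A \<omega> * ((M1 (p n (Suc i)) \<omega> - M1 (p n i) \<omega>) * (M2 (p n (Suc i)) \<omega> - M2 (p n i) \<omega>)))" for i
      using intA[OF p(1)[of n "Suc i"] p(1)[of n "Suc i"]] intA[OF p(1)[of n "Suc i"] p(1)[of n i]]
        intA[OF p(1)[of n i] p(1)[of n "Suc i"]] intA[OF p(1)[of n i] p(1)[of n i]]
      by (simp add: right_diff_distrib left_diff_distrib)
    have "(\<integral>\<omega>. indicator A \<omega> * Rs n \<omega> \<partial>P) =
      (\<Sum>i<n. (\<integral>\<omega>. indicator A \<omega> * ((M1 (p n (Suc i)) \<omega> - M1 (p n i) \<omega>) * (M2 (p n (Suc i)) \<omega> - M2 (p n i) \<omega>)) \<partial>P))"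
      unfolding Rs_def sum_distrib_left by (rule Bochner_Integration.integral_sum) (rule ints)
    also have "\<dots> = (\<Sum>i<n. (\<integral>\<omega>. indicator A \<omega> * (M1 (p n (Suc i)) \<omega> * M2 (p n (Suc i)) \<omega>) \<partial>P) -
        (\<integral>\<omega>. indicator A \<omega> * (M1 (p n i) \<omega> * M2 (p n i) \<omega>) \<partial>P))"
      by (intro sum.cong refl step[symmetric] p)
    also have "\<dots> = (\<integral>\<omega>. indicator A \<omega> * (M1 (p n n) \<omega> * M2 (p n n) \<omega>) \<partial>P) -
        (\<integral>\<omega>. indicator A \<omega> * (M1 (p n 0) \<omega> * M2 (p n 0) \<omega>) \<partial>P)"
      by (rule sum_lessThan_telescope)
    finally show ?thesis using n by (simp add: p_def)
  qed
  \<comment> \<open>One almost sure set for all partitions and all bounds \<open>e\<close>: it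
    serves with \<open>e = 2 * H\<close> for the domination and with small \<open>e\<close> for the
    limit.\<close>
  have Rb: "AE \<omega> in P. \<forall>n e. e \<ge> 0 \<longrightarrow> (\<forall>i<n. \<bar>M2 (p n (Suc i)) \<omega> - M2 (p n i) \<omega>\<bar> \<le> e) \<longrightarrow> \<bar>Rs n \<omega>\<bar> \<le> K \<omega> * e"
    using var G
  proof eventually_elim
    case (elim \<omega>)
    show ?case
    proof (intro allI impI)
      fix n :: nat and e :: real
      assume e0: "e \<ge> 0" and e: "\<forall>i<n. \<bar>M2 (p n (Suc i)) \<omega> - M2 (p n i) \<omega>\<bar> \<le> e"
      have "\<bar>Rs n \<omega>\<bar> \<le> (\<Sum>i<n. \<bar>M1 (p n (Suc i)) \<omega> - M1 (p n i) \<omega>\<bar> * \<bar>M2 (p n (Suc i)) \<omega> - M2 (p n i) \<omega>\<bar>)"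
        unfolding Rs_def abs_mult[symmetric] by (rule sum_abs)
      also have "\<dots> \<le> (\<Sum>i<n. (G (p n (Suc i)) \<omega> - G (p n i) \<omega>) * e)"
      proof (intro sum_mono mult_mono)
        fix i assume "i \<in> {..<n}"
        have "\<bar>M1 (p n (Suc i)) \<omega> - M1 (p n i) \<omega>\<bar> \<le> G (p n (Suc i)) \<omega> - G (p n i) \<omega>"
          using elim(1) p by blast
        then show "\<bar>M1 (p n (Suc i)) \<omega> - M1 (p n i) \<omega>\<bar> \<le> G (p n (Suc i)) \<omega> - G (p n i) \<omega>"
          "0 \<le> G (p n (Suc i)) \<omega> - G (p n i) \<omega>" by linarith+
      qed (use e in auto)
      also have "\<dots> = (G (p n n) \<omega> - G (p n 0) \<omega>) * e"
        unfolding sum_distrib_right[symmetric] sum_lessThan_telescope[of "\<lambda>i. G (p n i) \<omega>"] ..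
      also have "\<dots> \<le> K \<omega> * e"
      proof (rule mult_right_mono[OF _ e0])
        have "G 0 \<omega> \<le> G (p n 0) \<omega>" using elim(1)[rule_format, of 0 "p n 0"] p(1)[of n 0] by linarith
        then show "G (p n n) \<omega> - G (p n 0) \<omega> \<le> K \<omega>" using elim(2) p(1)[of n n] by fastforce
      qed
      finally show "\<bar>Rs n \<omega>\<bar> \<le> K \<omega> * e" .
    qed
  qed
  have lim: "(\<lambda>n. (\<integral>\<omega>. indicator A \<omega> * Rs n \<omega> \<partial>P)) \<longlonglongrightarrow> (\<integral>\<omega>. 0 \<partial>P)"
  proof (rule integral_dominated_convergence[where w="\<lambda>\<omega>. 2 * (K \<omega> * H \<omega>)"])
    show "(\<lambda>\<omega>. indicator A \<omega> * Rs n \<omega>) \<in> borel_measurable P" for n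
      unfolding Rs_def using m p AP by auto
    show "integrable P (\<lambda>\<omega>. 2 * (K \<omega> * H \<omega>))" using KH by simp
    show "AE \<omega> in P. norm (indicator A \<omega> * Rs n \<omega>) \<le> 2 * (K \<omega> * H \<omega>)" for n
      using Rb H dom
    proof eventually_elim
      case (elim \<omega>)
      have H0: "0 \<le> H \<omega>" using elim(2) abs_ge_zero order_trans by blast
      have KH0: "0 \<le> K \<omega> * H \<omega>" using elim(3) abs_ge_zero order_trans by blast
      have "\<forall>i<n. \<bar>M2 (p n (Suc i)) \<omega> - M2 (p n i) \<omega>\<bar> \<le> 2 * H \<omega>"
      proof (intro allI impI)
        fix i
        have "\<bar>M2 (p n (Suc i)) \<omega>\<bar> \<le> H \<omega>" "\<bar>M2 (p n i) \<omega>\<bar> \<le> H \<omega>" using elim(2) p(1) by auto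
        then show "\<bar>M2 (p n (Suc i)) \<omega> - M2 (p n i) \<omega>\<bar> \<le> 2 * H \<omega>" by linarith
      qed
      then have "\<bar>Rs n \<omega>\<bar> \<le> K \<omega> * (2 * H \<omega>)" using elim(1) H0 by auto
      then show ?case using KH0 by (auto simp: indicator_def)
    qed
    show "AE \<omega> in P. (\<lambda>n. indicator A \<omega> * Rs n \<omega>) \<longlonglongrightarrow> 0"
      using Rb cont K
    proof eventually_elim
      case (elim \<omega>)
      have K0: "0 \<le> K \<omega>" using elim(3) abs_ge_zero order_trans by blast
      have "(\<lambda>n. Rs n \<omega>) \<longlonglongrightarrow> 0"
      proof (rule LIMSEQ_I)
        fix r :: real assume r: "0 < r"
        \<comment> \<open>The summand 1 keeps the denominator positive when \<open>K\<close>
          vanishes, and the factor 2 makes the final inequality strict.\<close>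
        define e where "e = r / (2 * (K \<omega> + 1))"
        have e: "e > 0" "K \<omega> * e < r"
        proof -
          show "e > 0" using r K0 by (auto simp: e_def)
          have "K \<omega> * e \<le> r / 2" using r K0 by (auto simp: e_def field_simps)
          then show "K \<omega> * e < r" using r by linarith
        qed
        have "uniformly_continuous_on {s..t} (\<lambda>t. M2 t \<omega>)"
          by (rule compact_uniformly_continuous) (use elim(2) st in \<open>auto elim: continuous_on_subset\<close>)
        then obtain d where d: "d > 0" "\<And>v w. v \<in> {s..t} \<Longrightarrow> w \<in> {s..t} \<Longrightarrow> dist w v < d \<Longrightarrow> dist (M2 w \<omega>) (M2 v \<omega>) < e"
          unfolding uniformly_continuous_on_def using e by metis
        obtain n0 :: nat where n0: "(t - s) / d < n0" using reals_Archimedean2 by blast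
        show "\<exists>no. \<forall>n\<ge>no. norm (Rs n \<omega> - 0) < r"
        proof (intro exI allI impI)
          fix n assume n: "n \<ge> Suc n0"
          have "\<bar>M2 (p n (Suc i)) \<omega> - M2 (p n i) \<omega>\<bar> \<le> e" if i: "i < n" for i
          proof -
            have diff: "p n (Suc i) - p n i = (t - s) / n" using n by (simp add: p_def field_simps)
            have "(t - s) / n < d"
            proof -
              have "t - s < n0 * d" using n0 d(1) by (simp add: field_simps)
              also have "\<dots> \<le> n * d" using n d(1) by (intro mult_right_mono) auto
              finally show ?thesis using n by (simp add: field_simps)
            qed
            moreover have "p n (Suc i) \<le> t"
            proof -
              have "(t - s) * real (Suc i) / n \<le> (t - s) * 1"
                unfolding times_divide_eq_right[symmetric] using i st by (intro mult_left_mono) auto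
              then show ?thesis by (simp add: p_def)
            qed
            ultimately show ?thesis
              using d(2)[of "p n i" "p n (Suc i)"] p[of n i] p(2)[of n "Suc i"] diff
              by (auto simp: dist_real_def less_imp_le)
          qed
          then have "\<bar>Rs n \<omega>\<bar> \<le> K \<omega> * e" using elim(1) e(1) by auto
          then show "norm (Rs n \<omega> - 0) < r" using e(2) by auto
        qed
      qed
      then show ?case by (auto intro: tendsto_mult_right_zero)
    qed
  qed simp
  have "(\<lambda>n. (\<integral>\<omega>. indicator A \<omega> * Rs n \<omega> \<partial>P)) \<longlonglongrightarrow>
    ((\<integral>\<omega>. indicator A \<omega> * (M1 t \<omega> * M2 t \<omega>) \<partial>P) - (\<integral>\<omega>. indicator A \<omega> * (M1 s \<omega> * M2 s \<omega>) \<partial>P))"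
    by (rule Lim_transform_eventually[OF tendsto_const])
       (rule eventually_mono[OF eventually_gt_at_top[of 0]], rule sum_eq)
  from LIMSEQ_unique[OF this lim]
  show "(\<integral>\<omega>. indicator A \<omega> * (M1 t \<omega> * M2 t \<omega>) \<partial>P) = (\<integral>\<omega>. indicator A \<omega> * (M1 s \<omega> * M2 s \<omega>) \<partial>P)"
    by simp
qed

end

section \<open>Localization along rational times\<close>

context filtered_prob_space begin

text \<open>Nonnegative rational times are indexed as absolute values of elements of the countable
  type \<open>rat\<close>, so that quantifiers over them preserve measurability.\<close>

lemma rational_between_nonneg:
  fixes a b :: real assumes "a < b" "0 \<le> a"
  obtains r :: rat where "a < \<bar>of_rat r\<bar>" "\<bar>of_rat r\<bar> < b"
proof -
  obtain q where q: "q \<in> \<rat>" "a < q" "q < b" using Rats_dense_in_real[OF assms(1)] by blast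
  then obtain r where "q = of_rat r" by (auto elim: Rats_cases)
  moreover have "\<bar>q\<bar> = q" using q assms(2) by simp
  ultimately have e: "\<bar>of_rat r\<bar> = q" by (simp only:)
  show ?thesis by (rule that[of r]; unfold e; fact)
qed

text \<open>
  Since paths are only almost surely regular and the filtration need not be complete, a process
  stopped at a general stopping time need not be adapted; for stopping times with countably many
  values it is. A rounded hitting time overshoots, but rounding on a grid that is fine enough for the
  level makes the overshoot square integrable.
\<close>
lemma rational_localization:
  fixes Y :: "real \<Rightarrow> 'w \<Rightarrow> real"
  assumes Y: "adapted Fi Y"
    and reg: "AE \<omega> in P. Y 0 \<omega> \<le> 0 \<and>
      (\<forall>t\<ge>0. ((\<lambda>s. Y s \<omega>) \<longlongrightarrow> Y t \<omega>) (at_right t)) \<and>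
      (\<forall>t>0. \<exists>d>0. \<forall>v. t - d < v \<and> v < t \<and> 0 \<le> v \<longrightarrow> Y t \<omega> \<le> Y v \<omega> + 3/2) \<and>
      (\<forall>t. \<exists>c. \<forall>v. 0 \<le> v \<and> v \<le> t \<longrightarrow> Y v \<omega> \<le> c)"
  obtains T :: "nat \<Rightarrow> 'w \<Rightarrow> real" and D :: "nat \<Rightarrow> 'w \<Rightarrow> real" where
    "\<And>n. stopping_time Fi (T n)" "\<And>n \<omega>. T n \<omega> \<in> \<rat>" "\<And>n \<omega>. 0 \<le> T n \<omega>" "\<And>n \<omega>. T n \<omega> \<le> n"
    "\<And>\<omega>. incseq (\<lambda>n. T n \<omega>)" "AE \<omega> in P. filterlim (\<lambda>n. T n \<omega>) at_top sequentially"
    "\<And>n. D n \<in> borel_measurable P" "\<And>n. integrable P (\<lambda>\<omega>. (D n \<omega>)\<^sup>2)"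
    "\<And>n. AE \<omega> in P. \<forall>v. 0 \<le> v \<and> v \<le> T n \<omega> \<longrightarrow> Y v \<omega> \<le> D n \<omega>"
proof -
  define q where "q r = \<bar>real_of_rat r\<bar>" for r
  have q0: "0 \<le> q r" for r by (simp add: q_def)
  have qR: "\<exists>r. x = q r" if "x \<in> \<rat>" "0 \<le> x" for x
    using that unfolding q_def by (metis Rats_cases abs_of_nonneg)
  have meas: "Y (q r) \<in> borel_measurable (Fi t)" if "q r \<le> t" for r t
    using Y measurable_Fi_mono[OF q0 that] q0 by (auto simp: adapted_def)
  have measP[measurable]: "Y (q r) \<in> borel_measurable P" for r
    using Y adapted_measurable q0 by blast
  \<comment> \<open>The bad event of level \<open>m\<close> on the dyadic grid of mesh
    \<open>1 / 2^k\<close>: up to the start of some grid cell \<open>Y\<close> stays at most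
    \<open>2 m\<close>, yet \<open>2 m + 2\<close> is exceeded by the end of that cell, so that
    rounding the crossing time up would overshoot.\<close>
  define B where "B m k = {\<omega>\<in>space P. \<exists>j::nat. (\<forall>r. q r < j / 2^k \<longrightarrow> Y (q r) \<omega> \<le> 2 * real m) \<and>
      (\<exists>r. q r \<le> Suc j / 2^k \<and> Y (q r) \<omega> > 2 * real m + 2)}" for m k :: nat
  have B[measurable]: "B m k \<in> sets P" for m k unfolding B_def by measurable
  \<comment> \<open>At the crossing time \<open>z\<close> of the level \<open>2 m\<close> an upward
    jump has size at most 3/2, hence \<open>Y z < 2 m + 2\<close>. Right continuity keeps
    \<open>Y\<close> below this level for a short while, which outlasts the grid cell once the mesh
    is fine.\<close>
  have not_B: "AE \<omega> in P. \<forall>m. eventually (\<lambda>k. \<omega> \<notin> B m k) sequentially"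
    using reg
  proof eventually_elim
    case (elim \<omega>)
    show ?case
    proof
      fix m
      define Z where "Z = {x. \<exists>r. x = q r \<and> Y x \<omega> > 2 * real m}"
      show "eventually (\<lambda>k. \<omega> \<notin> B m k) sequentially"
      proof (cases "Z = {}")
        case True
        then have le: "Y (q r) \<omega> \<le> 2 * real m" for r unfolding Z_def by (metis (mono_tags, lifting) empty_Collect_eq not_le)
        have "\<omega> \<notin> B m k" for k
        proof
          assume "\<omega> \<in> B m k"
          then obtain r where "Y (q r) \<omega> > 2 * real m + 2" by (auto simp: B_def)
          then show False using le[of r] by linarith
        qed
        then show ?thesis by simp
      next
        case False
        define z where "z = Inf Z"
        have bdd: "bdd_below Z" by (rule bdd_belowI[of _ 0]) (auto simp: Z_def q0)
        have z0: "0 \<le> z" unfolding z_def by (rule cInf_greatest[OF False]) (auto simp: Z_def q0)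
        have zle: "z \<le> x" if "x \<in> Z" for x unfolding z_def using that bdd by (rule cInf_lower)
        have Yz: "Y z \<omega> < 2 * real m + 2"
        proof (cases "z = 0")
          case True then show ?thesis using elim by auto
        next
          case zpos: False
          then obtain d where d: "d > 0" "\<And>v. z - d < v \<Longrightarrow> v < z \<Longrightarrow> 0 \<le> v \<Longrightarrow> Y z \<omega> \<le> Y v \<omega> + 3/2"
            using elim z0 by (metis less_eq_real_def)
          obtain r where r: "max 0 (z - d) < q r" "q r < z"
            using rational_between_nonneg[of "max 0 (z - d)" z] zpos z0 d(1) unfolding q_def by auto
          then have "q r \<notin> Z" using zle by force
          then have "Y (q r) \<omega> \<le> 2 * real m" by (auto simp: Z_def)
          moreover have "Y z \<omega> \<le> Y (q r) \<omega> + 3/2" using d(2)[of "q r"] r by auto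
          ultimately show ?thesis by linarith
        qed
        have "((\<lambda>s. Y s \<omega>) \<longlongrightarrow> Y z \<omega>) (at_right z)" using elim z0 by blast
        then have "eventually (\<lambda>s. Y s \<omega> < 2 * real m + 2) (at_right z)"
          using Yz by (rule order_tendstoD(2))
        then obtain b where b: "b > z" "\<And>s. z < s \<Longrightarrow> s < b \<Longrightarrow> Y s \<omega> < 2 * real m + 2"
          unfolding eventually_at_right_field by blast
        have "(\<lambda>k. (1/2::real) ^ k) \<longlonglongrightarrow> 0" by (rule LIMSEQ_power_zero) simp
        then have "eventually (\<lambda>k. (1/2::real) ^ k < b - z) sequentially"
          by (rule order_tendstoD(2)) (use b in simp)
        then show ?thesis
        proof eventually_elim
          case (elim k)
          show ?case
          proof
            assume "\<omega> \<in> B m k"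
            then obtain j r where j: "\<And>r. q r < real j / 2^k \<Longrightarrow> Y (q r) \<omega> \<le> 2 * real m"
              and r: "q r \<le> real (Suc j) / 2^k" "Y (q r) \<omega> > 2 * real m + 2"
              unfolding B_def by blast
            have jz: "real j / 2^k \<le> z"
            proof (rule ccontr)
              assume "\<not> real j / 2^k \<le> z"
              then obtain x where "x \<in> Z" "x < real j / 2^k"
                using cInf_lessD[OF False, of "real j / 2^k"] by (auto simp: z_def)
              then show False using j unfolding Z_def by force
            qed
            have "real (Suc j) / 2^k = real j / 2^k + (1/2)^k" by (simp add: field_simps)
            then have "q r < b" using r(1) jz elim by linarith
            moreover have "q r \<in> Z" using r(2) by (auto simp: Z_def)
            then have "z \<le> q r" by (rule zle)
            ultimately show False using b(2)[of "q r"] r(2) Yz by (cases "q r = z") auto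
          qed
        qed
      qed
    qed
  qed
  have prob_B: "(\<lambda>k. prob (B m k)) \<longlonglongrightarrow> 0" for m
  proof -
    have "(\<lambda>k. \<integral>\<omega>. indicator (B m k) \<omega> \<partial>P) \<longlonglongrightarrow> (\<integral>\<omega>. (0::real) \<partial>P)"
    proof (rule integral_dominated_convergence[where w="\<lambda>_. 1"])
      show "AE \<omega> in P. (\<lambda>k. indicat_real (B m k) \<omega>) \<longlonglongrightarrow> 0"
        using not_B
      proof eventually_elim
        case (elim \<omega>)
        then have "eventually (\<lambda>k. \<omega> \<notin> B m k) sequentially" by blast
        then have "eventually (\<lambda>k. indicat_real (B m k) \<omega> = 0) sequentially"
          by eventually_elim simp
        then show ?case by (rule tendsto_eventually)
      qed
    qed (auto simp: indicator_def)
    then show ?thesis by simp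
  qed
  \<comment> \<open>Calibrated so that the series of \<open>(2 m + 4)^2\<close> times the
    probability of the bad event of level \<open>m\<close> is dominated by a geometric
    series.\<close>
  define e where "e m = (1/2) ^ m / (2 * real m + 4)\<^sup>2" for m :: nat
  have "\<exists>k. prob (B m k) < e m" for m
  proof -
    have "e m > 0" by (auto simp: e_def intro!: divide_pos_pos zero_less_power)
    then have "eventually (\<lambda>k. prob (B m k) < e m) sequentially"
      using prob_B order_tendstoD(2) by blast
    then show ?thesis by (rule eventually_happens'[rotated]) simp
  qed
  then obtain \<kappa> where \<kappa>: "\<And>m. prob (B m (\<kappa> m)) < e m" by metis
  \<comment> \<open>At the grid point \<open>x\<close> a crossing of \<open>2 m\<close> has been
    observed and no overshoot above \<open>2 m + 2\<close> has occurred. Only rational times up to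
    \<open>x\<close> are inspected, so the event is known at time \<open>x\<close>.\<close>
  define A where "A m x = {\<omega>. (\<exists>r. q r < x \<and> Y (q r) \<omega> > 2 * real m) \<and> (\<forall>r. q r \<le> x \<longrightarrow> Y (q r) \<omega> \<le> 2 * real m + 2)}" for m x
  have A: "{\<omega>\<in>space P. \<omega> \<in> A m x} \<in> sets (Fi t)" if x: "0 \<le> x" "x \<le> t" for m x t
  proof -
    have 1: "Measurable.pred (Fi t) (\<lambda>\<omega>. q r < x \<and> Y (q r) \<omega> > 2 * real m)" for r
    proof (cases "q r < x")
      case True
      then have [measurable]: "Y (q r) \<in> borel_measurable (Fi t)" using x meas by simp
      show ?thesis by measurable
    qed simp
    have 2: "Measurable.pred (Fi t) (\<lambda>\<omega>. q r \<le> x \<longrightarrow> Y (q r) \<omega> \<le> 2 * real m + 2)" for r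
    proof (cases "q r \<le> x")
      case True
      then have [measurable]: "Y (q r) \<in> borel_measurable (Fi t)" using x meas by simp
      show ?thesis by measurable
    qed simp
    have "Measurable.pred (Fi t) (\<lambda>\<omega>. (\<exists>r. q r < x \<and> Y (q r) \<omega> > 2 * real m) \<and> (\<forall>r. q r \<le> x \<longrightarrow> Y (q r) \<omega> \<le> 2 * real m + 2))"
      by (rule pred_intros_logic(3)[OF pred_intros_countable(2) pred_intros_countable(1)]) (rule 1, rule 2)
    then show ?thesis unfolding A_def pred_def mem_Collect_eq space_Fi[OF order_trans[OF x]] .
  qed
  \<comment> \<open>Every level from \<open>n\<close> on may trigger the stopping: if the grid of
    level \<open>n\<close> is too coarse for a path and overshoots, a later level still catches it.
    Quantifying over all \<open>m \<ge> n\<close> also makes the times increase with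
    \<open>n\<close>.\<close>
  define Cd where "Cd n \<omega> = {real n} \<union> {x. x < real n \<and> (\<exists>m\<ge>n. (\<exists>j::nat. x = Suc j / 2 ^ \<kappa> m) \<and> \<omega> \<in> A m x)}" for n \<omega>
  define T where "T n \<omega> = Inf (Cd n \<omega>)" for n \<omega>
  have Cd0: "0 \<le> x" if "x \<in> Cd n \<omega>" for x n \<omega> using that by (auto simp: Cd_def)
  have CdR: "x \<in> \<rat>" if "x \<in> Cd n \<omega>" for x n \<omega> using that by (auto simp: Cd_def)
  have Tin: "T n \<omega> \<in> Cd n \<omega>" for n \<omega>
  proof -
    consider "Cd n \<omega> = {real n}" | x1 m1 where "x1 < real n" "n \<le> m1" "\<omega> \<in> A m1 x1" "x1 \<in> Cd n \<omega>"
      unfolding Cd_def by blast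
    then show ?thesis
    proof cases
      case 1 then show ?thesis by (simp add: T_def)
    next
      case 2
      \<comment> \<open>A candidate of level \<open>m\<close> up to \<open>x1\<close> has seen a
        value above \<open>2 m\<close>, while all values seen up to \<open>x1\<close> are at most
        \<open>2 m1 + 2\<close>. Hence \<open>m \<le> m1\<close>, only finitely many grids matter,
        and the infimum is attained.\<close>
      have "Cd n \<omega> \<inter> {..x1} \<subseteq> (\<Union>m\<in>{..m1}. (\<lambda>j. Suc j / 2 ^ \<kappa> m) ` {..nat \<lceil>real n * 2 ^ \<kappa> m\<rceil>})"
      proof
        fix x assume "x \<in> Cd n \<omega> \<inter> {..x1}"
        then obtain m j where m: "x < real n" "x \<le> x1" "x = Suc j / 2 ^ \<kappa> m" "\<omega> \<in> A m x"
          using 2 by (auto simp: Cd_def)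
        obtain r where r: "q r < x" "Y (q r) \<omega> > 2 * real m" using m(4) by (auto simp: A_def)
        then have "Y (q r) \<omega> \<le> 2 * real m1 + 2" using 2(3) m(2) by (auto simp: A_def)
        then have "real m < real m1 + 1" using r by linarith
        then have mm: "m \<le> m1" by linarith
        have "real (Suc j) \<le> real n * 2 ^ \<kappa> m" using m(1,3) by (simp add: field_simps)
        then have "int j \<le> \<lceil>real n * 2 ^ \<kappa> m\<rceil>" by linarith
        then have "j \<le> nat \<lceil>real n * 2 ^ \<kappa> m\<rceil>" by linarith
        then show "x \<in> (\<Union>m\<in>{..m1}. (\<lambda>j. Suc j / 2 ^ \<kappa> m) ` {..nat \<lceil>real n * 2 ^ \<kappa> m\<rceil>})"
          using mm m(3) by blast
      qed
      then have fin: "finite (Cd n \<omega> \<inter> {..x1})" by (rule finite_subset) auto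
      define y where "y = Min (Cd n \<omega> \<inter> {..x1})"
      have y: "y \<in> Cd n \<omega> \<inter> {..x1}" unfolding y_def by (rule Min_in[OF fin]) (use 2 in auto)
      have "y \<le> x" if "x \<in> Cd n \<omega>" for x
      proof (cases "x \<le> x1")
        case True then show ?thesis unfolding y_def using that by (intro Min_le[OF fin]) auto
      next
        case False then show ?thesis using y by auto
      qed
      then have "T n \<omega> = y" unfolding T_def using y by (intro cInf_eq_minimum) auto
      then show ?thesis using y by simp
    qed
  qed
  have Tle: "T n \<omega> \<le> x" if "x \<in> Cd n \<omega>" for x n \<omega>
    unfolding T_def using that by (rule cInf_lower) (auto intro!: bdd_belowI[of _ 0] Cd0)
  have T0: "0 \<le> T n \<omega>" for n \<omega> using Cd0[OF Tin] .
  have Tn: "T n \<omega> \<le> n" for n \<omega> by (rule Tle) (simp add: Cd_def)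
  have TR: "T n \<omega> \<in> \<rat>" for n \<omega> using CdR[OF Tin] .
  have stop: "stopping_time Fi (T n)" for n
    unfolding stopping_time_def
  proof
    fix t
    show "Measurable.pred (Fi t) (\<lambda>\<omega>. T n \<omega> \<le> t)"
    proof (cases "0 \<le> t \<and> t < n")
      case True
      have eq: "{\<omega>\<in>space (Fi t). T n \<omega> \<le> t} =
        (\<Union>m\<in>{n..}. \<Union>j\<in>{j::nat. Suc j / 2 ^ \<kappa> m \<le> t}. {\<omega>\<in>space P. \<omega> \<in> A m (Suc j / 2 ^ \<kappa> m)})" (is "?L = ?R")
      proof safe
        fix \<omega> assume \<omega>: "\<omega> \<in> space (Fi t)" and le: "T n \<omega> \<le> t"
        then show "\<omega> \<in> ?R" using Tin[of n \<omega>] True space_Fi[of t] by (force simp: Cd_def)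
      next
        fix \<omega> m j assume \<omega>: "\<omega> \<in> space P" "m \<ge> n" "Suc j / 2 ^ \<kappa> m \<le> t" "\<omega> \<in> A m (Suc j / 2 ^ \<kappa> m)"
        show "\<omega> \<in> space (Fi t)" using \<omega> space_Fi[of t] True by simp
        have "Suc j / 2 ^ \<kappa> m \<in> Cd n \<omega>" using \<omega> True by (force simp: Cd_def)
        from Tle[OF this] show "T n \<omega> \<le> t" using \<omega> by simp
      qed
      have "?R \<in> sets (Fi t)"
        by (intro sets.countable_UN'' countableI_type A) auto
      then show ?thesis using eq by (simp add: pred_def)
    next
      case False
      then have "(\<forall>\<omega>. \<not> T n \<omega> \<le> t) \<or> (\<forall>\<omega>. T n \<omega> \<le> t)" using T0 Tn by (meson not_le order_trans)
      then show ?thesis by auto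
    qed
  qed
  have incT: "incseq (\<lambda>n. T n \<omega>)" for \<omega>
  proof (rule incseq_SucI)
    fix n
    have "T n \<omega> \<le> x" if "x \<in> Cd (Suc n) \<omega>" for x
    proof (cases "x < n")
      case True
      then have "x \<in> Cd n \<omega>" using that by (auto simp: Cd_def intro: Suc_leD)
      then show ?thesis by (rule Tle)
    next
      case False then show ?thesis using Tn[of n \<omega>] by linarith
    qed
    then show "T n \<omega> \<le> T (Suc n) \<omega>" using Tin by blast
  qed
  have limT: "AE \<omega> in P. filterlim (\<lambda>n. T n \<omega>) at_top sequentially"
    using reg
  proof eventually_elim
    case (elim \<omega>)
    show ?case unfolding filterlim_at_top
    proof
      fix t :: real
      have "\<exists>c. \<forall>v. 0 \<le> v \<and> v \<le> t \<longrightarrow> Y v \<omega> \<le> c" using elim by simp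
      then obtain c where c: "\<And>v. 0 \<le> v \<Longrightarrow> v \<le> t \<Longrightarrow> Y v \<omega> \<le> c" by blast
      obtain n0 :: nat where n0: "max t c < n0" using reals_Archimedean2 by blast
      show "eventually (\<lambda>n. t \<le> T n \<omega>) sequentially"
        unfolding eventually_sequentially
      proof (intro exI allI impI)
        fix n assume n: "n0 \<le> n"
        show "t \<le> T n \<omega>"
        proof (rule ccontr)
          assume "\<not> t \<le> T n \<omega>"
          then have lt: "T n \<omega> < t" by simp
          then have "T n \<omega> \<noteq> real n" using n0 n by auto
          then obtain m where m: "n \<le> m" "\<omega> \<in> A m (T n \<omega>)" using Tin[of n \<omega>] by (auto simp: Cd_def)
          then obtain r where "q r < T n \<omega>" "Y (q r) \<omega> > 2 * real m" by (auto simp: A_def)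
          then show False using c[of "q r"] q0[of r] lt m(1) n n0 by auto
        qed
      qed
    qed
  qed
  \<comment> \<open>If level \<open>m\<close> is good, the end of the grid cell that contains the
    first crossing of \<open>2 m\<close> is a candidate, and \<open>2 m + 2\<close> is not exceeded
    up to there.\<close>
  have bound: "Y (q r) \<omega> \<le> 2 * real m + 2"
    if \<omega>: "\<omega> \<in> space P" "\<omega> \<notin> B m (\<kappa> m)" and m: "n \<le> m" and r: "q r \<le> T n \<omega>" for r \<omega> m n
  proof (rule ccontr)
    assume "\<not> Y (q r) \<omega> \<le> 2 * real m + 2"
    then have gt: "Y (q r) \<omega> > 2 * real m + 2" by simp
    define Z where "Z = {x. \<exists>r. x = q r \<and> Y x \<omega> > 2 * real m}"
    have rZ: "q r \<in> Z" using gt by (auto simp: Z_def)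
    define z where "z = Inf Z"
    have bdd: "bdd_below Z" by (rule bdd_belowI[of _ 0]) (auto simp: Z_def q0)
    have z0: "0 \<le> z" unfolding z_def by (rule cInf_greatest) (use rZ in \<open>auto simp: Z_def q0\<close>)
    have zle: "z \<le> x" if "x \<in> Z" for x unfolding z_def using that bdd by (rule cInf_lower)
    define j where "j = nat \<lfloor>z * 2 ^ \<kappa> m\<rfloor>"
    have j: "real j / 2 ^ \<kappa> m \<le> z" "z < real (Suc j) / 2 ^ \<kappa> m"
    proof -
      have "0 \<le> z * 2 ^ \<kappa> m" using z0 by simp
      then have "real j \<le> z * 2 ^ \<kappa> m" "z * 2 ^ \<kappa> m < real j + 1" unfolding j_def by linarith+
      then show "real j / 2 ^ \<kappa> m \<le> z" "z < real (Suc j) / 2 ^ \<kappa> m" by (auto simp: field_simps)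
    qed
    let ?x = "real (Suc j) / 2 ^ \<kappa> m"
    have before: "Y (q r') \<omega> \<le> 2 * real m" if "q r' < real j / 2 ^ \<kappa> m" for r'
    proof -
      have "q r' \<notin> Z" using zle[of "q r'"] that j by auto
      then show ?thesis by (auto simp: Z_def)
    qed
    have after: "Y (q r') \<omega> \<le> 2 * real m + 2" if "q r' \<le> ?x" for r'
    proof (rule ccontr)
      assume "\<not> Y (q r') \<omega> \<le> 2 * real m + 2"
      then have "q r' \<le> ?x \<and> Y (q r') \<omega> > 2 * real m + 2" using that by simp
      then have "\<omega> \<in> B m (\<kappa> m)" unfolding B_def using before \<omega>(1) by blast
      then show False using \<omega>(2) by contradiction
    qed
    have "Z \<noteq> {}" using rZ by auto
    then obtain r' where r': "q r' < ?x" "Y (q r') \<omega> > 2 * real m"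
      using cInf_lessD[of Z ?x] j(2) by (auto simp: z_def Z_def)
    have "T n \<omega> \<le> ?x"
    proof (cases "?x < n")
      case True
      then have "?x \<in> Cd n \<omega>" using m r' after unfolding Cd_def A_def by blast
      then show ?thesis by (rule Tle)
    next
      case False then show ?thesis using Tn[of n \<omega>] by linarith
    qed
    then show False using after[of r] r gt by linarith
  qed
  \<comment> \<open>The smallest good level \<open>m \<ge> n\<close> bounds \<open>Y\<close> by
    \<open>2 m + 2\<close>. If \<open>m = n\<close>, the first summand covers this; otherwise level
    \<open>m - 1\<close> is bad and contributes
    \<open>(2 (m - 1) + 4)^2 = (2 m + 2)^2\<close>.\<close>
  define D2 where "D2 n \<omega> = ennreal ((2 * real n + 2)\<^sup>2) + (\<Sum>m. ennreal ((2 * real m + 4)\<^sup>2) * indicator (B m (\<kappa> m)) \<omega>)" for n \<omega>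
  have D2m[measurable]: "D2 n \<in> borel_measurable P" for n unfolding D2_def by measurable
  have D2int: "(\<integral>\<^sup>+\<omega>. D2 n \<omega> \<partial>P) < \<infinity>" for n
  proof -
    have "(\<integral>\<^sup>+\<omega>. D2 n \<omega> \<partial>P) = ennreal ((2 * real n + 2)\<^sup>2) + (\<Sum>m. ennreal ((2 * real m + 4)\<^sup>2) * emeasure P (B m (\<kappa> m)))"
      unfolding D2_def by (subst nn_integral_add) (auto simp: nn_integral_suminf nn_integral_cmult emeasure_space_1)
    also have "(\<Sum>m. ennreal ((2 * real m + 4)\<^sup>2) * emeasure P (B m (\<kappa> m))) \<le> (\<Sum>m. ennreal ((1/2) ^ m))"
    proof (rule suminf_le)
      fix m
      have pos: "(2 * real m + 4)\<^sup>2 > 0" by (rule zero_less_power) linarith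
      have "ennreal ((2 * real m + 4)\<^sup>2) * emeasure P (B m (\<kappa> m)) = ennreal ((2 * real m + 4)\<^sup>2 * prob (B m (\<kappa> m)))"
        by (simp add: emeasure_eq_measure ennreal_mult)
      also have "\<dots> \<le> ennreal ((1/2) ^ m)"
        using \<kappa>[of m] pos by (intro ennreal_leI) (simp add: e_def field_simps)
      finally show "ennreal ((2 * real m + 4)\<^sup>2) * emeasure P (B m (\<kappa> m)) \<le> ennreal ((1/2) ^ m)" .
    qed auto
    also have "(\<Sum>m. ennreal ((1/2) ^ m)) = ennreal (\<Sum>m. (1/2) ^ m)"
      by (rule suminf_ennreal2) (auto intro: summable_geometric)
    finally show ?thesis
      by (metis (no_types, lifting) add_left_mono ennreal_add_eq_top ennreal_neq_top infinity_ennreal_def leD not_less_iff_gr_or_eq top.not_eq_extremum)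
  qed
  define D where "D n \<omega> = sqrt (enn2real (D2 n \<omega>))" for n \<omega>
  have Dm: "D n \<in> borel_measurable P" for n unfolding D_def by measurable
  have Dint: "integrable P (\<lambda>\<omega>. (D n \<omega>)\<^sup>2)" for n
  proof -
    have "integrable P (\<lambda>\<omega>. enn2real (D2 n \<omega>))"
    proof (rule integrableI_nonneg)
      have "(\<integral>\<^sup>+\<omega>. ennreal (enn2real (D2 n \<omega>)) \<partial>P) \<le> (\<integral>\<^sup>+\<omega>. D2 n \<omega> \<partial>P)"
        by (intro nn_integral_mono) (simp add: ennreal_enn2real_if)
      then show "(\<integral>\<^sup>+\<omega>. ennreal (enn2real (D2 n \<omega>)) \<partial>P) < \<infinity>" using D2int[of n] by simp
    qed auto
    then show ?thesis by (simp add: D_def)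
  qed
  have Dbound: "AE \<omega> in P. \<forall>v. 0 \<le> v \<and> v \<le> T n \<omega> \<longrightarrow> Y v \<omega> \<le> D n \<omega>" for n
  proof -
    have "AE \<omega> in P. D2 n \<omega> \<noteq> \<infinity>"
      using D2int by (intro nn_integral_PInf_AE) (auto simp: less_top)
    then show ?thesis using reg AE_space
    proof eventually_elim
      case (elim \<omega>)
      \<comment> \<open>If all levels from \<open>n\<close> on were bad, infinitely many terms of
        size at least 1 would make \<open>D2\<close> infinite.\<close>
      have "\<exists>m\<ge>n. \<omega> \<notin> B m (\<kappa> m)"
      proof (rule ccontr)
        assume "\<not> (\<exists>m\<ge>n. \<omega> \<notin> B m (\<kappa> m))"
        then have all: "\<omega> \<in> B m (\<kappa> m)" if "m \<ge> n" for m using that by blast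
        have "of_nat K \<le> D2 n \<omega>" for K :: nat
        proof -
          have "of_nat K = (\<Sum>m\<in>{n..<n+K}. (1::ennreal))" by simp
          also have "\<dots> \<le> (\<Sum>m\<in>{n..<n+K}. ennreal ((2 * real m + 4)\<^sup>2) * indicator (B m (\<kappa> m)) \<omega>)"
          proof (rule sum_mono)
            fix m assume "m \<in> {n..<n+K}"
            moreover have "ennreal 1 \<le> ennreal ((2 * real m + 4)\<^sup>2)"
              by (rule ennreal_leI, rule one_le_power) linarith
            ultimately show "1 \<le> ennreal ((2 * real m + 4)\<^sup>2) * indicator (B m (\<kappa> m)) \<omega>"
              using all[of m] by simp
          qed
          also have "\<dots> \<le> (\<Sum>m. ennreal ((2 * real m + 4)\<^sup>2) * indicator (B m (\<kappa> m)) \<omega>)"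
            by (rule sum_le_suminf) auto
          also have "\<dots> \<le> D2 n \<omega>" by (simp add: D2_def)
          finally show ?thesis .
        qed
        then have "D2 n \<omega> = \<top>" by (metis ennreal_Ex_less_of_nat leD top.not_eq_extremum)
        then show False using elim by simp
      qed
      define m where "m = (LEAST m. n \<le> m \<and> \<omega> \<notin> B m (\<kappa> m))"
      have m: "n \<le> m" "\<omega> \<notin> B m (\<kappa> m)"
        using LeastI_ex[of "\<lambda>m. n \<le> m \<and> \<omega> \<notin> B m (\<kappa> m)"] \<open>\<exists>m\<ge>n. \<omega> \<notin> B m (\<kappa> m)\<close> unfolding m_def by blast+
      have "ennreal ((2 * real m + 2)\<^sup>2) \<le> D2 n \<omega>"
      proof (cases "m = n")
        case True then show ?thesis by (simp add: D2_def)
      next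
        case False
        then obtain k where k: "m = Suc k" "n \<le> k" using m(1) by (cases m) auto
        then have "\<omega> \<in> B k (\<kappa> k)"
          using not_less_Least[of k "\<lambda>m. n \<le> m \<and> \<omega> \<notin> B m (\<kappa> m)"] unfolding m_def[symmetric] by auto
        have "ennreal ((2 * real m + 2)\<^sup>2) = (\<Sum>m\<in>{k}. ennreal ((2 * real m + 4)\<^sup>2) * indicator (B m (\<kappa> m)) \<omega>)"
          using \<open>\<omega> \<in> B k (\<kappa> k)\<close> k by (simp add: algebra_simps)
        also have "\<dots> \<le> (\<Sum>m. ennreal ((2 * real m + 4)\<^sup>2) * indicator (B m (\<kappa> m)) \<omega>)"
          by (rule sum_le_suminf) auto
        also have "\<dots> \<le> D2 n \<omega>" by (simp add: D2_def)
        finally show ?thesis .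
      qed
      then have "enn2real (ennreal ((2 * real m + 2)\<^sup>2)) \<le> enn2real (D2 n \<omega>)"
        using elim(1) by (intro enn2real_mono) (auto simp: less_top)
      then have mD: "2 * real m + 2 \<le> D n \<omega>"
        unfolding D_def by (intro real_le_rsqrt) simp
      have rat: "Y (q r) \<omega> \<le> D n \<omega>" if "q r \<le> T n \<omega>" for r
        using bound[OF elim(3) m(2,1) that] mD by linarith
      show ?case
      proof (intro allI impI)
        fix v assume v: "0 \<le> v \<and> v \<le> T n \<omega>"
        show "Y v \<omega> \<le> D n \<omega>"
        proof (cases "v = T n \<omega>")
          case True
          then obtain r where "v = q r" using qR TR T0 by metis
          then show ?thesis using rat v by auto
        next
          case False
          then have lt: "v < T n \<omega>" using v by simp
          show ?thesis
          proof (rule ccontr)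
            assume "\<not> Y v \<omega> \<le> D n \<omega>"
            then have "eventually (\<lambda>s. D n \<omega> < Y s \<omega>) (at_right v)"
              using elim(2) v by (intro order_tendstoD(1)[of "\<lambda>s. Y s \<omega>" "Y v \<omega>"]) auto
            then obtain b where b: "b > v" "\<And>s. v < s \<Longrightarrow> s < b \<Longrightarrow> D n \<omega> < Y s \<omega>"
              unfolding eventually_at_right_field by blast
            obtain r where r: "v < q r" "q r < min b (T n \<omega>)"
              using rational_between_nonneg[of v "min b (T n \<omega>)"] b(1) lt v unfolding q_def by auto
            then show False using b(2)[of "q r"] rat[of r] by auto
          qed
        qed
      qed
    qed
  qed
  show ?thesis
    by (rule that[of T D, OF stop TR T0 Tn incT limT Dm Dint Dbound])
qed

end

section \<open>Orthogonality to continuous local martingales\<close>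

context filtered_prob_space begin

lemma martingale_cong_space:
  assumes "martingale P Fi N" and eq: "\<And>t \<omega>. 0 \<le> t \<Longrightarrow> \<omega> \<in> space P \<Longrightarrow> N' t \<omega> = N t \<omega>"
  shows "martingale P Fi N'"
proof (rule martingaleI)
  show "adapted Fi N'"
    unfolding adapted_def
  proof (intro allI impI)
    fix t :: real assume t: "0 \<le> t"
    have "N t \<in> borel_measurable (Fi t)" using assms(1) t by (simp add: martingale_def adapted_def)
    then show "N' t \<in> borel_measurable (Fi t)"
      using measurable_cong[of "Fi t" "N' t" "N t" borel] eq[OF t] space_Fi[OF t] by simp
  qed
  have "AE \<omega> in P. cadlag (\<lambda>t. N t \<omega>)" using assms(1) by (simp add: martingale_def)
  then show "AE \<omega> in P. cadlag (\<lambda>t. N' t \<omega>)"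
    using AE_space
  proof eventually_elim
    case (elim \<omega>)
    note eq = eq[OF _ elim(2)]
    show ?case unfolding cadlag_def
    proof safe
      fix t :: real assume t: "0 \<le> t"
      have "eventually (\<lambda>s. N s \<omega> = N' s \<omega>) (at_right t)"
        using t eq by (auto simp: eventually_at_right_field intro!: exI[of _ "t+1"])
      then show "((\<lambda>t. N' t \<omega>) \<longlongrightarrow> N' t \<omega>) (at_right t)"
        using Lim_transform_eventually[of "\<lambda>t. N t \<omega>" "N t \<omega>" "at_right t" "\<lambda>t. N' t \<omega>"] elim(1) t
        by (simp add: cadlag_def eq)
    next
      fix t :: real assume t: "0 < t"
      then obtain l where l: "((\<lambda>t. N t \<omega>) \<longlongrightarrow> l) (at_left t)" using elim by (auto simp: cadlag_def)
      have "eventually (\<lambda>s. N s \<omega> = N' s \<omega>) (at_left t)"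
        using t eq by (auto simp: eventually_at_left_field intro!: exI[of _ 0])
      then have "((\<lambda>t. N' t \<omega>) \<longlongrightarrow> l) (at_left t)"
        by (rule Lim_transform_eventually[OF l])
      then show "\<exists>l. ((\<lambda>t. N' t \<omega>) \<longlongrightarrow> l) (at_left t)" ..
    qed
  qed
  show "integrable P (N' t)" if "0 \<le> t" for t
    using assms(1) that Bochner_Integration.integrable_cong[of P P "N' t" "N t"] eq[OF that] by (simp add: martingale_def)
  show "(\<integral>\<omega>. indicator A \<omega> * N' t \<omega> \<partial>P) = (\<integral>\<omega>. indicator A \<omega> * N' s \<omega> \<partial>P)"
    if "0 \<le> s" "s \<le> t" "A \<in> sets (Fi s)" for s t A
    using martingale_indicator[OF assms(1) that] that eq[of t] eq[of s]
    by (simp cong: Bochner_Integration.integral_cong)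
qed

text \<open>This is how a large initial value of \<open>L\<close> is cut off: an event of time 0
  belongs to the past of every time.\<close>

lemma martingale_times_initial:
  assumes N: "martingale P Fi N" and B: "B \<in> sets (Fi 0)"
  shows "martingale P Fi (\<lambda>t \<omega>. if \<omega> \<in> B then N t \<omega> else 0)"
proof (rule martingaleI)
  have BF: "B \<in> sets (Fi t)" if "0 \<le> t" for t using B filtration_mono[OF order_refl that] by blast
  have BP: "B \<in> sets P" by (rule sets_Fi[OF order_refl B])
  have eq: "(if \<omega> \<in> B then x else 0) = indicator B \<omega> * x" for \<omega> and x :: real by (simp add: indicator_def)
  show "adapted Fi (\<lambda>t \<omega>. if \<omega> \<in> B then N t \<omega> else 0)"
    unfolding adapted_def eq
  proof (intro allI impI borel_measurable_times)
    fix t :: real assume t: "0 \<le> t"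
    show "indicat_real B \<in> borel_measurable (Fi t)" using BF[OF t] by simp
    show "N t \<in> borel_measurable (Fi t)" using N t by (simp add: martingale_def adapted_def)
  qed
  have "AE \<omega> in P. cadlag (\<lambda>t. N t \<omega>)" using N by (simp add: martingale_def)
  then show "AE \<omega> in P. cadlag (\<lambda>t. if \<omega> \<in> B then N t \<omega> else 0)"
  proof eventually_elim
    case (elim \<omega>)
    show ?case by (cases "\<omega> \<in> B") (auto simp: elim, auto simp: cadlag_def)
  qed
  show "integrable P (\<lambda>\<omega>. if \<omega> \<in> B then N t \<omega> else 0)" if "0 \<le> t" for t
    unfolding eq using N that BP integrable_mult_indicator[of B P "N t"] by (simp add: martingale_def)
  fix s t A assume st: "0 \<le> s" "s \<le> t" and A: "A \<in> sets (Fi s)"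
  have "A \<inter> B \<in> sets (Fi s)" using A BF[OF st(1)] by blast
  from martingale_indicator[OF N st this]
  show "(\<integral>\<omega>. indicator A \<omega> * (if \<omega> \<in> B then N t \<omega> else 0) \<partial>P) = (\<integral>\<omega>. indicator A \<omega> * (if \<omega> \<in> B then N s \<omega> else 0) \<partial>P)"
    unfolding eq by (simp add: indicator_inter_arith mult.assoc)
qed

lemma stopping_time_min:
  assumes "stopping_time Fi S" "stopping_time Fi T"
  shows "stopping_time Fi (\<lambda>\<omega>. min (S \<omega>) (T \<omega>))"
  using assms unfolding stopping_time_def min_le_iff_disj by (intro allI pred_intros_logic(5)) blast+

lemma localizing_const: "localizing_sequence P Fi (\<lambda>n _. real n)"
proof -
  have "filterlim (\<lambda>n. real n) at_top sequentially" by (rule filterlim_real_sequentially)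
  then show ?thesis by (auto simp: localizing_sequence_def stopping_time_def incseq_def)
qed

lemma martingale_imp_local_martingale:
  assumes stop: "\<And>\<sigma>. stopping_time Fi \<sigma> \<Longrightarrow> (\<And>\<omega>. 0 \<le> \<sigma> \<omega>) \<Longrightarrow> martingale P Fi (\<lambda>t \<omega>. N (min t (\<sigma> \<omega>)) \<omega>)"
    and N: "martingale P Fi N"
  shows "local_martingale P Fi N"
  unfolding local_martingale_def
proof (intro conjI exI[of _ "\<lambda>n _. real n"] allI)
  show "martingale P Fi (\<lambda>t \<omega>. N (min t (real n)) \<omega>)" for n
    by (rule stop) (auto simp: stopping_time_def)
qed (use N localizing_const in \<open>auto simp: martingale_def\<close>)

text \<open>
  \<open>C\<close> counts jumps and controls the variation of \<open>N\<close>. Both \<open>N\<close> and \<open>L\<close> are stopped when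
  \<open>\<bar>L - L\<^sub>0\<bar> + C\<close> becomes large, and on \<open>{\<bar>L\<^sub>0\<bar> > n}\<close> already at time 0, where \<open>N\<close> vanishes.
\<close>
lemma purely_discontinuous_local_martingaleI:
  assumes stop: "\<And>\<sigma>. stopping_time Fi \<sigma> \<Longrightarrow> (\<And>\<omega>. 0 \<le> \<sigma> \<omega>) \<Longrightarrow> martingale P Fi (\<lambda>t \<omega>. N (min t (\<sigma> \<omega>)) \<omega>)"
    and N: "martingale P Fi N" and N0: "\<And>\<omega>. N 0 \<omega> = 0"
    and C: "adapted Fi C"
    and C0: "\<And>\<omega>. C 0 \<omega> = 0" and Cmono: "\<And>\<omega> v w. \<omega> \<in> space P \<Longrightarrow> 0 \<le> v \<Longrightarrow> v \<le> w \<Longrightarrow> C v \<omega> \<le> C w \<omega>"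
    and Cright: "\<And>\<omega> t. \<omega> \<in> space P \<Longrightarrow> 0 \<le> t \<Longrightarrow> ((\<lambda>s. C s \<omega>) \<longlongrightarrow> C t \<omega>) (at_right t)"
    and Cjump: "\<And>\<omega> t. \<omega> \<in> space P \<Longrightarrow> 0 < t \<Longrightarrow> \<exists>d>0. \<forall>v. t - d < v \<and> v < t \<and> 0 \<le> v \<longrightarrow> C t \<omega> \<le> C v \<omega> + 1"
    and var: "\<And>\<omega> v w. \<omega> \<in> space P \<Longrightarrow> 0 \<le> v \<Longrightarrow> v \<le> w \<Longrightarrow> \<bar>N w \<omega> - N v \<omega>\<bar> \<le> \<kappa> * (C w \<omega> - C v \<omega> + (w - v))"
    and \<kappa>: "0 \<le> \<kappa>"
  shows "purely_disc_local_martingale P Fi N"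
  unfolding purely_disc_local_martingale_def
proof (intro conjI allI impI)
  have adN: "adapted Fi N" and cadN: "AE \<omega> in P. cadlag (\<lambda>t. N t \<omega>)" using N by (simp_all add: martingale_def)
  show "local_martingale P Fi N" by (rule martingale_imp_local_martingale[OF stop N])
  show "AE \<omega> in P. N 0 \<omega> = 0" using N0 by simp
  fix L assume "cont_local_martingale P Fi L"
  then have adL: "adapted Fi L" and cL: "AE \<omega> in P. continuous_on {0..} (\<lambda>t. L t \<omega>)"
    and "\<exists>\<tau>. localizing_sequence P Fi \<tau> \<and> (\<forall>n. martingale P Fi (\<lambda>t \<omega>. L (min t (\<tau> n \<omega>)) \<omega>))"
    by (auto simp: cont_local_martingale_def local_martingale_def)
  then obtain \<tau> where \<tau>: "localizing_sequence P Fi \<tau>" and L: "\<And>n. martingale P Fi (\<lambda>t \<omega>. L (min t (\<tau> n \<omega>)) \<omega>)"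
    by blast
  have \<tau>0: "0 \<le> \<tau> n \<omega>" and \<tau>s: "stopping_time Fi (\<tau> n)" for n \<omega>
    using \<tau> by (auto simp: localizing_sequence_def)
  \<comment> \<open>\<open>Y\<close> starts at 0. Its upward jumps come from \<open>C\<close> and
    are at most 1; the slack up to 3/2 absorbs the oscillation of the continuous \<open>L\<close>
    near a given time.\<close>
  define Y where "Y t \<omega> = \<bar>L t \<omega> - L 0 \<omega>\<bar> + C t \<omega>" for t \<omega>
  have adY: "adapted Fi Y"
    unfolding adapted_def
  proof (intro allI impI)
    fix t :: real assume t: "0 \<le> t"
    have [measurable]: "L t \<in> borel_measurable (Fi t)" "L 0 \<in> borel_measurable (Fi t)" "C t \<in> borel_measurable (Fi t)"
      using adL C t measurable_Fi_mono[OF order_refl t] by (auto simp: adapted_def)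
    show "Y t \<in> borel_measurable (Fi t)" unfolding Y_def by measurable
  qed
  have reg: "AE \<omega> in P. Y 0 \<omega> \<le> 0 \<and>
      (\<forall>t\<ge>0. ((\<lambda>s. Y s \<omega>) \<longlongrightarrow> Y t \<omega>) (at_right t)) \<and>
      (\<forall>t>0. \<exists>d>0. \<forall>v. t - d < v \<and> v < t \<and> 0 \<le> v \<longrightarrow> Y t \<omega> \<le> Y v \<omega> + 3/2) \<and>
      (\<forall>t. \<exists>c. \<forall>v. 0 \<le> v \<and> v \<le> t \<longrightarrow> Y v \<omega> \<le> c)"
    using cL AE_space
  proof eventually_elim
    case (elim \<omega>)
    have Lr: "((\<lambda>s. L s \<omega>) \<longlongrightarrow> L t \<omega>) (at_right t)" if "0 \<le> t" for t
      using cadlag_continuous[OF elim(1)] that by (simp add: cadlag_def)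
    show ?case
    proof (intro conjI allI impI)
      show "Y 0 \<omega> \<le> 0" by (simp add: Y_def C0)
    next
      fix t :: real assume "0 \<le> t"
      then show "((\<lambda>s. Y s \<omega>) \<longlongrightarrow> Y t \<omega>) (at_right t)"
        unfolding Y_def by (intro tendsto_intros Lr Cright elim)
    next
      fix t :: real assume t: "0 < t"
      obtain d where d: "d > 0" "\<And>v. t - d < v \<Longrightarrow> v < t \<Longrightarrow> 0 \<le> v \<Longrightarrow> C t \<omega> \<le> C v \<omega> + 1"
        using Cjump[OF elim(2) t] by blast
      have "continuous (at t within {0..}) (\<lambda>t. L t \<omega>)" using elim(1) t by (auto simp: continuous_on_eq_continuous_within)
      then obtain d' where d': "d' > 0" "\<And>v. 0 \<le> v \<Longrightarrow> dist v t < d' \<Longrightarrow> dist (L v \<omega>) (L t \<omega>) < 1/2"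
        unfolding continuous_within_eps_delta by (metis atLeast_iff half_gt_zero zero_less_one)
      show "\<exists>d>0. \<forall>v. t - d < v \<and> v < t \<and> 0 \<le> v \<longrightarrow> Y t \<omega> \<le> Y v \<omega> + 3/2"
      proof (intro exI[of _ "min d d'"] conjI allI impI)
        fix v assume v: "t - min d d' < v \<and> v < t \<and> 0 \<le> v"
        then have "C t \<omega> \<le> C v \<omega> + 1" using d(2) by auto
        moreover have "dist (L v \<omega>) (L t \<omega>) < 1/2" using v by (intro d'(2)) (auto simp: dist_real_def)
        ultimately show "Y t \<omega> \<le> Y v \<omega> + 3/2" unfolding Y_def dist_real_def by linarith
      qed (use d d' in auto)
    next
      fix t :: real
      show "\<exists>c. \<forall>v. 0 \<le> v \<and> v \<le> t \<longrightarrow> Y v \<omega> \<le> c"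
      proof (cases "0 \<le> t")
        case True
        have "compact ((\<lambda>v. L v \<omega>) ` {0..t})"
          by (rule compact_continuous_image) (use elim(1) in \<open>auto elim: continuous_on_subset\<close>)
        then have "bounded ((\<lambda>v. L v \<omega>) ` {0..t})" by (rule compact_imp_bounded)
        then obtain b where "\<forall>x\<in>(\<lambda>v. L v \<omega>) ` {0..t}. norm x \<le> b" unfolding bounded_iff ..
        then have b: "\<And>v. v \<in> {0..t} \<Longrightarrow> norm (L v \<omega>) \<le> b" by simp
        have "Y v \<omega> \<le> 2 * b + C t \<omega>" if v: "0 \<le> v" "v \<le> t" for v
        proof -
          have "\<bar>L v \<omega>\<bar> \<le> b" "\<bar>L 0 \<omega>\<bar> \<le> b" using b[of v] b[of 0] v True by auto
          then show ?thesis using Cmono[OF elim(2) v] unfolding Y_def by linarith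
        qed
        then show ?thesis by blast
      next
        case False then show ?thesis by auto
      qed
    qed
  qed
  obtain T D where T: "\<And>n. stopping_time Fi (T n)" "\<And>n \<omega>. T n \<omega> \<in> \<rat>" "\<And>n \<omega>. 0 \<le> T n \<omega>" "\<And>n \<omega>. T n \<omega> \<le> real n"
    "\<And>\<omega>. incseq (\<lambda>n. T n \<omega>)" "AE \<omega> in P. filterlim (\<lambda>n. T n \<omega>) at_top sequentially"
    and D: "\<And>n. D n \<in> borel_measurable P" "\<And>n. integrable P (\<lambda>\<omega>. (D n \<omega>)\<^sup>2)"
    "\<And>n. AE \<omega> in P. \<forall>v. 0 \<le> v \<and> v \<le> T n \<omega> \<longrightarrow> Y v \<omega> \<le> D n \<omega>"
    by (rule rational_localization[OF adY reg]) blast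
  define S where "S n \<omega> = min (\<tau> n \<omega>) (if \<bar>L 0 \<omega>\<bar> \<le> real n then T n \<omega> else 0)" for n \<omega>
  have L0m: "L 0 \<in> borel_measurable (Fi 0)" using adL by (simp add: adapted_def)
  have Bn: "{\<omega>\<in>space P. \<bar>L 0 \<omega>\<bar> \<le> real n} \<in> sets (Fi 0)" for n
    using borel_measurable_le[OF borel_measurable_abs[OF L0m], of "\<lambda>_. real n"] space_Fi[of 0] by simp
  have S0: "0 \<le> S n \<omega>" for n \<omega> using \<tau>0 T(3) by (simp add: S_def)
  have Sstop: "stopping_time Fi (S n)" for n
    unfolding S_def
  proof (rule stopping_time_min[OF \<tau>s], unfold stopping_time_def, intro allI)
    fix t
    show "Measurable.pred (Fi t) (\<lambda>\<omega>. (if \<bar>L 0 \<omega>\<bar> \<le> real n then T n \<omega> else 0) \<le> t)"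
    proof (cases "0 \<le> t")
      case True
      have [measurable]: "L 0 \<in> borel_measurable (Fi t)" by (rule measurable_Fi_mono[OF order_refl True L0m])
      have [measurable]: "Measurable.pred (Fi t) (\<lambda>\<omega>. T n \<omega> \<le> t)" using T(1) by (simp add: stopping_time_def)
      have "((if \<bar>L 0 \<omega>\<bar> \<le> real n then T n \<omega> else 0) \<le> t) = (\<bar>L 0 \<omega>\<bar> \<le> real n \<longrightarrow> T n \<omega> \<le> t)" for \<omega>
        using True by auto
      then show ?thesis by simp
    next
      case False
      then have "\<not> (if \<bar>L 0 \<omega>\<bar> \<le> real n then T n \<omega> else 0) \<le> t" for \<omega>
        using T(3)[of n \<omega>] by auto
      then show ?thesis by simp
    qed
  qed
  have loc: "localizing_sequence P Fi S"
    unfolding localizing_sequence_def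
  proof (intro conjI allI Sstop S0)
    have "AE \<omega> in P. incseq (\<lambda>n. \<tau> n \<omega>) \<and> filterlim (\<lambda>n. \<tau> n \<omega>) at_top sequentially"
      using \<tau> by (simp add: localizing_sequence_def)
    then show "AE \<omega> in P. incseq (\<lambda>n. S n \<omega>) \<and> filterlim (\<lambda>n. S n \<omega>) at_top sequentially"
      using T(6)
    proof eventually_elim
      case (elim \<omega>)
      have inc: "S n \<omega> \<le> S (Suc n) \<omega>" for n
        unfolding S_def
      proof (rule min.mono)
        show "\<tau> n \<omega> \<le> \<tau> (Suc n) \<omega>" using elim by (auto simp: incseq_Suc_iff)
        show "(if \<bar>L 0 \<omega>\<bar> \<le> real n then T n \<omega> else 0) \<le> (if \<bar>L 0 \<omega>\<bar> \<le> real (Suc n) then T (Suc n) \<omega> else 0)"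
          using incseq_SucD[OF T(5)[of \<omega>], of n] T(3)[of "Suc n" \<omega>] by simp
      qed
      have "filterlim (\<lambda>n. S n \<omega>) at_top sequentially"
        unfolding filterlim_at_top
      proof
        fix Z :: real
        obtain n0 :: nat where "\<bar>L 0 \<omega>\<bar> \<le> n0" using real_arch_simple by blast
        have "eventually (\<lambda>n. Z \<le> \<tau> n \<omega>) sequentially" "eventually (\<lambda>n. Z \<le> T n \<omega>) sequentially"
          using elim unfolding filterlim_at_top by auto
        then show "eventually (\<lambda>n. Z \<le> S n \<omega>) sequentially"
          using eventually_ge_at_top[of n0]
        proof eventually_elim
          case (elim n)
          then have "\<bar>L 0 \<omega>\<bar> \<le> n" using \<open>\<bar>L 0 \<omega>\<bar> \<le> n0\<close> by linarith
          then show ?case using elim by (simp add: S_def)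
        qed
      qed
      then show ?case using inc by (auto intro: incseq_SucI)
    qed
  qed
  have main: "martingale P Fi (\<lambda>t \<omega>. N (min t (S n \<omega>)) \<omega> * L (min t (S n \<omega>)) \<omega>)" for n
  proof -
    define B where "B = {\<omega>\<in>space P. \<bar>L 0 \<omega>\<bar> \<le> real n}"
    define \<sigma> where "\<sigma> \<omega> = min (\<tau> n \<omega>) (T n \<omega>)" for \<omega>
    have \<sigma>: "stopping_time Fi \<sigma>" "\<And>\<omega>. 0 \<le> \<sigma> \<omega>"
      unfolding \<sigma>_def by (auto intro!: stopping_time_min \<tau>s T \<tau>0)
    define M1 where "M1 t \<omega> = N (min t (\<sigma> \<omega>)) \<omega>" for t \<omega>
    define L2 where "L2 t \<omega> = (if \<omega> \<in> B then L (min t (\<tau> n \<omega>)) \<omega> else 0)" for t \<omega>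
    \<comment> \<open>The time \<open>S n\<close> may have uncountably many values. Stopping at
      \<open>\<tau> n\<close> is part of what is known about \<open>L\<close>, so optional stopping
      has to add only the rational time \<open>T n\<close>.\<close>
    define M2 where "M2 t \<omega> = L2 (min t (T n \<omega>)) \<omega>" for t \<omega>
    have min3: "min (min t (T n \<omega>)) (\<tau> n \<omega>) = min t (\<sigma> \<omega>)" for t \<omega> by (simp add: \<sigma>_def min.commute min.left_commute)
    have M1: "martingale P Fi M1" unfolding M1_def by (rule stop[OF \<sigma>])
    have L2: "martingale P Fi L2" unfolding L2_def B_def by (rule martingale_times_initial[OF L Bn])
    have Lbound: "AE \<omega> in P. \<forall>v\<ge>0. \<bar>M2 v \<omega>\<bar> \<le> real n + D n \<omega>"
      using D(3)[of n] AE_space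
    proof eventually_elim
      case (elim \<omega>)
      show ?case
      proof (intro allI impI)
        fix v :: real assume v: "0 \<le> v"
        have "\<bar>L (min v (\<sigma> \<omega>)) \<omega>\<bar> \<le> real n + D n \<omega>" if "\<bar>L 0 \<omega>\<bar> \<le> real n"
        proof -
          have m: "0 \<le> min v (\<sigma> \<omega>)" "min v (\<sigma> \<omega>) \<le> T n \<omega>" using v \<sigma>(2)[of \<omega>] by (auto simp: \<sigma>_def)
          then have "Y (min v (\<sigma> \<omega>)) \<omega> \<le> D n \<omega>" using elim(1) by blast
          moreover have "0 \<le> C (min v (\<sigma> \<omega>)) \<omega>" using Cmono[OF elim(2) order_refl m(1)] C0 by simp
          ultimately show ?thesis using that unfolding Y_def by linarith
        qed
        moreover have "0 \<le> D n \<omega>"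
        proof -
          have "Y 0 \<omega> \<le> D n \<omega>" using elim(1) T(3) by blast
          then show ?thesis by (simp add: Y_def C0)
        qed
        ultimately show "\<bar>M2 v \<omega>\<bar> \<le> real n + D n \<omega>" by (auto simp: M2_def L2_def min3 B_def)
      qed
    qed
    have D1: "integrable P (D n)"
      by (rule square_integrable_imp_integrable[OF D(1,2)])
    have M2: "martingale P Fi M2"
      unfolding M2_def
      by (rule martingale_stop_countable[OF L2 T(1,3) countable_rat T(2), where D="\<lambda>\<omega>. real n + D n \<omega>"])
         (use D1 Lbound in \<open>simp_all add: M2_def\<close>)
    have cont2: "AE \<omega> in P. continuous_on {0..} (\<lambda>t. M2 t \<omega>)"
      using cL
    proof eventually_elim
      case (elim \<omega>)
      have "continuous_on {0..} (\<lambda>t. L (min t (\<sigma> \<omega>)) \<omega>)"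
        by (rule continuous_on_compose2[OF elim]) (use \<sigma>(2) in \<open>auto intro!: continuous_intros\<close>)
      then show ?case by (cases "\<omega> \<in> B") (auto simp: M2_def L2_def min3)
    qed
    define K where "K \<omega> = \<kappa> * (D n \<omega> + real n)" for \<omega>
    define G where "G t \<omega> = \<kappa> * (C (min t (\<sigma> \<omega>)) \<omega> + min t (\<sigma> \<omega>))" for t \<omega>
    have CD: "AE \<omega> in P. \<forall>v\<ge>0. C (min v (\<sigma> \<omega>)) \<omega> + min v (\<sigma> \<omega>) \<le> D n \<omega> + real n"
      using D(3)[of n]
    proof eventually_elim
      case (elim \<omega>)
      show ?case
      proof (intro allI impI)
        fix v :: real assume v: "0 \<le> v"
        have m: "0 \<le> min v (\<sigma> \<omega>)" "min v (\<sigma> \<omega>) \<le> T n \<omega>" using v \<sigma>(2)[of \<omega>] by (auto simp: \<sigma>_def)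
        then have "Y (min v (\<sigma> \<omega>)) \<omega> \<le> D n \<omega>" using elim by blast
        then show "C (min v (\<sigma> \<omega>)) \<omega> + min v (\<sigma> \<omega>) \<le> D n \<omega> + real n"
          using m T(4)[of n \<omega>] unfolding Y_def by linarith
      qed
    qed
    have "martingale P Fi (\<lambda>t \<omega>. M1 t \<omega> * M2 t \<omega>)"
    proof (rule product_martingale[OF M1 M2 cont2, where G=G and K=K and H="\<lambda>\<omega>. real n + D n \<omega>"])
      show "AE \<omega> in P. \<forall>v w. 0 \<le> v \<and> v \<le> w \<longrightarrow> \<bar>M1 w \<omega> - M1 v \<omega>\<bar> \<le> G w \<omega> - G v \<omega>"
        using AE_space
      proof eventually_elim
        case (elim \<omega>)
        show ?case
        proof (intro allI impI)
          fix v w :: real assume vw: "0 \<le> v \<and> v \<le> w"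
          have "0 \<le> min v (\<sigma> \<omega>)" "min v (\<sigma> \<omega>) \<le> min w (\<sigma> \<omega>)" using vw \<sigma>(2)[of \<omega>] by auto
          from var[OF elim this] show "\<bar>M1 w \<omega> - M1 v \<omega>\<bar> \<le> G w \<omega> - G v \<omega>"
            by (simp add: M1_def G_def algebra_simps)
        qed
      qed
      have G0: "G 0 \<omega> = 0" for \<omega> using \<sigma>(2)[of \<omega>] by (simp add: G_def C0 min_absorb1)
      show "AE \<omega> in P. \<forall>t\<ge>0. G t \<omega> - G 0 \<omega> \<le> K \<omega>"
        using CD
      proof eventually_elim
        case (elim \<omega>)
        then show ?case unfolding G0 by (auto simp: G_def K_def intro!: mult_left_mono \<kappa>)
      qed
      show "AE \<omega> in P. \<forall>t\<ge>0. \<bar>M1 t \<omega>\<bar> \<le> K \<omega>"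
        using CD AE_space
      proof eventually_elim
        case (elim \<omega>)
        show ?case
        proof (intro allI impI)
          fix v :: real assume v: "0 \<le> v"
          have "0 \<le> min v (\<sigma> \<omega>)" using v \<sigma>(2)[of \<omega>] by auto
          from var[OF elim(2) order_refl this]
          have "\<bar>M1 v \<omega>\<bar> \<le> \<kappa> * (C (min v (\<sigma> \<omega>)) \<omega> + min v (\<sigma> \<omega>))" by (simp add: M1_def N0 C0)
          also have "\<dots> \<le> K \<omega>" unfolding K_def using elim(1) v \<kappa> by (intro mult_left_mono) auto
          finally show "\<bar>M1 v \<omega>\<bar> \<le> K \<omega>" .
        qed
      qed
      \<comment> \<open>Both bounds are linear in \<open>D n\<close>, so their product is integrable
        because \<open>D n\<close> is square integrable; this is why the localization provides
        squares.\<close>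
      have "(\<lambda>\<omega>. K \<omega> * (real n + D n \<omega>)) = (\<lambda>\<omega>. \<kappa> * ((D n \<omega>)\<^sup>2 + 2 * real n * D n \<omega> + (real n)\<^sup>2))"
        by (auto simp: K_def power2_eq_square algebra_simps)
      then show "integrable P (\<lambda>\<omega>. K \<omega> * (real n + D n \<omega>))" using D1 D(2) by simp
    qed (fact Lbound)
    then show ?thesis
    proof (rule martingale_cong_space)
      fix t :: real and \<omega> assume t: "0 \<le> t" and \<omega>: "\<omega> \<in> space P"
      show "N (min t (S n \<omega>)) \<omega> * L (min t (S n \<omega>)) \<omega> = M1 t \<omega> * M2 t \<omega>"
      proof (cases "\<omega> \<in> B")
        case True
        then show ?thesis by (simp add: M1_def M2_def L2_def min3) (simp add: S_def \<sigma>_def B_def)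
      next
        case False
        then have "S n \<omega> = 0" using \<omega> \<tau>0[of n \<omega>] by (simp add: S_def B_def)
        then show ?thesis using False t by (simp add: M2_def L2_def N0 min_absorb2)
      qed
    qed
  qed
  show "local_martingale P Fi (\<lambda>t \<omega>. N t \<omega> * L t \<omega>)"
    unfolding local_martingale_def
  proof (intro conjI exI[of _ S] allI loc main)
    show "adapted Fi (\<lambda>t \<omega>. N t \<omega> * L t \<omega>)" using adN adL by (simp add: adapted_def borel_measurable_times)
    show "AE \<omega> in P. cadlag (\<lambda>t. N t \<omega> * L t \<omega>)"
      using cadN cL by eventually_elim (simp add: cadlag_mult cadlag_continuous)
  qed
qed

end

section \<open>Paths in finite sets\<close>

definition jump_times :: "(real \<Rightarrow> 'a::real_normed_vector) \<Rightarrow> real \<Rightarrow> real \<Rightarrow> real set" where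
  "jump_times y s t = {r. s < r \<and> r \<le> t \<and> jump y r \<noteq> 0}"

definition jump_sum :: "(real \<Rightarrow> 'a::real_normed_vector) \<Rightarrow> ('a \<Rightarrow> 'a \<Rightarrow> 'b::comm_monoid_add) \<Rightarrow> real \<Rightarrow> 'b" where
  "jump_sum y k t = (\<Sum>r\<in>jump_times y 0 t. k (left_lim y r) (jump y r))"

lemma jump_sum_0: "jump_sum y k 0 = 0"
  by (simp add: jump_sum_def jump_times_def cong: conj_cong)

lemma uniform_gap:
  assumes "finite (R :: real set)"
  obtains g where "g > 0" "\<And>r r'. r \<in> R \<Longrightarrow> r' \<in> R \<Longrightarrow> r \<noteq> r' \<Longrightarrow> g \<le> \<bar>r - r'\<bar>"
proof -
  define D where "D = insert 1 ((\<lambda>(r, r'). \<bar>r - r'\<bar>) ` (R \<times> R) - {0})"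
  have D: "finite D" "D \<noteq> {}" using assms by (auto simp: D_def)
  show ?thesis
  proof (rule that)
    have "Min D \<in> D" using D by (rule Min_in)
    then show "0 < Min D" by (auto simp: D_def)
    fix r r' assume "r \<in> R" "r' \<in> R" "r \<noteq> r'"
    then have "\<bar>r - r'\<bar> \<in> D" by (force simp: D_def)
    then show "Min D \<le> \<bar>r - r'\<bar>" using D by simp
  qed
qed

locale finite_path =
  fixes y :: "real \<Rightarrow> 'a::real_normed_vector" and E :: "'a set"
  assumes cadlag: "cadlag y" and fin: "finite E" and range: "0 \<le> t \<Longrightarrow> y t \<in> E"
begin

text \<open>The remaining points of a finite set form a closed set, so a path that converges to
  \<open>x\<close> must eventually avoid them. Paths in \<open>E\<close> are therefore step
  functions.\<close>

lemma discrete: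
  assumes "x \<in> E" "(y \<longlongrightarrow> x) F" "eventually (\<lambda>s. 0 \<le> s) F"
  shows "eventually (\<lambda>s. y s = x) F"
proof -
  have "open (- (E - {x}))" using fin by (intro open_Compl finite_imp_closed) auto
  then have "eventually (\<lambda>s. y s \<in> - (E - {x})) F"
    using assms by (intro topological_tendstoD) auto
  then show ?thesis using assms(3) by eventually_elim (use range in auto)
qed

lemma right_constant:
  assumes "0 \<le> t"
  obtains d where "d > 0" "\<And>s. t \<le> s \<Longrightarrow> s < t + d \<Longrightarrow> y s = y t"
proof -
  have "(y \<longlongrightarrow> y t) (at_right t)" using cadlag assms by (simp add: cadlag_def)
  moreover have "eventually (\<lambda>s. 0 \<le> s) (at_right t)"
    using assms by (auto simp: eventually_at_right_field intro!: exI[of _ "t + 1"])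
  ultimately have "eventually (\<lambda>s. y s = y t) (at_right t)"
    by (intro discrete range assms)
  then obtain b where b: "b > t" "\<And>s. t < s \<Longrightarrow> s < b \<Longrightarrow> y s = y t"
    unfolding eventually_at_right_field by auto
  show ?thesis
  proof (rule that[of "b - t"])
    fix s assume "t \<le> s" "s < t + (b - t)"
    then show "y s = y t" using b(2)[of s] by (cases "s = t") auto
  qed (use b in simp)
qed

lemma left_tendsto: "0 < t \<Longrightarrow> (y \<longlongrightarrow> left_lim y t) (at_left t)"
proof -
  assume t: "0 < t"
  then obtain l where l: "(y \<longlongrightarrow> l) (at_left t)" using cadlag by (auto simp: cadlag_def)
  then have "Lim (at_left t) y = l" by (intro tendsto_Lim) (simp_all add: trivial_limit_at_left_real)
  then show ?thesis using l t by (simp add: left_lim_def)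
qed

lemma left_lim_0: "left_lim y 0 = y 0"
  by (simp add: left_lim_def)

lemma left_lim_range: "0 \<le> t \<Longrightarrow> left_lim y t \<in> E"
proof (cases "t = 0")
  case False
  assume "0 \<le> t"
  then have t: "0 < t" using False by simp
  have "eventually (\<lambda>s. y s \<in> E) (at_left t)"
    using t range by (auto simp: eventually_at_left_field intro!: exI[of _ 0])
  then show ?thesis
    by (intro Lim_in_closed_set[OF finite_imp_closed[OF fin] _ _ left_tendsto[OF t]])
       (simp_all add: trivial_limit_at_left_real)
qed (simp add: left_lim_0 range)

lemma left_constant:
  assumes "0 < t"
  obtains d where "d > 0" "\<And>s. t - d < s \<Longrightarrow> s < t \<Longrightarrow> 0 \<le> s \<Longrightarrow> y s = left_lim y t"
proof -
  have "eventually (\<lambda>s. 0 \<le> s) (at_left t)"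
    using assms by (auto simp: eventually_at_left_field intro!: exI[of _ 0])
  then have "eventually (\<lambda>s. y s = left_lim y t) (at_left t)"
    using assms by (intro discrete left_lim_range left_tendsto) auto
  then obtain b where b: "b < t" "\<And>s. b < s \<Longrightarrow> s < t \<Longrightarrow> y s = left_lim y t"
    unfolding eventually_at_left_field by auto
  show ?thesis by (rule that[of "t - b"]) (use b in auto)
qed

lemma left_lim_eqI:
  assumes "0 < t" "d > 0" "\<And>s. t - d < s \<Longrightarrow> s < t \<Longrightarrow> 0 \<le> s \<Longrightarrow> y s = c"
  shows "left_lim y t = c"
proof -
  obtain d' where d': "d' > 0" "\<And>s. t - d' < s \<Longrightarrow> s < t \<Longrightarrow> 0 \<le> s \<Longrightarrow> y s = left_lim y t"
    using left_constant[OF assms(1)] by blast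
  define s where "s = max (t / 2) (max (t - d / 2) (t - d' / 2))"
  have "t - d < s" "t - d' < s" "s < t" "0 \<le> s" using assms d' by (auto simp: s_def less_max_iff_disj)
  then show ?thesis using d'(2)[of s] assms(3)[of s] by simp
qed

lemma no_jumps_right:
  assumes "0 \<le> t"
  obtains d where "d > 0" "\<And>s. t \<le> s \<Longrightarrow> s < t + d \<Longrightarrow> y s = y t"
    "\<And>s. t < s \<Longrightarrow> s < t + d \<Longrightarrow> left_lim y s = y t" "\<And>s. t < s \<Longrightarrow> s < t + d \<Longrightarrow> jump y s = 0"
proof -
  obtain d where d: "d > 0" "\<And>s. t \<le> s \<Longrightarrow> s < t + d \<Longrightarrow> y s = y t" by (rule right_constant[OF assms]) blast
  have l: "left_lim y s = y t" if "t < s" "s < t + d" for s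
  proof (rule left_lim_eqI[of s "s - t"])
    fix v assume "s - (s - t) < v" "v < s"
    then show "y v = y t" by (intro d(2)) (use that in auto)
  qed (use that assms in auto)
  then have "jump y s = 0" if "t < s" "s < t + d" for s
    using that d(2)[of s] by (simp add: jump_def)
  from that[OF d(1) d(2) l this] show ?thesis .
qed

lemma no_jumps_left:
  assumes "0 < t"
  obtains d where "d > 0" "\<And>s. t - d < s \<Longrightarrow> s < t \<Longrightarrow> 0 \<le> s \<Longrightarrow> y s = left_lim y t"
    "\<And>s. t - d < s \<Longrightarrow> s < t \<Longrightarrow> 0 < s \<Longrightarrow> jump y s = 0"
proof -
  obtain d where d: "d > 0" "\<And>s. t - d < s \<Longrightarrow> s < t \<Longrightarrow> 0 \<le> s \<Longrightarrow> y s = left_lim y t"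
    by (rule left_constant[OF assms]) blast
  have "jump y s = 0" if s: "t - d < s" "s < t" "0 < s" for s
  proof -
    have "left_lim y s = left_lim y t"
      by (rule left_lim_eqI[of s "s - (t - d)"]) (use s d in auto)
    then show ?thesis using d(2)[of s] s by (simp add: jump_def)
  qed
  then show ?thesis using that d by blast
qed

text \<open>Infinitely many jump times in a bounded interval would accumulate, but every point has a
  one-sided neighbourhood without jumps on either side.\<close>

lemma finite_jump_times:
  assumes "0 \<le> s"
  shows "finite (jump_times y s t)"
proof (rule ccontr)
  assume inf: "infinite (jump_times y s t)"
  have "jump_times y s t \<subseteq> {0..t}" using assms by (auto simp: jump_times_def)
  then obtain p where p: "p \<in> {0..t}" "p islimpt jump_times y s t"
    using compact_eq_Bolzano_Weierstrass[of "{0..t}"] inf by auto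
  obtain d where d: "d > 0" "\<And>s. p < s \<Longrightarrow> s < p + d \<Longrightarrow> jump y s = 0"
    by (rule no_jumps_right[of p]) (use p in simp, blast)
  obtain d' where d': "d' > 0" "\<And>s. p - d' < s \<Longrightarrow> s < p \<Longrightarrow> 0 < s \<Longrightarrow> jump y s = 0"
  proof (cases "p = 0")
    case True then show ?thesis using that[of 1] by auto
  next
    case False
    then have "0 < p" using p by simp
    then show ?thesis by (rule no_jumps_left) (rule that)
  qed
  obtain r where r: "r \<in> jump_times y s t" "r \<noteq> p" "dist r p < min d d'"
    using p(2) d(1) d'(1) unfolding islimpt_approachable by (meson min_less_iff_conj)
  then have "jump y r = 0"
    using d(2)[of r] d'(2)[of r] assms by (cases "r < p") (auto simp: dist_real_def jump_times_def)
  then show False using r by (simp add: jump_times_def)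
qed

lemma jump_times_split:
  assumes "s \<le> t" "t \<le> u"
  shows "jump_times y s u = jump_times y s t \<union> jump_times y t u" "jump_times y s t \<inter> jump_times y t u = {}"
  using assms by (auto simp: jump_times_def)

lemma sum_jump_times_split:
  fixes g :: "real \<Rightarrow> 'b::comm_monoid_add"
  assumes "0 \<le> s" "s \<le> t" "t \<le> u"
  shows "(\<Sum>r\<in>jump_times y s u. g r) = (\<Sum>r\<in>jump_times y s t. g r) + (\<Sum>r\<in>jump_times y t u. g r)"
  using assms jump_times_split[OF assms(2,3)] by (simp add: sum.union_disjoint finite_jump_times)

lemma jump_times_right:
  assumes "0 \<le> t"
  obtains d where "d > 0" "\<And>v. v < t + d \<Longrightarrow> jump_times y t v = {}" "\<And>v. t \<le> v \<Longrightarrow> v < t + d \<Longrightarrow> y v = y t"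
proof -
  obtain d where d: "d > 0" "\<And>s. t \<le> s \<Longrightarrow> s < t + d \<Longrightarrow> y s = y t"
     "\<And>s. t < s \<Longrightarrow> s < t + d \<Longrightarrow> jump y s = 0"
    by (rule no_jumps_right[OF assms]) blast
  have "jump_times y t v = {}" if "v < t + d" for v using that d(3) by (auto simp: jump_times_def)
  then show ?thesis using that d by blast
qed

lemma jump_times_left:
  assumes "0 < t"
  obtains d where "d > 0" "\<And>v. t - d < v \<Longrightarrow> v < t \<Longrightarrow> 0 \<le> v \<Longrightarrow> jump_times y v t = {r. r = t \<and> jump y t \<noteq> 0}"
    "\<And>v. t - d < v \<Longrightarrow> v < t \<Longrightarrow> 0 \<le> v \<Longrightarrow> y v = left_lim y t"
proof -
  obtain d where d: "d > 0" "\<And>s. t - d < s \<Longrightarrow> s < t \<Longrightarrow> 0 \<le> s \<Longrightarrow> y s = left_lim y t"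
    "\<And>s. t - d < s \<Longrightarrow> s < t \<Longrightarrow> 0 < s \<Longrightarrow> jump y s = 0"
    by (rule no_jumps_left[OF assms]) blast
  have "jump_times y v t = {r. r = t \<and> jump y t \<noteq> 0}" if v: "t - d < v" "v < t" "0 \<le> v" for v
  proof -
    have "r = t" if "r \<in> jump_times y v t" for r
    proof (rule ccontr)
      assume "r \<noteq> t"
      then have "jump y r = 0" using d(3)[of r] that v by (auto simp: jump_times_def)
      then show False using that by (simp add: jump_times_def)
    qed
    then show ?thesis using v by (auto simp: jump_times_def)
  qed
  then show ?thesis using that d by blast
qed

text \<open>After subtraction of the jumps up to time \<open>v\<close> the path is locally constant
  on \<open>[s, t]\<close>: nothing changes just to the right of a point, and just to the left the
  only change is the jump at the point itself, which cancels. Connectedness does the rest.\<close>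

lemma telescope:
  fixes f :: "'a \<Rightarrow> 'b::real_normed_vector"
  assumes st: "0 \<le> s" "s \<le> t"
  shows "f (y t) - f (y s) = (\<Sum>r\<in>jump_times y s t. f (y r) - f (left_lim y r))"
proof -
  define g where "g v = f (y v) - (\<Sum>r\<in>jump_times y s v. f (y r) - f (left_lim y r))" for v
  have "g s = g t"
  proof (rule connected_local_const[of "{s..t}"])
    show "\<forall>a\<in>{s..t}. eventually (\<lambda>b. g a = g b) (at a within {s..t})"
    proof
      fix a assume a: "a \<in> {s..t}"
      then have a0: "0 \<le> a" using st by simp
      obtain d where d: "d > 0" "\<And>v. v < a + d \<Longrightarrow> jump_times y a v = {}" "\<And>v. a \<le> v \<Longrightarrow> v < a + d \<Longrightarrow> y v = y a"
        by (rule jump_times_right[OF a0]) blast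
      have right: "g a = g v" if "a \<le> v" "v < a + d" for v
        using sum_jump_times_split[of s a v "\<lambda>r. f (y r) - f (left_lim y r)"] that d(1) d(2,3)[of v] a st by (simp add: g_def)
      obtain d' where d': "d' > 0" "\<And>v. a - d' < v \<Longrightarrow> v < a \<Longrightarrow> s \<le> v \<Longrightarrow> g v = g a"
      proof (cases "a = s")
        case True then show ?thesis using that[of 1] by auto
      next
        case False
        then have "0 < a" using a st by simp
        then obtain d' where d': "d' > 0"
            "\<And>v. a - d' < v \<Longrightarrow> v < a \<Longrightarrow> 0 \<le> v \<Longrightarrow> jump_times y v a = {r. r = a \<and> jump y a \<noteq> 0}"
            "\<And>v. a - d' < v \<Longrightarrow> v < a \<Longrightarrow> 0 \<le> v \<Longrightarrow> y v = left_lim y a"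
          by (rule jump_times_left) blast
        have "g v = g a" if v: "a - d' < v" "v < a" "s \<le> v" for v
        proof (cases "jump y a = 0")
          case True
          then show ?thesis
            using sum_jump_times_split[of s v a "\<lambda>r. f (y r) - f (left_lim y r)"] v st d'(2,3)[of v]
            by (simp add: g_def jump_def)
        next
          case False
          then have "{r. r = a \<and> jump y a \<noteq> 0} = {a}" by auto
          then show ?thesis
            using sum_jump_times_split[of s v a "\<lambda>r. f (y r) - f (left_lim y r)"] v st d'(2,3)[of v]
            by (simp add: g_def)
        qed
        then show ?thesis using that d'(1) by blast
      qed
      show "eventually (\<lambda>b. g a = g b) (at a within {s..t})"
        unfolding eventually_at
      proof (intro exI[of _ "min d d'"] conjI ballI impI)
        fix x assume x: "x \<in> {s..t}" "x \<noteq> a \<and> dist x a < min d d'"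
        show "g a = g x"
        proof (cases "a \<le> x")
          case True then show ?thesis using right[of x] x by (simp add: dist_real_def)
        next
          case False then show ?thesis using d'(2)[of x] x by (simp add: dist_real_def)
        qed
      qed (use d d' in simp)
    qed
  qed (use st in auto)
  moreover have "jump_times y s s = {}" by (auto simp: jump_times_def)
  ultimately show ?thesis by (simp add: g_def)
qed

lemma constant_without_jumps:
  assumes "0 \<le> s" "s \<le> t" "jump_times y s t = {}"
  shows "y t = y s"
  using telescope[OF assms(1,2), of "\<lambda>x. x"] assms(3) by simp

lemma left_lim_without_jumps:
  assumes "0 \<le> s" "s < t" "jump_times y s t \<subseteq> {t}"
  shows "left_lim y t = y s"
proof (rule left_lim_eqI[of t "t - s"])
  fix v assume v: "t - (t - s) < v" "v < t" "0 \<le> v"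
  show "y v = y s"
    by (rule constant_without_jumps) (use assms v in \<open>auto simp: jump_times_def\<close>)
qed (use assms in auto)

lemma jump_sum_right:
  fixes k :: "'a \<Rightarrow> 'a \<Rightarrow> 'b::{comm_monoid_add, topological_space}"
  assumes "0 \<le> t"
  shows "(jump_sum y k \<longlongrightarrow> jump_sum y k t) (at_right t)"
proof -
  obtain d where d: "d > 0" "\<And>v. v < t + d \<Longrightarrow> jump_times y t v = {}" by (rule jump_times_right[OF assms]) blast
  have "jump_sum y k v = jump_sum y k t" if "t < v" "v < t + d" for v
    using sum_jump_times_split[of 0 t v "\<lambda>r. k (left_lim y r) (jump y r)"] that assms d(2)[of v]
    by (simp add: jump_sum_def)
  then have "eventually (\<lambda>v. jump_sum y k v = jump_sum y k t) (at_right t)"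
    using d(1) unfolding eventually_at_right_field by (intro exI[of _ "t + d"]) auto
  then show ?thesis by (rule tendsto_eventually)
qed

lemma jump_sum_left:
  assumes "0 < t"
  obtains d where "d > 0"
    "\<And>v. t - d < v \<Longrightarrow> v < t \<Longrightarrow> 0 \<le> v \<Longrightarrow> jump_sum y k t = jump_sum y k v + (if jump y t = 0 then 0 else k (left_lim y t) (jump y t))"
proof -
  obtain d where d: "d > 0" "\<And>v. t - d < v \<Longrightarrow> v < t \<Longrightarrow> 0 \<le> v \<Longrightarrow> jump_times y v t = {r. r = t \<and> jump y t \<noteq> 0}"
    by (rule jump_times_left[OF assms]) blast
  show ?thesis
  proof (rule that[OF d(1)])
    fix v assume v: "t - d < v" "v < t" "0 \<le> v"
    show "jump_sum y k t = jump_sum y k v + (if jump y t = 0 then 0 else k (left_lim y t) (jump y t))"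
      using sum_jump_times_split[of 0 v t "\<lambda>r. k (left_lim y r) (jump y r)"] v d(2)[OF v]
      by (cases "jump y t = 0") (simp_all add: jump_sum_def)
  qed
qed

lemma cadlag_jump_sum:
  fixes k :: "'a \<Rightarrow> 'a \<Rightarrow> 'b::real_normed_vector"
  shows "cadlag (jump_sum y k)"
  unfolding cadlag_def
proof safe
  fix t :: real assume t: "0 < t"
  let ?c = "if jump y t = 0 then 0 else k (left_lim y t) (jump y t)"
  obtain d where d: "d > 0" "\<And>v. t - d < v \<Longrightarrow> v < t \<Longrightarrow> 0 \<le> v \<Longrightarrow> jump_sum y k t = jump_sum y k v + ?c"
    by (rule jump_sum_left[OF t, of k]) blast
  have "eventually (\<lambda>v. jump_sum y k v = jump_sum y k t - ?c) (at_left t)"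
    unfolding eventually_at_left_field
  proof (intro exI[of _ "max 0 (t - d)"] conjI allI impI)
    fix v assume "max 0 (t - d) < v" "v < t"
    then show "jump_sum y k v = jump_sum y k t - ?c" using d(2)[of v] by simp
  qed (use t d in simp)
  then show "\<exists>l. (jump_sum y k \<longlongrightarrow> l) (at_left t)" using tendsto_eventually by blast
qed (rule jump_sum_right)

text \<open>Once the mesh is smaller than the least gap between jump times, each grid cell contains
  at most one jump, and the grid sum equals the jump sum; cells without a jump contribute
  \<open>k x 0 = 0\<close>. This makes jump sums accessible to adaptedness.\<close>

lemma jump_sum_grid:
  fixes k :: "'a \<Rightarrow> 'a \<Rightarrow> 'b::{comm_monoid_add, topological_space}" and t :: real
  assumes t: "0 \<le> t" and k: "\<And>x. k x 0 = 0"
  shows "(\<lambda>m. \<Sum>j<m. k (y (t * real j / real m)) (y (t * Suc j / m) - y (t * j / m))) \<longlonglongrightarrow> jump_sum y k t"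
proof -
  obtain g where g: "g > 0" "\<And>r r'. r \<in> jump_times y 0 t \<Longrightarrow> r' \<in> jump_times y 0 t \<Longrightarrow> r \<noteq> r' \<Longrightarrow> g \<le> \<bar>r - r'\<bar>"
    using uniform_gap[OF finite_jump_times[of 0 t]] by auto
  obtain m0 :: nat where m0: "t / g < m0" using reals_Archimedean2 by blast
  have "(\<Sum>j<m. k (y (t * j / m)) (y (t * Suc j / m) - y (t * j / m))) = jump_sum y k t" if m: "m > m0" for m
  proof -
    have mpos: "m > 0" using m by simp
    have mesh: "t / m < g"
    proof -
      have "t < m0 * g" using m0 g(1) by (simp add: field_simps)
      also have "\<dots> \<le> m * g" using m g(1) by (intro mult_right_mono) auto
      finally show ?thesis using mpos by (simp add: field_simps)
    qed
    have "(\<Sum>j<n. k (y (t * j / m)) (y (t * Suc j / m) - y (t * j / m))) = jump_sum y k (t * n / m)" if "n \<le> m" for n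
      using that
    proof (induction n)
      case 0 then show ?case by (simp add: jump_sum_0)
    next
      case (Suc n)
      let ?a = "t * n / m" and ?b = "t * Suc n / m"
      have ab: "0 \<le> ?a" "?a \<le> ?b" "?b \<le> t" "?b - ?a = t / m"
      proof -
        show "0 \<le> ?a" using t by simp
        show "?a \<le> ?b" using t by (intro divide_right_mono mult_left_mono) auto
        have "t * (Suc n / m) \<le> t * 1" using Suc.prems t mpos by (intro mult_left_mono) auto
        then show "?b \<le> t" by simp
        show "?b - ?a = t / m" by (simp add: add_divide_distrib algebra_simps)
      qed
      have "(\<Sum>r\<in>jump_times y ?a ?b. k (left_lim y r) (jump y r)) = k (y ?a) (y ?b - y ?a)"
      proof (cases "jump_times y ?a ?b = {}")
        case True
        then have "y ?b = y ?a" using constant_without_jumps ab by blast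
        then show ?thesis using True k by simp
      next
        case False
        then obtain r where r: "r \<in> jump_times y ?a ?b" by blast
        have "r' = r" if "r' \<in> jump_times y ?a ?b" for r'
        proof (rule ccontr)
          assume "r' \<noteq> r"
          moreover have "r \<in> jump_times y 0 t" "r' \<in> jump_times y 0 t" using r that ab by (auto simp: jump_times_def)
          ultimately have "g \<le> \<bar>r' - r\<bar>" using g(2) by blast
          moreover have "\<bar>r' - r\<bar> \<le> ?b - ?a" using r that by (auto simp: jump_times_def)
          ultimately show False using ab(4) mesh by linarith
        qed
        then have eq: "jump_times y ?a ?b = {r}" using r by blast
        have rab: "?a < r" "r \<le> ?b" using r by (simp_all add: jump_times_def)
        have "jump_times y ?a ?b = jump_times y ?a r \<union> jump_times y r ?b"
          using rab by (intro jump_times_split) simp_all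
        moreover have "r \<notin> jump_times y r ?b" by (simp add: jump_times_def)
        moreover have "r' = r" if "r' \<in> jump_times y r ?b" for r'
          using that eq \<open>jump_times y ?a ?b = jump_times y ?a r \<union> jump_times y r ?b\<close> by blast
        ultimately have sub: "jump_times y ?a r \<subseteq> {r}" "jump_times y r ?b = {}"
          unfolding eq by (blast, metis ex_in_conv)
        have "left_lim y r = y ?a" by (rule left_lim_without_jumps[OF ab(1) rab(1) sub(1)])
        moreover have "y ?b = y r"
          by (rule constant_without_jumps[OF _ rab(2) sub(2)]) (use ab(1) rab(1) in linarith)
        ultimately show ?thesis unfolding eq by (simp add: jump_def)
      qed
      then show ?case
        using Suc sum_jump_times_split[of 0 ?a ?b "\<lambda>r. k (left_lim y r) (jump y r)"] ab
        by (simp add: jump_sum_def)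
    qed
    from this[of m] show ?thesis using mpos by simp
  qed
  then have "eventually (\<lambda>m. (\<Sum>j<m. k (y (t * j / m)) (y (t * Suc j / m) - y (t * j / m))) = jump_sum y k t) sequentially"
    by (rule eventually_mono[OF eventually_gt_at_top[of m0]])
  then show ?thesis by (rule tendsto_eventually)
qed

end

section \<open>Kernels and compensators\<close>

text \<open>The closed shells \<open>K n\<close> are compact, avoid 0 and exhaust the punctured
  space. On subsets of a shell the set function gives the finite value of the measure, and 0 carries
  no mass.\<close>

lemma radon_measure_eqI:
  assumes "radon_measure \<mu>" "radon_measure \<nu>" "set_function \<mu> = set_function \<nu>"
  shows "\<mu> = (\<nu> :: (real^'n) measure)"
proof (rule measure_eqI)
  show sets: "sets \<mu> = sets \<nu>" using assms by (simp add: radon_measure_def)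
  fix A assume "A \<in> sets \<mu>"
  then have A: "A \<in> sets borel" using assms by (simp add: radon_measure_def)
  define K :: "nat \<Rightarrow> (real^'n) set" where "K n = cball 0 (real n + 1) - ball 0 (1 / (real n + 1))" for n
  have K: "compact (K n)" "0 \<notin> K n" for n
    unfolding K_def by (auto intro!: compact_diff)
  have inc: "incseq (\<lambda>n. A \<inter> K n)"
  proof (rule incseq_SucI, safe)
    fix n x assume "x \<in> K n"
    then have x: "norm x \<le> real n + 1" "1 / (real n + 1) \<le> norm x" by (auto simp: K_def)
    have "1 / (real (Suc n) + 1) \<le> 1 / (real n + 1)" by (intro divide_left_mono) auto
    then have "1 / (real (Suc n) + 1) \<le> norm x" using x(2) by (rule order_trans)
    then show "x \<in> K (Suc n)" using x(1) by (simp add: K_def)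
  qed
  have un: "(\<Union>n. A \<inter> K n) = A - {0}"
  proof (intro set_eqI iffI)
    fix x assume "x \<in> A - {0}"
    then have x: "x \<in> A" "x \<noteq> 0" by simp_all
    obtain n :: nat where n: "max (norm x) (1 / norm x) \<le> n" using real_arch_simple by blast
    have "1 / (real n + 1) \<le> norm x" using n x by (simp add: field_simps add_increasing)
    then show "x \<in> (\<Union>n. A \<inter> K n)" using n x by (auto simp: K_def intro!: exI[of _ n])
  qed (use K in auto)
  have eq: "emeasure \<rho> A = (SUP n. ennreal (set_function \<rho> (A \<inter> K n)))" if \<rho>: "radon_measure \<rho>" for \<rho>
  proof -
    have s: "sets \<rho> = sets borel" "emeasure \<rho> {0} = 0" using \<rho> by (auto simp: radon_measure_def)
    have AK: "A \<inter> K n \<in> sets borel" for n using A K(1)[of n] by (auto intro: borel_compact)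
    have "emeasure \<rho> A = emeasure \<rho> (A - {0})"
      using s A by (intro emeasure_Diff_null_set[symmetric] null_setsI) simp_all
    also have "\<dots> = (SUP n. emeasure \<rho> (A \<inter> K n))"
      unfolding un[symmetric] by (rule SUP_emeasure_incseq[symmetric]) (use inc AK s in auto)
    also have "\<dots> = (SUP n. ennreal (set_function \<rho> (A \<inter> K n)))"
    proof (rule SUP_cong[OF refl])
      fix n
      have "emeasure \<rho> (A \<inter> K n) \<le> emeasure \<rho> (K n)"
        using K(1)[of n] s by (intro emeasure_mono) (auto intro: borel_compact)
      also have "\<dots> < \<infinity>" using \<rho> K by (simp add: radon_measure_def)
      finally have "emeasure \<rho> (A \<inter> K n) = ennreal (measure \<rho> (A \<inter> K n))"
        by (intro emeasure_eq_ennreal_measure) auto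
      moreover have "A \<inter> K n \<in> punctured_bounded"
        unfolding punctured_bounded_def using AK K by blast
      ultimately show "emeasure \<rho> (A \<inter> K n) = ennreal (set_function \<rho> (A \<inter> K n))"
        by (simp add: set_function_def)
    qed
    finally show ?thesis .
  qed
  show "emeasure \<mu> A = emeasure \<nu> A" using eq[OF assms(1)] eq[OF assms(2)] assms(3) by simp
qed

lemma measure_from_eqI: "radon_measure \<mu> \<Longrightarrow> set_function \<mu> = m \<Longrightarrow> measure_from m = \<mu>"
  unfolding measure_from_def by (rule the_equality) (auto intro: radon_measure_eqI)

lemma measure_from_positive:
  assumes "is_positive m"
  shows "radon_measure (measure_from m)" "set_function (measure_from m) = m"
proof -
  obtain \<mu> where \<mu>: "radon_measure \<mu>" "set_function \<mu> = m"
    using assms unfolding is_positive_def by (elim exE conjE)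
  then have "measure_from m = \<mu>" by (rule measure_from_eqI)
  then show "radon_measure (measure_from m)" "set_function (measure_from m) = m" using \<mu> by simp_all
qed

lemma radon_measure_sigma_finite:
  assumes "radon_measure (\<mu> :: (real^'n) measure)"
  shows "sigma_finite_measure \<mu>"
proof
  define K :: "nat \<Rightarrow> (real^'n) set" where "K n = cball 0 (real n + 1) - ball 0 (1 / (real n + 1))" for n
  have K: "compact (K n)" "0 \<notin> K n" for n
    unfolding K_def by (auto intro!: compact_diff)
  have s: "sets \<mu> = sets borel" "emeasure \<mu> {0} = 0" "\<And>n. emeasure \<mu> (K n) < \<infinity>" "space \<mu> = UNIV"
    using assms K sets_eq_imp_space_eq[of \<mu> borel] by (auto simp: radon_measure_def)
  have "\<exists>n. x \<in> K n" if "x \<noteq> 0" for x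
  proof -
    obtain n :: nat where n: "max (norm x) (1 / norm x) \<le> n" using real_arch_simple by blast
    have "1 / (real n + 1) \<le> norm x" using n that by (simp add: field_simps add_increasing)
    then show ?thesis using n by (auto simp: K_def intro!: exI[of _ n])
  qed
  then have "x \<in> \<Union> (insert {0} (range K))" for x by (cases "x = 0") auto
  then have "\<Union> (insert {0} (range K)) = space \<mu>" using s by blast
  then show "\<exists>A. countable A \<and> A \<subseteq> sets \<mu> \<and> \<Union> A = space \<mu> \<and> (\<forall>a\<in>A. emeasure \<mu> a \<noteq> \<infinity>)"
    using s K(1) by (intro exI[of _ "insert {0} (range K)"]) (auto intro: borel_compact simp: less_top)
qed

text \<open>Serves for \<open>kernel_measure\<close>, whose values are sums of product measures over
  the states.\<close>

lemma nn_integral_finite_sum_measure: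
  assumes fin: "finite I" and sets: "\<And>i. i \<in> I \<Longrightarrow> sets (\<kappa> i) = sets N"
    and em: "\<And>A. A \<in> sets N \<Longrightarrow> emeasure N A = (\<Sum>i\<in>I. emeasure (\<kappa> i) A)"
    and f: "f \<in> borel_measurable N"
  shows "(\<integral>\<^sup>+z. f z \<partial>N) = (\<Sum>i\<in>I. \<integral>\<^sup>+z. f z \<partial>\<kappa> i)"
  using f
proof (induction rule: borel_measurable_induct)
  case (cong f g)
  have "(\<integral>\<^sup>+z. f z \<partial>\<kappa> i) = (\<integral>\<^sup>+z. g z \<partial>\<kappa> i)" if "i \<in> I" for i
    using cong(3) sets_eq_imp_space_eq[OF sets[OF that]] by (intro nn_integral_cong) simp
  moreover have "(\<integral>\<^sup>+z. f z \<partial>N) = (\<integral>\<^sup>+z. g z \<partial>N)" using cong(3) by (intro nn_integral_cong) simp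
  ultimately show ?case using cong(4) by simp
next
  case (set A)
  then show ?case using em sets by simp
next
  case (mult u c)
  have "u \<in> borel_measurable (\<kappa> i)" if "i \<in> I" for i
    using mult(2) measurable_cong_sets[OF sets[OF that] refl] by blast
  then show ?case using mult by (simp add: nn_integral_cmult sum_distrib_left)
next
  case (add u v)
  have "u \<in> borel_measurable (\<kappa> i)" "v \<in> borel_measurable (\<kappa> i)" if "i \<in> I" for i
    using add(1,3) measurable_cong_sets[OF sets[OF that] refl] by blast+
  then show ?case using add by (simp add: nn_integral_add sum.distrib)
next
  case (seq U)
  have m: "U j \<in> borel_measurable (\<kappa> i)" if "i \<in> I" for i j
    using seq(1) measurable_cong_sets[OF sets[OF that] refl] by blast
  have inc: "incseq (\<lambda>j. \<integral>\<^sup>+z. U j z \<partial>\<kappa> i)" for i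
    using seq(3) by (auto simp: incseq_def le_fun_def intro!: nn_integral_mono)
  have "(\<integral>\<^sup>+z. (SUP j. U j) z \<partial>N) = (SUP j. \<integral>\<^sup>+z. U j z \<partial>N)"
    unfolding SUP_apply by (rule nn_integral_monotone_convergence_SUP[OF seq(3,1)])
  also have "\<dots> = (SUP j. \<Sum>i\<in>I. \<integral>\<^sup>+z. U j z \<partial>\<kappa> i)" using seq.IH by simp
  also have "\<dots> = (\<Sum>i\<in>I. SUP j. \<integral>\<^sup>+z. U j z \<partial>\<kappa> i)"
    by (rule ennreal_SUP_sum) (rule inc)
  also have "\<dots> = (\<Sum>i\<in>I. \<integral>\<^sup>+z. (SUP j. U j) z \<partial>\<kappa> i)"
    unfolding SUP_apply by (intro sum.cong refl nn_integral_monotone_convergence_SUP[symmetric] seq(3) m)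
  finally show ?case .
qed

section \<open>The predictable sigma-field\<close>

context filtered_prob_space begin

lemma space_predictable: "space (predictable_sigma P Fi) = space P \<times> {0..}"
  unfolding predictable_sigma_def by (rule space_measure_of_conv)

lemma predictable_generators:
  "{A \<times> {0} | A. A \<in> sets (Fi 0)} \<union> {A \<times> {s<..t} | A s t. 0 \<le> s \<and> s < t \<and> A \<in> sets (Fi s)} \<subseteq> Pow (space P \<times> {0..})"
proof -
  have "A \<subseteq> space P" if "0 \<le> s" "A \<in> sets (Fi s)" for A s
    using sets.sets_into_space[OF that(2)] space_Fi[OF that(1)] by simp
  from this[OF order_refl] this show ?thesis by fastforce
qed

lemma sets_predictable: "sets (predictable_sigma P Fi) = sigma_sets (space P \<times> {0..})
     ({A \<times> {0} | A. A \<in> sets (Fi 0)} \<union> {A \<times> {s<..t} | A s t. 0 \<le> s \<and> s < t \<and> A \<in> sets (Fi s)})"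
  unfolding predictable_sigma_def using predictable_generators by (rule sets_measure_of)

lemma predictable_rect0: "A \<in> sets (Fi 0) \<Longrightarrow> A \<times> {0} \<in> sets (predictable_sigma P Fi)"
  unfolding sets_predictable by (intro sigma_sets.Basic) blast

lemma predictable_rect: "0 \<le> s \<Longrightarrow> A \<in> sets (Fi s) \<Longrightarrow> A \<times> {s<..t} \<in> sets (predictable_sigma P Fi)"
proof (cases "s < t")
  case True
  assume "0 \<le> s" "A \<in> sets (Fi s)"
  then show ?thesis using True unfolding sets_predictable by (intro sigma_sets.Basic) blast
qed simp

lemma predictable_strip: "0 \<le> s \<Longrightarrow> A \<in> sets (Fi s) \<Longrightarrow> A \<times> {s<..} \<in> sets (predictable_sigma P Fi)"
proof -
  assume A: "0 \<le> s" "A \<in> sets (Fi s)"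
  have "A \<times> {s<..} = (\<Union>n::nat. A \<times> {s<..real n})" using real_arch_simple by auto
  also have "\<dots> \<in> sets (predictable_sigma P Fi)" using predictable_rect[OF A] by blast
  finally show ?thesis .
qed

text \<open>The complement consists of the points with \<open>\<sigma> \<omega> < v\<close>; a
  rational time \<open>q\<close> in between makes it a countable union of the strips
  \<open>{\<sigma> \<le> q} \<times> {q<..}\<close>.\<close>

lemma predictable_stochastic_interval:
  assumes "stopping_time Fi \<sigma>" "\<And>\<omega>. 0 \<le> \<sigma> \<omega>"
  shows "{(\<omega>, v). \<omega> \<in> space P \<and> 0 \<le> v \<and> v \<le> \<sigma> \<omega>} \<in> sets (predictable_sigma P Fi)"
proof -
  let ?q = "\<lambda>r. \<bar>real_of_rat r\<bar>"
  have eq: "{(\<omega>, v). \<omega> \<in> space P \<and> 0 \<le> v \<and> v \<le> \<sigma> \<omega>} =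
    space (predictable_sigma P Fi) - (\<Union>r. {\<omega>\<in>space P. \<sigma> \<omega> \<le> ?q r} \<times> {?q r<..})" (is "?L = ?R")
  proof (rule set_eqI, clarify)
    fix \<omega> v
    have "(\<exists>r. \<sigma> \<omega> \<le> ?q r \<and> ?q r < v) = (\<sigma> \<omega> < v)"
    proof
      assume "\<sigma> \<omega> < v"
      then obtain r where "\<sigma> \<omega> < ?q r" "?q r < v" using rational_between_nonneg[OF _ assms(2)[of \<omega>], of v] by blast
      then show "\<exists>r. \<sigma> \<omega> \<le> ?q r \<and> ?q r < v" by (intro exI[of _ r]) simp
    qed auto
    then show "(\<omega>, v) \<in> ?L \<longleftrightarrow> (\<omega>, v) \<in> ?R" by (auto simp: space_predictable not_le)
  qed
  have "(\<Union>r. {\<omega>\<in>space P. \<sigma> \<omega> \<le> ?q r} \<times> {?q r<..}) \<in> sets (predictable_sigma P Fi)"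
    by (intro sets.countable_UN'' countableI_type predictable_strip abs_ge_zero stopping_time_eq_sets(3)[OF assms])
  then show ?thesis unfolding eq by (rule sets.compl_sets)
qed

lemma predictable_section:
  assumes "\<omega> \<in> space P"
  shows "(\<lambda>t. (\<omega>, t)) \<in> measurable (restrict_space borel {0..}) (predictable_sigma P Fi)"
  unfolding predictable_sigma_def
proof (rule measurable_measure_of[OF predictable_generators])
  show "(\<lambda>t. (\<omega>, t)) \<in> space (restrict_space borel {0..}) \<rightarrow> space P \<times> {0..}"
    using assms by (auto simp: space_restrict_space)
  fix G assume G: "G \<in> {A \<times> {0} | A. A \<in> sets (Fi 0)} \<union> {A \<times> {s<..t} | A s t. 0 \<le> s \<and> s < t \<and> A \<in> sets (Fi s)}"
  have "\<exists>T\<in>sets borel. (\<lambda>t. (\<omega>, t)) -` G = (T :: real set)"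
  proof -
    have "(\<lambda>t. (\<omega>, t)) -` (A \<times> T) = (if \<omega> \<in> A then T else {})" for A and T :: "real set" by auto
    then show ?thesis using G by (auto split: if_splits)
  qed
  then show "(\<lambda>t. (\<omega>, t)) -` G \<inter> space (restrict_space borel {0..}) \<in> sets (restrict_space borel {0..})"
    by (auto simp: sets_restrict_space space_restrict_space Int_commute)
qed

lemma predictable_time_section:
  assumes t: "0 \<le> t"
  shows "(\<lambda>\<omega>. (\<omega>, t)) \<in> measurable (Fi t) (predictable_sigma P Fi)"
  unfolding predictable_sigma_def
proof (rule measurable_measure_of[OF predictable_generators])
  show "(\<lambda>\<omega>. (\<omega>, t)) \<in> space (Fi t) \<rightarrow> space P \<times> {0..}"
    using t space_Fi by auto
  fix G assume "G \<in> {A \<times> {0} | A. A \<in> sets (Fi 0)} \<union> {A \<times> {s<..t} | A s t. 0 \<le> s \<and> s < t \<and> A \<in> sets (Fi s)}"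
  then consider A where "G = A \<times> {0}" "A \<in> sets (Fi 0)"
    | A s t' where "G = A \<times> {s<..t'}" "0 \<le> s" "A \<in> sets (Fi s)" by blast
  then show "(\<lambda>\<omega>. (\<omega>, t)) -` G \<inter> space (Fi t) \<in> sets (Fi t)"
  proof cases
    case 1
    then have "A \<in> sets (Fi t)" using filtration_mono[OF order_refl t] by blast
    moreover have "(\<lambda>\<omega>. (\<omega>, t)) -` G \<inter> space (Fi t) = (if t = 0 then A \<inter> space (Fi t) else {})" using 1 by auto
    ultimately show ?thesis using sets.Int[OF _ sets.top, of A "Fi t"] by (cases "t = 0") simp_all
  next
    case 2
    show ?thesis
    proof (cases "s < t \<and> t \<le> t'")
      case True
      then have "A \<in> sets (Fi t)" using filtration_mono[of s t] 2 by (auto simp only: subset_iff)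
      moreover have "(\<lambda>\<omega>. (\<omega>, t)) -` G \<inter> space (Fi t) = A \<inter> space (Fi t)" using 2 True by auto
      ultimately show ?thesis by simp
    next
      case False
      then have "(\<lambda>\<omega>. (\<omega>, t)) -` G \<inter> space (Fi t) = {}" using 2 by auto
      then show ?thesis by (simp only: sets.empty_sets)
    qed
  qed
qed

lemma predictable_imp_adapted:
  assumes "predictable P Fi Z"
  shows "adapted Fi Z"
  unfolding adapted_def
proof (intro allI impI)
  fix t :: real assume "0 \<le> t"
  from measurable_compose[OF predictable_time_section[OF this] assms[unfolded predictable_def]]
  show "Z t \<in> borel_measurable (Fi t)" by simp
qed

end

section \<open>Processes with finitely many states and their jump kernels\<close>

locale finite_state_process = filtered_prob_space P Fi for P :: "'w measure" and Fi +
  fixes X :: "real \<Rightarrow> 'w \<Rightarrow> real^'n" and E :: "(real^'n) set"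
  assumes X_adapted: "adapted Fi X" and paths: "\<omega> \<in> space P \<Longrightarrow> finite_path (\<lambda>t. X t \<omega>) E"
begin

abbreviation Xm :: "'w \<Rightarrow> real \<Rightarrow> real^'n" where "Xm \<omega> \<equiv> left_lim (\<lambda>t. X t \<omega>)"
abbreviation jumps :: "'w \<Rightarrow> real \<Rightarrow> real \<Rightarrow> real set" where "jumps \<omega> \<equiv> jump_times (\<lambda>t. X t \<omega>)"
abbreviation dX :: "'w \<Rightarrow> real \<Rightarrow> real^'n" where "dX \<omega> \<equiv> jump (\<lambda>t. X t \<omega>)"

lemma finite_E: "finite E"
proof -
  obtain \<omega> where "\<omega> \<in> space P" using not_empty by blast
  then interpret finite_path "\<lambda>t. X t \<omega>" E by (rule paths)
  show ?thesis by (rule fin)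
qed

lemma X_eq_sets: "0 \<le> t \<Longrightarrow> {\<omega>\<in>space P. X t \<omega> = x} \<in> sets (Fi t)"
proof -
  assume t: "0 \<le> t"
  have "X t \<in> borel_measurable (Fi t)" using X_adapted t by (simp add: adapted_def)
  then have "X t -` {x} \<inter> space (Fi t) \<in> sets (Fi t)" by (rule measurable_sets) simp
  moreover have "X t -` {x} \<inter> space (Fi t) = {\<omega>\<in>space P. X t \<omega> = x}" using space_Fi[OF t] by auto
  ultimately show ?thesis by simp
qed

text \<open>The left limit at \<open>t\<close> is the eventual value of \<open>X\<close> at the left
  ends of the dyadic cells that contain \<open>t\<close>. The set is therefore the limit inferior of
  the sets \<open>S k\<close>, which are unions of predictable rectangles.\<close>

lemma predictable_left_lim: "{(\<omega>, t). \<omega> \<in> space P \<and> 0 \<le> t \<and> Xm \<omega> t = x} \<in> sets (predictable_sigma P Fi)"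
proof -
  define S where "S k = {\<omega>\<in>space P. X 0 \<omega> = x} \<times> {0} \<union>
    (\<Union>j. {\<omega>\<in>space P. X (real j / 2^k) \<omega> = x} \<times> {real j / 2^k <.. real (Suc j) / 2^k})" for k :: nat
  have S: "S k \<in> sets (predictable_sigma P Fi)" for k
    unfolding S_def by (intro sets.Un predictable_rect0 X_eq_sets sets.countable_UN'' countableI_type predictable_rect) auto
  have "{(\<omega>, t). \<omega> \<in> space P \<and> 0 \<le> t \<and> Xm \<omega> t = x} = (\<Union>K. \<Inter>k\<in>{K..}. S k)"
  proof (rule set_eqI, clarify)
    fix \<omega> t
    show "((\<omega>, t) \<in> {(\<omega>, t). \<omega> \<in> space P \<and> 0 \<le> t \<and> Xm \<omega> t = x}) = ((\<omega>, t) \<in> (\<Union>K. \<Inter>k\<in>{K..}. S k))"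
    proof (cases "\<omega> \<in> space P \<and> 0 \<le> t")
      case False
      have "(\<omega>, t) \<notin> S k" for k
      proof
        assume "(\<omega>, t) \<in> S k"
        then have "\<omega> \<in> space P" "t = 0 \<or> (\<exists>j. real j / 2^k < t)" by (auto simp: S_def)
        moreover have "0 \<le> real j / 2^k" for j by simp
        ultimately show False using False by (metis less_eq_real_def order_trans)
      qed
      then show ?thesis using False by auto
    next
      case True
      interpret finite_path "\<lambda>t. X t \<omega>" E using True paths by simp
      show ?thesis
      proof (cases "t = 0")
        case t0: True
        have "(\<omega>, t) \<in> S k \<longleftrightarrow> X 0 \<omega> = x" for k
        proof -
          have "\<not> real j / 2^k < 0" for j by (simp add: not_less)
          then show ?thesis using True t0 by (auto simp: S_def simp del: of_nat_Suc)
        qed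
        then show ?thesis using True t0 left_lim_0 by auto
      next
        case False
        then have tpos: "0 < t" using True by simp
        \<comment> \<open>The index of the dyadic cell, open on the left and closed on the right,
          that contains \<open>t\<close>: rounding up and subtracting 1 puts its left end strictly
          before \<open>t\<close>.\<close>
        define j where "j k = nat (\<lceil>2^k * t\<rceil> - 1)" for k :: nat
        have j: "real (j k) / 2^k < t" "t \<le> real (Suc (j k)) / 2^k" for k
        proof -
          have "0 < 2^k * t" using tpos by simp
          then have "1 \<le> \<lceil>2^k * t\<rceil>" by linarith
          then have "real (j k) = of_int \<lceil>2^k * t\<rceil> - 1" by (simp add: j_def)
          then have "real (j k) < 2^k * t" "2^k * t \<le> real (j k) + 1" by linarith+
          then show "real (j k) / 2^k < t" "t \<le> real (Suc (j k)) / 2^k" by (auto simp: field_simps)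
        qed
        have S_iff: "(\<omega>, t) \<in> S k \<longleftrightarrow> X (real (j k) / 2^k) \<omega> = x" for k
        proof
          assume "(\<omega>, t) \<in> S k"
          then obtain i where i: "X (real i / 2^k) \<omega> = x" "real i / 2^k < t" "t \<le> real (Suc i) / 2^k"
            using False by (auto simp: S_def)
          have "real i < real (Suc (j k))" "real (j k) < real (Suc i)"
            using i(2,3) j[of k] by (auto simp: field_simps)
          then have "i = j k" by linarith
          then show "X (real (j k) / 2^k) \<omega> = x" using i by simp
        next
          assume "X (real (j k) / 2^k) \<omega> = x"
          then show "(\<omega>, t) \<in> S k" using True j[of k] by (auto simp: S_def)
        qed
        obtain d where d: "d > 0" "\<And>s. t - d < s \<Longrightarrow> s < t \<Longrightarrow> 0 \<le> s \<Longrightarrow> X s \<omega> = Xm \<omega> t"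
          by (rule left_constant[OF tpos]) blast
        have "(\<lambda>k. (1/2::real) ^ k) \<longlonglongrightarrow> 0" by (rule LIMSEQ_power_zero) simp
        then have "eventually (\<lambda>k. (1/2::real) ^ k < d) sequentially"
          by (rule order_tendstoD(2)) (use d in simp)
        then have "eventually (\<lambda>k. X (real (j k) / 2^k) \<omega> = Xm \<omega> t) sequentially"
        proof eventually_elim
          case (elim k)
          have "real (Suc (j k)) / 2^k = real (j k) / 2^k + (1/2)^k" by (simp add: field_simps)
          then show ?case using j[of k] elim by (intro d(2)) auto
        qed
        then obtain K where K: "\<And>k. k \<ge> K \<Longrightarrow> X (real (j k) / 2^k) \<omega> = Xm \<omega> t"
          unfolding eventually_sequentially by blast
        have "Xm \<omega> t = x \<longleftrightarrow> (\<exists>K. \<forall>k\<ge>K. X (real (j k) / 2^k) \<omega> = x)"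
        proof
          assume "Xm \<omega> t = x" then show "\<exists>K. \<forall>k\<ge>K. X (real (j k) / 2^k) \<omega> = x" using K by blast
        next
          assume "\<exists>K. \<forall>k\<ge>K. X (real (j k) / 2^k) \<omega> = x"
          then obtain K' where "\<And>k. k \<ge> K' \<Longrightarrow> X (real (j k) / 2^k) \<omega> = x" by blast
          from this[of "max K K'"] K[of "max K K'"] show "Xm \<omega> t = x" by simp
        qed
        then show ?thesis using True S_iff by auto
      qed
    qed
  qed
  also have "\<dots> \<in> sets (predictable_sigma P Fi)"
    by (intro sets.countable_UN'' sets.countable_INT' countableI_type) (use S in auto)
  finally show ?thesis .
qed

end

lemma finite_support_nn_integral:
  fixes \<mu> :: "(real^'n) measure"
  assumes \<mu>: "radon_measure \<mu>" and D: "finite D" "emeasure \<mu> (- D) = 0" and f: "f \<in> borel_measurable borel"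
  shows "(\<integral>\<^sup>+\<xi>. f \<xi> \<partial>\<mu>) = (\<Sum>u\<in>D - {0}. ennreal (measure \<mu> {u}) * f u)"
proof -
  have s: "sets \<mu> = sets borel" "emeasure \<mu> {0} = 0" using \<mu> by (simp_all add: radon_measure_def)
  have sp: "space \<mu> = UNIV" using sets_eq_imp_space_eq[OF s(1)] by simp
  have fin: "emeasure \<mu> {u} = ennreal (measure \<mu> {u})" if "u \<noteq> 0" for u
  proof (rule emeasure_eq_ennreal_measure)
    have "compact {u}" "0 \<notin> {u}" using that by auto
    then have "emeasure \<mu> {u} < \<infinity>" using \<mu> unfolding radon_measure_def by blast
    then show "emeasure \<mu> {u} \<noteq> \<top>" by simp
  qed
  have "closed D" by (rule finite_imp_closed[OF D(1)])
  then have "- D \<in> null_sets \<mu>" using D s by (intro null_setsI) auto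
  moreover have "{0} \<in> null_sets \<mu>" using s by (intro null_setsI) auto
  ultimately have "- D \<union> {0} \<in> null_sets \<mu>" by (rule null_sets.Un)
  then have AE: "AE \<xi> in \<mu>. \<xi> \<in> D - {0}" by (rule AE_I'[of _ \<mu>]) (auto simp: sp)
  have "(\<integral>\<^sup>+\<xi>. f \<xi> \<partial>\<mu>) = (\<integral>\<^sup>+\<xi>. (\<Sum>u\<in>D - {0}. f u * indicator {u} \<xi>) \<partial>\<mu>)"
    using AE
  proof (intro nn_integral_cong_AE, eventually_elim)
    case (elim \<xi>)
    have "(\<Sum>u\<in>D - {0}. f u * indicator {u} \<xi>) = (\<Sum>u\<in>D - {0}. if u = \<xi> then f u else 0)"
      by (rule sum.cong) (auto simp: indicator_def)
    then show ?case using elim D(1) by simp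
  qed
  also have "\<dots> = (\<Sum>u\<in>D - {0}. f u * emeasure \<mu> {u})"
    using s by (subst nn_integral_sum) (auto simp: nn_integral_cmult_indicator)
  also have "\<dots> = (\<Sum>u\<in>D - {0}. ennreal (measure \<mu> {u}) * f u)"
    by (rule sum.cong) (auto simp: fin mult.commute)
  finally show ?thesis .
qed

lemma sets_kernel_measure: "sets (kernel_measure F y) = sets borel"
  unfolding kernel_measure_def
  using sets_measure_of[of "sets borel" "UNIV :: (real \<times> (real^'n)) set"] by (simp add: sets.sigma_sets_eq[of borel, simplified])

locale finite_state_kernel = finite_state_process P Fi X E
  for P :: "'w measure" and Fi and X :: "real \<Rightarrow> 'w \<Rightarrow> real^'n" and E +
  fixes F :: "real^'n \<Rightarrow> (real^'n) set \<Rightarrow> real"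
  assumes positive: "x \<in> E \<Longrightarrow> is_positive (F x)"
begin

abbreviation jump_law :: "real^'n \<Rightarrow> (real^'n) measure" where "jump_law x \<equiv> measure_from (F x)"

lemma jump_law: "x \<in> E \<Longrightarrow> radon_measure (jump_law x)" "x \<in> E \<Longrightarrow> set_function (jump_law x) = F x"
  using measure_from_positive[OF positive] by blast+

lemma sets_jump_law: "x \<in> E \<Longrightarrow> sets (jump_law x) = sets borel"
  using jump_law(1) by (simp add: radon_measure_def)

lemma left_lim_sets: "\<omega> \<in> space P \<Longrightarrow> {t. 0 \<le> t \<and> Xm \<omega> t = x} \<in> sets borel"
proof -
  assume \<omega>: "\<omega> \<in> space P"
  from measurable_sets[OF predictable_section[OF \<omega>] predictable_left_lim[of x]]
  have "{t. 0 \<le> t \<and> Xm \<omega> t = x} \<in> sets (restrict_space borel {0..})"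
    using \<omega> by (simp add: vimage_def space_restrict_space Int_def conj_ac cong: conj_cong)
  then show ?thesis by (auto simp: sets_restrict_space)
qed

text \<open>\<open>kernel_measure\<close> is given by a formula for its values, which describes a
  measure only once countable additivity is known. Sorting the times by the state occupied just
  before turns the formula into a finite sum of product measures \<open>\<kappa> x\<close>.\<close>

lemma kernel_integral:
  assumes \<omega>: "\<omega> \<in> space P" and f: "f \<in> borel_measurable borel"
  shows "(\<integral>\<^sup>+z. f z \<partial>kernel_measure F (\<lambda>r. X r \<omega>)) =
    (\<Sum>x\<in>E. \<integral>\<^sup>+t. indicator {t. 0 \<le> t \<and> Xm \<omega> t = x} t * (\<integral>\<^sup>+\<xi>. f (t, \<xi>) \<partial>jump_law x) \<partial>lborel)"
proof -
  interpret finite_path "\<lambda>t. X t \<omega>" E by (rule paths[OF \<omega>])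
  define B where "B x = {t. 0 \<le> t \<and> Xm \<omega> t = x}" for x
  have B: "B x \<in> sets borel" for x unfolding B_def by (rule left_lim_sets[OF \<omega>])
  define \<kappa> where "\<kappa> x = density lborel (indicator (B x)) \<Otimes>\<^sub>M jump_law x" for x
  have sets: "sets (\<kappa> x) = sets borel" if "x \<in> E" for x
  proof -
    have "sets (\<kappa> x) = sets (borel \<Otimes>\<^sub>M borel)"
      unfolding \<kappa>_def using sets_jump_law[OF that] by (intro sets_pair_measure_cong) auto
    then show ?thesis by (simp only: borel_prod)
  qed
  have sf: "sigma_finite_measure (jump_law x)" if "x \<in> E" for x
    by (rule radon_measure_sigma_finite[OF jump_law(1)[OF that]])
  have em_\<kappa>: "emeasure (\<kappa> x) A = (\<integral>\<^sup>+t. indicator (B x) t * emeasure (jump_law x) (Pair t -` A) \<partial>lborel)"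
    if x: "x \<in> E" and A: "A \<in> sets borel" for x A
  proof -
    interpret sigma_finite_measure "jump_law x" by (rule sf[OF x])
    have A': "A \<in> sets (density lborel (indicator (B x)) \<Otimes>\<^sub>M jump_law x)" using A sets[OF x] unfolding \<kappa>_def by (simp only:)
    have m: "(\<lambda>t. emeasure (jump_law x) (Pair t -` A)) \<in> borel_measurable lborel"
      using measurable_emeasure_Pair[OF A'] by simp
    show ?thesis unfolding \<kappa>_def
      by (subst emeasure_pair_measure_alt[OF A']) (use B m in \<open>simp add: nn_integral_density\<close>)
  qed
  have base: "(\<integral>\<^sup>+t\<in>{0..}. emeasure (measure_from (F (Xm \<omega> t))) (Pair t -` A) \<partial>lborel) = (\<Sum>x\<in>E. emeasure (\<kappa> x) A)"
    if A: "A \<in> sets borel" for A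
  proof -
    have m: "(\<lambda>t. indicator (B x) t * emeasure (jump_law x) (Pair t -` A)) \<in> borel_measurable lborel" if x: "x \<in> E" for x
    proof -
      interpret sigma_finite_measure "jump_law x" by (rule sf[OF x])
      have "A \<in> sets (lborel \<Otimes>\<^sub>M jump_law x)"
        using A sets_jump_law[OF x] by (simp add: borel_prod[symmetric] cong: sets_pair_measure_cong)
      from measurable_emeasure_Pair[OF this] show ?thesis using B by auto
    qed
    have "(\<integral>\<^sup>+t\<in>{0..}. emeasure (measure_from (F (Xm \<omega> t))) (Pair t -` A) \<partial>lborel) =
      (\<integral>\<^sup>+t. (\<Sum>x\<in>E. indicator (B x) t * emeasure (jump_law x) (Pair t -` A)) \<partial>lborel)"
    proof (rule nn_integral_cong)
      fix t :: real
      show "emeasure (measure_from (F (Xm \<omega> t))) (Pair t -` A) * indicator {0..} t =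
        (\<Sum>x\<in>E. indicator (B x) t * emeasure (jump_law x) (Pair t -` A))"
      proof (cases "0 \<le> t")
        case True
        have "(\<Sum>x\<in>E. indicator (B x) t * emeasure (jump_law x) (Pair t -` A)) =
          (\<Sum>x\<in>E. if x = Xm \<omega> t then emeasure (jump_law x) (Pair t -` A) else 0)"
          by (rule sum.cong) (use True in \<open>auto simp: B_def indicator_def\<close>)
        then show ?thesis using True left_lim_range[OF True] finite_E by simp
      next
        case False then show ?thesis by (simp add: B_def)
      qed
    qed
    also have "\<dots> = (\<Sum>x\<in>E. \<integral>\<^sup>+t. indicator (B x) t * emeasure (jump_law x) (Pair t -` A) \<partial>lborel)"
      by (rule nn_integral_sum[OF m])
    also have "\<dots> = (\<Sum>x\<in>E. emeasure (\<kappa> x) A)" using em_\<kappa> A by simp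
    finally show ?thesis .
  qed
  have em: "emeasure (kernel_measure F (\<lambda>r. X r \<omega>)) A = (\<Sum>x\<in>E. emeasure (\<kappa> x) A)" if A: "A \<in> sets borel" for A
  proof -
    let ?m = "\<lambda>A. \<integral>\<^sup>+t\<in>{0..}. emeasure (measure_from (F (Xm \<omega> t))) (Pair t -` A) \<partial>lborel"
    have "emeasure (kernel_measure F (\<lambda>r. X r \<omega>)) A = ?m A"
    proof (rule emeasure_measure_of[OF kernel_measure_def])
      show "positive (sets (kernel_measure F (\<lambda>r. X r \<omega>))) ?m" by (simp add: positive_def)
      have ca: "countably_additive (sets borel) (\<lambda>A. \<Sum>x\<in>E. emeasure (\<kappa> x) A)"
      proof (rule countably_additiveI)
        fix A :: "nat \<Rightarrow> (real \<times> (real^'n)) set"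
        assume A: "range A \<subseteq> sets borel" "disjoint_family A" "(\<Union>i. A i) \<in> sets borel"
        have "(\<Sum>i. \<Sum>x\<in>E. emeasure (\<kappa> x) (A i)) = (\<Sum>x\<in>E. \<Sum>i. emeasure (\<kappa> x) (A i))"
          by (rule suminf_sum) simp
        also have "\<dots> = (\<Sum>x\<in>E. emeasure (\<kappa> x) (\<Union>i. A i))"
          using A sets by (intro sum.cong refl suminf_emeasure) auto
        finally show "(\<Sum>i. \<Sum>x\<in>E. emeasure (\<kappa> x) (A i)) = (\<Sum>x\<in>E. emeasure (\<kappa> x) (\<Union>i. A i))" .
      qed
      show "countably_additive (sets (kernel_measure F (\<lambda>r. X r \<omega>))) ?m"
        unfolding sets_kernel_measure countably_additive_def
      proof (intro allI impI)
        fix A :: "nat \<Rightarrow> (real \<times> (real^'n)) set"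
        assume A: "range A \<subseteq> sets borel" "disjoint_family A" "(\<Union>i. A i) \<in> sets borel"
        then have "A i \<in> sets borel" for i by auto
        then show "(\<Sum>i. ?m (A i)) = ?m (\<Union>i. A i)"
          using ca A base unfolding countably_additive_def by simp
      qed
      show "A \<in> sets (kernel_measure F (\<lambda>r. X r \<omega>))" unfolding sets_kernel_measure by (rule A)
    qed simp
    then show ?thesis using base[OF A] by simp
  qed
  note sk = sets_kernel_measure[of F "\<lambda>r. X r \<omega>"]
  have "(\<integral>\<^sup>+z. f z \<partial>kernel_measure F (\<lambda>r. X r \<omega>)) = (\<Sum>x\<in>E. \<integral>\<^sup>+z. f z \<partial>\<kappa> x)"
  proof (rule nn_integral_finite_sum_measure[OF finite_E])
    show "f \<in> borel_measurable (kernel_measure F (\<lambda>r. X r \<omega>))"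
      using f measurable_cong_sets[OF sk refl] by blast
  qed (use sets sk em in auto)
  also have "\<dots> = (\<Sum>x\<in>E. \<integral>\<^sup>+t. indicator (B x) t * (\<integral>\<^sup>+\<xi>. f (t, \<xi>) \<partial>jump_law x) \<partial>lborel)"
  proof (rule sum.cong[OF refl])
    fix x assume x: "x \<in> E"
    interpret sigma_finite_measure "jump_law x" by (rule sf[OF x])
    have fm: "f \<in> borel_measurable (density lborel (indicator (B x)) \<Otimes>\<^sub>M jump_law x)"
      using f measurable_cong_sets[OF sets[OF x] refl] unfolding \<kappa>_def by blast
    have "(\<integral>\<^sup>+z. f z \<partial>\<kappa> x) = (\<integral>\<^sup>+t. (\<integral>\<^sup>+\<xi>. f (t, \<xi>) \<partial>jump_law x) \<partial>density lborel (indicator (B x)))"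
      unfolding \<kappa>_def by (rule nn_integral_fst[OF fm, symmetric])
    also have "\<dots> = (\<integral>\<^sup>+t. indicator (B x) t * (\<integral>\<^sup>+\<xi>. f (t, \<xi>) \<partial>jump_law x) \<partial>lborel)"
      using B borel_measurable_nn_integral_fst[OF fm] by (subst nn_integral_density) auto
    finally show "(\<integral>\<^sup>+z. f z \<partial>\<kappa> x) = (\<integral>\<^sup>+t. indicator (B x) t * (\<integral>\<^sup>+\<xi>. f (t, \<xi>) \<partial>jump_law x) \<partial>lborel)" .
  qed
  finally show ?thesis unfolding B_def .
qed

text \<open>Undoes the sorting by states; in this form two kernels can be compared time by
  time.\<close>

lemma kernel_integral_pointwise:
  assumes \<omega>: "\<omega> \<in> space P" and f: "f \<in> borel_measurable borel"
  shows "(\<integral>\<^sup>+z. f z \<partial>kernel_measure F (\<lambda>r. X r \<omega>)) =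
    (\<integral>\<^sup>+t\<in>{0..}. (\<integral>\<^sup>+\<xi>. f (t, \<xi>) \<partial>jump_law (Xm \<omega> t)) \<partial>lborel)"
proof -
  interpret finite_path "\<lambda>t. X t \<omega>" E by (rule paths[OF \<omega>])
  have m: "(\<lambda>t. indicator {t. 0 \<le> t \<and> Xm \<omega> t = x} t * (\<integral>\<^sup>+\<xi>. f (t, \<xi>) \<partial>jump_law x)) \<in> borel_measurable lborel" if x: "x \<in> E" for x
  proof -
    interpret sigma_finite_measure "jump_law x" by (rule radon_measure_sigma_finite[OF jump_law(1)[OF x]])
    have "sets (borel :: (real \<times> (real^'n)) measure) = sets (lborel \<Otimes>\<^sub>M jump_law x)"
      unfolding borel_prod[symmetric] by (intro sets_pair_measure_cong) (simp_all add: sets_jump_law[OF x])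
    then have "f \<in> borel_measurable (lborel \<Otimes>\<^sub>M jump_law x)" using f measurable_cong_sets by blast
    from borel_measurable_nn_integral_fst[OF this]
    show ?thesis using left_lim_sets[OF \<omega>, of x] by (intro borel_measurable_times_ennreal borel_measurable_indicator) simp_all
  qed
  have "(\<integral>\<^sup>+z. f z \<partial>kernel_measure F (\<lambda>r. X r \<omega>)) =
    (\<integral>\<^sup>+t. (\<Sum>x\<in>E. indicator {t. 0 \<le> t \<and> Xm \<omega> t = x} t * (\<integral>\<^sup>+\<xi>. f (t, \<xi>) \<partial>jump_law x)) \<partial>lborel)"
    unfolding kernel_integral[OF assms] by (rule nn_integral_sum[symmetric, OF m])
  also have "\<dots> = (\<integral>\<^sup>+t\<in>{0..}. (\<integral>\<^sup>+\<xi>. f (t, \<xi>) \<partial>jump_law (Xm \<omega> t)) \<partial>lborel)"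
  proof (rule nn_integral_cong)
    fix t :: real
    show "(\<Sum>x\<in>E. indicator {t. 0 \<le> t \<and> Xm \<omega> t = x} t * (\<integral>\<^sup>+\<xi>. f (t, \<xi>) \<partial>jump_law x)) =
      (\<integral>\<^sup>+\<xi>. f (t, \<xi>) \<partial>jump_law (Xm \<omega> t)) * indicator {0..} t"
    proof (cases "0 \<le> t")
      case True
      have "(\<Sum>x\<in>E. indicator {t. 0 \<le> t \<and> Xm \<omega> t = x} t * (\<integral>\<^sup>+\<xi>. f (t, \<xi>) \<partial>jump_law x)) =
        (\<Sum>x\<in>E. if x = Xm \<omega> t then (\<integral>\<^sup>+\<xi>. f (t, \<xi>) \<partial>jump_law x) else 0)"
        by (rule sum.cong) (use True in \<open>auto simp: indicator_def\<close>)
      then show ?thesis using True left_lim_range[OF True] finite_E by simp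
    qed simp
  qed
  finally show ?thesis .
qed

text \<open>The predictable sigma-field knows nonnegative times only, so the section is measurable
  on a restricted space, and the indicator extends it by 0.\<close>

lemma section_measurable:
  assumes W: "W \<in> borel_measurable (predictable_sigma P Fi \<Otimes>\<^sub>M borel)" and \<omega>: "\<omega> \<in> space P"
    and T: "T \<in> sets borel" "T \<subseteq> {0..}"
  shows "(\<lambda>z. W ((\<omega>, fst z), snd z) * indicator (T \<times> UNIV) z :: ennreal) \<in> borel_measurable (borel :: (real \<times> (real^'n)) measure)"
proof -
  have fs: "fst \<in> borel_measurable (borel :: (real \<times> (real^'n)) measure)" "snd \<in> borel_measurable (borel :: (real \<times> (real^'n)) measure)"
    by (auto intro!: borel_measurable_continuous_onI continuous_intros)
  have 1: "(\<lambda>z. ((\<omega>, fst z), snd z)) \<in> measurable (restrict_space (borel :: (real \<times> (real^'n)) measure) ({0..} \<times> UNIV)) (predictable_sigma P Fi \<Otimes>\<^sub>M borel)"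
    by (intro measurable_Pair measurable_compose[OF measurable_restrict_space3 predictable_section[OF \<omega>]] measurable_restrict_space1 fs) auto
  have Tm: "T \<times> (UNIV :: (real^'n) set) \<in> sets borel" using T(1) by (simp add: borel_prod[symmetric])
  have "(\<lambda>z. W ((\<omega>, fst z), snd z)) \<in> borel_measurable (restrict_space (borel :: (real \<times> (real^'n)) measure) ({0..} \<times> UNIV))"
    by (rule measurable_compose[OF 1 W])
  then have "(\<lambda>z. W ((\<omega>, fst z), snd z) * indicator ({0..} \<times> UNIV) z) \<in> borel_measurable borel"
    by (subst (asm) borel_measurable_restrict_space_iff_ennreal) (auto simp: borel_prod[symmetric])
  then have "(\<lambda>z. W ((\<omega>, fst z), snd z) * indicator ({0..} \<times> UNIV) z * indicator (T \<times> UNIV) z) \<in> borel_measurable borel"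
    by (rule borel_measurable_times_ennreal) (use Tm in simp)
  moreover have "W ((\<omega>, fst z), snd z) * indicator ({0..} \<times> UNIV) z * indicator (T \<times> UNIV) z =
    W ((\<omega>, fst z), snd z) * indicator (T \<times> UNIV) z" for z
    using T(2) by (auto simp: indicator_def)
  ultimately show ?thesis by simp
qed

lemma jump_measure_integral:
  assumes f: "(\<lambda>z. f z * indicator ({0..} \<times> UNIV) z) \<in> borel_measurable borel"
  shows "(\<integral>\<^sup>+z\<in>{0..} \<times> UNIV. f z \<partial>jump_measure X \<omega>) = (\<integral>\<^sup>+s. f (s, dX \<omega> s) \<partial>count_space {s. 0 < s \<and> dX \<omega> s \<noteq> 0})"
  unfolding jump_measure_def
  by (subst nn_integral_distr) (use f in \<open>auto intro!: nn_integral_cong simp: indicator_def\<close>)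

end

section \<open>The compensator identity\<close>

locale finite_state_characteristics = finite_state_kernel P Fi X E F
  for P :: "'w measure" and Fi and X :: "real \<Rightarrow> 'w \<Rightarrow> real^'n" and E F +
  assumes compensator: "is_compensator P Fi X (\<lambda>\<omega>. kernel_measure F (\<lambda>r. X r \<omega>))"
begin

text \<open>The integrand \<open>k (X\<^sub>t\<^sub>-) \<xi>\<close> on the set \<open>G\<close>.
  Spelled out as a sum over the states it is jointly measurable as soon as each \<open>k x\<close>
  is measurable.\<close>

definition lift_kernel :: "('w \<times> real) set \<Rightarrow> (real^'n \<Rightarrow> real^'n \<Rightarrow> ennreal) \<Rightarrow> ('w \<times> real) \<times> (real^'n) \<Rightarrow> ennreal" where
  "lift_kernel G k z = (\<Sum>x\<in>E. indicator (G \<inter> {(\<omega>, t). \<omega> \<in> space P \<and> 0 \<le> t \<and> Xm \<omega> t = x}) (fst z) * k x (snd z))"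

context
  fixes G and k :: "real^'n \<Rightarrow> real^'n \<Rightarrow> ennreal"
  assumes G: "G \<in> sets (predictable_sigma P Fi)" and k: "\<And>x. x \<in> E \<Longrightarrow> k x \<in> borel_measurable borel"
begin

lemma lift_kernel_measurable: "lift_kernel G k \<in> borel_measurable (predictable_sigma P Fi \<Otimes>\<^sub>M borel)"
  unfolding lift_kernel_def
proof (intro borel_measurable_sum borel_measurable_times_ennreal)
  fix x assume x: "x \<in> E"
  have "indicator (G \<inter> {(\<omega>, t). \<omega> \<in> space P \<and> 0 \<le> t \<and> Xm \<omega> t = x}) \<in> borel_measurable (predictable_sigma P Fi)"
    using G predictable_left_lim by (intro borel_measurable_indicator sets.Int)
  from measurable_compose[OF measurable_fst this]
  show "(\<lambda>z. indicator (G \<inter> {(\<omega>, t). \<omega> \<in> space P \<and> 0 \<le> t \<and> Xm \<omega> t = x}) (fst z)) \<in> borel_measurable (predictable_sigma P Fi \<Otimes>\<^sub>M borel)" .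
  from measurable_compose[OF measurable_snd k[OF x]]
  show "(\<lambda>z. k x (snd z)) \<in> borel_measurable (predictable_sigma P Fi \<Otimes>\<^sub>M borel)" .
qed

lemma lift_kernel_eq:
  assumes "\<omega> \<in> space P" "0 \<le> s"
  shows "lift_kernel G k ((\<omega>, s), \<xi>) = indicator G (\<omega>, s) * k (Xm \<omega> s) \<xi>"
proof -
  interpret finite_path "\<lambda>t. X t \<omega>" E by (rule paths) fact
  have "lift_kernel G k ((\<omega>, s), \<xi>) = (\<Sum>x\<in>E. if x = Xm \<omega> s then indicator G (\<omega>, s) * k x \<xi> else 0)"
    unfolding lift_kernel_def by (rule sum.cong) (use assms in \<open>auto simp: indicator_def\<close>)
  then show ?thesis using left_lim_range[OF assms(2)] finite_E by simp
qed

lemma lift_kernel_integral: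
  assumes \<omega>: "\<omega> \<in> space P" and T: "T \<in> sets borel" "T \<subseteq> {0..}"
  shows "(\<integral>\<^sup>+z\<in>T \<times> UNIV. lift_kernel G k ((\<omega>, fst z), snd z) \<partial>kernel_measure F (\<lambda>r. X r \<omega>)) =
    (\<Sum>x\<in>E. \<integral>\<^sup>+t. indicator G (\<omega>, t) * indicator {t\<in>T. Xm \<omega> t = x} t * (\<integral>\<^sup>+\<xi>. k x \<xi> \<partial>jump_law x) \<partial>lborel)"
proof -
  have "(\<integral>\<^sup>+z\<in>T \<times> UNIV. lift_kernel G k ((\<omega>, fst z), snd z) \<partial>kernel_measure F (\<lambda>r. X r \<omega>)) =
    (\<Sum>x\<in>E. \<integral>\<^sup>+t. indicator {t. 0 \<le> t \<and> Xm \<omega> t = x} t * (\<integral>\<^sup>+\<xi>. lift_kernel G k ((\<omega>, t), \<xi>) * indicator (T \<times> UNIV) (t, \<xi>) \<partial>jump_law x) \<partial>lborel)"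
    by (subst kernel_integral[OF \<omega>]) (use section_measurable[OF lift_kernel_measurable \<omega> T] in simp_all)
  also have "\<dots> = (\<Sum>x\<in>E. \<integral>\<^sup>+t. indicator G (\<omega>, t) * indicator {t\<in>T. Xm \<omega> t = x} t * (\<integral>\<^sup>+\<xi>. k x \<xi> \<partial>jump_law x) \<partial>lborel)"
  proof (intro sum.cong refl nn_integral_cong)
    fix x t assume x: "x \<in> E"
    have km: "k x \<in> borel_measurable (jump_law x)" using k[OF x] measurable_cong_sets[OF sets_jump_law[OF x] refl] by blast
    show "indicator {t. 0 \<le> t \<and> Xm \<omega> t = x} t * (\<integral>\<^sup>+\<xi>. lift_kernel G k ((\<omega>, t), \<xi>) * indicator (T \<times> UNIV) (t, \<xi>) \<partial>jump_law x) =
      indicator G (\<omega>, t) * indicator {t\<in>T. Xm \<omega> t = x} t * (\<integral>\<^sup>+\<xi>. k x \<xi> \<partial>jump_law x)"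
    proof (cases "t \<in> T \<and> Xm \<omega> t = x")
      case True
      then show ?thesis using lift_kernel_eq[OF \<omega>, of t] km T(2) by (auto simp: nn_integral_cmult subset_iff)
    next
      case False
      then show ?thesis by (cases "t \<in> T") auto
    qed
  qed
  finally show ?thesis .
qed

text \<open>The Levy system formula: the compensator identity for integrands that depend on the
  state before the jump and on the jump.\<close>

lemma jump_formula:
  "(\<integral>\<^sup>+\<omega>. \<integral>\<^sup>+s. indicator G (\<omega>, s) * k (Xm \<omega> s) (dX \<omega> s) \<partial>count_space {s. 0 < s \<and> dX \<omega> s \<noteq> 0} \<partial>P) =
    (\<integral>\<^sup>+\<omega>. (\<Sum>x\<in>E. \<integral>\<^sup>+t. indicator G (\<omega>, t) * indicator {t\<in>{0..}. Xm \<omega> t = x} t * (\<integral>\<^sup>+\<xi>. k x \<xi> \<partial>jump_law x) \<partial>lborel) \<partial>P)"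
    (is "?lhs = ?rhs")
proof -
  let ?W = "lift_kernel G k"
  have "?lhs = (\<integral>\<^sup>+\<omega>. (\<integral>\<^sup>+z\<in>{0..} \<times> UNIV. ?W ((\<omega>, fst z), snd z) \<partial>jump_measure X \<omega>) \<partial>P)"
  proof (rule nn_integral_cong)
    fix \<omega> assume \<omega>: "\<omega> \<in> space P"
    show "(\<integral>\<^sup>+s. indicator G (\<omega>, s) * k (Xm \<omega> s) (dX \<omega> s) \<partial>count_space {s. 0 < s \<and> dX \<omega> s \<noteq> 0}) =
      (\<integral>\<^sup>+z\<in>{0..} \<times> UNIV. ?W ((\<omega>, fst z), snd z) \<partial>jump_measure X \<omega>)"
      by (subst jump_measure_integral, rule section_measurable[OF lift_kernel_measurable \<omega>])
         (auto intro!: nn_integral_cong simp: lift_kernel_eq[OF \<omega>])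
  qed
  also have "\<dots> = (\<integral>\<^sup>+\<omega>. (\<integral>\<^sup>+z\<in>{0..} \<times> UNIV. ?W ((\<omega>, fst z), snd z) \<partial>kernel_measure F (\<lambda>r. X r \<omega>)) \<partial>P)"
    using compensator lift_kernel_measurable unfolding is_compensator_def by blast
  also have "\<dots> = ?rhs"
    by (rule nn_integral_cong, rule lift_kernel_integral) auto
  finally show ?thesis .
qed

lemma predictable_compensator:
  "predictable P Fi (\<lambda>T \<omega>. \<Sum>x\<in>E. \<integral>\<^sup>+t. indicator G (\<omega>, t) * indicator {t\<in>{0..T}. Xm \<omega> t = x} t * (\<integral>\<^sup>+\<xi>. k x \<xi> \<partial>jump_law x) \<partial>lborel)"
proof -
  have "predictable P Fi (\<lambda>t \<omega>. \<integral>\<^sup>+z\<in>{0..t} \<times> UNIV. lift_kernel G k ((\<omega>, fst z), snd z) \<partial>kernel_measure F (\<lambda>r. X r \<omega>))"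
    using compensator lift_kernel_measurable unfolding is_compensator_def by blast
  then show ?thesis
    unfolding predictable_def
  proof (rule iffD1[OF measurable_cong, rotated])
    fix z assume "z \<in> space (predictable_sigma P Fi)"
    then have z: "fst z \<in> space P" by (auto simp: space_predictable)
    have T: "{0..snd z} \<in> sets borel" "{0..snd z} \<subseteq> {0..}" by auto
    show "(\<lambda>(\<omega>, t). \<integral>\<^sup>+z\<in>{0..t} \<times> UNIV. lift_kernel G k ((\<omega>, fst z), snd z) \<partial>kernel_measure F (\<lambda>r. X r \<omega>)) z =
      (\<lambda>(\<omega>, T). \<Sum>x\<in>E. \<integral>\<^sup>+t. indicator G (\<omega>, t) * indicator {t\<in>{0..T}. Xm \<omega> t = x} t * (\<integral>\<^sup>+\<xi>. k x \<xi> \<partial>jump_law x) \<partial>lborel) z"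
      unfolding split_beta by (rule lift_kernel_integral[OF z T])
  qed
qed

end

text \<open>The process stays in its starting point for a positive time, so jumps out of \<open>E\<close> would be seen.\<close>
lemma jump_law_support:
  assumes x0: "x0 \<in> E" and start: "AE \<omega> in P. X 0 \<omega> = x0"
  shows "emeasure (jump_law x0) (- (\<lambda>y. y - x0) ` E) = 0"
proof (rule ccontr)
  let ?D = "(\<lambda>y. y - x0) ` E"
  let ?c = "emeasure (jump_law x0) (- ?D)"
  assume pos: "?c \<noteq> 0"
  have D: "- ?D \<in> sets borel" using finite_E by (intro borel_open open_Compl finite_imp_closed finite_imageI)
  \<comment> \<open>Selects the jumps from \<open>x0\<close> to points outside \<open>E\<close>. The
    path makes none of them, whereas a positive mass \<open>?c\<close> would be charged during the
    initial interval spent in \<open>x0\<close>.\<close>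
  define k :: "real^'n \<Rightarrow> real^'n \<Rightarrow> ennreal" where "k x \<xi> = (if x = x0 then indicator (- ?D) \<xi> else 0)" for x \<xi>
  have km: "k x \<in> borel_measurable borel" for x
    unfolding k_def using D by (cases "x = x0") simp_all
  let ?G = "space P \<times> {0<..1::real}"
  have G: "?G \<in> sets (predictable_sigma P Fi)"
    using predictable_rect[of 0 "space P" 1] space_Fi[of 0] sets.top[of "Fi 0"] by simp
  have "(\<integral>\<^sup>+\<omega>. \<integral>\<^sup>+s. indicator ?G (\<omega>, s) * k (Xm \<omega> s) (dX \<omega> s) \<partial>count_space {s. 0 < s \<and> dX \<omega> s \<noteq> 0} \<partial>P) = (\<integral>\<^sup>+\<omega>. 0 \<partial>P)"
  proof (rule nn_integral_cong)
    fix \<omega> assume \<omega>: "\<omega> \<in> space P"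
    interpret finite_path "\<lambda>t. X t \<omega>" E by (rule paths[OF \<omega>])
    have "k (Xm \<omega> s) (dX \<omega> s) = 0" if "0 < s" for s
      using range[of s] that by (auto simp: k_def jump_def indicator_def)
    then have "(\<integral>\<^sup>+s. indicator ?G (\<omega>, s) * k (Xm \<omega> s) (dX \<omega> s) \<partial>count_space {s. 0 < s \<and> dX \<omega> s \<noteq> 0}) =
      (\<integral>\<^sup>+s. 0 \<partial>count_space {s. 0 < s \<and> dX \<omega> s \<noteq> 0})" by (intro nn_integral_cong) auto
    then show "(\<integral>\<^sup>+s. indicator ?G (\<omega>, s) * k (Xm \<omega> s) (dX \<omega> s) \<partial>count_space {s. 0 < s \<and> dX \<omega> s \<noteq> 0}) = 0" by simp
  qed
  with jump_formula[OF G, of k, OF km]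
  have zero: "(\<integral>\<^sup>+\<omega>. (\<Sum>x\<in>E. \<integral>\<^sup>+t. indicator ?G (\<omega>, t) * indicator {t\<in>{0..}. Xm \<omega> t = x} t * (\<integral>\<^sup>+\<xi>. k x \<xi> \<partial>jump_law x) \<partial>lborel) \<partial>P) = 0"
    by simp
  have "AE \<omega> in P. 0 < (\<Sum>x\<in>E. \<integral>\<^sup>+t. indicator ?G (\<omega>, t) * indicator {t\<in>{0..}. Xm \<omega> t = x} t * (\<integral>\<^sup>+\<xi>. k x \<xi> \<partial>jump_law x) \<partial>lborel)"
    using start AE_space
  proof eventually_elim
    case (elim \<omega>)
    interpret finite_path "\<lambda>t. X t \<omega>" E by (rule paths[OF elim(2)])
    obtain d where d: "d > 0" "\<And>s. 0 < s \<Longrightarrow> s < 0 + d \<Longrightarrow> Xm \<omega> s = X 0 \<omega>"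
      by (rule no_jumps_right[of 0]) (simp, blast)
    define e where "e = min d 1"
    have e: "0 < e" "e \<le> d" "e \<le> 1" using d(1) by (auto simp: e_def)
    have kc: "(\<integral>\<^sup>+\<xi>. k x0 \<xi> \<partial>jump_law x0) = ?c"
      using D sets_jump_law[OF x0] by (simp add: k_def)
    have "0 < ?c * ennreal e" using pos e(1) by (simp add: ennreal_zero_less_mult_iff zero_less_iff_neq_zero)
    also have "\<dots> = (\<integral>\<^sup>+t. ?c * indicator {0<..<e} t \<partial>lborel)"
      using e(1) by (subst nn_integral_cmult_indicator) auto
    also have "\<dots> \<le> (\<integral>\<^sup>+t. indicator ?G (\<omega>, t) * indicator {t\<in>{0..}. Xm \<omega> t = x0} t * (\<integral>\<^sup>+\<xi>. k x0 \<xi> \<partial>jump_law x0) \<partial>lborel)"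
    proof (rule nn_integral_mono)
      fix t :: real
      show "?c * indicator {0<..<e} t \<le> indicator ?G (\<omega>, t) * indicator {t\<in>{0..}. Xm \<omega> t = x0} t * (\<integral>\<^sup>+\<xi>. k x0 \<xi> \<partial>jump_law x0)"
        unfolding kc using d(2)[of t] elim e by (cases "0 < t \<and> t < e") auto
    qed
    also have "\<dots> \<le> (\<Sum>x\<in>E. \<integral>\<^sup>+t. indicator ?G (\<omega>, t) * indicator {t\<in>{0..}. Xm \<omega> t = x} t * (\<integral>\<^sup>+\<xi>. k x \<xi> \<partial>jump_law x) \<partial>lborel)"
      using x0 finite_E by (intro member_le_sum) auto
    finally show ?case .
  qed
  moreover have "AE \<omega> in P. (\<Sum>x\<in>E. \<integral>\<^sup>+t. indicator ?G (\<omega>, t) * indicator {t\<in>{0..}. Xm \<omega> t = x} t * (\<integral>\<^sup>+\<xi>. k x \<xi> \<partial>jump_law x) \<partial>lborel) = 0"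
  proof -
    let ?f = "\<lambda>\<omega>. \<Sum>x\<in>E. \<integral>\<^sup>+t. indicator ?G (\<omega>, t) * indicator {t\<in>{0..}. Xm \<omega> t = x} t * (\<integral>\<^sup>+\<xi>. k x \<xi> \<partial>jump_law x) \<partial>lborel"
    \<comment> \<open>Measurability of \<open>?f\<close> comes from the predictability clause at
      time 1: the set \<open>?G\<close> ends there, so integrating over later times adds
      nothing.\<close>
    have "adapted Fi (\<lambda>T \<omega>. \<Sum>x\<in>E. \<integral>\<^sup>+t. indicator ?G (\<omega>, t) * indicator {t\<in>{0..T}. Xm \<omega> t = x} t * (\<integral>\<^sup>+\<xi>. k x \<xi> \<partial>jump_law x) \<partial>lborel)"
      by (rule predictable_imp_adapted[OF predictable_compensator[OF G km]])
    from adapted_measurable[OF this zero_le_one]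
    have "(\<lambda>\<omega>. \<Sum>x\<in>E. \<integral>\<^sup>+t. indicator ?G (\<omega>, t) * indicator {t\<in>{0..1}. Xm \<omega> t = x} t * (\<integral>\<^sup>+\<xi>. k x \<xi> \<partial>jump_law x) \<partial>lborel) \<in> borel_measurable P" .
    also have "(\<lambda>\<omega>. \<Sum>x\<in>E. \<integral>\<^sup>+t. indicator ?G (\<omega>, t) * indicator {t\<in>{0..1}. Xm \<omega> t = x} t * (\<integral>\<^sup>+\<xi>. k x \<xi> \<partial>jump_law x) \<partial>lborel) = ?f"
      by (intro ext sum.cong refl nn_integral_cong) (auto simp: indicator_def)
    finally have fm: "?f \<in> borel_measurable P" .
    show ?thesis by (rule iffD1[OF nn_integral_0_iff_AE[OF fm] zero])
  qed
  ultimately have "AE \<omega> in P. False" by eventually_elim simp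
  then show False by simp
qed

end

section \<open>Jump chains\<close>

context filtered_prob_space begin

text \<open>The dyadic times \<open>\<tau> m\<close> are stopping times with countably many values
  and decrease to \<open>\<sigma>\<close> within \<open>1 / 2^m\<close>. They are strictly larger
  than \<open>\<sigma>\<close>, so right continuity gives the limit. Right continuity holds here at
  every point of the space, so no null set has to belong to the filtration.\<close>

lemma adapted_stop_right_continuous:
  fixes Z :: "real \<Rightarrow> 'w \<Rightarrow> real"
  assumes Z: "adapted Fi Z" and right: "\<And>\<omega> t. \<omega> \<in> space P \<Longrightarrow> 0 \<le> t \<Longrightarrow> ((\<lambda>s. Z s \<omega>) \<longlongrightarrow> Z t \<omega>) (at_right t)"
    and \<sigma>: "stopping_time Fi \<sigma>" "\<And>\<omega>. 0 \<le> \<sigma> \<omega>"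
  shows "adapted Fi (\<lambda>t \<omega>. Z (min t (\<sigma> \<omega>)) \<omega>)"
  unfolding adapted_def
proof (intro allI impI)
  fix t :: real assume t: "0 \<le> t"
  define \<tau> where "\<tau> m \<omega> = (real (nat \<lfloor>2^m * \<sigma> \<omega>\<rfloor>) + 1) / 2^m" for m :: nat and \<omega>
  have \<tau>_alt: "\<tau> m \<omega> = (of_int \<lfloor>2^m * \<sigma> \<omega>\<rfloor> + 1) / 2^m" for m \<omega>
    using \<sigma>(2)[of \<omega>] by (simp add: \<tau>_def)
  have \<tau>0: "0 \<le> \<tau> m \<omega>" for m \<omega> by (simp add: \<tau>_def)
  have \<tau>gt: "\<sigma> \<omega> < \<tau> m \<omega>" "\<tau> m \<omega> \<le> \<sigma> \<omega> + (1/2)^m" for m \<omega>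
  proof -
    have "2^m * \<sigma> \<omega> < of_int \<lfloor>2^m * \<sigma> \<omega>\<rfloor> + 1" "of_int \<lfloor>2^m * \<sigma> \<omega>\<rfloor> + 1 \<le> 2^m * \<sigma> \<omega> + (1::real)" by linarith+
    then show "\<sigma> \<omega> < \<tau> m \<omega>" "\<tau> m \<omega> \<le> \<sigma> \<omega> + (1/2)^m"
      unfolding \<tau>_alt by (simp_all add: field_simps)
  qed
  have \<tau>s: "stopping_time Fi (\<tau> m)" for m
    unfolding stopping_time_def
  proof
    fix u :: real
    show "Measurable.pred (Fi u) (\<lambda>\<omega>. \<tau> m \<omega> \<le> u)"
    proof (cases "0 \<le> u")
      case False
      then have "\<not> \<tau> m \<omega> \<le> u" for \<omega> using \<tau>0[of m \<omega>] by linarith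
      then show ?thesis by simp
    next
      case u: True
      define q where "q = of_int \<lfloor>2^m * u\<rfloor> / (2^m :: real)"
      have q: "q \<le> u" unfolding q_def by (simp add: divide_le_eq mult.commute)
      have less: "\<tau> m \<omega> \<le> u \<longleftrightarrow> \<sigma> \<omega> < q" for \<omega>
      proof -
        have "\<tau> m \<omega> \<le> u \<longleftrightarrow> of_int (\<lfloor>2^m * \<sigma> \<omega>\<rfloor> + 1) \<le> 2^m * u"
          unfolding \<tau>_alt by (simp add: field_simps)
        also have "\<dots> \<longleftrightarrow> \<lfloor>2^m * \<sigma> \<omega>\<rfloor> + 1 \<le> \<lfloor>2^m * u\<rfloor>" by (rule le_floor_iff[symmetric])
        also have "\<dots> \<longleftrightarrow> \<lfloor>2^m * \<sigma> \<omega>\<rfloor> < \<lfloor>2^m * u\<rfloor>" by linarith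
        also have "\<dots> \<longleftrightarrow> 2^m * \<sigma> \<omega> < of_int \<lfloor>2^m * u\<rfloor>" by (rule floor_less_iff)
        finally show ?thesis by (simp add: q_def field_simps)
      qed
      have "(\<lambda>\<omega>. \<sigma> \<omega> < q) = (\<lambda>\<omega>. \<exists>r::rat. \<bar>of_rat r\<bar> < q \<and> \<sigma> \<omega> \<le> \<bar>of_rat r\<bar>)"
      proof (intro ext iffI)
        fix \<omega> assume "\<sigma> \<omega> < q"
        then obtain r where "\<sigma> \<omega> < \<bar>of_rat r\<bar>" "\<bar>of_rat r\<bar> < q"
          by (rule rational_between_nonneg[OF _ \<sigma>(2)])
        then show "\<exists>r::rat. \<bar>of_rat r\<bar> < q \<and> \<sigma> \<omega> \<le> \<bar>of_rat r\<bar>" by (intro exI[of _ r]) simp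
      qed (use order_le_less_trans in blast)
      then have eq: "(\<lambda>\<omega>. \<tau> m \<omega> \<le> u) = (\<lambda>\<omega>. \<exists>r::rat. \<bar>of_rat r\<bar> < q \<and> \<sigma> \<omega> \<le> \<bar>of_rat r\<bar>)"
        unfolding less .
      show ?thesis unfolding eq
      proof (rule pred_intros_countable(2))
        fix r :: rat
        show "Measurable.pred (Fi u) (\<lambda>\<omega>. \<bar>of_rat r\<bar> < q \<and> \<sigma> \<omega> \<le> \<bar>of_rat r\<bar>)"
        proof (cases "\<bar>real_of_rat r\<bar> < q")
          case True
          have "Measurable.pred (Fi \<bar>real_of_rat r\<bar>) (\<lambda>\<omega>. \<sigma> \<omega> \<le> \<bar>of_rat r\<bar>)"
            using \<sigma>(1) unfolding stopping_time_def by blast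
          then have "Measurable.pred (Fi u) (\<lambda>\<omega>. \<sigma> \<omega> \<le> \<bar>of_rat r\<bar>)"
            by (rule measurable_Fi_mono[rotated 2]) (use True q in auto)
          then show ?thesis by (simp only: True simp_thms)
        next
          case False then show ?thesis by (simp only: simp_thms) simp
        qed
      qed
    qed
  qed
  have \<tau>R: "\<tau> m \<omega> \<in> \<rat>" for m \<omega> unfolding \<tau>_def by simp
  show "(\<lambda>\<omega>. Z (min t (\<sigma> \<omega>)) \<omega>) \<in> borel_measurable (Fi t)"
  proof (rule borel_measurable_LIMSEQ_real)
    show "(\<lambda>\<omega>. Z (min t (\<tau> m \<omega>)) \<omega>) \<in> borel_measurable (Fi t)" for m
      using adapted_stop_countable[OF Z \<tau>s[of m] \<tau>0 countable_rat \<tau>R] t unfolding adapted_def by blast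
    fix \<omega> assume "\<omega> \<in> space (Fi t)"
    then have \<omega>: "\<omega> \<in> space P" using space_Fi[OF t] by simp
    show "(\<lambda>m. Z (min t (\<tau> m \<omega>)) \<omega>) \<longlonglongrightarrow> Z (min t (\<sigma> \<omega>)) \<omega>"
    proof (cases "t \<le> \<sigma> \<omega>")
      case True
      then have "min t (\<tau> m \<omega>) = t" for m using \<tau>gt(1)[of \<omega> m] by simp
      then show ?thesis using True by simp
    next
      case False
      have lim0: "(\<lambda>m. \<sigma> \<omega> + (1/2::real)^m) \<longlonglongrightarrow> \<sigma> \<omega> + 0" by (intro tendsto_intros LIMSEQ_power_zero) simp
      have "(\<lambda>m. min t (\<tau> m \<omega>)) \<longlonglongrightarrow> \<sigma> \<omega>"
      proof (rule tendsto_sandwich[OF _ _ tendsto_const])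
        show "eventually (\<lambda>m. \<sigma> \<omega> \<le> min t (\<tau> m \<omega>)) sequentially" using False \<tau>gt(1)[of \<omega>] by (auto simp: less_imp_le)
        show "eventually (\<lambda>m. min t (\<tau> m \<omega>) \<le> \<sigma> \<omega> + (1/2)^m) sequentially" using \<tau>gt(2)[of _ \<omega>] by (auto simp: min_le_iff_disj)
        show "(\<lambda>m. \<sigma> \<omega> + (1/2::real)^m) \<longlonglongrightarrow> \<sigma> \<omega>" using lim0 by simp
      qed
      then have "filterlim (\<lambda>m. min t (\<tau> m \<omega>)) (at_right (\<sigma> \<omega>)) sequentially"
      proof -
        have gt: "\<sigma> \<omega> < min t (\<tau> m \<omega>)" for m using False \<tau>gt(1)[of \<omega> m] by simp
        have "eventually (\<lambda>m. min t (\<tau> m \<omega>) \<in> {\<sigma> \<omega><..} \<and> min t (\<tau> m \<omega>) \<noteq> \<sigma> \<omega>) sequentially"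
          by (intro always_eventually allI conjI less_imp_neq[OF gt, symmetric]) (simp only: greaterThan_iff gt)
        then show ?thesis unfolding filterlim_at using \<open>(\<lambda>m. min t (\<tau> m \<omega>)) \<longlonglongrightarrow> \<sigma> \<omega>\<close> by blast
      qed
      from filterlim_compose[OF right[OF \<omega> \<sigma>(2)] this] show ?thesis using False by simp
    qed
  qed
qed

end

section \<open>Rates, jump sums and occupation times\<close>

locale jump_chain = finite_state_characteristics P Fi X E F
  for P :: "'w measure" and Fi and X :: "real \<Rightarrow> 'w \<Rightarrow> real^'n" and E F +
  assumes support: "x \<in> E \<Longrightarrow> emeasure (jump_law x) (- (\<lambda>y. y - x) ` E) = 0"
begin

definition U :: "(real^'n) set" where "U = (\<lambda>(x, y). y - x) ` (E \<times> E) - {0}"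
definition rate :: "real^'n \<Rightarrow> real^'n \<Rightarrow> real" where "rate u x = F x {u}"
definition occ :: "real^'n \<Rightarrow> real \<Rightarrow> 'w \<Rightarrow> real" where "occ x t \<omega> = measure lborel {v\<in>{0..t}. Xm \<omega> v = x}"
definition J :: "(real^'n \<Rightarrow> real^'n \<Rightarrow> real) \<Rightarrow> real \<Rightarrow> 'w \<Rightarrow> real" where "J k t \<omega> = jump_sum (\<lambda>t. X t \<omega>) k t"
text \<open>The compensator of \<open>J k\<close>: the time integral of the intensity
  \<open>\<Sum>u\<in>U. rate u x * k x u\<close> along the left limits, written with occupation
  times because only finitely many states occur.\<close>

definition A :: "(real^'n \<Rightarrow> real^'n \<Rightarrow> real) \<Rightarrow> real \<Rightarrow> 'w \<Rightarrow> real" where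
  "A k t \<omega> = (\<Sum>x\<in>E. \<Sum>u\<in>U. rate u x * k x u * occ x t \<omega>)"

lemma finite_U: "finite U" using finite_E by (simp add: U_def)

lemma zero_notin_U: "0 \<notin> U" by (simp add: U_def)

lemma rate_measure:
  assumes "x \<in> E" "u \<noteq> 0"
  shows "rate u x = measure (jump_law x) {u}"
proof -
  have "{u} \<in> punctured_bounded" unfolding punctured_bounded_def using assms(2) by (auto intro!: exI[of _ "{u}"])
  then show ?thesis using jump_law(2)[OF assms(1)] by (simp add: rate_def set_function_def fun_eq_iff) (metis)
qed

lemma rate_nonneg: "x \<in> E \<Longrightarrow> u \<noteq> 0 \<Longrightarrow> 0 \<le> rate u x"
  by (simp add: rate_measure)

lemma rate_posD:
  assumes "x \<in> E" "u \<noteq> 0" "0 < rate u x"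
  shows "x + u \<in> E"
proof (rule ccontr)
  assume "x + u \<notin> E"
  then have "u \<notin> (\<lambda>y. y - x) ` E" by (auto simp: algebra_simps)
  then have "{u} \<subseteq> - (\<lambda>y. y - x) ` E" by simp
  moreover have "- (\<lambda>y. y - x) ` E \<in> sets (jump_law x)"
    using sets_jump_law[OF assms(1)] finite_E by (simp add: finite_imp_closed)
  ultimately have "emeasure (jump_law x) {u} \<le> 0" using support[OF assms(1)] emeasure_mono by metis
  then show False using assms rate_measure[OF assms(1,2)] by (simp add: measure_def)
qed

lemma jump_law_integral:
  assumes x: "x \<in> E" and f: "f \<in> borel_measurable borel"
  shows "(\<integral>\<^sup>+\<xi>. f \<xi> \<partial>jump_law x) = (\<Sum>u\<in>U. ennreal (rate u x) * f u)"
proof -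
  have "- insert 0 U \<subseteq> - (\<lambda>y. y - x) ` E" using x by (auto simp: U_def)
  moreover have "- (\<lambda>y. y - x) ` E \<in> sets (jump_law x)"
    using sets_jump_law[OF x] finite_E by (simp add: finite_imp_closed)
  ultimately have "emeasure (jump_law x) (- insert 0 U) \<le> 0" using support[OF x] emeasure_mono by metis
  then have "emeasure (jump_law x) (- insert 0 U) = 0" by simp
  then have "(\<integral>\<^sup>+\<xi>. f \<xi> \<partial>jump_law x) = (\<Sum>u\<in>insert 0 U - {0}. ennreal (measure (jump_law x) {u}) * f u)"
    by (intro finite_support_nn_integral jump_law x f finite.insertI finite_U)
  also have "insert 0 U - {0} = U" using zero_notin_U by blast
  also have "(\<Sum>u\<in>U. ennreal (measure (jump_law x) {u}) * f u) = (\<Sum>u\<in>U. ennreal (rate u x) * f u)"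
    by (rule sum.cong[OF refl], subst rate_measure[OF x]) (use zero_notin_U in auto)
  finally show ?thesis .
qed

text \<open>Apart from 0 the jump law lives on the finite set \<open>U\<close>, so its support
  consists of the atoms. This turns \<open>jump_sizes\<close> into a condition on rates.\<close>

lemma measure_support_jump_law:
  assumes x: "x \<in> E"
  shows "measure_support (jump_law x) - {0} = {u\<in>U. 0 < rate u x}"
proof (intro set_eqI iffI)
  fix v assume v: "v \<in> measure_support (jump_law x) - {0}"
  define V where "V = - (insert 0 (U - {v}))"
  have V: "open V" unfolding V_def using finite_U by (intro open_Compl finite_imp_closed) simp
  have "v \<in> V" using v by (simp add: V_def)
  then have "emeasure (jump_law x) V > 0" using v V unfolding measure_support_def by blast
  moreover have "emeasure (jump_law x) V = (\<Sum>u\<in>U. ennreal (rate u x) * indicator V u)"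
    using jump_law_integral[OF x, of "indicator V"] V sets_jump_law[OF x] by simp
  moreover have "(\<Sum>u\<in>U. ennreal (rate u x) * indicator V u) = (\<Sum>u\<in>U. if u = v then ennreal (rate u x) else 0)"
    by (rule sum.cong) (use v zero_notin_U in \<open>auto simp: V_def indicator_def\<close>)
  ultimately show "v \<in> {u\<in>U. 0 < rate u x}" using finite_U by (auto split: if_splits)
next
  fix v assume v: "v \<in> {u\<in>U. 0 < rate u x}"
  have "emeasure (jump_law x) V > 0" if V: "open V" "v \<in> V" for V
  proof -
    have "0 < ennreal (rate v x) * indicator V v" using v V by simp
    also have "\<dots> \<le> (\<Sum>u\<in>U. ennreal (rate u x) * indicator V u)" using v finite_U by (intro member_le_sum) auto
    also have "\<dots> = emeasure (jump_law x) V"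
      using jump_law_integral[OF x, of "indicator V"] V sets_jump_law[OF x] by simp
    finally show ?thesis .
  qed
  then show "v \<in> measure_support (jump_law x) - {0}" using v zero_notin_U by (auto simp: measure_support_def)
qed

lemma jump_sizes_eq: "jump_sizes E F = {u\<in>U. \<exists>x\<in>E. 0 < rate u x}"
proof -
  have "jump_sizes E F = (\<Union>x\<in>E. measure_support (jump_law x) - {0})" by (auto simp: jump_sizes_def)
  also have "\<dots> = (\<Union>x\<in>E. {u\<in>U. 0 < rate u x})" by (intro SUP_cong refl measure_support_jump_law)
  finally show ?thesis by auto
qed

lemma dX_in_U:
  assumes "\<omega> \<in> space P" "0 < s" "dX \<omega> s \<noteq> 0"
  shows "dX \<omega> s \<in> U" "Xm \<omega> s \<in> E" "X s \<omega> \<in> E"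
proof -
  interpret finite_path "\<lambda>t. X t \<omega>" E by (rule paths[OF assms(1)])
  show "Xm \<omega> s \<in> E" "X s \<omega> \<in> E" using left_lim_range[of s] range[of s] assms by auto
  then show "dX \<omega> s \<in> U" using assms(3) by (force simp: U_def jump_def)
qed

lemma occ_0: "occ x 0 \<omega> = 0"
proof -
  have "{v\<in>{0..0}. Xm \<omega> v = x} \<subseteq> {0}" by auto
  from subset_singletonD[OF this] show ?thesis
    unfolding occ_def measure_def by (elim disjE) (simp_all only: emeasure_empty emeasure_lborel_singleton enn2real_0)
qed

lemma occ_sets: "\<omega> \<in> space P \<Longrightarrow> 0 \<le> s \<Longrightarrow> {v. s \<le> v \<and> v \<le> t \<and> Xm \<omega> v = x} \<in> sets borel"
  "\<omega> \<in> space P \<Longrightarrow> 0 \<le> s \<Longrightarrow> {v. s < v \<and> v \<le> t \<and> Xm \<omega> v = x} \<in> sets borel"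
proof -
  assume \<omega>: "\<omega> \<in> space P" and s: "0 \<le> s"
  have "{v. s \<le> v \<and> v \<le> t \<and> Xm \<omega> v = x} = {t. 0 \<le> t \<and> Xm \<omega> t = x} \<inter> {s..t}" using s by auto
  then show "{v. s \<le> v \<and> v \<le> t \<and> Xm \<omega> v = x} \<in> sets borel" using left_lim_sets[OF \<omega>, of x] by simp
  have "{v. s < v \<and> v \<le> t \<and> Xm \<omega> v = x} = {t. 0 \<le> t \<and> Xm \<omega> t = x} \<inter> {s<..t}" using s by auto
  then show "{v. s < v \<and> v \<le> t \<and> Xm \<omega> v = x} \<in> sets borel" using left_lim_sets[OF \<omega>, of x] by simp
qed

lemma occ_diff:
  assumes \<omega>: "\<omega> \<in> space P" and st: "0 \<le> s" "s \<le> t"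
  shows "occ x t \<omega> - occ x s \<omega> = measure lborel {v. s < v \<and> v \<le> t \<and> Xm \<omega> v = x}"
    "emeasure lborel {v. s < v \<and> v \<le> t \<and> Xm \<omega> v = x} = ennreal (occ x t \<omega> - occ x s \<omega>)"
    "0 \<le> occ x t \<omega> - occ x s \<omega>" "occ x t \<omega> - occ x s \<omega> \<le> t - s"
proof -
  let ?D = "{v. s < v \<and> v \<le> t \<and> Xm \<omega> v = x}" and ?S = "{v. 0 \<le> v \<and> v \<le> s \<and> Xm \<omega> v = x}"
  have fm: "emeasure lborel B < \<infinity>" if "B \<subseteq> {0..t}" "B \<in> sets borel" for B
  proof -
    have "emeasure lborel B \<le> emeasure lborel {0..t}" using that by (intro emeasure_mono) auto
    also have "\<dots> < \<infinity>" by (cases "0 \<le> t") simp_all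
    finally show ?thesis .
  qed
  have sets: "?D \<in> sets borel" "?S \<in> sets borel" using occ_sets[OF \<omega>] st by auto
  have "?D \<subseteq> {0..t}" "?S \<subseteq> {0..t}" using st by auto
  note fin = fm[OF this(1) sets(1)] fm[OF this(2) sets(2)]
  have m: "measure lborel (?D \<union> ?S) = measure lborel ?D + measure lborel ?S"
    by (rule measure_Union) (use sets fin in auto)
  have U: "?D \<union> ?S = {v\<in>{0..t}. Xm \<omega> v = x}" using st by auto
  have S: "?S = {v\<in>{0..s}. Xm \<omega> v = x}" by auto
  have "occ x t \<omega> = measure lborel ?D + occ x s \<omega>" using m unfolding U unfolding S occ_def .
  then show 1: "occ x t \<omega> - occ x s \<omega> = measure lborel ?D" by linarith
  then show 2: "emeasure lborel ?D = ennreal (occ x t \<omega> - occ x s \<omega>)"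
    using fin(1) by (simp add: emeasure_eq_ennreal_measure less_top)
  show "0 \<le> occ x t \<omega> - occ x s \<omega>" unfolding 1 by simp
  have "emeasure lborel ?D \<le> emeasure lborel {s<..t}" using sets by (intro emeasure_mono) auto
  then have "ennreal (occ x t \<omega> - occ x s \<omega>) \<le> ennreal (t - s)" unfolding 2 using st by simp
  then show "occ x t \<omega> - occ x s \<omega> \<le> t - s" using st by (simp add: ennreal_le_iff)
qed

lemma A_0: "A k 0 \<omega> = 0" by (simp add: A_def occ_0)

lemma J_0: "J k 0 \<omega> = 0" by (simp add: J_def jump_sum_0)

lemma A_diff: "A k t \<omega> - A k s \<omega> = (\<Sum>x\<in>E. \<Sum>u\<in>U. rate u x * k x u * (occ x t \<omega> - occ x s \<omega>))"
  by (simp add: A_def sum_subtractf right_diff_distrib)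

lemma J_diff:
  assumes "\<omega> \<in> space P" "0 \<le> s" "s \<le> t"
  shows "J k t \<omega> - J k s \<omega> = (\<Sum>r\<in>jumps \<omega> s t. k (Xm \<omega> r) (dX \<omega> r))"
proof -
  interpret finite_path "\<lambda>t. X t \<omega>" E by (rule paths[OF assms(1)])
  show ?thesis using sum_jump_times_split[of 0 s t "\<lambda>r. k (Xm \<omega> r) (dX \<omega> r)"] assms by (simp add: J_def jump_sum_def)
qed

definition total_rate :: real where "total_rate = (\<Sum>x\<in>E. \<Sum>u\<in>U. rate u x)"
text \<open>A sum in place of a maximum: the crude bound suffices and is defined even when
  \<open>U\<close> is empty.\<close>

definition kmax :: "(real^'n \<Rightarrow> real^'n \<Rightarrow> real) \<Rightarrow> real" where "kmax k = (\<Sum>x\<in>E. \<Sum>u\<in>U. \<bar>k x u\<bar>)"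

lemma kmax: "x \<in> E \<Longrightarrow> u \<in> U \<Longrightarrow> \<bar>k x u\<bar> \<le> kmax k" "0 \<le> kmax k"
proof -
  show "0 \<le> kmax k" unfolding kmax_def by (intro sum_nonneg) simp
  assume "x \<in> E" "u \<in> U"
  then have "\<bar>k x u\<bar> \<le> (\<Sum>u\<in>U. \<bar>k x u\<bar>)" "(\<Sum>u\<in>U. \<bar>k x u\<bar>) \<le> kmax k"
    unfolding kmax_def using finite_E finite_U
    by (intro member_le_sum[of u U "\<lambda>u. \<bar>k x u\<bar>"] member_le_sum[of x E "\<lambda>x. \<Sum>u\<in>U. \<bar>k x u\<bar>"]; auto intro: sum_nonneg)+
  then show "\<bar>k x u\<bar> \<le> kmax k" by simp
qed

lemma total_rate_nonneg: "0 \<le> total_rate"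
  unfolding total_rate_def by (intro sum_nonneg rate_nonneg) (use zero_notin_U in auto)

lemma A_variation:
  assumes "\<omega> \<in> space P" "0 \<le> s" "s \<le> t"
  shows "\<bar>A k t \<omega> - A k s \<omega>\<bar> \<le> kmax k * total_rate * (t - s)"
proof -
  have "\<bar>A k t \<omega> - A k s \<omega>\<bar> \<le> (\<Sum>x\<in>E. \<Sum>u\<in>U. \<bar>rate u x * k x u * (occ x t \<omega> - occ x s \<omega>)\<bar>)"
    unfolding A_diff by (intro order_trans[OF sum_abs] sum_mono sum_abs)
  also have "\<dots> \<le> (\<Sum>x\<in>E. \<Sum>u\<in>U. rate u x * (kmax k * (t - s)))"
  proof (intro sum_mono)
    fix x u assume xu: "x \<in> E" "u \<in> U"
    then have "u \<noteq> 0" using zero_notin_U by auto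
    have "\<bar>k x u\<bar> * \<bar>occ x t \<omega> - occ x s \<omega>\<bar> \<le> kmax k * (t - s)"
      using occ_diff(3,4)[OF assms, of x] kmax(1)[OF xu, of k] kmax(2)[of k] by (intro mult_mono) auto
    then show "\<bar>rate u x * k x u * (occ x t \<omega> - occ x s \<omega>)\<bar> \<le> rate u x * (kmax k * (t - s))"
      unfolding abs_mult using rate_nonneg[OF xu(1) \<open>u \<noteq> 0\<close>] by (simp add: mult.assoc mult_left_mono)
  qed
  also have "\<dots> = kmax k * total_rate * (t - s)"
    by (simp add: total_rate_def sum_distrib_left sum_distrib_right mult_ac)
  finally show ?thesis .
qed

lemma J_variation:
  assumes "\<omega> \<in> space P" "0 \<le> s" "s \<le> t"
  shows "\<bar>J k t \<omega> - J k s \<omega>\<bar> \<le> kmax k * (J (\<lambda>_ _. 1) t \<omega> - J (\<lambda>_ _. 1) s \<omega>)"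
proof -
  have "\<bar>J k t \<omega> - J k s \<omega>\<bar> \<le> (\<Sum>r\<in>jumps \<omega> s t. \<bar>k (Xm \<omega> r) (dX \<omega> r)\<bar>)"
    unfolding J_diff[OF assms] by (rule sum_abs)
  also have "\<dots> \<le> (\<Sum>r\<in>jumps \<omega> s t. kmax k * 1)"
    using dX_in_U[OF assms(1)] assms(2) by (intro sum_mono) (auto simp: jump_times_def intro!: kmax)
  finally show ?thesis unfolding J_diff[OF assms] sum_distrib_left .
qed

text \<open>Sums over a grid of \<open>[0, t]\<close> depend on finitely many values of
  \<open>X\<close> up to time \<open>t\<close>, and \<open>jump_sum_grid\<close> identifies their
  limit.\<close>

lemma J_adapted: "adapted Fi (J k)"
  unfolding adapted_def
proof (intro allI impI)
  fix t :: real assume t: "0 \<le> t"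
  \<comment> \<open>A jump sum sees nonzero jumps only, so the value at 0 may be reset to 0, as
    \<open>jump_sum_grid\<close> demands.\<close>
  define k' where "k' x u = (if u = 0 then 0 else k x u)" for x u
  have Jk': "J k t \<omega> = jump_sum (\<lambda>t. X t \<omega>) k' t" for \<omega>
    unfolding J_def jump_sum_def by (rule sum.cong) (auto simp: k'_def jump_times_def)
  have meas: "(\<lambda>\<omega>. k' (X a \<omega>) (X b \<omega> - X a \<omega>)) \<in> borel_measurable (Fi t)" if ab: "0 \<le> a" "a \<le> t" "0 \<le> b" "b \<le> t" for a b
  proof -
    let ?g = "\<lambda>\<omega>. \<Sum>x\<in>E. \<Sum>y\<in>E. k' x (y - x) * (indicator {\<omega>\<in>space P. X a \<omega> = x} \<omega> * indicator {\<omega>\<in>space P. X b \<omega> = y} \<omega>)"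
    have s: "{\<omega>\<in>space P. X a \<omega> = x} \<in> sets (Fi t)" "{\<omega>\<in>space P. X b \<omega> = x} \<in> sets (Fi t)" for x
      using X_eq_sets[OF ab(1), of x] X_eq_sets[OF ab(3), of x] filtration_mono[OF ab(1,2)] filtration_mono[OF ab(3,4)] by (auto simp only: subset_iff)
    have "?g \<in> borel_measurable (Fi t)"
      by (intro borel_measurable_sum borel_measurable_times borel_measurable_const borel_measurable_indicator s)
    moreover have "k' (X a \<omega>) (X b \<omega> - X a \<omega>) = ?g \<omega>" if \<omega>: "\<omega> \<in> space (Fi t)" for \<omega>
    proof -
      have \<omega>: "\<omega> \<in> space P" using \<omega> space_Fi[OF t] by simp
      interpret finite_path "\<lambda>t. X t \<omega>" E by (rule paths[OF \<omega>])
      have "?g \<omega> = (\<Sum>x\<in>E. \<Sum>y\<in>E. if x = X a \<omega> then (if y = X b \<omega> then k' x (y - x) else 0) else 0)"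
        by (intro sum.cong refl) (use \<omega> in \<open>auto simp: indicator_def\<close>)
      also have "\<dots> = (\<Sum>x\<in>E. if x = X a \<omega> then (\<Sum>y\<in>E. if y = X b \<omega> then k' x (y - x) else 0) else 0)"
        by (intro sum.cong refl) auto
      finally show ?thesis using range[OF ab(1)] range[OF ab(3)] finite_E by simp
    qed
    ultimately show ?thesis by (subst measurable_cong) auto
  qed
  show "J k t \<in> borel_measurable (Fi t)"
    unfolding Jk'
  proof (rule borel_measurable_LIMSEQ_real)
    fix \<omega> assume \<omega>: "\<omega> \<in> space (Fi t)"
    have \<omega>: "\<omega> \<in> space P" using \<omega> space_Fi[OF t] by simp
    interpret finite_path "\<lambda>t. X t \<omega>" E by (rule paths[OF \<omega>])
    show "(\<lambda>m. \<Sum>j<m. k' (X (t * real j / real m) \<omega>) (X (t * real (Suc j) / real m) \<omega> - X (t * real j / real m) \<omega>)) \<longlonglongrightarrow> jump_sum (\<lambda>t. X t \<omega>) k' t"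
      by (rule jump_sum_grid[OF t]) (simp add: k'_def)
  next
    fix m
    show "(\<lambda>\<omega>. \<Sum>j<m. k' (X (t * real j / real m) \<omega>) (X (t * real (Suc j) / real m) \<omega> - X (t * real j / real m) \<omega>)) \<in> borel_measurable (Fi t)"
    proof (intro borel_measurable_sum meas)
      fix j assume "j \<in> {..<m}"
      then have j: "j < m" by simp
      show "0 \<le> t * real j / real m" "0 \<le> t * real (Suc j) / real m" using t by simp_all
      have "t * (real j / real m) \<le> t * 1" "t * (real (Suc j) / real m) \<le> t * 1"
        by (rule mult_left_mono, use j in simp, use t in simp)+
      then show "t * real j / real m \<le> t" "t * real (Suc j) / real m \<le> t"
        by (simp_all only: times_divide_eq_right mult_1_right)
    qed
  qed
qed

text \<open>The predictability clause of the compensator, applied to the integrand that selects the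
  jump \<open>u\<close> out of the state \<open>x\<close>, yields the occupation time multiplied by
  the rate. In \<open>A\<close> it occurs only in this product.\<close>

lemma rate_occ_predictable:
  assumes x: "x \<in> E" and u: "u \<in> U"
  shows "predictable P Fi (\<lambda>t \<omega>. rate u x * occ x t \<omega>)"
proof -
  have u0: "u \<noteq> 0" using u zero_notin_U by auto
  define k :: "real^'n \<Rightarrow> real^'n \<Rightarrow> ennreal" where "k y \<xi> = (if y = x then indicator {u} \<xi> else 0)" for y \<xi>
  have km: "k y \<in> borel_measurable borel" for y unfolding k_def by (cases "y = x") simp_all
  have kint: "(\<integral>\<^sup>+\<xi>. k y \<xi> \<partial>jump_law y) = (if y = x then ennreal (rate u x) else 0)" if "y \<in> E" for y
  proof (cases "y = x")
    case True
    have "(\<Sum>v\<in>U. ennreal (rate v x) * indicator {u} v) = (\<Sum>v\<in>U. if v = u then ennreal (rate v x) else 0)"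
      by (rule sum.cong) (auto simp: indicator_def)
    then show ?thesis using jump_law_integral[OF x, of "k x"] km u finite_U True by (simp add: k_def)
  qed (simp add: k_def)
  let ?G = "space (predictable_sigma P Fi)"
  have "predictable P Fi (\<lambda>T \<omega>. \<Sum>y\<in>E. \<integral>\<^sup>+t. indicator ?G (\<omega>, t) * indicator {t\<in>{0..T}. Xm \<omega> t = y} t * (\<integral>\<^sup>+\<xi>. k y \<xi> \<partial>jump_law y) \<partial>lborel)"
    by (rule predictable_compensator[OF sets.top km])
  then have "(\<lambda>z. enn2real ((\<lambda>(\<omega>, T). \<Sum>y\<in>E. \<integral>\<^sup>+t. indicator ?G (\<omega>, t) * indicator {t\<in>{0..T}. Xm \<omega> t = y} t * (\<integral>\<^sup>+\<xi>. k y \<xi> \<partial>jump_law y) \<partial>lborel) z)) \<in> borel_measurable (predictable_sigma P Fi)"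
    unfolding predictable_def by (rule borel_measurable_enn2real)
  then show ?thesis
    unfolding predictable_def
  proof (rule iffD1[OF measurable_cong, rotated])
    fix z assume z: "z \<in> ?G"
    obtain \<omega> T where z': "z = (\<omega>, T)" by (cases z)
    have \<omega>: "\<omega> \<in> space P" "0 \<le> T" using z z' by (auto simp: space_predictable)
    have S: "{t\<in>{0..T}. Xm \<omega> t = y} \<in> sets borel" for y using occ_sets(1)[OF \<omega>(1) order_refl, of T y] by simp
    have em: "emeasure lborel {t\<in>{0..T}. Xm \<omega> t = x} = ennreal (occ x T \<omega>)"
    proof -
      have "emeasure lborel {t\<in>{0..T}. Xm \<omega> t = x} \<le> emeasure lborel {0..T}" using S by (intro emeasure_mono) auto
      also have "\<dots> < \<infinity>" using \<omega> by simp
      finally show ?thesis unfolding occ_def by (intro emeasure_eq_ennreal_measure) simp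
    qed
    have "(\<Sum>y\<in>E. \<integral>\<^sup>+t. indicator ?G (\<omega>, t) * indicator {t\<in>{0..T}. Xm \<omega> t = y} t * (\<integral>\<^sup>+\<xi>. k y \<xi> \<partial>jump_law y) \<partial>lborel) =
      (\<Sum>y\<in>E. if y = x then ennreal (rate u x) * emeasure lborel {t\<in>{0..T}. Xm \<omega> t = x} else 0)"
    proof (rule sum.cong[OF refl])
      fix y assume y: "y \<in> E"
      have "(\<integral>\<^sup>+t. indicator ?G (\<omega>, t) * indicator {t\<in>{0..T}. Xm \<omega> t = y} t * (\<integral>\<^sup>+\<xi>. k y \<xi> \<partial>jump_law y) \<partial>lborel) =
        (\<integral>\<^sup>+t. (if y = x then ennreal (rate u x) else 0) * indicator {t\<in>{0..T}. Xm \<omega> t = y} t \<partial>lborel)"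
        unfolding kint[OF y] by (rule nn_integral_cong) (use \<omega> in \<open>auto simp: space_predictable indicator_def\<close>)
      then show "(\<integral>\<^sup>+t. indicator ?G (\<omega>, t) * indicator {t\<in>{0..T}. Xm \<omega> t = y} t * (\<integral>\<^sup>+\<xi>. k y \<xi> \<partial>jump_law y) \<partial>lborel) =
        (if y = x then ennreal (rate u x) * emeasure lborel {t\<in>{0..T}. Xm \<omega> t = x} else 0)"
        using S[of y] by (simp add: nn_integral_cmult_indicator)
    qed
    also have "\<dots> = ennreal (rate u x) * emeasure lborel {t\<in>{0..T}. Xm \<omega> t = x}"
      using x finite_E by simp
    also have "\<dots> = ennreal (rate u x * occ x T \<omega>)"
      unfolding em using rate_nonneg[OF x u0] by (simp add: ennreal_mult occ_def)
    finally show "enn2real ((\<lambda>(\<omega>, T). \<Sum>y\<in>E. \<integral>\<^sup>+t. indicator ?G (\<omega>, t) * indicator {t\<in>{0..T}. Xm \<omega> t = y} t * (\<integral>\<^sup>+\<xi>. k y \<xi> \<partial>jump_law y) \<partial>lborel) z) =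
      (\<lambda>(\<omega>, t). rate u x * occ x t \<omega>) z"
      using rate_nonneg[OF x u0] by (simp add: z' occ_def)
  qed
qed

lemma A_predictable: "predictable P Fi (A k)"
proof -
  have "(\<lambda>z. \<Sum>x\<in>E. \<Sum>u\<in>U. k x u * (\<lambda>(\<omega>, t). rate u x * occ x t \<omega>) z) \<in> borel_measurable (predictable_sigma P Fi)"
    using rate_occ_predictable unfolding predictable_def
    by (intro borel_measurable_sum borel_measurable_times borel_measurable_const) blast
  moreover have "(\<lambda>z. \<Sum>x\<in>E. \<Sum>u\<in>U. k x u * (\<lambda>(\<omega>, t). rate u x * occ x t \<omega>) z) = (\<lambda>(\<omega>, t). A k t \<omega>)"
    by (auto simp: A_def fun_eq_iff mult_ac)
  ultimately show ?thesis by (simp add: predictable_def)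
qed

lemma A_adapted: "adapted Fi (A k)"
  by (rule predictable_imp_adapted[OF A_predictable])

end

section \<open>Compensated jump sums as martingales\<close>

context jump_chain begin

lemma J_right: "\<omega> \<in> space P \<Longrightarrow> 0 \<le> t \<Longrightarrow> ((\<lambda>s. J k s \<omega>) \<longlongrightarrow> J k t \<omega>) (at_right t)"
proof -
  assume \<omega>: "\<omega> \<in> space P" and t: "0 \<le> t"
  interpret finite_path "\<lambda>t. X t \<omega>" E by (rule paths[OF \<omega>])
  show ?thesis unfolding J_def by (rule jump_sum_right[OF t])
qed

lemma A_continuous: "\<omega> \<in> space P \<Longrightarrow> continuous_on {0..} (\<lambda>t. A k t \<omega>)"
proof -
  assume \<omega>: "\<omega> \<in> space P"
  define c where "c = kmax k * total_rate + 1"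
  have c: "0 < c" using kmax(2)[of k] total_rate_nonneg by (simp add: c_def add_nonneg_pos)
  have lip: "\<bar>A k t \<omega> - A k s \<omega>\<bar> \<le> c * (t - s)" if "0 \<le> s" "s \<le> t" for s t
  proof -
    have "kmax k * total_rate * (t - s) \<le> c * (t - s)" using that by (intro mult_right_mono) (auto simp: c_def)
    then show ?thesis using A_variation[OF \<omega> that, of k] by linarith
  qed
  have lip2: "dist (A k t \<omega>) (A k s \<omega>) \<le> c * dist t s" if "s \<in> {0..}" "t \<in> {0..}" for s t
  proof (cases "s \<le> t")
    case True then show ?thesis using lip[of s t] that by (simp add: dist_real_def)
  next
    case False then show ?thesis using lip[of t s] that by (simp add: dist_real_def abs_minus_commute)
  qed
  show ?thesis
    unfolding continuous_on_iff
  proof (intro ballI allI impI)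
    fix x e :: real assume x: "x \<in> {0..}" and e: "0 < e"
    show "\<exists>d>0. \<forall>x'\<in>{0..}. dist x' x < d \<longrightarrow> dist (A k x' \<omega>) (A k x \<omega>) < e"
    proof (intro exI[of _ "e / c"] conjI ballI impI)
      fix x' assume x': "x' \<in> {0..}" "dist x' x < e / c"
      have "c * dist x' x < c * (e / c)" using x'(2) c by (intro mult_strict_left_mono)
      then show "dist (A k x' \<omega>) (A k x \<omega>) < e" using lip2[OF x x'(1)] c by simp
    qed (use e c in simp)
  qed
qed

lemma A_right: "\<omega> \<in> space P \<Longrightarrow> 0 \<le> t \<Longrightarrow> ((\<lambda>s. A k s \<omega>) \<longlongrightarrow> A k t \<omega>) (at_right t)"
  using cadlag_continuous[OF A_continuous, of \<omega> k] by (simp add: cadlag_def)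

lemma cadlag_compensated: "\<omega> \<in> space P \<Longrightarrow> cadlag (\<lambda>t. J k t \<omega> - A k t \<omega>)"
proof -
  assume \<omega>: "\<omega> \<in> space P"
  interpret finite_path "\<lambda>t. X t \<omega>" E by (rule paths[OF \<omega>])
  have cJ: "cadlag (\<lambda>t. J k t \<omega>)" unfolding J_def by (rule cadlag_jump_sum)
  have cA: "cadlag (\<lambda>t. A k t \<omega>)" by (rule cadlag_continuous[OF A_continuous[OF \<omega>]])
  show ?thesis
    unfolding cadlag_def
  proof safe
    fix t :: real assume "0 \<le> t"
    then show "((\<lambda>t. J k t \<omega> - A k t \<omega>) \<longlongrightarrow> J k t \<omega> - A k t \<omega>) (at_right t)"
      using cJ cA by (intro tendsto_diff) (simp_all add: cadlag_def)
  next
    fix t :: real assume "0 < t"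
    then obtain l l' where "((\<lambda>t. J k t \<omega>) \<longlongrightarrow> l) (at_left t)" "((\<lambda>t. A k t \<omega>) \<longlongrightarrow> l') (at_left t)"
      using cJ cA unfolding cadlag_def by blast
    from tendsto_diff[OF this] show "\<exists>l. ((\<lambda>t. J k t \<omega> - A k t \<omega>) \<longlongrightarrow> l) (at_left t)" by blast
  qed
qed

text \<open>The predictable set \<open>G\<close> consists of \<open>B\<close> times the interval
  from \<open>s\<close> to \<open>t\<close>, cut off at \<open>\<sigma>\<close>. On one side of
  \<open>jump_formula\<close> it collects the jumps between the stopped times, on the other the
  occupation times of the same interval.\<close>

lemma jump_compensation_nn:
  assumes B: "B \<in> sets (Fi s)" and st: "0 \<le> s" "s \<le> t"
    and \<sigma>: "stopping_time Fi \<sigma>" "\<And>\<omega>. 0 \<le> \<sigma> \<omega>" and k: "\<And>x u. 0 \<le> k x u"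
  shows "(\<integral>\<^sup>+\<omega>. indicator B \<omega> * ennreal (J k (min t (\<sigma> \<omega>)) \<omega> - J k (min s (\<sigma> \<omega>)) \<omega>) \<partial>P) =
    (\<integral>\<^sup>+\<omega>. indicator B \<omega> * ennreal (A k (min t (\<sigma> \<omega>)) \<omega> - A k (min s (\<sigma> \<omega>)) \<omega>) \<partial>P)"
proof -
  define G where "G = B \<times> {s<..t} \<inter> {(\<omega>, v). \<omega> \<in> space P \<and> 0 \<le> v \<and> v \<le> \<sigma> \<omega>}"
  have G: "G \<in> sets (predictable_sigma P Fi)"
    unfolding G_def by (intro sets.Int predictable_rect B st predictable_stochastic_interval \<sigma>)
  \<comment> \<open>Extends the values of \<open>k x\<close> on the finite set \<open>U\<close> by
    0, which makes the function measurable for arbitrary \<open>k\<close>.\<close>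
  define kk :: "real^'n \<Rightarrow> real^'n \<Rightarrow> ennreal" where "kk x \<xi> = (\<Sum>u\<in>U. ennreal (k x u) * indicator {u} \<xi>)" for x \<xi>
  have km: "kk x \<in> borel_measurable borel" for x
    unfolding kk_def by (intro borel_measurable_sum borel_measurable_times_ennreal) auto
  have kk: "kk x u = ennreal (k x u)" if "u \<in> U" for x u
  proof -
    have "kk x u = (\<Sum>v\<in>U. if v = u then ennreal (k x v) else 0)"
      unfolding kk_def by (rule sum.cong) (auto simp: indicator_def)
    then show ?thesis using that finite_U by simp
  qed
  have G_iff: "(\<omega>, r) \<in> G \<longleftrightarrow> \<omega> \<in> B \<and> min s (\<sigma> \<omega>) < r \<and> r \<le> min t (\<sigma> \<omega>)" if "\<omega> \<in> space P" for \<omega> r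
    using that st \<sigma>(2)[of \<omega>] by (auto simp: G_def min_def split: if_splits)
  have "(\<integral>\<^sup>+\<omega>. indicator B \<omega> * ennreal (J k (min t (\<sigma> \<omega>)) \<omega> - J k (min s (\<sigma> \<omega>)) \<omega>) \<partial>P) =
    (\<integral>\<^sup>+\<omega>. \<integral>\<^sup>+r. indicator G (\<omega>, r) * kk (Xm \<omega> r) (dX \<omega> r) \<partial>count_space {r. 0 < r \<and> dX \<omega> r \<noteq> 0} \<partial>P)"
  proof (rule nn_integral_cong)
    fix \<omega> assume \<omega>: "\<omega> \<in> space P"
    interpret finite_path "\<lambda>t. X t \<omega>" E by (rule paths[OF \<omega>])
    let ?a = "min s (\<sigma> \<omega>)" and ?b = "min t (\<sigma> \<omega>)"
    have ab: "0 \<le> ?a" "?a \<le> ?b" using st \<sigma>(2)[of \<omega>] by auto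
    have "(\<integral>\<^sup>+r. indicator G (\<omega>, r) * kk (Xm \<omega> r) (dX \<omega> r) \<partial>count_space {r. 0 < r \<and> dX \<omega> r \<noteq> 0}) =
      (\<Sum>r\<in>jumps \<omega> ?a ?b. indicator G (\<omega>, r) * kk (Xm \<omega> r) (dX \<omega> r))"
    proof (rule nn_integral_count_space')
      show "finite (jumps \<omega> ?a ?b)" by (rule finite_jump_times[OF ab(1)])
      show "jumps \<omega> ?a ?b \<subseteq> {r. 0 < r \<and> dX \<omega> r \<noteq> 0}" using ab(1) by (auto simp: jump_times_def)
      fix r assume "r \<in> {r. 0 < r \<and> dX \<omega> r \<noteq> 0}" "r \<notin> jumps \<omega> ?a ?b"
      then have "(\<omega>, r) \<notin> G" unfolding G_iff[OF \<omega>] by (simp add: jump_times_def)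
      then show "indicator G (\<omega>, r) * kk (Xm \<omega> r) (dX \<omega> r) = 0" by simp
    qed
    also have "\<dots> = (\<Sum>r\<in>jumps \<omega> ?a ?b. indicator B \<omega> * ennreal (k (Xm \<omega> r) (dX \<omega> r)))"
    proof (rule sum.cong[OF refl])
      fix r assume r: "r \<in> jumps \<omega> ?a ?b"
      then have r': "?a < r" "r \<le> ?b" "dX \<omega> r \<noteq> 0" "0 < r" using ab(1) by (auto simp: jump_times_def)
      have "dX \<omega> r \<in> U" using dX_in_U(1)[OF \<omega> r'(4,3)] .
      moreover have "(indicator G (\<omega>, r) :: ennreal) = indicator B \<omega>"
      proof -
        have "(\<omega>, r) \<in> G \<longleftrightarrow> \<omega> \<in> B" using G_iff[OF \<omega>, of r] r'(1,2) by blast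
        then show ?thesis unfolding indicator_def by (simp only:)
      qed
      ultimately show "indicator G (\<omega>, r) * kk (Xm \<omega> r) (dX \<omega> r) = indicator B \<omega> * ennreal (k (Xm \<omega> r) (dX \<omega> r))"
        by (simp add: kk)
    qed
    also have "\<dots> = indicator B \<omega> * ennreal (J k ?b \<omega> - J k ?a \<omega>)"
      unfolding J_diff[OF \<omega> ab] sum_distrib_left[symmetric] by (simp add: k sum_ennreal)
    finally show "indicator B \<omega> * ennreal (J k ?b \<omega> - J k ?a \<omega>) =
      (\<integral>\<^sup>+r. indicator G (\<omega>, r) * kk (Xm \<omega> r) (dX \<omega> r) \<partial>count_space {r. 0 < r \<and> dX \<omega> r \<noteq> 0})" by simp
  qed
  also have "\<dots> = (\<integral>\<^sup>+\<omega>. (\<Sum>x\<in>E. \<integral>\<^sup>+t. indicator G (\<omega>, t) * indicator {t\<in>{0..}. Xm \<omega> t = x} t * (\<integral>\<^sup>+\<xi>. kk x \<xi> \<partial>jump_law x) \<partial>lborel) \<partial>P)"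
    by (rule jump_formula[OF G km])
  also have "\<dots> = (\<integral>\<^sup>+\<omega>. indicator B \<omega> * ennreal (A k (min t (\<sigma> \<omega>)) \<omega> - A k (min s (\<sigma> \<omega>)) \<omega>) \<partial>P)"
  proof (rule nn_integral_cong)
    fix \<omega> assume \<omega>: "\<omega> \<in> space P"
    let ?a = "min s (\<sigma> \<omega>)" and ?b = "min t (\<sigma> \<omega>)"
    have ab: "0 \<le> ?a" "?a \<le> ?b" using st \<sigma>(2)[of \<omega>] by auto
    have "(\<Sum>x\<in>E. \<integral>\<^sup>+t. indicator G (\<omega>, t) * indicator {t\<in>{0..}. Xm \<omega> t = x} t * (\<integral>\<^sup>+\<xi>. kk x \<xi> \<partial>jump_law x) \<partial>lborel)
      = (\<Sum>x\<in>E. indicator B \<omega> * ennreal (\<Sum>u\<in>U. rate u x * k x u * (occ x ?b \<omega> - occ x ?a \<omega>)))"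
    proof (rule sum.cong[OF refl])
      fix x assume x: "x \<in> E"
      have r0: "0 \<le> rate u x" if "u \<in> U" for u using rate_nonneg[OF x] that zero_notin_U by metis
      have "(\<integral>\<^sup>+\<xi>. kk x \<xi> \<partial>jump_law x) = (\<Sum>u\<in>U. ennreal (rate u x * k x u))"
        unfolding jump_law_integral[OF x km] by (intro sum.cong refl) (simp add: kk ennreal_mult r0 k)
      also have "\<dots> = ennreal (\<Sum>u\<in>U. rate u x * k x u)" by (rule sum_ennreal) (simp add: r0 k)
      finally have kint: "(\<integral>\<^sup>+\<xi>. kk x \<xi> \<partial>jump_law x) = ennreal (\<Sum>u\<in>U. rate u x * k x u)" .
      have "(\<integral>\<^sup>+t. indicator G (\<omega>, t) * indicator {t\<in>{0..}. Xm \<omega> t = x} t * (\<integral>\<^sup>+\<xi>. kk x \<xi> \<partial>jump_law x) \<partial>lborel) =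
        (\<integral>\<^sup>+t. (indicator B \<omega> * ennreal (\<Sum>u\<in>U. rate u x * k x u)) * indicator {v. ?a < v \<and> v \<le> ?b \<and> Xm \<omega> v = x} t \<partial>lborel)"
        unfolding kint by (rule nn_integral_cong) (use ab in \<open>auto simp: indicator_def G_iff[OF \<omega>]\<close>)
      also have "\<dots> = (indicator B \<omega> * ennreal (\<Sum>u\<in>U. rate u x * k x u)) * ennreal (occ x ?b \<omega> - occ x ?a \<omega>)"
        unfolding occ_diff(2)[OF \<omega> ab, symmetric]
        by (rule nn_integral_cmult_indicator, unfold sets_lborel, rule occ_sets(2)[OF \<omega> ab(1)])
      also have "\<dots> = indicator B \<omega> * ennreal ((\<Sum>u\<in>U. rate u x * k x u) * (occ x ?b \<omega> - occ x ?a \<omega>))"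
        using occ_diff(3)[OF \<omega> ab, of x] r0 k by (simp add: ennreal_mult mult.assoc sum_nonneg)
      finally show "(\<integral>\<^sup>+t. indicator G (\<omega>, t) * indicator {t\<in>{0..}. Xm \<omega> t = x} t * (\<integral>\<^sup>+\<xi>. kk x \<xi> \<partial>jump_law x) \<partial>lborel) =
        indicator B \<omega> * ennreal (\<Sum>u\<in>U. rate u x * k x u * (occ x ?b \<omega> - occ x ?a \<omega>))"
        by (simp add: sum_distrib_right)
    qed
    also have "\<dots> = indicator B \<omega> * ennreal (A k ?b \<omega> - A k ?a \<omega>)"
      unfolding A_diff sum_distrib_left[symmetric]
    proof (subst sum_ennreal)
      fix x assume x: "x \<in> E"
      have r0: "0 \<le> rate u x" if "u \<in> U" for u using rate_nonneg[OF x] that zero_notin_U by metis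
      show "0 \<le> (\<Sum>u\<in>U. rate u x * k x u * (occ x ?b \<omega> - occ x ?a \<omega>))"
        by (intro sum_nonneg mult_nonneg_nonneg r0 k occ_diff(3)[OF \<omega> ab])
    qed simp
    finally show "(\<Sum>x\<in>E. \<integral>\<^sup>+t. indicator G (\<omega>, t) * indicator {t\<in>{0..}. Xm \<omega> t = x} t * (\<integral>\<^sup>+\<xi>. kk x \<xi> \<partial>jump_law x) \<partial>lborel) =
      indicator B \<omega> * ennreal (A k ?b \<omega> - A k ?a \<omega>)" .
  qed
  finally show ?thesis .
qed

lemma stopping_time_const: "stopping_time Fi (\<lambda>_. c)"
  unfolding stopping_time_def by simp

lemma count_nonneg: "\<omega> \<in> space P \<Longrightarrow> 0 \<le> s \<Longrightarrow> s \<le> t \<Longrightarrow> J (\<lambda>_ _. 1) s \<omega> \<le> J (\<lambda>_ _. 1) t \<omega>"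
  using J_diff[of \<omega> s t "\<lambda>_ _. 1"] by simp

text \<open>The expected number of jumps equals the expectation of its compensator, which grows at
  most linearly in \<open>t\<close>.\<close>

lemma integrable_count:
  assumes t: "0 \<le> t"
  shows "integrable P (J (\<lambda>_ _. 1) t)"
proof (rule integrableI_nonneg)
  show "J (\<lambda>_ _. 1) t \<in> borel_measurable P" by (rule adapted_measurable[OF J_adapted t])
  show "AE \<omega> in P. 0 \<le> J (\<lambda>_ _. 1) t \<omega>" using AE_space count_nonneg[OF _ order_refl t] J_0 by fastforce
  have "(\<integral>\<^sup>+\<omega>. ennreal (J (\<lambda>_ _. 1) t \<omega>) \<partial>P) =
    (\<integral>\<^sup>+\<omega>. indicator (space P) \<omega> * ennreal (J (\<lambda>_ _. 1) (min t t) \<omega> - J (\<lambda>_ _. 1) (min 0 t) \<omega>) \<partial>P)"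
    using t by (intro nn_integral_cong) (simp add: J_0 min_absorb1)
  also have "\<dots> = (\<integral>\<^sup>+\<omega>. indicator (space P) \<omega> * ennreal (A (\<lambda>_ _. 1) (min t t) \<omega> - A (\<lambda>_ _. 1) (min 0 t) \<omega>) \<partial>P)"
    by (rule jump_compensation_nn[OF _ order_refl t stopping_time_const t]) (use sets.top[of "Fi 0"] space_Fi[of 0] in simp_all)
  also have "\<dots> \<le> (\<integral>\<^sup>+\<omega>. ennreal (kmax (\<lambda>_ _. 1) * total_rate * t) \<partial>P)"
  proof (rule nn_integral_mono)
    fix \<omega> assume \<omega>: "\<omega> \<in> space P"
    have "A (\<lambda>_ _. 1) t \<omega> \<le> kmax (\<lambda>_ _. 1) * total_rate * t"
      using A_variation[OF \<omega> order_refl t, of "\<lambda>_ _. 1"] by (simp add: A_0)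
    then show "indicator (space P) \<omega> * ennreal (A (\<lambda>_ _. 1) (min t t) \<omega> - A (\<lambda>_ _. 1) (min 0 t) \<omega>) \<le> ennreal (kmax (\<lambda>_ _. 1) * total_rate * t)"
      using \<omega> t by (simp add: A_0 min_absorb1 ennreal_leI)
  qed
  also have "\<dots> < \<infinity>" by (simp add: emeasure_space_1)
  finally show "(\<integral>\<^sup>+\<omega>. ennreal (J (\<lambda>_ _. 1) t \<omega>) \<partial>P) < \<infinity>" .
qed

context
  fixes \<sigma> assumes \<sigma>: "stopping_time Fi \<sigma>" "\<And>\<omega>. 0 \<le> \<sigma> \<omega>"
begin

lemma stopped_adapted: "adapted Fi (\<lambda>t \<omega>. J k (min t (\<sigma> \<omega>)) \<omega>)" "adapted Fi (\<lambda>t \<omega>. A k (min t (\<sigma> \<omega>)) \<omega>)"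
  by (intro adapted_stop_right_continuous J_adapted J_right A_adapted A_right \<sigma>; assumption)+

lemma stopped_integrable:
  assumes t: "0 \<le> t"
  shows "integrable P (\<lambda>\<omega>. J k (min t (\<sigma> \<omega>)) \<omega>)" "integrable P (\<lambda>\<omega>. A k (min t (\<sigma> \<omega>)) \<omega>)"
proof -
  have m: "0 \<le> min t (\<sigma> \<omega>)" "min t (\<sigma> \<omega>) \<le> t" for \<omega> using t \<sigma>(2)[of \<omega>] by auto
  show "integrable P (\<lambda>\<omega>. J k (min t (\<sigma> \<omega>)) \<omega>)"
  proof (rule Bochner_Integration.integrable_bound)
    show "integrable P (\<lambda>\<omega>. kmax k * J (\<lambda>_ _. 1) t \<omega>)" using integrable_count[OF t] by simp
    show "(\<lambda>\<omega>. J k (min t (\<sigma> \<omega>)) \<omega>) \<in> borel_measurable P" by (rule adapted_measurable[OF stopped_adapted(1) t])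
    show "AE \<omega> in P. norm (J k (min t (\<sigma> \<omega>)) \<omega>) \<le> norm (kmax k * J (\<lambda>_ _. 1) t \<omega>)"
    proof (rule AE_I2)
      fix \<omega> assume \<omega>: "\<omega> \<in> space P"
      have "\<bar>J k (min t (\<sigma> \<omega>)) \<omega>\<bar> \<le> kmax k * J (\<lambda>_ _. 1) (min t (\<sigma> \<omega>)) \<omega>"
        using J_variation[OF \<omega> order_refl m(1), of k] by (simp add: J_0)
      also have "\<dots> \<le> kmax k * J (\<lambda>_ _. 1) t \<omega>" by (intro mult_left_mono kmax count_nonneg \<omega> m)
      finally show "norm (J k (min t (\<sigma> \<omega>)) \<omega>) \<le> norm (kmax k * J (\<lambda>_ _. 1) t \<omega>)" by simp
    qed
  qed
  show "integrable P (\<lambda>\<omega>. A k (min t (\<sigma> \<omega>)) \<omega>)"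
  proof (rule Bochner_Integration.integrable_bound)
    show "integrable P (\<lambda>\<omega>. kmax k * total_rate * t)" by simp
    show "(\<lambda>\<omega>. A k (min t (\<sigma> \<omega>)) \<omega>) \<in> borel_measurable P" by (rule adapted_measurable[OF stopped_adapted(2) t])
    show "AE \<omega> in P. norm (A k (min t (\<sigma> \<omega>)) \<omega>) \<le> norm (kmax k * total_rate * t)"
    proof (rule AE_I2)
      fix \<omega> assume \<omega>: "\<omega> \<in> space P"
      have "\<bar>A k (min t (\<sigma> \<omega>)) \<omega>\<bar> \<le> kmax k * total_rate * min t (\<sigma> \<omega>)"
        using A_variation[OF \<omega> order_refl m(1), of k] by (simp add: A_0)
      also have "\<dots> \<le> kmax k * total_rate * t" by (intro mult_left_mono mult_nonneg_nonneg kmax total_rate_nonneg m)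
      finally show "norm (A k (min t (\<sigma> \<omega>)) \<omega>) \<le> norm (kmax k * total_rate * t)" by simp
    qed
  qed
qed

text \<open>The compensator identity is one between integrals of nonnegative functions, so
  \<open>k\<close> is split into its positive and negative parts; integrability of the stopped
  processes allows the difference.\<close>

lemma jump_compensation:
  assumes B: "B \<in> sets (Fi s)" and st: "0 \<le> s" "s \<le> t"
  shows "(\<integral>\<omega>. indicator B \<omega> * (J k (min t (\<sigma> \<omega>)) \<omega> - J k (min s (\<sigma> \<omega>)) \<omega>) \<partial>P) =
    (\<integral>\<omega>. indicator B \<omega> * (A k (min t (\<sigma> \<omega>)) \<omega> - A k (min s (\<sigma> \<omega>)) \<omega>) \<partial>P)"
proof -
  have t: "0 \<le> t" using st by simp
  have BP: "B \<in> sets P" by (rule sets_Fi[OF st(1) B])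
  have intJ: "integrable P (\<lambda>\<omega>. indicator B \<omega> * (J k (min t (\<sigma> \<omega>)) \<omega> - J k (min s (\<sigma> \<omega>)) \<omega>))" for k
    using integrable_mult_indicator[OF BP Bochner_Integration.integrable_diff[OF stopped_integrable(1)[OF t] stopped_integrable(1)[OF st(1)]]] by simp
  have intA: "integrable P (\<lambda>\<omega>. indicator B \<omega> * (A k (min t (\<sigma> \<omega>)) \<omega> - A k (min s (\<sigma> \<omega>)) \<omega>))" for k
    using integrable_mult_indicator[OF BP Bochner_Integration.integrable_diff[OF stopped_integrable(2)[OF t] stopped_integrable(2)[OF st(1)]]] by simp
  have pos: "(\<integral>\<omega>. indicator B \<omega> * (J k (min t (\<sigma> \<omega>)) \<omega> - J k (min s (\<sigma> \<omega>)) \<omega>) \<partial>P) =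
    (\<integral>\<omega>. indicator B \<omega> * (A k (min t (\<sigma> \<omega>)) \<omega> - A k (min s (\<sigma> \<omega>)) \<omega>) \<partial>P)" if k: "\<And>x u. 0 \<le> k x u" for k
  proof -
    have ab: "0 \<le> min s (\<sigma> \<omega>)" "min s (\<sigma> \<omega>) \<le> min t (\<sigma> \<omega>)" for \<omega> using st \<sigma>(2)[of \<omega>] by auto
    have Jn: "0 \<le> J k (min t (\<sigma> \<omega>)) \<omega> - J k (min s (\<sigma> \<omega>)) \<omega>" if "\<omega> \<in> space P" for \<omega>
      unfolding J_diff[OF that ab] by (intro sum_nonneg k)
    have An: "0 \<le> A k (min t (\<sigma> \<omega>)) \<omega> - A k (min s (\<sigma> \<omega>)) \<omega>" if "\<omega> \<in> space P" for \<omega>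
      unfolding A_diff
    proof (intro sum_nonneg mult_nonneg_nonneg k occ_diff(3)[OF that ab])
      fix x u assume "x \<in> E" "u \<in> U"
      then show "0 \<le> rate u x" using rate_nonneg zero_notin_U by metis
    qed
    have "(\<integral>\<omega>. indicator B \<omega> * (J k (min t (\<sigma> \<omega>)) \<omega> - J k (min s (\<sigma> \<omega>)) \<omega>) \<partial>P) =
      enn2real (\<integral>\<^sup>+\<omega>. ennreal (indicator B \<omega> * (J k (min t (\<sigma> \<omega>)) \<omega> - J k (min s (\<sigma> \<omega>)) \<omega>)) \<partial>P)"
      by (rule integral_eq_nn_integral) (use intJ[of k] Jn in auto)
    also have "(\<integral>\<^sup>+\<omega>. ennreal (indicator B \<omega> * (J k (min t (\<sigma> \<omega>)) \<omega> - J k (min s (\<sigma> \<omega>)) \<omega>)) \<partial>P) =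
      (\<integral>\<^sup>+\<omega>. indicator B \<omega> * ennreal (J k (min t (\<sigma> \<omega>)) \<omega> - J k (min s (\<sigma> \<omega>)) \<omega>) \<partial>P)"
      by (rule nn_integral_cong) (simp add: indicator_def)
    also have "\<dots> = (\<integral>\<^sup>+\<omega>. indicator B \<omega> * ennreal (A k (min t (\<sigma> \<omega>)) \<omega> - A k (min s (\<sigma> \<omega>)) \<omega>) \<partial>P)"
      by (rule jump_compensation_nn[OF B st \<sigma> k])
    also have "\<dots> = (\<integral>\<^sup>+\<omega>. ennreal (indicator B \<omega> * (A k (min t (\<sigma> \<omega>)) \<omega> - A k (min s (\<sigma> \<omega>)) \<omega>)) \<partial>P)"
      by (rule nn_integral_cong) (simp add: indicator_def)
    also have "enn2real \<dots> = (\<integral>\<omega>. indicator B \<omega> * (A k (min t (\<sigma> \<omega>)) \<omega> - A k (min s (\<sigma> \<omega>)) \<omega>) \<partial>P)"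
      by (rule integral_eq_nn_integral[symmetric]) (use intA[of k] An in auto)
    finally show ?thesis .
  qed
  define kp where "kp x u = max (k x u) 0" for x u
  define kn where "kn x u = max (- k x u) 0" for x u
  have k_split: "k x u = kp x u - kn x u" for x u by (simp add: kp_def kn_def)
  have Jk: "J k v \<omega> = J kp v \<omega> - J kn v \<omega>" for v \<omega>
    by (simp add: J_def jump_sum_def k_split sum_subtractf)
  have Ak: "A k v \<omega> = A kp v \<omega> - A kn v \<omega>" for v \<omega>
    by (simp add: A_def k_split sum_subtractf left_diff_distrib right_diff_distrib)
  have J2: "indicator B \<omega> * (J k a \<omega> - J k b \<omega>) = indicator B \<omega> * (J kp a \<omega> - J kp b \<omega>) - indicator B \<omega> * (J kn a \<omega> - J kn b \<omega>)" for a b \<omega>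
    by (simp add: Jk algebra_simps)
  have A2: "indicator B \<omega> * (A k a \<omega> - A k b \<omega>) = indicator B \<omega> * (A kp a \<omega> - A kp b \<omega>) - indicator B \<omega> * (A kn a \<omega> - A kn b \<omega>)" for a b \<omega>
    by (simp add: Ak algebra_simps)
  show ?thesis
    unfolding J2 A2 Bochner_Integration.integral_diff[OF intJ intJ] Bochner_Integration.integral_diff[OF intA intA]
    by (subst (1 2) pos) (auto simp: kp_def kn_def)
qed

lemma stopped_martingale: "martingale P Fi (\<lambda>t \<omega>. J k (min t (\<sigma> \<omega>)) \<omega> - A k (min t (\<sigma> \<omega>)) \<omega>)"
proof (rule martingaleI)
  show "adapted Fi (\<lambda>t \<omega>. J k (min t (\<sigma> \<omega>)) \<omega> - A k (min t (\<sigma> \<omega>)) \<omega>)"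
    using stopped_adapted[of k] by (simp add: adapted_def borel_measurable_diff)
  show "AE \<omega> in P. cadlag (\<lambda>t. J k (min t (\<sigma> \<omega>)) \<omega> - A k (min t (\<sigma> \<omega>)) \<omega>)"
  proof (rule AE_I2)
    fix \<omega> assume \<omega>: "\<omega> \<in> space P"
    have "cadlag (\<lambda>t. J k t \<omega> - A k t \<omega>)" by (rule cadlag_compensated[OF \<omega>])
    then show "cadlag (\<lambda>t. J k (min t (\<sigma> \<omega>)) \<omega> - A k (min t (\<sigma> \<omega>)) \<omega>)" by (rule cadlag_stop[OF _ \<sigma>(2)])
  qed
  show "integrable P (\<lambda>\<omega>. J k (min t (\<sigma> \<omega>)) \<omega> - A k (min t (\<sigma> \<omega>)) \<omega>)" if "0 \<le> t" for t
    using stopped_integrable[OF that, of k] by simp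
  fix s t B assume st: "0 \<le> s" "s \<le> t" and B: "B \<in> sets (Fi s)"
  have t: "0 \<le> t" using st by simp
  have BP: "B \<in> sets P" by (rule sets_Fi[OF st(1) B])
  have int: "integrable P (\<lambda>\<omega>. indicator B \<omega> * J k (min v (\<sigma> \<omega>)) \<omega>)" "integrable P (\<lambda>\<omega>. indicator B \<omega> * A k (min v (\<sigma> \<omega>)) \<omega>)" if "0 \<le> v" for v
    using integrable_mult_indicator[OF BP stopped_integrable(1)[OF that]] integrable_mult_indicator[OF BP stopped_integrable(2)[OF that]] by simp_all
  show "(\<integral>\<omega>. indicator B \<omega> * (J k (min t (\<sigma> \<omega>)) \<omega> - A k (min t (\<sigma> \<omega>)) \<omega>) \<partial>P) =
    (\<integral>\<omega>. indicator B \<omega> * (J k (min s (\<sigma> \<omega>)) \<omega> - A k (min s (\<sigma> \<omega>)) \<omega>) \<partial>P)"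
    using jump_compensation[OF B st, of k] int[OF t] int[OF st(1)] by (simp add: right_diff_distrib)
qed

end

text \<open>The clock is the number of jumps. Between \<open>v\<close> and \<open>w\<close> the sum
  \<open>J k\<close> varies by at most \<open>kmax k\<close> times the number of jumps, and
  \<open>A k\<close> by at most \<open>kmax k * total_rate * (w - v)\<close>; the constant covers
  both.\<close>

theorem compensated_jumps_purely_discontinuous:
  "purely_disc_local_martingale P Fi (\<lambda>t \<omega>. J k t \<omega> - A k t \<omega>)"
proof (rule purely_discontinuous_local_martingaleI[where C="J (\<lambda>_ _. 1)" and \<kappa>="kmax k * (1 + total_rate)"])
  show "martingale P Fi (\<lambda>t \<omega>. J k (min t (\<sigma> \<omega>)) \<omega> - A k (min t (\<sigma> \<omega>)) \<omega>)"
    if "stopping_time Fi \<sigma>" "\<And>\<omega>. 0 \<le> \<sigma> \<omega>" for \<sigma> by (rule stopped_martingale[OF that])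
  show "martingale P Fi (\<lambda>t \<omega>. J k t \<omega> - A k t \<omega>)"
  proof (rule martingaleI)
    have m: "martingale P Fi (\<lambda>t \<omega>. J k (min t c) \<omega> - A k (min t c) \<omega>)" if "0 \<le> c" for c
      by (rule stopped_martingale[OF stopping_time_const that])
    show "adapted Fi (\<lambda>t \<omega>. J k t \<omega> - A k t \<omega>)"
      using J_adapted[of k] A_adapted[of k] by (simp add: adapted_def borel_measurable_diff)
    show "integrable P (\<lambda>\<omega>. J k t \<omega> - A k t \<omega>)" if "0 \<le> t" for t
      using m[OF that] that by (auto simp: martingale_def dest!: spec[of _ t])
    show "(\<integral>\<omega>. indicator B \<omega> * (J k t \<omega> - A k t \<omega>) \<partial>P) = (\<integral>\<omega>. indicator B \<omega> * (J k s \<omega> - A k s \<omega>) \<partial>P)"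
      if "0 \<le> s" "s \<le> t" "B \<in> sets (Fi s)" for s t B
      using martingale_indicator[OF m[of t] that] that by (simp add: min_absorb1)
    show "AE \<omega> in P. cadlag (\<lambda>t. J k t \<omega> - A k t \<omega>)" by (rule AE_I2[OF cadlag_compensated])
  qed
  show "J k 0 \<omega> - A k 0 \<omega> = 0" for \<omega> by (simp add: J_0 A_0)
  show "adapted Fi (J (\<lambda>_ _. 1))" by (rule J_adapted)
  show "J (\<lambda>_ _. 1) 0 \<omega> = 0" for \<omega> by (rule J_0)
  show "J (\<lambda>_ _. 1) v \<omega> \<le> J (\<lambda>_ _. 1) w \<omega>" if "\<omega> \<in> space P" "0 \<le> v" "v \<le> w" for \<omega> v w by (rule count_nonneg[OF that])
  show "((\<lambda>s. J (\<lambda>_ _. 1) s \<omega>) \<longlongrightarrow> J (\<lambda>_ _. 1) t \<omega>) (at_right t)" if "\<omega> \<in> space P" "0 \<le> t" for \<omega> t by (rule J_right[OF that])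
  show "\<exists>d>0. \<forall>v. t - d < v \<and> v < t \<and> 0 \<le> v \<longrightarrow> J (\<lambda>_ _. 1) t \<omega> \<le> J (\<lambda>_ _. 1) v \<omega> + 1" if \<omega>: "\<omega> \<in> space P" and t: "0 < t" for \<omega> t
  proof -
    interpret finite_path "\<lambda>t. X t \<omega>" E by (rule paths[OF \<omega>])
    obtain d where d: "d > 0" "\<And>v. t - d < v \<Longrightarrow> v < t \<Longrightarrow> 0 \<le> v \<Longrightarrow>
      jump_sum (\<lambda>t. X t \<omega>) (\<lambda>_ _. 1::real) t = jump_sum (\<lambda>t. X t \<omega>) (\<lambda>_ _. 1) v + (if dX \<omega> t = 0 then 0 else 1)"
      by (rule jump_sum_left[OF t, of "\<lambda>_ _. 1::real"]) blast
    show ?thesis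
    proof (intro exI[of _ d] conjI allI impI)
      fix v assume "t - d < v \<and> v < t \<and> 0 \<le> v"
      then show "J (\<lambda>_ _. 1) t \<omega> \<le> J (\<lambda>_ _. 1) v \<omega> + 1" using d(2)[of v] by (simp add: J_def)
    qed (rule d(1))
  qed
  show "0 \<le> kmax k * (1 + total_rate)" using kmax(2)[of k] total_rate_nonneg by simp
  show "\<bar>(J k w \<omega> - A k w \<omega>) - (J k v \<omega> - A k v \<omega>)\<bar> \<le> kmax k * (1 + total_rate) * (J (\<lambda>_ _. 1) w \<omega> - J (\<lambda>_ _. 1) v \<omega> + (w - v))"
    if \<omega>: "\<omega> \<in> space P" and vw: "0 \<le> v" "v \<le> w" for \<omega> v w
  proof -
    let ?c = "J (\<lambda>_ _. 1) w \<omega> - J (\<lambda>_ _. 1) v \<omega>"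
    have c: "0 \<le> ?c" using count_nonneg[OF \<omega> vw] by simp
    have "\<bar>(J k w \<omega> - A k w \<omega>) - (J k v \<omega> - A k v \<omega>)\<bar> \<le> kmax k * ?c + kmax k * total_rate * (w - v)"
      using J_variation[OF \<omega> vw, of k] A_variation[OF \<omega> vw, of k] by linarith
    also have "\<dots> \<le> kmax k * (1 + total_rate) * ?c + kmax k * (1 + total_rate) * (w - v)"
    proof (intro add_mono mult_right_mono)
      have "kmax k * 1 \<le> kmax k * (1 + total_rate)" "kmax k * total_rate \<le> kmax k * (1 + total_rate)"
        by (intro mult_left_mono kmax(2); use total_rate_nonneg in simp)+
      then show "kmax k \<le> kmax k * (1 + total_rate)" "kmax k * total_rate \<le> kmax k * (1 + total_rate)" by simp_all
    qed (use c vw in auto)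
    finally show ?thesis by (simp add: distrib_left)
  qed
qed

end

section \<open>Monotone levels\<close>

context jump_chain begin

lemma sum_occ:
  assumes \<omega>: "\<omega> \<in> space P" and t: "0 \<le> t"
  shows "(\<Sum>x\<in>E. occ x t \<omega>) = t"
proof -
  interpret finite_path "\<lambda>t. X t \<omega>" E by (rule paths[OF \<omega>])
  have s: "{v\<in>{0..t}. Xm \<omega> v = x} \<in> sets borel" for x using occ_sets(1)[OF \<omega> order_refl, of t x] by simp
  have fin: "emeasure lborel {v\<in>{0..t}. Xm \<omega> v = x} \<noteq> \<infinity>" for x
  proof -
    have "emeasure lborel {v\<in>{0..t}. Xm \<omega> v = x} \<le> emeasure lborel {0..t}" using s by (intro emeasure_mono) auto
    also have "\<dots> < \<infinity>" using t by simp
    finally show ?thesis by simp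
  qed
  have "measure lborel (\<Union>x\<in>E. {v\<in>{0..t}. Xm \<omega> v = x}) = (\<Sum>x\<in>E. measure lborel {v\<in>{0..t}. Xm \<omega> v = x})"
    by (rule measure_finite_Union[OF finite_E]) (use s fin in \<open>auto simp: disjoint_family_on_def\<close>)
  moreover have "(\<Union>x\<in>E. {v\<in>{0..t}. Xm \<omega> v = x}) = {0..t}" using left_lim_range by auto
  ultimately show ?thesis using t by (simp add: occ_def)
qed

lemma expectation_jump_sum:
  assumes "0 \<le> t" "\<And>x u. 0 \<le> k x u"
  shows "(\<integral>\<^sup>+\<omega>. ennreal (J k t \<omega>) \<partial>P) = (\<integral>\<^sup>+\<omega>. ennreal (A k t \<omega>) \<partial>P)"
proof -
  have "space P \<in> sets (Fi 0)" using sets.top[of "Fi 0"] space_Fi[of 0] by simp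
  from jump_compensation_nn[OF this order_refl assms(1) stopping_time_const[of t] assms(1) assms(2)]
  have eq: "(\<integral>\<^sup>+\<omega>. indicator (space P) \<omega> * ennreal (J k (min t t) \<omega> - J k (min 0 t) \<omega>) \<partial>P) =
    (\<integral>\<^sup>+\<omega>. indicator (space P) \<omega> * ennreal (A k (min t t) \<omega> - A k (min 0 t) \<omega>) \<partial>P)" .
  have "(\<integral>\<^sup>+\<omega>. ennreal (J k t \<omega>) \<partial>P) = (\<integral>\<^sup>+\<omega>. indicator (space P) \<omega> * ennreal (J k (min t t) \<omega> - J k (min 0 t) \<omega>) \<partial>P)"
    using assms(1) by (intro nn_integral_cong) (simp add: J_0 min_absorb1)
  also note eq
  also have "(\<integral>\<^sup>+\<omega>. indicator (space P) \<omega> * ennreal (A k (min t t) \<omega> - A k (min 0 t) \<omega>) \<partial>P) = (\<integral>\<^sup>+\<omega>. ennreal (A k t \<omega>) \<partial>P)"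
    using assms(1) by (intro nn_integral_cong) (simp add: A_0 min_absorb1)
  finally show ?thesis .
qed

definition S :: "(real^'n) set" where "S = {u\<in>U. \<exists>x\<in>E. 0 < rate u x}"

text \<open>The number of jumps with size outside \<open>S\<close> has compensator 0, hence
  expectation 0, on every interval \<open>[0, n]\<close>.\<close>

lemma jumps_in_S: "AE \<omega> in P. \<forall>r>0. dX \<omega> r \<noteq> 0 \<longrightarrow> dX \<omega> r \<in> S"
proof -
  define k where "k x u = (if u \<in> S then 0 else 1 :: real)" for x u :: "real^'n"
  have A0: "A k t \<omega> = 0" for t \<omega>
    unfolding A_def
  proof (intro sum.neutral ballI)
    fix x u assume "x \<in> E" "u \<in> U"
    then have "u \<in> S \<or> rate u x = 0" using rate_nonneg[of x u] zero_notin_U unfolding S_def by force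
    then show "rate u x * k x u * occ x t \<omega> = 0" by (auto simp: k_def)
  qed
  have "AE \<omega> in P. J k (real n) \<omega> \<le> 0" for n
  proof -
    have "(\<integral>\<^sup>+\<omega>. ennreal (J k (real n) \<omega>) \<partial>P) = 0"
      by (subst expectation_jump_sum) (simp_all add: A0 k_def)
    moreover have "(\<lambda>\<omega>. ennreal (J k (real n) \<omega>)) \<in> borel_measurable P"
      using adapted_measurable[OF J_adapted, of "real n"] by simp
    ultimately have "AE \<omega> in P. ennreal (J k (real n) \<omega>) = 0" using nn_integral_0_iff_AE by blast
    then show ?thesis by eventually_elim (simp add: ennreal_eq_0_iff)
  qed
  then have "AE \<omega> in P. \<forall>n. J k (real n) \<omega> \<le> 0" by (simp add: AE_all_countable)
  then show ?thesis using AE_space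
  proof eventually_elim
    case (elim \<omega>)
    interpret finite_path "\<lambda>t. X t \<omega>" E by (rule paths[OF elim(2)])
    show ?case
    proof (intro allI impI, rule ccontr)
      fix r :: real assume r: "0 < r" "dX \<omega> r \<noteq> 0" "dX \<omega> r \<notin> S"
      obtain n :: nat where n: "r \<le> n" using real_arch_simple by blast
      have "1 = (\<Sum>r\<in>{r}. k (Xm \<omega> r) (dX \<omega> r))" using r by (simp add: k_def)
      also have "\<dots> \<le> (\<Sum>r\<in>jumps \<omega> 0 n. k (Xm \<omega> r) (dX \<omega> r))"
        by (rule sum_mono2) (use r n finite_jump_times in \<open>auto simp: jump_times_def k_def\<close>)
      finally have "1 \<le> J k (real n) \<omega>" unfolding J_def jump_sum_def .
      moreover have "J k (real n) \<omega> \<le> 0" using elim(1) ..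
      ultimately show False by linarith
    qed
  qed
qed

text \<open>On \<open>Q n\<close> the level is positive during all of \<open>[0, n]\<close>, where
  the jump \<open>u0\<close> has rate at least \<open>c\<close>; but every such jump lowers the
  level, so at most \<open>N\<close> of them occur. Comparing expectations gives
  \<open>c * n * prob (Q n) \<le> N\<close>, so almost surely the level is 0 at some integer
  time.\<close>

lemma monotone_level:
  fixes g :: "real^'n \<Rightarrow> real"
  assumes g_nat: "\<And>x. x \<in> E \<Longrightarrow> g x \<in> \<nat>"
    and g_step: "\<And>x u. x \<in> E \<Longrightarrow> u \<in> S \<Longrightarrow> x + u \<in> E \<Longrightarrow> g (x + u) = g x \<or> g (x + u) = g x - 1"
    and u0: "u0 \<in> U" "\<And>x. x \<in> E \<Longrightarrow> 0 < g x \<Longrightarrow> 0 < rate u0 x" "\<And>x. x \<in> E \<Longrightarrow> x + u0 \<in> E \<Longrightarrow> g (x + u0) = g x - 1"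
  shows "AE \<omega> in P. (\<forall>t>0. g (X t \<omega>) \<le> g (Xm \<omega> t)) \<and> (\<forall>t\<ge>0. g (X t \<omega>) \<le> g (X 0 \<omega>)) \<and>
    (let D = {t. 0 < t \<and> g (X t \<omega>) < g (Xm \<omega> t)} in finite D \<and> real (card D) \<le> g (X 0 \<omega>) \<and>
      (\<forall>t\<ge>0. (\<forall>s\<in>D. s \<le> t) \<longrightarrow> g (X t \<omega>) = 0))"
proof -
  have good: "g (X t \<omega>) - g (X s \<omega>) = - real (card {r\<in>jumps \<omega> s t. g (X r \<omega>) < g (Xm \<omega> r)})"
    "r > 0 \<Longrightarrow> g (X r \<omega>) = g (Xm \<omega> r) \<or> g (X r \<omega>) = g (Xm \<omega> r) - 1"
    if \<omega>: "\<omega> \<in> space P" "\<forall>r>0. dX \<omega> r \<noteq> 0 \<longrightarrow> dX \<omega> r \<in> S" and st: "0 \<le> s" "s \<le> t" for \<omega> s t r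
  proof -
    interpret finite_path "\<lambda>t. X t \<omega>" E by (rule paths[OF \<omega>(1)])
    have step: "g (X r \<omega>) = g (Xm \<omega> r) \<or> g (X r \<omega>) = g (Xm \<omega> r) - 1" if r: "r > 0" for r
    proof (cases "dX \<omega> r = 0")
      case True then show ?thesis by (simp add: jump_def)
    next
      case False
      have "Xm \<omega> r + dX \<omega> r = X r \<omega>" by (simp add: jump_def)
      then show ?thesis using g_step[of "Xm \<omega> r" "dX \<omega> r"] \<omega>(2) r False dX_in_U[OF \<omega>(1) r False] by auto
    qed
    then show "r > 0 \<Longrightarrow> g (X r \<omega>) = g (Xm \<omega> r) \<or> g (X r \<omega>) = g (Xm \<omega> r) - 1" .
    have "g (X t \<omega>) - g (X s \<omega>) = (\<Sum>r\<in>jumps \<omega> s t. g (X r \<omega>) - g (Xm \<omega> r))" by (rule telescope[OF st])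
    also have "\<dots> = (\<Sum>r\<in>jumps \<omega> s t. if g (X r \<omega>) < g (Xm \<omega> r) then -1 else 0)"
    proof (rule sum.cong[OF refl])
      fix r assume "r \<in> jumps \<omega> s t"
      then have "r > 0" using st by (simp add: jump_times_def)
      then show "g (X r \<omega>) - g (Xm \<omega> r) = (if g (X r \<omega>) < g (Xm \<omega> r) then -1 else 0)" using step[of r] by auto
    qed
    also have "\<dots> = (\<Sum>r\<in>{r\<in>jumps \<omega> s t. g (X r \<omega>) < g (Xm \<omega> r)}. -1)"
      by (rule sum.inter_filter[symmetric, OF finite_jump_times[OF st(1)]])
    finally show "g (X t \<omega>) - g (X s \<omega>) = - real (card {r\<in>jumps \<omega> s t. g (X r \<omega>) < g (Xm \<omega> r)})" by simp
  qed
  define N where "N = (\<Sum>x\<in>E. g x)"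
  have g0: "0 \<le> g x" if "x \<in> E" for x using g_nat[OF that] by (auto elim: Nats_cases)
  have gN: "g x \<le> N" if "x \<in> E" for x unfolding N_def using that finite_E g0 by (intro member_le_sum) auto
  \<comment> \<open>The element 1 keeps the minimum defined when \<open>g\<close> vanishes on all of
    \<open>E\<close>.\<close>
  define c where "c = Min (insert 1 (rate u0 ` {x\<in>E. 0 < g x}))"
  have c: "0 < c" unfolding c_def using finite_E u0(2) by (subst Min_gr_iff) auto
  have c_le: "c \<le> rate u0 x" if "x \<in> E" "0 < g x" for x
    unfolding c_def using that finite_E by (intro Min_le) auto
  define k where "k x u = (if u = u0 then 1 else 0 :: real)" for x u :: "real^'n"
  define Q where "Q n = {\<omega>\<in>space P. X (real n) \<omega> \<in> {x\<in>E. 0 < g x}}" for n :: nat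
  have Q: "Q n \<in> sets P" for n
  proof -
    have m: "X (real n) \<in> borel_measurable P" by (rule adapted_measurable[OF X_adapted]) simp
    have "{x\<in>E. 0 < g x} \<in> sets borel" using finite_E by (intro borel_closed finite_imp_closed) simp
    from measurable_sets[OF m this] show ?thesis by (simp add: Q_def vimage_def Int_def conj_commute)
  qed
  have Q_bound: "c * real n * prob (Q n) \<le> N" for n
  proof -
    have "ennreal (c * real n * prob (Q n)) = (\<integral>\<^sup>+\<omega>. ennreal (c * real n) * indicator (Q n) \<omega> \<partial>P)"
      using Q c by (simp add: nn_integral_cmult_indicator emeasure_eq_measure ennreal_mult)
    also have "\<dots> \<le> (\<integral>\<^sup>+\<omega>. ennreal (A k (real n) \<omega>) \<partial>P)"
    proof (rule nn_integral_mono_AE)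
      show "AE \<omega> in P. ennreal (c * real n) * indicator (Q n) \<omega> \<le> ennreal (A k (real n) \<omega>)"
        using jumps_in_S AE_space
      proof eventually_elim
        case (elim \<omega>)
        interpret finite_path "\<lambda>t. X t \<omega>" E by (rule paths[OF elim(2)])
        show ?case
        proof (cases "\<omega> \<in> Q n")
          case True
          have gpos: "0 < g (Xm \<omega> v)" if v: "0 \<le> v" "v \<le> real n" for v
          proof -
            have "g (X n \<omega>) \<le> g (X v \<omega>)" using good(1)[OF elim(2,1) v] by linarith
            moreover have "g (X v \<omega>) \<le> g (Xm \<omega> v)"
              using good(2)[OF elim(2,1) order_refl order_refl, of v] v left_lim_0 by (cases "v = 0") auto
            ultimately show ?thesis using True by (simp add: Q_def)
          qed
          have "c * real n = (\<Sum>x\<in>E. c * occ x n \<omega>)"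
            using sum_occ[OF elim(2), of n] by (simp add: sum_distrib_left[symmetric])
          also have "\<dots> \<le> (\<Sum>x\<in>E. rate u0 x * occ x n \<omega>)"
          proof (rule sum_mono)
            fix x assume x: "x \<in> E"
            show "c * occ x n \<omega> \<le> rate u0 x * occ x n \<omega>"
            proof (cases "0 < g x")
              case True then show ?thesis using c_le[OF x] by (intro mult_right_mono) (auto simp: occ_def)
            next
              case False
              then have "{v\<in>{0..real n}. Xm \<omega> v = x} = {}" using gpos by auto
              then have "occ x n \<omega> = 0" unfolding occ_def by (simp only: measure_empty)
              then show ?thesis by simp
            qed
          qed
          also have "\<dots> = A k n \<omega>"
            unfolding A_def
          proof (rule sum.cong[OF refl])
            fix x
            have "(\<Sum>u\<in>U. rate u x * k x u * occ x n \<omega>) = (\<Sum>u\<in>U. if u = u0 then rate u x * occ x n \<omega> else 0)"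
              by (rule sum.cong) (auto simp: k_def)
            then show "rate u0 x * occ x n \<omega> = (\<Sum>u\<in>U. rate u x * k x u * occ x n \<omega>)" using u0(1) finite_U by simp
          qed
          finally show ?thesis using True by (simp add: ennreal_leI)
        qed simp
      qed
    qed
    also have "\<dots> = (\<integral>\<^sup>+\<omega>. ennreal (J k (real n) \<omega>) \<partial>P)" by (rule expectation_jump_sum[symmetric]) (simp_all add: k_def)
    also have "\<dots> \<le> (\<integral>\<^sup>+\<omega>. ennreal N \<partial>P)"
    proof (rule nn_integral_mono_AE)
      show "AE \<omega> in P. ennreal (J k (real n) \<omega>) \<le> ennreal N"
        using jumps_in_S AE_space
      proof eventually_elim
        case (elim \<omega>)
        interpret finite_path "\<lambda>t. X t \<omega>" E by (rule paths[OF elim(2)])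
        have "J k n \<omega> = (\<Sum>r\<in>jumps \<omega> 0 n. k (Xm \<omega> r) (dX \<omega> r))" by (simp add: J_def jump_sum_def)
        also have "\<dots> \<le> (\<Sum>r\<in>jumps \<omega> 0 n. if g (X r \<omega>) < g (Xm \<omega> r) then 1 else 0)"
        proof (rule sum_mono)
          fix r assume "r \<in> jumps \<omega> 0 n"
          then have r: "0 < r" "dX \<omega> r \<noteq> 0" by (auto simp: jump_times_def)
          have "g (X r \<omega>) < g (Xm \<omega> r)" if "dX \<omega> r = u0"
          proof -
            have "Xm \<omega> r + u0 = X r \<omega>" using that by (simp add: jump_def algebra_simps)
            then show ?thesis using u0(3)[of "Xm \<omega> r"] dX_in_U[OF elim(2) r] by simp
          qed
          then show "k (Xm \<omega> r) (dX \<omega> r) \<le> (if g (X r \<omega>) < g (Xm \<omega> r) then 1 else 0)" by (auto simp: k_def)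
        qed
        also have "\<dots> = real (card {r\<in>jumps \<omega> 0 n. g (X r \<omega>) < g (Xm \<omega> r)})"
          using finite_jump_times[of 0 n] by (simp add: sum.inter_filter[symmetric])
        also have "\<dots> = g (X 0 \<omega>) - g (X n \<omega>)" using good(1)[OF elim(2,1), of 0 n] by simp
        also have "\<dots> \<le> N" using gN[OF range[of 0]] g0[OF range[of n]] by simp
        finally show ?case by (rule ennreal_leI)
      qed
    qed
    also have "\<dots> = ennreal N" by (simp add: emeasure_space_1)
    finally show ?thesis using g0 by (subst (asm) ennreal_le_iff) (auto simp: N_def intro: sum_nonneg)
  qed
  have "prob (\<Inter>n. Q n) = 0"
  proof (rule ccontr)
    assume "prob (\<Inter>n. Q n) \<noteq> 0"
    then have p: "0 < prob (\<Inter>n. Q n)" by (simp add: less_le)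
    obtain n :: nat where n: "N / (c * prob (\<Inter>n. Q n)) < n" using reals_Archimedean2 by blast
    have "N < c * real n * prob (\<Inter>n. Q n)" using n c p by (simp add: field_simps)
    also have "\<dots> \<le> c * real n * prob (Q n)"
      using c Q by (intro mult_left_mono finite_measure_mono) auto
    finally show False using Q_bound[of n] by simp
  qed
  moreover have "(\<Inter>n. Q n) \<in> sets P" using Q by auto
  ultimately have "AE \<omega> in P. \<omega> \<notin> (\<Inter>n. Q n)" by (simp add: prob_eq_0)
  then show ?thesis using jumps_in_S AE_space
  proof eventually_elim
    case (elim \<omega>)
    interpret finite_path "\<lambda>t. X t \<omega>" E by (rule paths[OF elim(3)])
    define D where "D = {t. 0 < t \<and> g (X t \<omega>) < g (Xm \<omega> t)}"
    have step: "g (X r \<omega>) = g (Xm \<omega> r) \<or> g (X r \<omega>) = g (Xm \<omega> r) - 1" if "r > 0" for r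
      using good(2)[OF elim(3,2) order_refl order_refl that] .
    have dec: "g (X t \<omega>) \<le> g (X s \<omega>)" if "0 \<le> s" "s \<le> t" for s t
      using good(1)[OF elim(3,2) that] by linarith
    have DJ: "{r\<in>jumps \<omega> s t. g (X r \<omega>) < g (Xm \<omega> r)} = D \<inter> {s<..t}" if "0 \<le> s" for s t
      using that by (auto simp: D_def jump_times_def jump_def)
    have card_sub: "finite D' \<Longrightarrow> D' \<subseteq> D \<Longrightarrow> real (card D') \<le> g (X 0 \<omega>)" for D'
    proof -
      assume D': "finite D'" "D' \<subseteq> D"
      define t where "t = Max (insert 0 D')"
      have t: "0 \<le> t" "\<And>r. r \<in> D' \<Longrightarrow> r \<le> t" using D' by (auto simp: t_def)
      have "D' \<subseteq> D \<inter> {0<..t}" using D'(2) t by (auto simp: D_def)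
      moreover have "finite (D \<inter> {0<..t})" unfolding DJ[OF order_refl, of t, symmetric] using finite_jump_times[of 0 t] by simp
      ultimately have "card D' \<le> card (D \<inter> {0<..t})" by (rule card_mono[rotated])
      moreover have "g (X t \<omega>) - g (X 0 \<omega>) = - real (card (D \<inter> {0<..t}))"
        using good(1)[OF elim(3,2) order_refl t(1)] unfolding DJ[OF order_refl] .
      ultimately show "real (card D') \<le> g (X 0 \<omega>)" using g0[OF range[OF t(1)]] by linarith
    qed
    have finD: "finite D"
    proof (rule ccontr)
      assume inf: "infinite D"
      obtain m :: nat where m: "g (X 0 \<omega>) < m" using reals_Archimedean2 by blast
      obtain D' where "D' \<subseteq> D" "finite D'" "card D' = m" using infinite_arbitrarily_large[OF inf] by blast
      then show False using card_sub[of D'] m by simp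
    qed
    obtain n where "\<omega> \<notin> Q n" using elim(1) by blast
    then have gn: "g (X n \<omega>) = 0" using elim(3) range[of n] g0[OF range[of n]] by (auto simp: Q_def)
    have "g (X t \<omega>) = 0" if t: "0 \<le> t" "\<forall>s\<in>D. s \<le> t" for t
    proof (cases "n \<le> t")
      case True
      then show ?thesis using dec[of n t] gn g0[OF range[OF t(1)]] by simp
    next
      case False
      \<comment> \<open>No downward jump happens between \<open>t\<close> and \<open>n\<close>, so
        the level at \<open>t\<close> is already the level 0 of time \<open>n\<close>.\<close>
      then have "D \<inter> {t<..real n} = {}" using t(2) by auto
      moreover have "g (X n \<omega>) - g (X t \<omega>) = - real (card (D \<inter> {t<..real n}))"
        using good(1)[OF elim(3,2) t(1), of "real n"] False unfolding DJ[OF t(1)] by simp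
      ultimately show ?thesis using gn by simp
    qed
    moreover have "g (X t \<omega>) \<le> g (Xm \<omega> t)" if "t > 0" for t using step[OF that] by auto
    ultimately show ?case unfolding D_def[symmetric] Let_def using finD card_sub[OF finD order_refl] dec[OF order_refl] by blast
  qed
qed

end

section \<open>Independence of the coordinates\<close>

text \<open>A discrete Gronwall argument: in \<open>n\<close> steps of length
  \<open>h = (t - s) / n\<close> each step adds an error \<open>C * h^2\<close>, amplified by at
  most \<open>exp (c * (t - s))\<close>, so the total is of order \<open>1 / n\<close>.\<close>

lemma euler_estimate_zero:
  fixes W :: "real \<Rightarrow> real"
  assumes W0: "W s = 0" and pos: "\<And>t. s \<le> t \<Longrightarrow> 0 \<le> W t" and c: "0 \<le> c" and C: "0 \<le> C"
    and step: "\<And>t h. s \<le> t \<Longrightarrow> 0 \<le> h \<Longrightarrow> W (t + h) \<le> (1 + c * h) * W t + C * h\<^sup>2"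
    and t: "s \<le> t"
  shows "W t = 0"
proof -
  have bound: "W t \<le> (C * (t - s)\<^sup>2 * exp (c * (t - s))) * (1 / real n)" if n: "n > 0" for n :: nat
  proof -
    define h where "h = (t - s) / n"
    have h: "0 \<le> h" "real n * h = t - s" using t n by (auto simp: h_def)
    have "W (s + real i * h) \<le> real i * (C * h\<^sup>2) * (1 + c * h) ^ i" for i :: nat
    proof (induction i)
      case 0 then show ?case using W0 by simp
    next
      case (Suc i)
      have one: "1 \<le> 1 + c * h" using c h by simp
      have "W (s + real (Suc i) * h) = W ((s + real i * h) + h)" by (simp add: algebra_simps)
      also have "\<dots> \<le> (1 + c * h) * W (s + real i * h) + C * h\<^sup>2" using h by (intro step) simp_all
      also have "\<dots> \<le> (1 + c * h) * (real i * (C * h\<^sup>2) * (1 + c * h) ^ i) + C * h\<^sup>2 * (1 + c * h) ^ Suc i"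
      proof (rule add_mono)
        show "(1 + c * h) * W (s + real i * h) \<le> (1 + c * h) * (real i * (C * h\<^sup>2) * (1 + c * h) ^ i)"
          using Suc one by (intro mult_left_mono) auto
        have "C * h\<^sup>2 * 1 \<le> C * h\<^sup>2 * (1 + c * h) ^ Suc i"
          using C one by (intro mult_left_mono one_le_power) auto
        then show "C * h\<^sup>2 \<le> C * h\<^sup>2 * (1 + c * h) ^ Suc i" by simp
      qed
      also have "\<dots> = real (Suc i) * (C * h\<^sup>2) * (1 + c * h) ^ Suc i" by (simp add: algebra_simps)
      finally show ?case .
    qed
    from this[of n] have "W t \<le> real n * (C * h\<^sup>2) * (1 + c * h) ^ n" using h by simp
    also have "\<dots> \<le> real n * (C * h\<^sup>2) * exp (c * (t - s))"
    proof (rule mult_left_mono)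
      have "(1 + c * h) ^ n \<le> exp (c * h) ^ n" using c h by (intro power_mono exp_ge_add_one_self) simp
      also have "\<dots> = exp (real n * (c * h))" by (rule exp_of_nat_mult[symmetric])
      also have "real n * (c * h) = c * (t - s)" using h(2) by (simp add: mult.left_commute)
      finally show "(1 + c * h) ^ n \<le> exp (c * (t - s))" .
    qed (use C in simp)
    also have "real n * (C * h\<^sup>2) = C * (t - s)\<^sup>2 * (1 / real n)"
      using n by (simp add: h_def power2_eq_square field_simps)
    finally show ?thesis by (simp add: mult_ac)
  qed
  have "W t \<le> 0"
  proof (rule LIMSEQ_le[OF tendsto_const])
    have "(\<lambda>n. (C * (t - s)\<^sup>2 * exp (c * (t - s))) * (1 / real n)) \<longlonglongrightarrow> (C * (t - s)\<^sup>2 * exp (c * (t - s))) * 0"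
      by (intro tendsto_mult_left lim_1_over_n)
    then show "(\<lambda>n. (C * (t - s)\<^sup>2 * exp (c * (t - s))) * (1 / real n)) \<longlonglongrightarrow> 0" by simp
    show "\<exists>N. \<forall>n\<ge>N. W t \<le> (C * (t - s)\<^sup>2 * exp (c * (t - s))) * (1 / real n)"
      using bound by (intro exI[of _ 1]) simp
  qed
  then show ?thesis using pos[OF t] by simp
qed

lemma vec_nth_borel: "(\<lambda>x :: real^'n. x $ l) \<in> borel_measurable borel"
  by (intro borel_measurable_continuous_onI continuous_intros)

section \<open>Dynkin's formula with a quadratic error\<close>

context jump_chain begin

text \<open>The generator of the chain. The sum may contain jumps that lead out of \<open>E\<close>,
  but at points of \<open>E\<close> their rate is 0.\<close>

definition gen :: "(real^'n \<Rightarrow> real) \<Rightarrow> real^'n \<Rightarrow> real" where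
  "gen f x = (\<Sum>u\<in>U. rate u x * (f (x + u) - f x))"

definition expect_on :: "'w set \<Rightarrow> (real^'n \<Rightarrow> real) \<Rightarrow> real \<Rightarrow> real" where
  "expect_on B f t = (\<integral>\<omega>. indicator B \<omega> * f (X t \<omega>) \<partial>P)"

lemma X_in_E: "\<omega> \<in> space P \<Longrightarrow> 0 \<le> t \<Longrightarrow> X t \<omega> \<in> E"
  using paths finite_path.range by blast

lemma fX_measurable: "0 \<le> t \<Longrightarrow> (\<lambda>\<omega>. f (X t \<omega>)) \<in> borel_measurable (Fi t)" for f :: "real^'n \<Rightarrow> real"
proof -
  assume t: "0 \<le> t"
  have "(\<lambda>\<omega>. \<Sum>x\<in>E. f x * indicator {\<omega>\<in>space P. X t \<omega> = x} \<omega>) \<in> borel_measurable (Fi t)"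
    by (intro borel_measurable_sum borel_measurable_times borel_measurable_const borel_measurable_indicator X_eq_sets t)
  moreover have "f (X t \<omega>) = (\<Sum>x\<in>E. f x * indicator {\<omega>\<in>space P. X t \<omega> = x} \<omega>)" if "\<omega> \<in> space (Fi t)" for \<omega>
  proof -
    have \<omega>: "\<omega> \<in> space P" using that space_Fi[OF t] by simp
    have "(\<Sum>x\<in>E. f x * indicator {\<omega>\<in>space P. X t \<omega> = x} \<omega>) = (\<Sum>x\<in>E. if x = X t \<omega> then f x else 0)"
      by (rule sum.cong) (use \<omega> in \<open>auto simp: indicator_def\<close>)
    then show ?thesis using X_in_E[OF \<omega> t] finite_E by simp
  qed
  ultimately show ?thesis by (subst measurable_cong) auto
qed

definition fmax :: "(real^'n \<Rightarrow> real) \<Rightarrow> real" where "fmax f = (\<Sum>x\<in>E. \<bar>f x\<bar>)"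

lemma fmax: "x \<in> E \<Longrightarrow> \<bar>f x\<bar> \<le> fmax f" "0 \<le> fmax f"
  unfolding fmax_def using finite_E by (auto intro!: member_le_sum[of x E "\<lambda>x. \<bar>f x\<bar>"] sum_nonneg)

lemma integrable_fX:
  fixes f :: "real^'n \<Rightarrow> real"
  assumes t: "0 \<le> t" and B: "B \<in> sets P"
  shows "integrable P (\<lambda>\<omega>. indicator B \<omega> * f (X t \<omega>))"
proof (rule Bochner_Integration.integrable_bound)
  show "integrable P (\<lambda>\<omega>. fmax f)" by simp
  show "(\<lambda>\<omega>. indicator B \<omega> * f (X t \<omega>)) \<in> borel_measurable P"
    by (intro borel_measurable_times borel_measurable_indicator B measurable_Fi[OF t fX_measurable[OF t]])
  show "AE \<omega> in P. norm (indicator B \<omega> * f (X t \<omega>)) \<le> norm (fmax f)"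
    using fmax X_in_E t by (intro AE_I2) (auto simp: indicator_def)
qed

text \<open>If no jump occurred, the compensator would grow by exactly
  \<open>h * gen f (X t)\<close>. Otherwise the error is at most \<open>h * fmax (gen f)\<close>
  times the number of jumps, whose expectation is again of order \<open>h\<close>. The bound is
  uniform in \<open>t\<close> and feeds \<open>euler_estimate_zero\<close> directly, without
  derivatives of expectations.\<close>

lemma dynkin_step:
  assumes B: "B \<in> sets (Fi t)" and t: "0 \<le> t" and h: "0 \<le> h"
  shows "\<bar>expect_on B f (t + h) - expect_on B f t - h * expect_on B (gen f) t\<bar> \<le> fmax (gen f) * (kmax (\<lambda>_ _. 1) * total_rate) * h\<^sup>2"
proof -
  have th: "0 \<le> t + h" "t \<le> t + h" using t h by auto
  have BP: "B \<in> sets P" by (rule sets_Fi[OF t B])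
  define k where "k x u = f (x + u) - f x" for x u
  have Jk: "J k (t + h) \<omega> - J k t \<omega> = f (X (t + h) \<omega>) - f (X t \<omega>)" if \<omega>: "\<omega> \<in> space P" for \<omega>
  proof -
    interpret finite_path "\<lambda>t. X t \<omega>" E by (rule paths[OF \<omega>])
    have "f (X (t + h) \<omega>) - f (X t \<omega>) = (\<Sum>r\<in>jumps \<omega> t (t + h). f (X r \<omega>) - f (Xm \<omega> r))" by (rule telescope[OF t th(2)])
    then show ?thesis unfolding J_diff[OF \<omega> t th(2)] by (simp add: k_def jump_def)
  qed
  let ?J1 = "J (\<lambda>_ _. 1)" and ?K = "kmax (\<lambda>_ _. 1) * total_rate"
  have comp: "(\<integral>\<omega>. indicator B \<omega> * (J k (t + h) \<omega> - J k t \<omega>) \<partial>P) = (\<integral>\<omega>. indicator B \<omega> * (A k (t + h) \<omega> - A k t \<omega>) \<partial>P)" for k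
    using jump_compensation[OF stopping_time_const[of "t + h"] th(1) B t th(2), of k] th by (simp add: min_absorb1)
  have Aint: "integrable P (\<lambda>\<omega>. indicator B \<omega> * (A k (t + h) \<omega> - A k t \<omega>))" for k
    using integrable_mult_indicator[OF BP Bochner_Integration.integrable_diff[OF
      stopped_integrable(2)[OF stopping_time_const[of "t + h"] th(1) th(1), of k] stopped_integrable(2)[OF stopping_time_const[of "t + h"] th(1) t, of k]]] th
    by (simp add: min_absorb1)
  have J1int: "integrable P (\<lambda>\<omega>. ?J1 (t + h) \<omega> - ?J1 t \<omega>)" using integrable_count t th by simp
  have J1: "(\<integral>\<omega>. ?J1 (t + h) \<omega> - ?J1 t \<omega> \<partial>P) \<le> ?K * h"
  proof -
    have "space P \<in> sets (Fi t)" using sets.top[of "Fi t"] space_Fi[OF t] by simp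
    from jump_compensation[OF stopping_time_const[of "t + h"] th(1) this t th(2), of "\<lambda>_ _. 1"]
    have "(\<integral>\<omega>. indicator (space P) \<omega> * (?J1 (t + h) \<omega> - ?J1 t \<omega>) \<partial>P) = (\<integral>\<omega>. indicator (space P) \<omega> * (A (\<lambda>_ _. 1) (t + h) \<omega> - A (\<lambda>_ _. 1) t \<omega>) \<partial>P)"
      using th by (simp add: min_absorb1)
    moreover have "(\<integral>\<omega>. indicator (space P) \<omega> * (A (\<lambda>_ _. 1) (t + h) \<omega> - A (\<lambda>_ _. 1) t \<omega>) \<partial>P) \<le> (\<integral>\<omega>. ?K * h \<partial>P)"
    proof (rule integral_mono)
      show "integrable P (\<lambda>\<omega>. indicator (space P) \<omega> * (A (\<lambda>_ _. 1) (t + h) \<omega> - A (\<lambda>_ _. 1) t \<omega>))"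
        using Bochner_Integration.integrable_diff[OF
          stopped_integrable(2)[OF stopping_time_const[of "t + h"] th(1) th(1), of "\<lambda>_ _. 1"] stopped_integrable(2)[OF stopping_time_const[of "t + h"] th(1) t, of "\<lambda>_ _. 1"]] th
          integrable_mult_indicator[OF sets.top, of P "\<lambda>\<omega>. A (\<lambda>_ _. 1) (t + h) \<omega> - A (\<lambda>_ _. 1) t \<omega>"]
        by (simp add: min_absorb1)
      fix \<omega> assume \<omega>: "\<omega> \<in> space P"
      show "indicator (space P) \<omega> * (A (\<lambda>_ _. 1) (t + h) \<omega> - A (\<lambda>_ _. 1) t \<omega>) \<le> ?K * h"
        using A_variation[OF \<omega> t th(2), of "\<lambda>_ _. 1"] \<omega> by simp
    qed simp
    moreover have "(\<integral>\<omega>. indicator (space P) \<omega> * (?J1 (t + h) \<omega> - ?J1 t \<omega>) \<partial>P) = (\<integral>\<omega>. ?J1 (t + h) \<omega> - ?J1 t \<omega> \<partial>P)"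
      by (rule Bochner_Integration.integral_cong) auto
    ultimately show ?thesis by (simp add: prob_space)
  qed
  have est: "\<bar>(A k (t + h) \<omega> - A k t \<omega>) - h * gen f (X t \<omega>)\<bar> \<le> fmax (gen f) * (h * (?J1 (t + h) \<omega> - ?J1 t \<omega>))" if \<omega>: "\<omega> \<in> space P" for \<omega>
  proof -
    interpret finite_path "\<lambda>t. X t \<omega>" E by (rule paths[OF \<omega>])
    \<comment> \<open>Without a jump the occupation time of the state \<open>X t\<close> grows by
      exactly \<open>h\<close>; with a jump the error of at most \<open>h\<close> is covered by the
      count, which is then at least 1.\<close>
    have occ_est: "\<bar>(occ x (t + h) \<omega> - occ x t \<omega>) - (if x = X t \<omega> then h else 0)\<bar> \<le> h * (?J1 (t + h) \<omega> - ?J1 t \<omega>)" for x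
    proof (cases "jumps \<omega> t (t + h) = {}")
      case True
      have Xc: "Xm \<omega> v = X t \<omega>" if v: "t < v" "v \<le> t + h" for v
        by (rule left_lim_without_jumps[OF t v(1)]) (use True v in \<open>auto simp: jump_times_def\<close>)
      have "{v. t < v \<and> v \<le> t + h \<and> Xm \<omega> v = x} = (if x = X t \<omega> then {t<..t + h} else {})"
        using Xc by auto
      then have "occ x (t + h) \<omega> - occ x t \<omega> = (if x = X t \<omega> then h else 0)"
        unfolding occ_diff(1)[OF \<omega> t th(2)] using h by simp
      then show ?thesis using True by (simp add: J_diff[OF \<omega> t th(2)])
    next
      case False
      have "1 \<le> card (jumps \<omega> t (t + h))" using False finite_jump_times[OF t] by (simp add: Suc_leI card_gt_0_iff)
      then have "1 \<le> ?J1 (t + h) \<omega> - ?J1 t \<omega>" unfolding J_diff[OF \<omega> t th(2)] by simp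
      then have "h * 1 \<le> h * (?J1 (t + h) \<omega> - ?J1 t \<omega>)" using h by (intro mult_left_mono)
      moreover have "\<bar>(occ x (t + h) \<omega> - occ x t \<omega>) - (if x = X t \<omega> then h else 0)\<bar> \<le> h"
        using occ_diff(3,4)[OF \<omega> t th(2), of x] by auto
      ultimately show ?thesis by simp
    qed
    have "A k (t + h) \<omega> - A k t \<omega> = (\<Sum>x\<in>E. gen f x * (occ x (t + h) \<omega> - occ x t \<omega>))"
      unfolding A_diff gen_def by (simp add: k_def sum_distrib_right)
    moreover have "h * gen f (X t \<omega>) = (\<Sum>x\<in>E. gen f x * (if x = X t \<omega> then h else 0))"
    proof -
      have "(\<Sum>x\<in>E. gen f x * (if x = X t \<omega> then h else 0)) = (\<Sum>x\<in>E. if x = X t \<omega> then gen f x * h else 0)"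
        by (rule sum.cong) auto
      then show ?thesis using range[OF t] finite_E by simp
    qed
    ultimately have eq: "(A k (t + h) \<omega> - A k t \<omega>) - h * gen f (X t \<omega>) =
      (\<Sum>x\<in>E. gen f x * ((occ x (t + h) \<omega> - occ x t \<omega>) - (if x = X t \<omega> then h else 0)))"
      by (simp add: sum_subtractf right_diff_distrib)
    show ?thesis
      unfolding eq fmax_def sum_distrib_right
      by (intro order_trans[OF sum_abs] sum_mono) (simp only: abs_mult, intro mult_left_mono occ_est abs_ge_zero)
  qed
  have "expect_on B f (t + h) - expect_on B f t = (\<integral>\<omega>. indicator B \<omega> * (J k (t + h) \<omega> - J k t \<omega>) \<partial>P)"
  proof -
    have "expect_on B f (t + h) - expect_on B f t = (\<integral>\<omega>. indicator B \<omega> * f (X (t + h) \<omega>) - indicator B \<omega> * f (X t \<omega>) \<partial>P)"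
      unfolding expect_on_def by (rule Bochner_Integration.integral_diff[symmetric]) (intro integrable_fX th t BP)+
    also have "\<dots> = (\<integral>\<omega>. indicator B \<omega> * (J k (t + h) \<omega> - J k t \<omega>) \<partial>P)"
      by (rule Bochner_Integration.integral_cong[OF refl]) (simp only: Jk right_diff_distrib)
    finally show ?thesis .
  qed
  also have "\<dots> = (\<integral>\<omega>. indicator B \<omega> * (A k (t + h) \<omega> - A k t \<omega>) \<partial>P)" by (rule comp)
  finally have main: "expect_on B f (t + h) - expect_on B f t - h * expect_on B (gen f) t =
    (\<integral>\<omega>. indicator B \<omega> * (A k (t + h) \<omega> - A k t \<omega>) - h * (indicator B \<omega> * gen f (X t \<omega>)) \<partial>P)"
    unfolding expect_on_def using Aint[of k] integrable_fX[OF t BP, of "gen f"] by simp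
  have "\<bar>\<integral>\<omega>. indicator B \<omega> * (A k (t + h) \<omega> - A k t \<omega>) - h * (indicator B \<omega> * gen f (X t \<omega>)) \<partial>P\<bar> \<le> (\<integral>\<omega>. fmax (gen f) * (h * (?J1 (t + h) \<omega> - ?J1 t \<omega>)) \<partial>P)"
  proof (rule order_trans[OF integral_abs_bound], rule integral_mono)
    show "integrable P (\<lambda>\<omega>. \<bar>indicator B \<omega> * (A k (t + h) \<omega> - A k t \<omega>) - h * (indicator B \<omega> * gen f (X t \<omega>))\<bar>)"
      using Aint[of k] integrable_fX[OF t BP, of "gen f"] by (intro integrable_abs Bochner_Integration.integrable_diff integrable_mult_right)
    show "integrable P (\<lambda>\<omega>. fmax (gen f) * (h * (?J1 (t + h) \<omega> - ?J1 t \<omega>)))" using J1int by (intro integrable_mult_right)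
    fix \<omega> assume \<omega>: "\<omega> \<in> space P"
    have "0 \<le> fmax (gen f) * (h * (?J1 (t + h) \<omega> - ?J1 t \<omega>))"
      using count_nonneg[OF \<omega> t th(2)] h fmax(2) by (intro mult_nonneg_nonneg) auto
    then show "\<bar>indicator B \<omega> * (A k (t + h) \<omega> - A k t \<omega>) - h * (indicator B \<omega> * gen f (X t \<omega>))\<bar> \<le> fmax (gen f) * (h * (?J1 (t + h) \<omega> - ?J1 t \<omega>))"
      using est[OF \<omega>] by (cases "\<omega> \<in> B") simp_all
  qed
  also have "\<dots> = fmax (gen f) * (h * (\<integral>\<omega>. ?J1 (t + h) \<omega> - ?J1 t \<omega> \<partial>P))" by simp
  also have "\<dots> \<le> fmax (gen f) * (h * (?K * h))" by (intro mult_left_mono J1 h fmax)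
  also have "\<dots> = fmax (gen f) * ?K * h\<^sup>2" by (simp add: power2_eq_square mult_ac)
  finally show ?thesis unfolding main .
qed

section \<open>Coordinates that are moved by separate jumps\<close>

context
  fixes i j :: 'n and U1 U2 :: "(real^'n) set" and r :: "real^'n \<Rightarrow> real \<Rightarrow> real"
  assumes U12: "U1 \<subseteq> U" "U2 \<subseteq> U" "U1 \<inter> U2 = {}"
    and rate0: "\<And>x u. x \<in> E \<Longrightarrow> u \<in> U - U1 - U2 \<Longrightarrow> rate u x = 0"
    and rate1: "\<And>x u. x \<in> E \<Longrightarrow> u \<in> U1 \<Longrightarrow> u $ j = 0 \<and> rate u x = r u (x $ i)"
    and rate2: "\<And>x u. x \<in> E \<Longrightarrow> u \<in> U2 \<Longrightarrow> u $ i = 0 \<and> rate u x = r u (x $ j)"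
begin

text \<open>\<open>G1\<close> and \<open>G2\<close> are the generators of the two coordinates as
  chains of their own, acting on functions of one real variable.\<close>

definition G1 :: "(real \<Rightarrow> real) \<Rightarrow> real \<Rightarrow> real" where "G1 \<alpha> y = (\<Sum>u\<in>U1. r u y * (\<alpha> (y + u $ i) - \<alpha> y))"
definition G2 :: "(real \<Rightarrow> real) \<Rightarrow> real \<Rightarrow> real" where "G2 \<beta> y = (\<Sum>u\<in>U2. r u y * (\<beta> (y + u $ j) - \<beta> y))"

text \<open>A product rule without a cross term, because no jump of positive rate moves both
  coordinates.\<close>

lemma gen_product:
  assumes x: "x \<in> E"
  shows "gen (\<lambda>x. \<alpha> (x $ i) * \<beta> (x $ j)) x = G1 \<alpha> (x $ i) * \<beta> (x $ j) + \<alpha> (x $ i) * G2 \<beta> (x $ j)"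
proof -
  let ?d = "\<lambda>u. rate u x * (\<alpha> ((x + u) $ i) * \<beta> ((x + u) $ j) - \<alpha> (x $ i) * \<beta> (x $ j))"
  have "gen (\<lambda>x. \<alpha> (x $ i) * \<beta> (x $ j)) x = (\<Sum>u\<in>U1 \<union> U2. ?d u)"
    unfolding gen_def by (rule sum.mono_neutral_right[OF finite_U]) (use U12 rate0[OF x] in auto)
  also have "\<dots> = (\<Sum>u\<in>U1. ?d u) + (\<Sum>u\<in>U2. ?d u)"
    using U12 finite_U finite_subset by (intro sum.union_disjoint) blast+
  also have "(\<Sum>u\<in>U1. ?d u) = G1 \<alpha> (x $ i) * \<beta> (x $ j)"
    unfolding G1_def sum_distrib_right by (rule sum.cong[OF refl]) (simp add: rate1[OF x] algebra_simps)
  also have "(\<Sum>u\<in>U2. ?d u) = \<alpha> (x $ i) * G2 \<beta> (x $ j)"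
    unfolding G2_def sum_distrib_left by (rule sum.cong[OF refl]) (simp add: rate2[OF x] algebra_simps)
  finally show ?thesis .
qed

text \<open>The covariance of a function of coordinate \<open>i\<close> and one of coordinate
  \<open>j\<close>, with the events \<open>B1\<close> and \<open>B2\<close> as additional factors.
  These events record the past of one coordinate each, so that independence of whole paths can be
  built up one time after the other.\<close>

definition Phi :: "'w set \<Rightarrow> 'w set \<Rightarrow> (real \<Rightarrow> real) \<Rightarrow> (real \<Rightarrow> real) \<Rightarrow> real \<Rightarrow> real" where
  "Phi B1 B2 \<alpha> \<beta> t = expect_on (B1 \<inter> B2) (\<lambda>x. \<alpha> (x $ i) * \<beta> (x $ j)) t - expect_on B1 (\<lambda>x. \<alpha> (x $ i)) t * expect_on B2 (\<lambda>x. \<beta> (x $ j)) t"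

lemma expect_on_cong: "0 \<le> t \<Longrightarrow> (\<And>x. x \<in> E \<Longrightarrow> f x = g x) \<Longrightarrow> expect_on B f t = expect_on B g t"
  unfolding expect_on_def by (rule Bochner_Integration.integral_cong) (simp_all add: X_in_E)

lemma expect_on_sum: "0 \<le> t \<Longrightarrow> B \<in> sets P \<Longrightarrow> finite I \<Longrightarrow> expect_on B (\<lambda>x. \<Sum>a\<in>I. c a * f a x) t = (\<Sum>a\<in>I. c a * expect_on B (f a) t)"
proof -
  assume t: "0 \<le> t" and B: "B \<in> sets P" and I: "finite I"
  have "expect_on B (\<lambda>x. \<Sum>a\<in>I. c a * f a x) t = (\<integral>\<omega>. (\<Sum>a\<in>I. c a * (indicator B \<omega> * f a (X t \<omega>))) \<partial>P)"
    unfolding expect_on_def by (rule Bochner_Integration.integral_cong) (simp_all add: sum_distrib_left mult_ac)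
  also have "\<dots> = (\<Sum>a\<in>I. c a * expect_on B (f a) t)"
    unfolding expect_on_def by (subst Bochner_Integration.integral_sum) (simp_all add: integrable_fX[OF t B])
  finally show ?thesis .
qed

lemma expect_on_add: "0 \<le> t \<Longrightarrow> B \<in> sets P \<Longrightarrow> expect_on B (\<lambda>x. f x + g x) t = expect_on B f t + expect_on B g t"
  unfolding expect_on_def using integrable_fX[of t B f] integrable_fX[of t B g] by (simp add: distrib_left)

lemma expect_on_bound: "0 \<le> t \<Longrightarrow> B \<in> sets P \<Longrightarrow> \<bar>expect_on B f t\<bar> \<le> fmax f"
proof -
  assume t: "0 \<le> t" and B: "B \<in> sets P"
  have "\<bar>expect_on B f t\<bar> \<le> (\<integral>\<omega>. fmax f \<partial>P)"
    unfolding expect_on_def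
  proof (rule order_trans[OF integral_abs_bound], rule integral_mono)
    show "integrable P (\<lambda>\<omega>. \<bar>indicator B \<omega> * f (X t \<omega>)\<bar>)" by (rule integrable_abs[OF integrable_fX[OF t B]])
    show "\<bar>indicator B \<omega> * f (X t \<omega>)\<bar> \<le> fmax f" if "\<omega> \<in> space P" for \<omega>
      using fmax(1)[OF X_in_E[OF that t], of f] fmax(2)[of f] by (simp add: indicator_def)
  qed simp
  then show ?thesis by (simp add: prob_space)
qed

text \<open>By \<open>gen_product\<close>, with the events omitted, the derivative of
  \<open>Phi \<alpha> \<beta>\<close> is
  \<open>Phi (G1 \<alpha>) \<beta> + Phi \<alpha> (G2 \<beta>)\<close>. The coordinates have
  finitely many values, so this is a closed linear system for the numbers
  \<open>Phi (e a) (e b)\<close>. The sum \<open>W\<close> of their absolute values starts at 0 and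
  satisfies the step inequality of \<open>euler_estimate_zero\<close>.\<close>

lemma Phi_zero_propagates:
  assumes s: "0 \<le> s" and B: "B1 \<in> sets (Fi s)" "B2 \<in> sets (Fi s)" and st: "s \<le> t"
    and zero: "\<And>\<alpha> \<beta>. Phi B1 B2 \<alpha> \<beta> s = 0"
  shows "Phi B1 B2 \<alpha> \<beta> t = 0"
proof -
  define I where "I = (\<lambda>x. x $ i) ` E"
  define I' where "I' = (\<lambda>x. x $ j) ` E"
  have finI: "finite I" "finite I'" using finite_E by (auto simp: I_def I'_def)
  define e where "e a y = (if y = a then 1 else 0 :: real)" for a y :: real
  define W where "W t = (\<Sum>a\<in>I. \<Sum>b\<in>I'. \<bar>Phi B1 B2 (e a) (e b) t\<bar>)" for t
  have BP: "B1 \<in> sets P" "B2 \<in> sets P" "B1 \<inter> B2 \<in> sets P" using B sets_Fi[OF s] by blast+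
  have BF: "B1 \<in> sets (Fi v)" "B2 \<in> sets (Fi v)" "B1 \<inter> B2 \<in> sets (Fi v)" if "s \<le> v" for v
    using B filtration_mono[OF s that] by blast+
  have expand: "Phi B1 B2 \<alpha> \<beta> v = (\<Sum>a\<in>I. \<Sum>b\<in>I'. \<alpha> a * \<beta> b * Phi B1 B2 (e a) (e b) v)" if v: "0 \<le> v" for \<alpha> \<beta> v
  proof -
    have ex: "\<alpha> y = (\<Sum>a\<in>I. \<alpha> a * e a y)" if "y \<in> I" for \<alpha> y
    proof -
      have "(\<Sum>a\<in>I. \<alpha> a * e a y) = (\<Sum>a\<in>I. if a = y then \<alpha> a else 0)" by (rule sum.cong) (auto simp: e_def)
      then show ?thesis using that finI by simp
    qed
    have ex': "\<beta> y = (\<Sum>a\<in>I'. \<beta> a * e a y)" if "y \<in> I'" for \<beta> y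
    proof -
      have "(\<Sum>a\<in>I'. \<beta> a * e a y) = (\<Sum>a\<in>I'. if a = y then \<beta> a else 0)" by (rule sum.cong) (auto simp: e_def)
      then show ?thesis using that finI by simp
    qed
    have "expect_on (B1 \<inter> B2) (\<lambda>x. \<alpha> (x $ i) * \<beta> (x $ j)) v = expect_on (B1 \<inter> B2) (\<lambda>x. \<Sum>p\<in>I \<times> I'. (\<alpha> (fst p) * \<beta> (snd p)) * (e (fst p) (x $ i) * e (snd p) (x $ j))) v"
    proof (rule expect_on_cong[OF v])
      fix x assume "x \<in> E"
      then have "x $ i \<in> I" "x $ j \<in> I'" by (auto simp: I_def I'_def)
      from ex[OF this(1), of \<alpha>] ex'[OF this(2), of \<beta>]
      have "\<alpha> (x $ i) * \<beta> (x $ j) = (\<Sum>a\<in>I. \<alpha> a * e a (x $ i)) * (\<Sum>b\<in>I'. \<beta> b * e b (x $ j))" by simp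
      then show "\<alpha> (x $ i) * \<beta> (x $ j) = (\<Sum>p\<in>I \<times> I'. (\<alpha> (fst p) * \<beta> (snd p)) * (e (fst p) (x $ i) * e (snd p) (x $ j)))"
        by (simp add: sum_product sum.cartesian_product split_beta mult_ac)
    qed
    also have "\<dots> = (\<Sum>p\<in>I \<times> I'. (\<alpha> (fst p) * \<beta> (snd p)) * expect_on (B1 \<inter> B2) (\<lambda>x. e (fst p) (x $ i) * e (snd p) (x $ j)) v)"
      by (rule expect_on_sum[OF v BP(3)]) (use finI in simp)
    finally have 1: "expect_on (B1 \<inter> B2) (\<lambda>x. \<alpha> (x $ i) * \<beta> (x $ j)) v =
      (\<Sum>a\<in>I. \<Sum>b\<in>I'. \<alpha> a * \<beta> b * expect_on (B1 \<inter> B2) (\<lambda>x. e a (x $ i) * e b (x $ j)) v)"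
      by (simp add: sum.cartesian_product split_beta)
    have "expect_on B1 (\<lambda>x. \<alpha> (x $ i)) v = expect_on B1 (\<lambda>x. \<Sum>a\<in>I. \<alpha> a * e a (x $ i)) v"
      by (rule expect_on_cong[OF v], rule ex) (simp add: I_def)
    also have "\<dots> = (\<Sum>a\<in>I. \<alpha> a * expect_on B1 (\<lambda>x. e a (x $ i)) v)" by (rule expect_on_sum[OF v BP(1) finI(1)])
    finally have 2: "expect_on B1 (\<lambda>x. \<alpha> (x $ i)) v = (\<Sum>a\<in>I. \<alpha> a * expect_on B1 (\<lambda>x. e a (x $ i)) v)" .
    have "expect_on B2 (\<lambda>x. \<beta> (x $ j)) v = expect_on B2 (\<lambda>x. \<Sum>a\<in>I'. \<beta> a * e a (x $ j)) v"
      by (rule expect_on_cong[OF v], rule ex') (simp add: I'_def)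
    also have "\<dots> = (\<Sum>a\<in>I'. \<beta> a * expect_on B2 (\<lambda>x. e a (x $ j)) v)" by (rule expect_on_sum[OF v BP(2) finI(2)])
    finally have 3: "expect_on B2 (\<lambda>x. \<beta> (x $ j)) v = (\<Sum>a\<in>I'. \<beta> a * expect_on B2 (\<lambda>x. e a (x $ j)) v)" .
    show ?thesis unfolding Phi_def 1 2 3 sum_product sum_subtractf[symmetric]
      by (intro sum.cong refl) (simp add: right_diff_distrib mult_ac)
  qed
  have Wbound: "\<bar>Phi B1 B2 \<alpha> \<beta> v\<bar> \<le> (\<Sum>a\<in>I. \<bar>\<alpha> a\<bar>) * (\<Sum>b\<in>I'. \<bar>\<beta> b\<bar>) * W v" if v: "0 \<le> v" for \<alpha> \<beta> v
  proof -
    have "\<bar>Phi B1 B2 \<alpha> \<beta> v\<bar> \<le> (\<Sum>a\<in>I. \<Sum>b\<in>I'. \<bar>\<alpha> a * \<beta> b * Phi B1 B2 (e a) (e b) v\<bar>)"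
      unfolding expand[OF v, of \<alpha> \<beta>] by (intro order_trans[OF sum_abs] sum_mono sum_abs)
    also have "\<dots> \<le> (\<Sum>a\<in>I. \<Sum>b\<in>I'. \<bar>\<alpha> a\<bar> * \<bar>\<beta> b\<bar> * W v)"
    proof (intro sum_mono)
      fix a b assume ab: "a \<in> I" "b \<in> I'"
      have "\<bar>Phi B1 B2 (e a) (e b) v\<bar> \<le> (\<Sum>b\<in>I'. \<bar>Phi B1 B2 (e a) (e b) v\<bar>)"
        using ab finI by (intro member_le_sum[of b I' "\<lambda>b. \<bar>Phi B1 B2 (e a) (e b) v\<bar>"]) auto
      also have "\<dots> \<le> W v" unfolding W_def
        using ab finI by (intro member_le_sum[of a I "\<lambda>a. \<Sum>b\<in>I'. \<bar>Phi B1 B2 (e a) (e b) v\<bar>"]) (auto intro: sum_nonneg)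
      finally show "\<bar>\<alpha> a * \<beta> b * Phi B1 B2 (e a) (e b) v\<bar> \<le> \<bar>\<alpha> a\<bar> * \<bar>\<beta> b\<bar> * W v"
        unfolding abs_mult by (intro mult_left_mono) auto
    qed
    also have "\<dots> = (\<Sum>a\<in>I. \<bar>\<alpha> a\<bar>) * (\<Sum>b\<in>I'. \<bar>\<beta> b\<bar>) * W v"
      by (subst sum_product) (simp only: sum_distrib_right)
    finally show ?thesis .
  qed
  let ?K = "kmax (\<lambda>_ _. 1) * total_rate"
  have K0: "0 \<le> ?K" using kmax(2) total_rate_nonneg by simp
  have Phi_step: "\<exists>c C. 0 \<le> c \<and> 0 \<le> C \<and> (\<forall>v h. s \<le> v \<longrightarrow> 0 \<le> h \<longrightarrow>
      \<bar>Phi B1 B2 \<alpha> \<beta> (v + h)\<bar> \<le> \<bar>Phi B1 B2 \<alpha> \<beta> v\<bar> + h * (c * W v) + C * h\<^sup>2)" for \<alpha> \<beta>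
  proof -
    let ?ab = "\<lambda>x. \<alpha> (x $ i) * \<beta> (x $ j)" and ?a = "\<lambda>x. \<alpha> (x $ i)" and ?b = "\<lambda>x. \<beta> (x $ j)"
    let ?ga = "\<lambda>x. G1 \<alpha> (x $ i)" and ?gb = "\<lambda>x. G2 \<beta> (x $ j)"
    have gena: "gen ?a x = ?ga x" "gen ?b x = ?gb x" if "x \<in> E" for x
      using gen_product[OF that, of \<alpha> "\<lambda>_. 1"] gen_product[OF that, of "\<lambda>_. 1" \<beta>] by (simp_all add: G1_def G2_def)
    define Cab where "Cab = fmax (gen ?ab) * ?K"
    define Ca where "Ca = fmax (gen ?a) * ?K"
    define Cb where "Cb = fmax (gen ?b) * ?K"
    have C0: "0 \<le> Cab" "0 \<le> Ca" "0 \<le> Cb" using fmax(2) K0 by (auto simp: Cab_def Ca_def Cb_def)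
    define c where "c = (\<Sum>a\<in>I. \<bar>G1 \<alpha> a\<bar>) * (\<Sum>b\<in>I'. \<bar>\<beta> b\<bar>) + (\<Sum>a\<in>I. \<bar>\<alpha> a\<bar>) * (\<Sum>b\<in>I'. \<bar>G2 \<beta> b\<bar>)"
    \<comment> \<open>A Lipschitz constant for the change from \<open>b0\<close> to
      \<open>b1\<close>: for \<open>h \<le> 1\<close> the quadratic error is at most linear in
      \<open>h\<close>, and for larger \<open>h\<close> the difference is at most
      \<open>2 * fmax ?b\<close> anyway.\<close>
    define Lb where "Lb = Cb + fmax ?gb + 2 * fmax ?b"
    define C where "C = Cab + (Ca * fmax ?b + fmax ?a * Cb + fmax ?ga * Lb)"
    have c0: "0 \<le> c" unfolding c_def by (intro add_nonneg_nonneg mult_nonneg_nonneg sum_nonneg) auto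
    have C0': "0 \<le> C" unfolding C_def Lb_def using C0 fmax(2) by (intro add_nonneg_nonneg mult_nonneg_nonneg) auto
    have "\<bar>Phi B1 B2 \<alpha> \<beta> (v + h)\<bar> \<le> \<bar>Phi B1 B2 \<alpha> \<beta> v\<bar> + h * (c * W v) + C * h\<^sup>2" if v: "s \<le> v" and h: "0 \<le> h" for v h
    proof -
      have v0: "0 \<le> v" "0 \<le> v + h" using v s h by auto
      have 1: "\<bar>expect_on (B1 \<inter> B2) ?ab (v + h) - expect_on (B1 \<inter> B2) ?ab v - h * (expect_on (B1 \<inter> B2) (\<lambda>x. ?ga x * ?b x) v + expect_on (B1 \<inter> B2) (\<lambda>x. ?a x * ?gb x) v)\<bar> \<le> Cab * h\<^sup>2"
      proof -
        have "expect_on (B1 \<inter> B2) (gen ?ab) v = expect_on (B1 \<inter> B2) (\<lambda>x. ?ga x * ?b x + ?a x * ?gb x) v"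
          by (rule expect_on_cong[OF v0(1) gen_product])
        then show ?thesis using dynkin_step[OF BF(3)[OF v] v0(1) h, of ?ab] unfolding expect_on_add[OF v0(1) BP(3)] Cab_def by simp
      qed
      have 2: "\<bar>expect_on B1 ?a (v + h) - expect_on B1 ?a v - h * expect_on B1 ?ga v\<bar> \<le> Ca * h\<^sup>2"
        using dynkin_step[OF BF(1)[OF v] v0(1) h, of ?a] expect_on_cong[OF v0(1) gena(1), where B=B1] unfolding Ca_def by simp
      have 3: "\<bar>expect_on B2 ?b (v + h) - expect_on B2 ?b v - h * expect_on B2 ?gb v\<bar> \<le> Cb * h\<^sup>2"
        using dynkin_step[OF BF(2)[OF v] v0(1) h, of ?b] expect_on_cong[OF v0(1) gena(2), where B=B2] unfolding Cb_def by simp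
      define a0 a1 g b0 b1 k where "a0 = expect_on B1 ?a v" and "a1 = expect_on B1 ?a (v + h)" and "g = expect_on B1 ?ga v"
        and "b0 = expect_on B2 ?b v" and "b1 = expect_on B2 ?b (v + h)" and "k = expect_on B2 ?gb v"
      have bd: "\<bar>a0\<bar> \<le> fmax ?a" "\<bar>b1\<bar> \<le> fmax ?b" "\<bar>g\<bar> \<le> fmax ?ga" "\<bar>k\<bar> \<le> fmax ?gb" "\<bar>b0\<bar> \<le> fmax ?b"
        unfolding a0_def b0_def b1_def g_def k_def by (intro expect_on_bound v0 BP)+
      have e1: "\<bar>a1 - a0 - h * g\<bar> \<le> Ca * h\<^sup>2" and e2: "\<bar>b1 - b0 - h * k\<bar> \<le> Cb * h\<^sup>2"
        using 2 3 by (simp_all add: a0_def a1_def b0_def b1_def g_def k_def)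
      have b_lip: "\<bar>b1 - b0\<bar> \<le> Lb * h"
      proof (cases "h \<le> 1")
        case True
        have "h\<^sup>2 \<le> h" using h True by (simp add: power2_eq_square mult_left_le)
        then have "Cb * h\<^sup>2 \<le> Cb * h" using C0(3) by (intro mult_left_mono)
        moreover have "\<bar>h * k\<bar> \<le> fmax ?gb * h"
          unfolding abs_mult using mult_left_mono[OF bd(4) h] h by (simp add: mult.commute)
        moreover have "0 \<le> 2 * fmax ?b * h" using h fmax(2) by simp
        ultimately show ?thesis using e2 unfolding Lb_def distrib_right by linarith
      next
        case False
        have "0 \<le> (Cb + fmax ?gb) * h" using h fmax(2) C0(3) by (intro mult_nonneg_nonneg add_nonneg_nonneg) auto
        moreover have "2 * fmax ?b * 1 \<le> 2 * fmax ?b * h" using False fmax(2) by (intro mult_left_mono) auto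
        ultimately show ?thesis using bd(2,5) unfolding Lb_def by (simp add: distrib_right)
      qed
      have prod: "\<bar>a1 * b1 - a0 * b0 - h * (g * b0 + a0 * k)\<bar> \<le> (Ca * fmax ?b + fmax ?a * Cb + fmax ?ga * Lb) * h\<^sup>2"
      proof -
        \<comment> \<open>The product rule for increments: the first two terms carry the errors of
          the two factors, and the last one is quadratic in \<open>h\<close> by
          \<open>b_lip\<close>.\<close>
        have "a1 * b1 - a0 * b0 - h * (g * b0 + a0 * k) = (a1 - a0 - h * g) * b1 + a0 * (b1 - b0 - h * k) + h * g * (b1 - b0)"
          by (simp add: algebra_simps)
        also have "\<bar>\<dots>\<bar> \<le> \<bar>a1 - a0 - h * g\<bar> * \<bar>b1\<bar> + \<bar>a0\<bar> * \<bar>b1 - b0 - h * k\<bar> + (h * \<bar>g\<bar>) * \<bar>b1 - b0\<bar>"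
          using h by (intro order_trans[OF abs_triangle_ineq] add_mono) (simp_all add: abs_mult)
        also have "\<dots> \<le> (Ca * h\<^sup>2) * fmax ?b + fmax ?a * (Cb * h\<^sup>2) + (h * fmax ?ga) * (Lb * h)"
          using h C0 fmax(2) by (intro add_mono mult_mono e1 e2 bd b_lip mult_left_mono) auto
        finally show ?thesis by (simp add: power2_eq_square algebra_simps)
      qed
      have Phis: "Phi B1 B2 \<alpha> \<beta> (v + h) = expect_on (B1 \<inter> B2) ?ab (v + h) - a1 * b1" "Phi B1 B2 \<alpha> \<beta> v = expect_on (B1 \<inter> B2) ?ab v - a0 * b0"
        "Phi B1 B2 (G1 \<alpha>) \<beta> v = expect_on (B1 \<inter> B2) (\<lambda>x. ?ga x * ?b x) v - g * b0" "Phi B1 B2 \<alpha> (G2 \<beta>) v = expect_on (B1 \<inter> B2) (\<lambda>x. ?a x * ?gb x) v - a0 * k"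
        by (simp_all add: Phi_def a0_def a1_def b0_def b1_def g_def k_def)
      have lin: "\<bar>Phi B1 B2 (G1 \<alpha>) \<beta> v + Phi B1 B2 \<alpha> (G2 \<beta>) v\<bar> \<le> c * W v"
        using Wbound[OF v0(1), of "G1 \<alpha>" \<beta>] Wbound[OF v0(1), of \<alpha> "G2 \<beta>"] unfolding c_def distrib_right by linarith
      have "\<bar>h * (Phi B1 B2 (G1 \<alpha>) \<beta> v + Phi B1 B2 \<alpha> (G2 \<beta>) v)\<bar> \<le> h * (c * W v)"
        unfolding abs_mult using lin h by (simp add: mult_left_mono)
      then have "\<bar>h * (expect_on (B1 \<inter> B2) (\<lambda>x. ?ga x * ?b x) v + expect_on (B1 \<inter> B2) (\<lambda>x. ?a x * ?gb x) v) - h * (g * b0 + a0 * k)\<bar> \<le> h * (c * W v)"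
        unfolding Phis by (simp add: algebra_simps)
      then show ?thesis using 1 prod unfolding Phis C_def distrib_right by linarith
    qed
    then show ?thesis using c0 C0' by blast
  qed
  then obtain c C where cC: "\<And>\<alpha> \<beta>. 0 \<le> c \<alpha> \<beta>" "\<And>\<alpha> \<beta>. 0 \<le> C \<alpha> \<beta>"
    "\<And>\<alpha> \<beta> v h. s \<le> v \<Longrightarrow> 0 \<le> h \<Longrightarrow> \<bar>Phi B1 B2 \<alpha> \<beta> (v + h)\<bar> \<le> \<bar>Phi B1 B2 \<alpha> \<beta> v\<bar> + h * (c \<alpha> \<beta> * W v) + C \<alpha> \<beta> * h\<^sup>2"
    by metis
  have "W t = 0"
  proof (rule euler_estimate_zero[where W=W and t=t and s=s and c="\<Sum>a\<in>I. \<Sum>b\<in>I'. c (e a) (e b)" and C="\<Sum>a\<in>I. \<Sum>b\<in>I'. C (e a) (e b)"])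
    show "W s = 0" by (simp add: W_def zero)
    show "0 \<le> W t" for t unfolding W_def by (intro sum_nonneg) simp
    show "0 \<le> (\<Sum>a\<in>I. \<Sum>b\<in>I'. c (e a) (e b))" "0 \<le> (\<Sum>a\<in>I. \<Sum>b\<in>I'. C (e a) (e b))" by (intro sum_nonneg cC)+
    fix v h :: real assume "s \<le> v" "0 \<le> h"
    then have "W (v + h) \<le> (\<Sum>a\<in>I. \<Sum>b\<in>I'. \<bar>Phi B1 B2 (e a) (e b) v\<bar> + h * (c (e a) (e b) * W v) + C (e a) (e b) * h\<^sup>2)"
      unfolding W_def[of "v + h"] by (intro sum_mono cC)
    also have "\<dots> = (1 + (\<Sum>a\<in>I. \<Sum>b\<in>I'. c (e a) (e b)) * h) * W v + (\<Sum>a\<in>I. \<Sum>b\<in>I'. C (e a) (e b)) * h\<^sup>2"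
      by (simp add: sum.distrib sum_distrib_left[symmetric] sum_distrib_right[symmetric] W_def[symmetric] distrib_right mult_ac) (simp add: algebra_simps)
    finally show "W (v + h) \<le> (1 + (\<Sum>a\<in>I. \<Sum>b\<in>I'. c (e a) (e b)) * h) * W v + (\<Sum>a\<in>I. \<Sum>b\<in>I'. C (e a) (e b)) * h\<^sup>2" .
  qed (rule st)
  then show ?thesis using Wbound[of t \<alpha> \<beta>] s st by simp
qed

text \<open>Induction on the largest time \<open>b\<close>. \<open>Phi\<close> vanishes at time
  \<open>b\<close> by the induction hypothesis, which is available for all test functions, and
  \<open>Phi_zero_propagates\<close> carries this on to \<open>T\<close>. The deterministic start
  makes all covariances vanish at time 0.\<close>

lemma cylinder_factorization:
  assumes Ts: "finite Ts" "Ts \<subseteq> {0..}" and start: "AE \<omega> in P. X 0 \<omega> = x0" and T: "0 \<le> T" "\<forall>t\<in>Ts. t \<le> T"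
    and H: "\<And>t. H t \<in> sets borel" "\<And>t. H' t \<in> sets borel"
  shows "Phi {\<omega>\<in>space P. \<forall>t\<in>Ts. X t \<omega> $ i \<in> H t} {\<omega>\<in>space P. \<forall>t\<in>Ts. X t \<omega> $ j \<in> H' t} \<alpha> \<beta> T = 0"
  using Ts T
proof (induction Ts arbitrary: T \<alpha> \<beta> rule: finite_linorder_max_induct)
  case empty
  have full: "space P \<in> sets (Fi 0)" using sets.top[of "Fi 0"] space_Fi[of 0] by simp
  have start_value: "expect_on (space P) f 0 = f x0" for f
  proof -
    have "expect_on (space P) f 0 = (\<integral>\<omega>. f x0 \<partial>P)"
      unfolding expect_on_def
    proof (rule integral_cong_AE)
      show "(\<lambda>\<omega>. indicator (space P) \<omega> * f (X 0 \<omega>)) \<in> borel_measurable P"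
        using integrable_fX[of 0 "space P" f] by (intro borel_measurable_integrable) simp
      show "AE \<omega> in P. indicator (space P) \<omega> * f (X 0 \<omega>) = f x0"
        using start AE_space by eventually_elim simp
    qed simp
    then show ?thesis by (simp add: prob_space)
  qed
  show ?case
    by (rule Phi_zero_propagates[of 0]) (use empty full start_value in \<open>simp_all add: Phi_def\<close>)
next
  case (insert b A)
  let ?B1 = "\<lambda>Ts. {\<omega>\<in>space P. \<forall>t\<in>Ts. X t \<omega> $ i \<in> H t}" and ?B2 = "\<lambda>Ts. {\<omega>\<in>space P. \<forall>t\<in>Ts. X t \<omega> $ j \<in> H' t}"
  have b0: "0 \<le> b" and A0: "A \<subseteq> {0..}" using insert.prems by auto
  have coord: "{\<omega>\<in>space P. X t \<omega> $ l \<in> V} \<in> sets (Fi t')" if "0 \<le> t" "t \<le> t'" "V \<in> sets borel" for t t' l V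
  proof -
    have t': "0 \<le> t'" using that by simp
    have "X t \<in> borel_measurable (Fi t')" using X_adapted that measurable_Fi_mono[of t t' "X t"] by (simp add: adapted_def)
    then have "(\<lambda>\<omega>. X t \<omega> $ l) \<in> borel_measurable (Fi t')" by (rule measurable_compose[OF _ vec_nth_borel])
    from measurable_sets[OF this that(3)] show ?thesis
      using space_Fi[OF t'] by (simp add: vimage_def Int_def conj_commute)
  qed
  have cyl: "?B1 Ts \<in> sets (Fi b)" "?B2 Ts \<in> sets (Fi b)" if "finite Ts" "Ts \<subseteq> {0..b}" for Ts
  proof -
    have "space P \<in> sets (Fi b)" using sets.top[of "Fi b"] space_Fi[OF b0] by simp
    then have "space P \<inter> (\<Inter>t\<in>Ts. {\<omega>\<in>space P. X t \<omega> $ i \<in> H t}) \<in> sets (Fi b)"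
      "space P \<inter> (\<Inter>t\<in>Ts. {\<omega>\<in>space P. X t \<omega> $ j \<in> H' t}) \<in> sets (Fi b)"
      using that coord[of _ b] H by (cases "Ts = {}"; auto intro!: sets.Int sets.finite_INT)+
    moreover have "space P \<inter> (\<Inter>t\<in>Ts. {\<omega>\<in>space P. X t \<omega> $ i \<in> H t}) = ?B1 Ts" "space P \<inter> (\<Inter>t\<in>Ts. {\<omega>\<in>space P. X t \<omega> $ j \<in> H' t}) = ?B2 Ts" by auto
    ultimately show "?B1 Ts \<in> sets (Fi b)" "?B2 Ts \<in> sets (Fi b)" by simp_all
  qed
  have at_b: "Phi (?B1 (insert b A)) (?B2 (insert b A)) \<alpha> \<beta> b = 0" for \<alpha> \<beta>
  proof -
    \<comment> \<open>The constraints at time \<open>b\<close> are moved from the events into the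
      test functions.\<close>
    define \<alpha>' where "\<alpha>' y = indicator (H b) y * \<alpha> y" for y
    define \<beta>' where "\<beta>' y = indicator (H' b) y * \<beta> y" for y
    have ind: "indicator (?B1 (insert b A)) \<omega> = (indicator (?B1 A) \<omega> * indicator (H b) (X b \<omega> $ i) :: real)"
      "indicator (?B2 (insert b A)) \<omega> = (indicator (?B2 A) \<omega> * indicator (H' b) (X b \<omega> $ j) :: real)" for \<omega>
      by (auto simp: indicator_def)
    have "Phi (?B1 (insert b A)) (?B2 (insert b A)) \<alpha> \<beta> b = Phi (?B1 A) (?B2 A) \<alpha>' \<beta>' b"
      unfolding Phi_def expect_on_def \<alpha>'_def \<beta>'_def indicator_inter_arith ind by (simp add: mult_ac)
    also have "\<dots> = 0" using insert.IH[OF A0 b0] insert.hyps(2) by (simp add: less_imp_le)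
    finally show ?thesis .
  qed
  have "0 \<le> x" "x \<le> b" if "x \<in> A" for x
    using subsetD[OF A0 that] bspec[OF insert.hyps(2) that] by simp_all
  then have sub: "insert b A \<subseteq> {0..b}" using b0 by auto
  show ?case
    by (rule Phi_zero_propagates[OF b0 cyl[OF _ sub] _ at_b]) (use insert in simp_all)
qed

text \<open>Cylinder events form an intersection-stable generator of the sigma-field of a path, and
  for them independence is the vanishing of \<open>Phi\<close> with constant test functions.\<close>

lemma independent_coordinates:
  assumes start: "AE \<omega> in P. X 0 \<omega> = x0"
  shows "independent_processes P (\<lambda>t \<omega>. X t \<omega> $ i) (\<lambda>t \<omega>. X t \<omega> $ j)"
proof -
  let ?Y = "\<lambda>l \<omega>. \<lambda>t\<in>{0..}. X t \<omega> $ l"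
  let ?M = "PiM {0..} (\<lambda>_. borel) :: (real \<Rightarrow> real) measure"
  define Gen where "Gen l = {?Y l -` A \<inter> space P | A. A \<in> prod_algebra {0..} (\<lambda>_. borel :: real measure)}" for l
  have meas: "?Y l \<in> measurable P ?M" for l
  proof (rule measurable_restrict)
    fix t :: real assume "t \<in> {0..}"
    then have "X t \<in> borel_measurable P" using adapted_measurable[OF X_adapted] by simp
    then show "(\<lambda>\<omega>. X t \<omega> $ l) \<in> borel_measurable P" by (rule measurable_compose[OF _ vec_nth_borel])
  qed
  have gen: "sigma_sets (space P) {?Y l -` A \<inter> space P | A. A \<in> sets ?M} = sigma_sets (space P) (Gen l)" for l
  proof -
    have "{?Y l -` A \<inter> space P | A. A \<in> sets ?M} = sigma_sets (space P) (Gen l)"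
      unfolding Gen_def sets_PiM by (rule sigma_sets_vimage_commute) auto
    moreover have "sigma_sets (space P) (sigma_sets (space P) (Gen l)) = sigma_sets (space P) (Gen l)"
      by (rule sigma_sets_sigma_sets_eq) (auto simp: Gen_def)
    ultimately show ?thesis by (simp only:)
  qed
  have GenE: "\<exists>Ts H. finite Ts \<and> Ts \<subseteq> {0..} \<and> (\<forall>t. H t \<in> sets borel) \<and> C = {\<omega>\<in>space P. \<forall>t\<in>Ts. X t \<omega> $ l \<in> H t}" if C: "C \<in> Gen l" for C l
  proof -
    obtain A where A: "A \<in> prod_algebra {0..} (\<lambda>_. borel :: real measure)" "C = ?Y l -` A \<inter> space P" using C by (auto simp: Gen_def)
    obtain Ts and H :: "real \<Rightarrow> real set" where Ts: "A = prod_emb {0..} (\<lambda>_. borel) Ts (Pi\<^sub>E Ts H)" "finite Ts" "Ts \<subseteq> {0..}" "\<And>t. t \<in> Ts \<Longrightarrow> H t \<in> sets borel"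
      using prod_algebraE[OF A(1)] by metis
    define H' where "H' t = (if t \<in> Ts then H t else UNIV)" for t
    have "C = {\<omega>\<in>space P. \<forall>t\<in>Ts. X t \<omega> $ l \<in> H' t}"
      unfolding A(2) Ts(1) prod_emb_def H'_def using Ts(3) by (auto simp: PiE_iff restrict_def extensional_def subset_iff)
    moreover have "H' t \<in> sets borel" for t using Ts(4) by (simp add: H'_def)
    ultimately show ?thesis using Ts(2,3) by blast
  qed
  have sub: "Gen l \<subseteq> events" for l
  proof
    fix C assume "C \<in> Gen l"
    then obtain A where "A \<in> prod_algebra {0..} (\<lambda>_. borel :: real measure)" "C = ?Y l -` A \<inter> space P" by (auto simp: Gen_def)
    then show "C \<in> events" using measurable_sets[OF meas[of l], of A] by (simp add: sets_PiM)
  qed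
  have indep: "indep_set (Gen i) (Gen j)"
  proof (rule indep_setI[OF sub sub])
    fix C C' assume C: "C \<in> Gen i" "C' \<in> Gen j"
    obtain Ts H where Ts: "finite Ts" "Ts \<subseteq> {0..}" "\<And>t. H t \<in> sets borel" "C = {\<omega>\<in>space P. \<forall>t\<in>Ts. X t \<omega> $ i \<in> H t}"
      using GenE[OF C(1)] by blast
    obtain Ts' H' where Ts': "finite Ts'" "Ts' \<subseteq> {0..}" "\<And>t. H' t \<in> sets borel" "C' = {\<omega>\<in>space P. \<forall>t\<in>Ts'. X t \<omega> $ j \<in> H' t}"
      using GenE[OF C(2)] by blast
    define T where "T = Max (insert 0 (Ts \<union> Ts'))"
    have T: "0 \<le> T" "\<forall>t\<in>Ts \<union> Ts'. t \<le> T" using Ts(1) Ts'(1) by (auto simp: T_def)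
    \<comment> \<open>Trivial constraints put both cylinders on a common set of times.\<close>
    define K where "K t = (if t \<in> Ts then H t else UNIV)" for t
    define K' where "K' t = (if t \<in> Ts' then H' t else UNIV)" for t
    have "Phi {\<omega>\<in>space P. \<forall>t\<in>Ts \<union> Ts'. X t \<omega> $ i \<in> K t} {\<omega>\<in>space P. \<forall>t\<in>Ts \<union> Ts'. X t \<omega> $ j \<in> K' t} (\<lambda>_. 1) (\<lambda>_. 1) T = 0"
      by (rule cylinder_factorization[OF _ _ start T]) (use Ts Ts' in \<open>auto simp: K_def K'_def\<close>)
    moreover have "{\<omega>\<in>space P. \<forall>t\<in>Ts \<union> Ts'. X t \<omega> $ i \<in> K t} = C" "{\<omega>\<in>space P. \<forall>t\<in>Ts \<union> Ts'. X t \<omega> $ j \<in> K' t} = C'"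
      unfolding Ts(4) Ts'(4) K_def K'_def by auto
    moreover have "C \<in> events" "C' \<in> events" using sub[of i] sub[of j] C by blast+
    ultimately show "prob (C \<inter> C') = prob C * prob C'" by (simp add: Phi_def expect_on_def)
  qed
  have stable: "Int_stable (Gen l)" for l
  proof (rule Int_stableI)
    fix a b assume "a \<in> Gen l" "b \<in> Gen l"
    then obtain A A' where A: "A \<in> prod_algebra {0..} (\<lambda>_. borel :: real measure)" "A' \<in> prod_algebra {0..} (\<lambda>_. borel :: real measure)"
      "a = ?Y l -` A \<inter> space P" "b = ?Y l -` A' \<inter> space P" by (auto simp: Gen_def)
    have "A \<inter> A' \<in> prod_algebra {0..} (\<lambda>_. borel :: real measure)" using Int_stable_prod_algebra A(1,2) unfolding Int_stable_def by blast
    moreover have "a \<inter> b = ?Y l -` (A \<inter> A') \<inter> space P" using A by auto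
    ultimately show "a \<inter> b \<in> Gen l" unfolding Gen_def by blast
  qed
  have "indep_set (sigma_sets (space P) (Gen i)) (sigma_sets (space P) (Gen j))"
    by (rule indep_set_sigma_sets[OF indep stable stable])
  then show ?thesis
    unfolding independent_processes_def indep_var_eq gen using meas by blast
qed

end

end

section \<open>Characteristics of the coordinates\<close>

text \<open>The image under the identity replaces the discrete sigma-field of the point measure by
  the Borel one. Negative masses count as 0.\<close>

definition two_atoms :: "real \<Rightarrow> real \<Rightarrow> (real^1) measure" where
  "two_atoms p q = distr (point_measure {vec 1, vec (-1)} (\<lambda>u. ennreal (if u = vec 1 then p else q))) borel (\<lambda>u. u)"

lemma vec1_neq: "(vec 1 :: real^1) \<noteq> vec (-1)"
  by (simp add: vec_eq_iff)

lemma two_atoms_nn_integral: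
  assumes "f \<in> borel_measurable borel"
  shows "(\<integral>\<^sup>+\<xi>. f \<xi> \<partial>two_atoms p q) = ennreal p * f (vec 1) + ennreal q * f (vec (-1))"
proof -
  have "(\<lambda>u. u) \<in> measurable (point_measure {vec 1, vec (-1)} (\<lambda>u. ennreal (if u = vec 1 then p else q))) (borel :: (real^1) measure)"
    by simp
  then show ?thesis
    unfolding two_atoms_def using assms vec1_neq
    by (simp add: nn_integral_distr nn_integral_point_measure_finite)
qed

lemma sets_two_atoms: "sets (two_atoms p q) = sets borel"
  by (simp add: two_atoms_def)

lemma emeasure_two_atoms:
  assumes "A \<in> sets borel"
  shows "emeasure (two_atoms p q) A = ennreal p * indicator A (vec 1) + ennreal q * indicator A (vec (-1))"
  using two_atoms_nn_integral[of "indicator A" p q] assms sets_two_atoms by simp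

lemma radon_two_atoms: "radon_measure (two_atoms p q)"
  unfolding radon_measure_def
proof (intro conjI allI impI)
  show "emeasure (two_atoms p q) {0} = 0" by (simp add: emeasure_two_atoms vec_eq_iff)
  fix K :: "(real^1) set" assume "compact K \<and> 0 \<notin> K"
  then have "K \<in> sets borel" by (auto intro: borel_compact)
  then show "emeasure (two_atoms p q) K < \<infinity>" by (auto simp: emeasure_two_atoms indicator_def)
qed (rule sets_two_atoms)

lemma measure_two_atoms:
  assumes "A \<in> sets borel" "0 \<le> p" "0 \<le> q"
  shows "measure (two_atoms p q) A = p * indicator A (vec 1) + q * indicator A (vec (-1))"
  using assms by (auto simp: measure_def emeasure_two_atoms indicator_def ennreal_plus[symmetric] simp del: ennreal_plus)

lemma cadlag_cong: "(\<And>t. 0 \<le> t \<Longrightarrow> f t = g t) \<Longrightarrow> cadlag f \<longleftrightarrow> cadlag g"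
proof -
  have *: "cadlag g" if eq: "\<And>t. 0 \<le> t \<Longrightarrow> f t = g t" and f: "cadlag f" for f g :: "real \<Rightarrow> 'a"
    unfolding cadlag_def
  proof safe
    fix t :: real assume t: "0 \<le> t"
    have ev: "eventually (\<lambda>s. f s = g s) (at_right t)"
      using eq t by (auto simp: eventually_at_right_field intro!: exI[of _ "t + 1"])
    have "(f \<longlongrightarrow> f t) (at_right t)" using f t by (simp add: cadlag_def)
    from Lim_transform_eventually[OF this ev] show "(g \<longlongrightarrow> g t) (at_right t)" using eq[OF t] by simp
  next
    fix t :: real assume t: "0 < t"
    have ev: "eventually (\<lambda>s. f s = g s) (at_left t)"
      using eq t by (auto simp: eventually_at_left_field intro!: exI[of _ 0])
    obtain l where "(f \<longlongrightarrow> l) (at_left t)" using f t by (auto simp: cadlag_def)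
    from Lim_transform_eventually[OF this ev] show "\<exists>l. (g \<longlongrightarrow> l) (at_left t)" ..
  qed
  assume "\<And>t. 0 \<le> t \<Longrightarrow> f t = g t"
  then show ?thesis using *[of f g] *[of g f] by metis
qed

lemma continuous_coordinate: "continuous_on UNIV (coordinate j)"
  unfolding coordinate_def[abs_def] vec_def by (intro continuous_intros)

lemma coordinate_diff: "coordinate j x - coordinate j y = coordinate j (x - y)"
  by (simp add: coordinate_def vec_eq_iff)

lemma coordinate_nth: "coordinate j x $ i = x $ j"
  by (simp add: coordinate_def)

lemma coordinate_eq_0: "coordinate j x = 0 \<longleftrightarrow> x $ j = 0"
  by (simp add: coordinate_def vec_eq_iff)

lemma coordinate_measurable: "coordinate j \<in> borel_measurable borel"
  by (rule borel_measurable_continuous_onI[OF continuous_coordinate])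

lemma cadlag_coordinate: "cadlag y \<Longrightarrow> cadlag (\<lambda>t. coordinate j (y t))"
  unfolding cadlag_def using continuous_on_tendsto_compose[OF continuous_coordinate] by (metis (mono_tags, lifting) UNIV_I eventuallyI)

lemma semimartingale_coordinate:
  assumes "semimartingale P Fi X"
  shows "semimartingale P Fi (\<lambda>t \<omega>. coordinate j (X t \<omega>))"
  unfolding semimartingale_def
proof (intro conjI allI)
  have "adapted Fi X" "AE \<omega> in P. cadlag (\<lambda>t. X t \<omega>)" using assms by (auto simp: semimartingale_def)
  then show "adapted Fi (\<lambda>t \<omega>. coordinate j (X t \<omega>))"
    using measurable_compose[OF _ coordinate_measurable] unfolding adapted_def by blast
  show "AE \<omega> in P. cadlag (\<lambda>t. coordinate j (X t \<omega>))"
    using \<open>AE \<omega> in P. cadlag (\<lambda>t. X t \<omega>)\<close> by (elim eventually_mono) (rule cadlag_coordinate)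
  fix i :: 1
  show "\<exists>N A. local_martingale P Fi N \<and> (AE \<omega> in P. N 0 \<omega> = 0) \<and> finite_variation P Fi A \<and>
      (AE \<omega> in P. \<forall>t\<ge>0. coordinate j (X t \<omega>) $ i = coordinate j (X 0 \<omega>) $ i + N t \<omega> + A t \<omega>)"
    using assms unfolding semimartingale_def coordinate_nth by blast
qed

context jump_chain begin

lemma coordinate_paths: "\<omega> \<in> space P \<Longrightarrow> finite_path (\<lambda>t. coordinate j (X t \<omega>)) (coordinate j ` E)"
proof -
  assume "\<omega> \<in> space P"
  then interpret finite_path "\<lambda>t. X t \<omega>" E by (rule paths)
  show ?thesis by standard (use cadlag_coordinate[OF cadlag] fin range in auto)
qed

lemma coordinate_left_lim:
  assumes \<omega>: "\<omega> \<in> space P" and t: "0 \<le> t"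
  shows "left_lim (\<lambda>t. coordinate j (X t \<omega>)) t = coordinate j (Xm \<omega> t)"
proof (cases "t = 0")
  case False
  then have t: "0 < t" using t by simp
  interpret finite_path "\<lambda>t. X t \<omega>" E by (rule paths[OF \<omega>])
  have "((\<lambda>t. coordinate j (X t \<omega>)) \<longlongrightarrow> coordinate j (Xm \<omega> t)) (at_left t)"
    by (rule continuous_on_tendsto_compose[OF continuous_coordinate left_tendsto[OF t]]) simp_all
  then have "Lim (at_left t) (\<lambda>t. coordinate j (X t \<omega>)) = coordinate j (Xm \<omega> t)"
    by (intro tendsto_Lim) (simp_all add: trivial_limit_at_left_real)
  then show ?thesis using t by (simp add: left_lim_def)
qed (simp add: left_lim_def)

lemma coordinate_jump: "\<omega> \<in> space P \<Longrightarrow> 0 \<le> t \<Longrightarrow> jump (\<lambda>t. coordinate j (X t \<omega>)) t = coordinate j (dX \<omega> t)"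
  by (simp add: jump_def coordinate_left_lim coordinate_diff)

context
  fixes j :: 'n and h1 :: "real^1 \<Rightarrow> real^1" and rp rm :: "real \<Rightarrow> real"
    and b1 :: "real^1 \<Rightarrow> real^1" and F1 :: "real^1 \<Rightarrow> (real^1) set \<Rightarrow> real"
  assumes h1: "truncation_function h1"
    and axes: "axis j 1 \<in> U" "axis j (-1) \<in> U"
    and rates: "\<And>x. x \<in> E \<Longrightarrow> rate (axis j 1) x = rp (x $ j)" "\<And>x. x \<in> E \<Longrightarrow> rate (axis j (-1)) x = rm (x $ j)"
    and no_other: "\<And>x u. x \<in> E \<Longrightarrow> u \<in> U \<Longrightarrow> u $ j \<noteq> 0 \<Longrightarrow> u \<noteq> axis j 1 \<Longrightarrow> u \<noteq> axis j (-1) \<Longrightarrow> rate u x = 0"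
    and b1: "\<And>y. b1 y = rp (y $ 1) *\<^sub>R h1 (vec 1) + rm (y $ 1) *\<^sub>R h1 (vec (-1))"
    and F1: "\<And>y. F1 y = (\<lambda>A. if A \<in> punctured_bounded then rp (y $ 1) * indicator A (vec 1) + rm (y $ 1) * indicator A (vec (-1)) else 0)"
begin

abbreviation Y where "Y \<equiv> \<lambda>t \<omega>. coordinate j (X t \<omega>)"

lemma h1_0: "h1 0 = 0"
  using h1 by (auto simp: truncation_function_def)

lemma rp_nonneg: "x \<in> E \<Longrightarrow> 0 \<le> rp (x $ j)" "x \<in> E \<Longrightarrow> 0 \<le> rm (x $ j)"
  using rates rate_nonneg[of x] axes zero_notin_U by metis+

lemma sum_rates:
  fixes f :: "real^'n \<Rightarrow> 'c::real_vector"
  assumes x: "x \<in> E" and f: "\<And>u. u $ j = 0 \<Longrightarrow> f u = 0"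
  shows "(\<Sum>u\<in>U. rate u x *\<^sub>R f u) = rp (x $ j) *\<^sub>R f (axis j 1) + rm (x $ j) *\<^sub>R f (axis j (-1))"
proof -
  have ne: "axis j 1 \<noteq> (axis j (-1) :: real^'n)" by (simp add: axis_eq_axis)
  have "(\<Sum>u\<in>U. rate u x *\<^sub>R f u) = (\<Sum>u\<in>{axis j 1, axis j (-1)}. rate u x *\<^sub>R f u)"
    by (rule sum.mono_neutral_right[OF finite_U]) (use axes no_other[OF x] f in auto)
  then show ?thesis using ne rates[OF x] by simp
qed

lemma measure_from_F1: "x \<in> E \<Longrightarrow> measure_from (F1 (coordinate j x)) = two_atoms (rp (x $ j)) (rm (x $ j))"
  "x \<in> E \<Longrightarrow> is_positive (F1 (coordinate j x))"
proof -
  assume x: "x \<in> E"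
  have eq: "set_function (two_atoms (rp (x $ j)) (rm (x $ j))) = F1 (coordinate j x)"
  proof
    fix A :: "(real^1) set"
    have "A \<in> punctured_bounded \<Longrightarrow> A \<in> sets borel" by (simp add: punctured_bounded_def)
    then show "set_function (two_atoms (rp (x $ j)) (rm (x $ j))) A = F1 (coordinate j x) A"
      by (simp add: set_function_def F1 coordinate_nth measure_two_atoms rp_nonneg[OF x])
  qed
  show "measure_from (F1 (coordinate j x)) = two_atoms (rp (x $ j)) (rm (x $ j))"
    by (rule measure_from_eqI[OF radon_two_atoms eq])
  show "is_positive (F1 (coordinate j x))" unfolding is_positive_def using radon_two_atoms eq by blast
qed

lemma coordinate_kernel: "finite_state_kernel P Fi Y (coordinate j ` E) F1"
proof -
  have "adapted Fi Y"
    using X_adapted measurable_compose[OF _ coordinate_measurable] unfolding adapted_def by blast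
  with coordinate_paths have "finite_state_process P Fi Y (coordinate j ` E)"
    by (intro finite_state_process.intro finite_state_process_axioms.intro filtered_prob_space_axioms)
  then show ?thesis
    by (rule finite_state_kernel.intro, intro finite_state_kernel_axioms.intro) (elim imageE, simp only: measure_from_F1(2))
qed

text \<open>Reads an integrand for the coordinate as one for \<open>X\<close>. The value 0 on jumps
  with vanishing component \<open>j\<close> is there because the coordinate does not jump at such
  times.\<close>

definition pull :: "(('w \<times> real) \<times> (real^1) \<Rightarrow> ennreal) \<Rightarrow> ('w \<times> real) \<times> (real^'n) \<Rightarrow> ennreal" where
  "pull W z = (if snd z $ j = 0 then 0 else W (fst z, coordinate j (snd z)))"

lemma pull_measurable:
  assumes "W \<in> borel_measurable (predictable_sigma P Fi \<Otimes>\<^sub>M borel)"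
  shows "pull W \<in> borel_measurable (predictable_sigma P Fi \<Otimes>\<^sub>M borel)"
proof -
  have c: "(\<lambda>z. snd z $ j) \<in> borel_measurable (predictable_sigma P Fi \<Otimes>\<^sub>M (borel :: (real^'n) measure))"
    by (rule measurable_compose[OF measurable_snd vec_nth_borel])
  have "(\<lambda>z. (fst z, coordinate j (snd z))) \<in> measurable (predictable_sigma P Fi \<Otimes>\<^sub>M borel) (predictable_sigma P Fi \<Otimes>\<^sub>M borel)"
    by (intro measurable_Pair measurable_fst measurable_compose[OF measurable_snd coordinate_measurable])
  from measurable_compose[OF this assms]
  have W: "(\<lambda>z. W (fst z, coordinate j (snd z))) \<in> borel_measurable (predictable_sigma P Fi \<Otimes>\<^sub>M borel)" .
  have "{z \<in> space (predictable_sigma P Fi \<Otimes>\<^sub>M (borel :: (real^'n) measure)). snd z $ j = 0} \<in> sets (predictable_sigma P Fi \<Otimes>\<^sub>M borel)"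
  proof -
    have eq: "{z \<in> space (predictable_sigma P Fi \<Otimes>\<^sub>M (borel :: (real^'n) measure)). snd z $ j = 0} = (\<lambda>z. snd z $ j) -` {0} \<inter> space (predictable_sigma P Fi \<Otimes>\<^sub>M borel)"
      by blast
    show ?thesis unfolding eq by (rule measurable_sets[OF c]) simp
  qed
  then show ?thesis unfolding pull_def[abs_def]
    by (intro measurable_If W measurable_const) simp_all
qed

lemma pull_kernel_integral:
  assumes W: "W \<in> borel_measurable (predictable_sigma P Fi \<Otimes>\<^sub>M borel)" and \<omega>: "\<omega> \<in> space P"
    and T: "T \<in> sets borel" "T \<subseteq> {0..}"
  shows "(\<integral>\<^sup>+z\<in>T \<times> UNIV. W ((\<omega>, fst z), snd z) \<partial>kernel_measure F1 (\<lambda>r. Y r \<omega>)) =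
    (\<integral>\<^sup>+z\<in>T \<times> UNIV. pull W ((\<omega>, fst z), snd z) \<partial>kernel_measure F (\<lambda>r. X r \<omega>))"
proof -
  interpret Y: finite_state_kernel P Fi Y "coordinate j ` E" F1 by (rule coordinate_kernel)
  interpret finite_path "\<lambda>t. X t \<omega>" E by (rule paths[OF \<omega>])
  note mY = Y.section_measurable[OF W \<omega> T]
  note mX = section_measurable[OF pull_measurable[OF W] \<omega> T]
  have sec: "(\<lambda>\<xi>. f (t, \<xi>)) \<in> borel_measurable borel" if "f \<in> borel_measurable borel" for t and f :: "real \<times> 'z::euclidean_space \<Rightarrow> ennreal"
    by (rule measurable_compose[OF _ that]) (simp add: borel_prod[symmetric])
  show ?thesis
    unfolding Y.kernel_integral_pointwise[OF \<omega> mY] kernel_integral_pointwise[OF \<omega> mX]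
  proof (rule nn_integral_cong)
    fix t :: real
    show "(\<integral>\<^sup>+\<xi>. W ((\<omega>, fst (t, \<xi>)), snd (t, \<xi>)) * indicator (T \<times> UNIV) (t, \<xi>) \<partial>measure_from (F1 (left_lim (\<lambda>t. Y t \<omega>) t))) * indicator {0..} t =
      (\<integral>\<^sup>+\<xi>. pull W ((\<omega>, fst (t, \<xi>)), snd (t, \<xi>)) * indicator (T \<times> UNIV) (t, \<xi>) \<partial>jump_law (Xm \<omega> t)) * indicator {0..} t"
    proof (cases "0 \<le> t")
      case True
      have x: "Xm \<omega> t \<in> E" by (rule left_lim_range[OF True])
      let ?f = "\<lambda>\<xi>. W ((\<omega>, t), \<xi>) * indicator (T \<times> UNIV) (t, \<xi>)"
      have "(\<integral>\<^sup>+\<xi>. W ((\<omega>, fst (t, \<xi>)), snd (t, \<xi>)) * indicator (T \<times> UNIV) (t, \<xi>) \<partial>measure_from (F1 (left_lim (\<lambda>t. Y t \<omega>) t))) =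
        ennreal (rp (Xm \<omega> t $ j)) * ?f (vec 1) + ennreal (rm (Xm \<omega> t $ j)) * ?f (vec (-1))"
        unfolding coordinate_left_lim[OF \<omega> True] measure_from_F1(1)[OF x]
        using sec[OF mY, of t] by (subst two_atoms_nn_integral) simp_all
      moreover have "(\<integral>\<^sup>+\<xi>. pull W ((\<omega>, fst (t, \<xi>)), snd (t, \<xi>)) * indicator (T \<times> UNIV) (t, \<xi>) \<partial>jump_law (Xm \<omega> t)) =
        (\<Sum>u\<in>U. ennreal (rate u (Xm \<omega> t)) * (pull W ((\<omega>, t), u) * indicator (T \<times> UNIV) (t, u)))"
        using jump_law_integral[OF x sec[OF mX, of t]] by simp
      moreover have "\<dots> = (\<Sum>u\<in>{axis j 1, axis j (-1)}. ennreal (rate u (Xm \<omega> t)) * (pull W ((\<omega>, t), u) * indicator (T \<times> UNIV) (t, u)))"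
        by (rule sum.mono_neutral_right[OF finite_U]) (use axes no_other[OF x] in \<open>auto simp: pull_def\<close>)
      moreover have "axis j 1 \<noteq> (axis j (-1) :: real^'n)" by (simp add: axis_eq_axis)
      moreover have "coordinate j (axis j c :: real^'n) = vec c" for c by (simp add: coordinate_def)
      ultimately show ?thesis using rates[OF x] by (simp add: pull_def indicator_def)
    qed simp
  qed
qed

text \<open>The coordinate jumps precisely when \<open>X\<close> jumps with a nonzero component
  \<open>j\<close>, so \<open>pull\<close> turns the predictability clause and both sides of the
  identity into statements about \<open>X\<close>.\<close>

lemma coordinate_compensator: "is_compensator P Fi Y (\<lambda>\<omega>. kernel_measure F1 (\<lambda>r. Y r \<omega>))"
  unfolding is_compensator_def
proof (intro conjI ballI allI impI)
  fix \<omega> assume \<omega>: "\<omega> \<in> space P"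
  show "sets (kernel_measure F1 (\<lambda>r. Y r \<omega>)) = sets borel" by (rule sets_kernel_measure)
  interpret Y: finite_state_kernel P Fi Y "coordinate j ` E" F1 by (rule coordinate_kernel)
  have s: "{..<0::real} \<times> (UNIV :: (real^1) set) \<in> sets borel" by (simp add: borel_prod[symmetric])
  have "emeasure (kernel_measure F1 (\<lambda>r. Y r \<omega>)) ({..<0} \<times> UNIV) = (\<integral>\<^sup>+z. indicator ({..<0} \<times> UNIV) z \<partial>kernel_measure F1 (\<lambda>r. Y r \<omega>))"
    using s by (simp add: sets_kernel_measure)
  also have "\<dots> = (\<integral>\<^sup>+t. 0 \<partial>(lborel :: real measure))"
  proof (subst Y.kernel_integral_pointwise[OF \<omega>])
    show "indicator ({..<0} \<times> UNIV) \<in> borel_measurable (borel :: (real \<times> (real^1)) measure)" using s by simp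
    have "(\<integral>\<^sup>+\<xi>. indicator ({..<0} \<times> UNIV) (t, \<xi>) \<partial>N) * indicator {0..} t = (0::ennreal)" for t :: real and N :: "(real^1) measure"
    proof (cases "0 \<le> t")
      case True
      then have "(\<lambda>\<xi>. indicator ({..<0} \<times> UNIV) (t, \<xi>) :: ennreal) = (\<lambda>\<xi>::real^1. 0)" by (simp add: indicator_def)
      then show ?thesis by simp
    qed simp
    then show "(\<integral>\<^sup>+t\<in>{0..}. (\<integral>\<^sup>+\<xi>. indicator ({..<0} \<times> UNIV) (t, \<xi>) \<partial>measure_from (F1 (left_lim (\<lambda>t. Y t \<omega>) t))) \<partial>lborel) = (\<integral>\<^sup>+t. 0 \<partial>(lborel :: real measure))"
      by (intro nn_integral_cong) blast
  qed
  finally show "emeasure (kernel_measure F1 (\<lambda>r. Y r \<omega>)) ({..<0} \<times> UNIV) = 0" by simp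
next
  fix W :: "('w \<times> real) \<times> (real^1) \<Rightarrow> ennreal"
  assume W: "W \<in> borel_measurable (predictable_sigma P Fi \<Otimes>\<^sub>M borel)"
  note W2 = pull_measurable[OF W]
  have X1: "predictable P Fi (\<lambda>t \<omega>. \<integral>\<^sup>+z\<in>{0..t} \<times> UNIV. pull W ((\<omega>, fst z), snd z) \<partial>kernel_measure F (\<lambda>r. X r \<omega>))"
    and X2: "(\<integral>\<^sup>+\<omega>. (\<integral>\<^sup>+z\<in>{0..} \<times> UNIV. pull W ((\<omega>, fst z), snd z) \<partial>jump_measure X \<omega>) \<partial>P) =
          (\<integral>\<^sup>+\<omega>. (\<integral>\<^sup>+z\<in>{0..} \<times> UNIV. pull W ((\<omega>, fst z), snd z) \<partial>kernel_measure F (\<lambda>r. X r \<omega>)) \<partial>P)"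
    using compensator W2 unfolding is_compensator_def by blast+
  from X1 show "predictable P Fi (\<lambda>t \<omega>. \<integral>\<^sup>+z\<in>{0..t} \<times> UNIV. W ((\<omega>, fst z), snd z) \<partial>kernel_measure F1 (\<lambda>r. Y r \<omega>))"
    unfolding predictable_def
  proof (rule iffD1[OF measurable_cong, rotated])
    fix z assume "z \<in> space (predictable_sigma P Fi)"
    then have z: "fst z \<in> space P" by (auto simp: space_predictable)
    have T: "{0..snd z} \<in> sets borel" "{0..snd z} \<subseteq> {0..}" by auto
    show "(\<lambda>(\<omega>, t). \<integral>\<^sup>+z\<in>{0..t} \<times> UNIV. pull W ((\<omega>, fst z), snd z) \<partial>kernel_measure F (\<lambda>r. X r \<omega>)) z =
      (\<lambda>(\<omega>, t). \<integral>\<^sup>+z\<in>{0..t} \<times> UNIV. W ((\<omega>, fst z), snd z) \<partial>kernel_measure F1 (\<lambda>r. Y r \<omega>)) z"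
      unfolding split_beta by (rule pull_kernel_integral[OF W z T, symmetric])
  qed
  interpret Y: finite_state_kernel P Fi Y "coordinate j ` E" F1 by (rule coordinate_kernel)
  have T: "{0::real..} \<in> sets borel" "{0::real..} \<subseteq> {0..}" by auto
  have "(\<integral>\<^sup>+\<omega>. (\<integral>\<^sup>+z\<in>{0..} \<times> UNIV. W ((\<omega>, fst z), snd z) \<partial>jump_measure Y \<omega>) \<partial>P) =
    (\<integral>\<^sup>+\<omega>. (\<integral>\<^sup>+z\<in>{0..} \<times> UNIV. pull W ((\<omega>, fst z), snd z) \<partial>jump_measure X \<omega>) \<partial>P)"
  proof (rule nn_integral_cong)
    fix \<omega> assume \<omega>: "\<omega> \<in> space P"
    have "(\<integral>\<^sup>+z\<in>{0..} \<times> UNIV. W ((\<omega>, fst z), snd z) \<partial>jump_measure Y \<omega>) =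
      (\<integral>\<^sup>+s. W ((\<omega>, s), jump (\<lambda>t. Y t \<omega>) s) \<partial>count_space {s. 0 < s \<and> jump (\<lambda>t. Y t \<omega>) s \<noteq> 0})"
      using Y.jump_measure_integral[OF Y.section_measurable[OF W \<omega> T]] by (simp only: fst_conv snd_conv)
    also have "\<dots> = (\<integral>\<^sup>+s. pull W ((\<omega>, s), dX \<omega> s) \<partial>count_space {s. 0 < s \<and> jump (\<lambda>t. Y t \<omega>) s \<noteq> 0})"
      by (rule nn_integral_cong) (auto simp: pull_def coordinate_jump[OF \<omega>] coordinate_eq_0)
    also have "\<dots> = (\<integral>\<^sup>+s. pull W ((\<omega>, s), dX \<omega> s) \<partial>count_space {s. 0 < s \<and> dX \<omega> s \<noteq> 0})"
      by (rule nn_integral_count_space_eq) (auto simp: pull_def coordinate_jump[OF \<omega>] coordinate_eq_0)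
    also have "\<dots> = (\<integral>\<^sup>+z\<in>{0..} \<times> UNIV. pull W ((\<omega>, fst z), snd z) \<partial>jump_measure X \<omega>)"
      using jump_measure_integral[OF section_measurable[OF W2 \<omega> T]] by (simp only: fst_conv snd_conv)
    finally show "(\<integral>\<^sup>+z\<in>{0..} \<times> UNIV. W ((\<omega>, fst z), snd z) \<partial>jump_measure Y \<omega>) =
      (\<integral>\<^sup>+z\<in>{0..} \<times> UNIV. pull W ((\<omega>, fst z), snd z) \<partial>jump_measure X \<omega>)" .
  qed
  also note X2
  also have "(\<integral>\<^sup>+\<omega>. (\<integral>\<^sup>+z\<in>{0..} \<times> UNIV. pull W ((\<omega>, fst z), snd z) \<partial>kernel_measure F (\<lambda>r. X r \<omega>)) \<partial>P) =
    (\<integral>\<^sup>+\<omega>. (\<integral>\<^sup>+z\<in>{0..} \<times> UNIV. W ((\<omega>, fst z), snd z) \<partial>kernel_measure F1 (\<lambda>r. Y r \<omega>)) \<partial>P)"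
    by (rule nn_integral_cong, rule pull_kernel_integral[OF W _ T, symmetric])
  finally show "(\<integral>\<^sup>+\<omega>. (\<integral>\<^sup>+z\<in>{0..} \<times> UNIV. W ((\<omega>, fst z), snd z) \<partial>jump_measure Y \<omega>) \<partial>P) =
    (\<integral>\<^sup>+\<omega>. (\<integral>\<^sup>+z\<in>{0..} \<times> UNIV. W ((\<omega>, fst z), snd z) \<partial>kernel_measure F1 (\<lambda>r. Y r \<omega>)) \<partial>P)" .
qed

abbreviation (input) kh :: "real^'n \<Rightarrow> real^'n \<Rightarrow> real" where "kh \<equiv> \<lambda>_ u. h1 (coordinate j u) $ 1"

text \<open>\<open>b1\<close> is the mean of the truncated jumps per unit of time, so its integral
  is the compensator \<open>A kh\<close>. Predictability and finite variation of the drift are then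
  inherited from \<open>A\<close>.\<close>

lemma drift_eq:
  assumes \<omega>: "\<omega> \<in> space P" and t: "0 \<le> t"
  shows "(LBINT s:{0..t}. b1 (left_lim (\<lambda>r. Y r \<omega>) s)) $ i = A kh t \<omega>"
proof -
  interpret finite_path "\<lambda>t. X t \<omega>" E by (rule paths[OF \<omega>])
  have S: "{v\<in>{0..t}. Xm \<omega> v = x} \<in> sets borel" for x using occ_sets(1)[OF \<omega> order_refl, of t x] by simp
  have Sfin: "emeasure lborel {v\<in>{0..t}. Xm \<omega> v = x} < \<infinity>" for x
  proof -
    have "emeasure lborel {v\<in>{0..t}. Xm \<omega> v = x} \<le> emeasure lborel {0..t}" using S by (intro emeasure_mono) auto
    also have "\<dots> < \<infinity>" using t by simp
    finally show ?thesis .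
  qed
  have "(LBINT s:{0..t}. b1 (left_lim (\<lambda>r. Y r \<omega>) s)) =
    (\<integral>s. (\<Sum>x\<in>E. indicat_real {v\<in>{0..t}. Xm \<omega> v = x} s *\<^sub>R b1 (coordinate j x)) \<partial>lborel)"
    unfolding set_lebesgue_integral_def
  proof (rule Bochner_Integration.integral_cong[OF refl])
    fix s :: real
    show "indicat_real {0..t} s *\<^sub>R b1 (left_lim (\<lambda>r. Y r \<omega>) s) = (\<Sum>x\<in>E. indicat_real {v\<in>{0..t}. Xm \<omega> v = x} s *\<^sub>R b1 (coordinate j x))"
    proof (cases "s \<in> {0..t}")
      case True
      have "(\<Sum>x\<in>E. indicat_real {v\<in>{0..t}. Xm \<omega> v = x} s *\<^sub>R b1 (coordinate j x)) =
        (\<Sum>x\<in>E. if x = Xm \<omega> s then b1 (coordinate j x) else 0)"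
        by (rule sum.cong) (use True in \<open>auto simp: indicator_def\<close>)
      then show ?thesis using True left_lim_range[of s] finite_E coordinate_left_lim[OF \<omega>, of s] by simp
    qed (auto simp: indicator_def)
  qed
  also have "\<dots> = (\<Sum>x\<in>E. occ x t \<omega> *\<^sub>R b1 (coordinate j x))"
  proof (subst Bochner_Integration.integral_sum)
    show "integrable lborel (\<lambda>s. indicat_real {v\<in>{0..t}. Xm \<omega> v = x} s *\<^sub>R b1 (coordinate j x))" for x
      using S[of x] Sfin[of x] by (intro integrable_scaleR_left integrable_real_indicator) simp_all
    show "(\<Sum>x\<in>E. \<integral>s. indicat_real {v\<in>{0..t}. Xm \<omega> v = x} s *\<^sub>R b1 (coordinate j x) \<partial>lborel) = (\<Sum>x\<in>E. occ x t \<omega> *\<^sub>R b1 (coordinate j x))"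
    proof (rule sum.cong[OF refl])
      fix x
      have int: "integrable lborel (indicat_real {v\<in>{0..t}. Xm \<omega> v = x})"
        using S[of x] Sfin[of x] by (intro integrable_real_indicator) simp_all
      show "(\<integral>s. indicat_real {v\<in>{0..t}. Xm \<omega> v = x} s *\<^sub>R b1 (coordinate j x) \<partial>lborel) = occ x t \<omega> *\<^sub>R b1 (coordinate j x)"
        using int S[of x] by (subst integral_scaleR_left) (simp_all add: occ_def)
    qed
  qed
  finally have "(LBINT s:{0..t}. b1 (left_lim (\<lambda>r. Y r \<omega>) s)) $ i = (\<Sum>x\<in>E. occ x t \<omega> * b1 (coordinate j x) $ i)"
    by simp
  also have "\<dots> = A kh t \<omega>"
    unfolding A_def
  proof (rule sum.cong[OF refl])
    fix x assume x: "x \<in> E"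
    have c: "coordinate j (axis j c :: real^'n) = vec c" for c by (simp add: coordinate_def)
    have i: "i = 1" by (rule num1_eq1)
    have "(\<Sum>u\<in>U. rate u x *\<^sub>R kh x u) = rp (x $ j) *\<^sub>R kh x (axis j 1) + rm (x $ j) *\<^sub>R kh x (axis j (-1))"
    proof (rule sum_rates[OF x])
      fix u :: "real^'n" assume "u $ j = 0"
      then have "coordinate j u = 0" by (simp add: coordinate_def vec_eq_iff)
      then show "kh x u = 0" by (simp add: h1_0)
    qed
    then have "(\<Sum>u\<in>U. rate u x * kh x u) = b1 (coordinate j x) $ i"
      unfolding b1 c i by (simp add: coordinate_nth)
    then show "occ x t \<omega> * b1 (coordinate j x) $ i = (\<Sum>u\<in>U. rate u x * kh x u * occ x t \<omega>)"
      by (simp only: sum_distrib_left[symmetric] mult.commute)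
  qed
  finally show ?thesis .
qed

lemma A_difference_mono:
  assumes \<omega>: "\<omega> \<in> space P"
  shows "\<exists>f g :: real \<Rightarrow> real. mono_on {0..} f \<and> mono_on {0..} g \<and> (\<forall>t. A k t \<omega> = f t - g t)"
proof -
  have mono: "mono_on {0..} (\<lambda>t. A k' t \<omega>)" if k': "\<And>x u. 0 \<le> k' x u" for k'
  proof (rule mono_onI)
    fix s t :: real assume st: "s \<in> {0..}" "t \<in> {0..}" "s \<le> t"
    have "0 \<le> A k' t \<omega> - A k' s \<omega>"
      unfolding A_diff
    proof (intro sum_nonneg mult_nonneg_nonneg k')
      fix x u assume "x \<in> E" "u \<in> U"
      then show "0 \<le> rate u x" using rate_nonneg zero_notin_U by metis
      show "0 \<le> occ x t \<omega> - occ x s \<omega>" using occ_diff(3)[OF \<omega>, of s t x] st by simp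
    qed
    then show "A k' s \<omega> \<le> A k' t \<omega>" by simp
  qed
  have "A k t \<omega> = A (\<lambda>x u. max (k x u) 0) t \<omega> - A (\<lambda>x u. max (- k x u) 0) t \<omega>" for t
  proof -
    have "k x u = max (k x u) 0 - max (- k x u) 0" for x u by simp
    then have "rate u x * k x u * occ x t \<omega> = rate u x * max (k x u) 0 * occ x t \<omega> - rate u x * max (- k x u) 0 * occ x t \<omega>" for x u
      by (metis left_diff_distrib right_diff_distrib)
    then show ?thesis by (simp add: A_def sum_subtractf)
  qed
  moreover have "mono_on {0..} (\<lambda>t. A (\<lambda>x u. max (k x u) 0) t \<omega>)" "mono_on {0..} (\<lambda>t. A (\<lambda>x u. max (- k x u) 0) t \<omega>)"
    by (rule mono, simp)+
  ultimately show ?thesis by blast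
qed

lemma martingale_zero: "martingale P Fi (\<lambda>_ _. 0)"
  by (rule martingaleI) (auto simp: adapted_def cadlag_def)

lemma local_martingale_zero: "local_martingale P Fi (\<lambda>_ _. 0)"
  by (rule martingale_imp_local_martingale) (simp_all add: martingale_zero)

text \<open>The coordinate moves by jumps alone. With the large jumps truncated, its increment is
  \<open>J kh\<close>, the sum of the drift \<open>A kh\<close> and the purely discontinuous part
  \<open>J kh - A kh\<close>; the continuous martingale part and the second characteristic
  vanish.\<close>

lemma coordinate_characteristics:
  "has_characteristics P Fi h1 Y
     (\<lambda>t \<omega>. LBINT s:{0..t}. b1 (left_lim (\<lambda>r. Y r \<omega>) s))
     (\<lambda>t \<omega>. LBINT s:{0..t}. (\<lambda>_. 0 :: real^1^1) (left_lim (\<lambda>r. Y r \<omega>) s))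
     (\<lambda>\<omega>. kernel_measure F1 (\<lambda>r. Y r \<omega>))"
  unfolding has_characteristics_def
proof (rule conjI, rule exI[of _ "\<lambda>_ _ _. 0"], rule exI[of _ "\<lambda>_ t \<omega>. J kh t \<omega> - A kh t \<omega>"], intro conjI allI)
  let ?B = "\<lambda>t \<omega>. LBINT s:{0..t}. b1 (left_lim (\<lambda>r. Y r \<omega>) s)"
  fix i :: 1
  show "predictable P Fi (\<lambda>t \<omega>. ?B t \<omega> $ i)"
    unfolding predictable_def
  proof (rule iffD1[OF measurable_cong A_predictable[of kh, unfolded predictable_def]])
    fix z assume "z \<in> space (predictable_sigma P Fi)"
    then have "fst z \<in> space P" "0 \<le> snd z" by (auto simp: space_predictable)
    from drift_eq[OF this] show "(\<lambda>(\<omega>, t). A kh t \<omega>) z = (\<lambda>(\<omega>, t). ?B t \<omega> $ i) z"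
      unfolding split_beta by simp
  qed
  show "finite_variation P Fi (\<lambda>t \<omega>. ?B t \<omega> $ i)"
    unfolding finite_variation_def
  proof (intro conjI AE_I2)
    show "adapted Fi (\<lambda>t \<omega>. ?B t \<omega> $ i)"
      unfolding adapted_def
    proof (intro allI impI)
      fix t :: real assume t: "0 \<le> t"
      have "A kh t \<in> borel_measurable (Fi t)" using A_adapted t by (simp add: adapted_def)
      then show "(\<lambda>\<omega>. ?B t \<omega> $ i) \<in> borel_measurable (Fi t)"
        by (rule iffD1[OF measurable_cong, rotated]) (use drift_eq[OF _ t] space_Fi[OF t] in simp)
    qed
    fix \<omega> assume \<omega>: "\<omega> \<in> space P"
    have fv: "A kh 0 \<omega> = 0" "cadlag (\<lambda>t. A kh t \<omega>)" by (rule A_0, rule cadlag_continuous[OF A_continuous[OF \<omega>]])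
    show "?B 0 \<omega> $ i = 0" using drift_eq[OF \<omega> order_refl] fv(1) by simp
    show "cadlag (\<lambda>t. ?B t \<omega> $ i)" using cadlag_cong[of "\<lambda>t. ?B t \<omega> $ i" "\<lambda>t. A kh t \<omega>", OF drift_eq[OF \<omega>]] fv(2) by blast
    show "\<exists>f g. mono_on {0..} f \<and> mono_on {0..} g \<and> (\<forall>t\<ge>0. ?B t \<omega> $ i = f t - g t)"
      using A_difference_mono[OF \<omega>, of kh] drift_eq[OF \<omega>, of _ i] by metis
  qed
next
  fix i :: 1
  show "cont_local_martingale P Fi (\<lambda>_ _. 0)"
    unfolding cont_local_martingale_def using local_martingale_zero by simp
  show "AE \<omega> in P. (0::real) = 0" by simp
  show "purely_disc_local_martingale P Fi (\<lambda>t \<omega>. J kh t \<omega> - A kh t \<omega>)" by (rule compensated_jumps_purely_discontinuous)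
next
  show "AE \<omega> in P. \<forall>t\<ge>0. \<forall>i. big_jumps_removed h1 (\<lambda>s. Y s \<omega>) t $ i =
    Y 0 \<omega> $ i + (LBINT s:{0..t}. b1 (left_lim (\<lambda>r. Y r \<omega>) s)) $ i + 0 + (J kh t \<omega> - A kh t \<omega>)"
  proof (intro AE_I2 allI impI)
    fix \<omega> and t :: real and i :: 1 assume \<omega>: "\<omega> \<in> space P" and t: "0 \<le> t"
    interpret finite_path "\<lambda>t. X t \<omega>" E by (rule paths[OF \<omega>])
    let ?j = "jump (\<lambda>s. Y s \<omega>)"
    have jc: "?j s = coordinate j (dX \<omega> s)" if "0 < s" for s using coordinate_jump[OF \<omega>, of s] that by simp
    have "(\<Sum>s\<in>{s\<in>{0<..t}. ?j s \<noteq> h1 (?j s)}. ?j s - h1 (?j s)) = (\<Sum>s\<in>jumps \<omega> 0 t. ?j s - h1 (?j s))"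
    proof (rule sum.mono_neutral_left[OF finite_jump_times[OF order_refl]])
      show "{s\<in>{0<..t}. ?j s \<noteq> h1 (?j s)} \<subseteq> jumps \<omega> 0 t"
      proof
        fix s assume s: "s \<in> {s\<in>{0<..t}. ?j s \<noteq> h1 (?j s)}"
        have "dX \<omega> s \<noteq> 0"
        proof
          assume "dX \<omega> s = 0"
          then have "?j s = 0" using jc[of s] s by (simp add: coordinate_def vec_eq_iff)
          then show False using s h1_0 by simp
        qed
        then show "s \<in> jumps \<omega> 0 t" using s by (simp add: jump_times_def)
      qed
    qed (auto simp: jump_times_def)
    moreover have "X t \<omega> $ j - X 0 \<omega> $ j = (\<Sum>s\<in>jumps \<omega> 0 t. X s \<omega> $ j - Xm \<omega> s $ j)"
      by (rule telescope[OF order_refl t])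
    moreover have "(\<Sum>s\<in>jumps \<omega> 0 t. ?j s - h1 (?j s)) $ 1 = (\<Sum>s\<in>jumps \<omega> 0 t. X s \<omega> $ j - Xm \<omega> s $ j) - J kh t \<omega>"
    proof -
      have "(\<Sum>s\<in>jumps \<omega> 0 t. ?j s - h1 (?j s)) $ 1 = (\<Sum>s\<in>jumps \<omega> 0 t. (?j s - h1 (?j s)) $ 1)" by (rule sum_component)
      also have "\<dots> = (\<Sum>s\<in>jumps \<omega> 0 t. (X s \<omega> $ j - Xm \<omega> s $ j) - kh (Xm \<omega> s) (dX \<omega> s))"
        by (rule sum.cong[OF refl]) (auto simp: jump_times_def jc coordinate_nth, simp add: jump_def)
      finally show ?thesis by (simp add: J_def jump_sum_def sum_subtractf)
    qed
    ultimately show "big_jumps_removed h1 (\<lambda>s. Y s \<omega>) t $ i =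
      Y 0 \<omega> $ i + (LBINT s:{0..t}. b1 (left_lim (\<lambda>r. Y r \<omega>) s)) $ i + 0 + (J kh t \<omega> - A kh t \<omega>)"
      unfolding big_jumps_removed_def drift_eq[OF \<omega> t] num1_eq1[of i]
      by (simp only: vector_minus_component coordinate_nth)
  qed
next
  fix i j' :: 1
  show "predictable P Fi (\<lambda>t \<omega>. (LBINT s:{0..t}. (\<lambda>_. 0 :: real^1^1) (left_lim (\<lambda>r. Y r \<omega>) s)) $ i $ j')"
    by (simp add: predictable_def set_lebesgue_integral_def split_beta)
  show "finite_variation P Fi (\<lambda>t \<omega>. (LBINT s:{0..t}. (\<lambda>_. 0 :: real^1^1) (left_lim (\<lambda>r. Y r \<omega>) s)) $ i $ j')"
    by (auto simp: finite_variation_def set_lebesgue_integral_def adapted_def cadlag_def intro!: exI[of _ "\<lambda>_. 0"] mono_onI)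
  show "local_martingale P Fi (\<lambda>t \<omega>. 0 * 0 - (LBINT s:{0..t}. (\<lambda>_. 0 :: real^1^1) (left_lim (\<lambda>r. Y r \<omega>) s)) $ i $ j')"
    using local_martingale_zero by (simp add: set_lebesgue_integral_def)
qed (rule coordinate_compensator)

lemma coordinate_triplet:
  assumes rp: "affine_map rp" and rm: "affine_map rm"
  shows "affine_triplet (coordinate j ` E) b1 (\<lambda>_. 0) F1"
  unfolding affine_triplet_def
proof (intro conjI allI ballI)
  have nth: "((1 - t) *\<^sub>R x + t *\<^sub>R y) $ 1 = (1 - t) *\<^sub>R (x $ 1) + t *\<^sub>R (y $ 1)" for t and x y :: "real^1" by simp
  have p: "rp (((1 - t) *\<^sub>R x + t *\<^sub>R y) $ 1) = (1 - t) * rp (x $ 1) + t * rp (y $ 1)"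
    and m: "rm (((1 - t) *\<^sub>R x + t *\<^sub>R y) $ 1) = (1 - t) * rm (x $ 1) + t * rm (y $ 1)" for t and x y :: "real^1"
    using rp rm unfolding nth affine_map_def by simp_all
  show "affine_map b1" unfolding affine_map_def b1 p m by (simp add: algebra_simps)
  show "affine_map (\<lambda>_. 0 :: real^1^1)" by (simp add: affine_map_def)
  show "transpose (0 :: real^1^1) = 0" by (simp add: transpose_def vec_eq_iff)
  show "affine_map (\<lambda>x. F1 x A)" for A unfolding affine_map_def F1 p m by (simp add: algebra_simps)
  fix y
  \<comment> \<open>Away from the state space \<open>rp\<close> and \<open>rm\<close> may be
    negative; their positive and negative parts give the two Radon measures.\<close>
  have "F1 y A = set_function (two_atoms (max (rp (y $ 1)) 0) (max (rm (y $ 1)) 0)) A -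
      set_function (two_atoms (max (- rp (y $ 1)) 0) (max (- rm (y $ 1)) 0)) A" for A
  proof (cases "A \<in> punctured_bounded")
    case True
    then have "A \<in> sets borel" by (simp add: punctured_bounded_def)
    moreover have "c = max c 0 - max (- c) 0" for c :: real by simp
    ultimately show ?thesis
      using True by (simp add: set_function_def F1 measure_two_atoms) (simp add: max_def algebra_simps)
  qed (simp add: set_function_def F1)
  then have "F1 y = (\<lambda>A. set_function (two_atoms (max (rp (y $ 1)) 0) (max (rm (y $ 1)) 0)) A -
      set_function (two_atoms (max (- rp (y $ 1)) 0) (max (- rm (y $ 1)) 0)) A)" ..
  then show "F1 y \<in> signed_radon_measures" unfolding signed_radon_measures_def using radon_two_atoms by blast
next
  fix v y :: "real^1" assume "y \<in> coordinate j ` E"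
  then obtain x where x: "x \<in> E" "y = coordinate j x" by blast
  show "0 \<le> v \<bullet> ((0 :: real^1^1) *v v)" by simp
  show "is_positive (F1 y)" unfolding x(2) by (rule measure_from_F1(2)[OF x(1)])
  show "(\<integral>\<^sup>+\<xi>. ennreal (min ((norm \<xi>)\<^sup>2) 1) \<partial>measure_from (F1 y)) < \<infinity>"
    unfolding x(2) measure_from_F1(1)[OF x(1)] by (subst two_atoms_nn_integral) (simp_all add: ennreal_mult_less_top)
qed

end

end

section \<open>Jump counters\<close>

lemma affine_map_linear:
  assumes "affine_map f"
  shows "linear (\<lambda>x. f x - f 0)"
proof -
  have aff: "f ((1 - t) *\<^sub>R x + t *\<^sub>R y) = (1 - t) *\<^sub>R f x + t *\<^sub>R f y" for x y t
    using assms by (simp add: affine_map_def)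
  have scale: "f (t *\<^sub>R x) - f 0 = t *\<^sub>R (f x - f 0)" for t x
    using aff[of t 0 x] by (simp add: algebra_simps)
  show ?thesis
  proof (rule linearI)
    fix x y
    \<comment> \<open>The definition speaks of weights with sum 1 only, so the sum is reached as
      twice the midpoint.\<close>
    have "f ((1/2) *\<^sub>R (x + y)) = (1/2) *\<^sub>R f x + (1/2) *\<^sub>R f y" using aff[of "1/2" x y] by (simp add: algebra_simps)
    moreover have "f ((1/2) *\<^sub>R (x + y)) - f 0 = (1/2) *\<^sub>R (f (x + y) - f 0)" by (rule scale)
    ultimately have "(1/2) *\<^sub>R (f (x + y) - f 0) = (1/2) *\<^sub>R (f x + f y) - f 0" by (simp add: algebra_simps)
    then have "2 *\<^sub>R ((1/2) *\<^sub>R (f (x + y) - f 0)) = 2 *\<^sub>R ((1/2) *\<^sub>R (f x + f y) - f 0)" by simp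
    then show "f (x + y) - f 0 = f x - f 0 + (f y - f 0)" by (simp add: algebra_simps scaleR_2)
  qed (rule scale)
qed

lemma affine_map_add: "affine_map f \<Longrightarrow> f (x + u) = f x + (f u - f 0)"
  using linear_add[OF affine_map_linear, of f x u] by (simp add: algebra_simps)

lemma affine_map_add_scaleR: "affine_map f \<Longrightarrow> f (x + t *\<^sub>R u) = f x + t *\<^sub>R (f u - f 0)"
  using affine_map_add[of f x "t *\<^sub>R u"] linear_scale[OF affine_map_linear, of f t u] by simp

lemma affine_map_eqI:
  assumes f: "affine_map f" and g: "affine_map g" and E: "affine hull E = UNIV" and eq: "\<And>x. x \<in> E \<Longrightarrow> f x = g x"
  shows "f = g"
proof -
  have "affine {x. f x = g x}"
    unfolding affine_alt using f g by (auto simp: affine_map_def)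
  with eq have "affine hull E \<subseteq> {x. f x = g x}" by (intro hull_minimal) auto
  then show ?thesis unfolding E by auto
qed

lemma affine_map_nth: "affine_map (\<lambda>x :: real^'n. x $ k)"
  by (simp add: affine_map_def)

text \<open>Minus the partial derivative in direction \<open>k\<close>. With this sign the slopes of
  all counters other than the projections are nonnegative, see \<open>slope_nonneg\<close>.\<close>

definition slope :: "(real^'n \<Rightarrow> real) \<Rightarrow> 'n \<Rightarrow> real" where
  "slope \<psi> k = \<psi> 0 - \<psi> (axis k 1)"

lemma UNIV_two: "i \<noteq> j \<Longrightarrow> UNIV = {i, j :: 2}"
  using exhaust_2 by auto metis+

lemma affine_map_slope:
  fixes \<psi> :: "real^2 \<Rightarrow> real"
  assumes "affine_map \<psi>" "i \<noteq> j"
  shows "\<psi> x = \<psi> 0 - slope \<psi> i * x $ i - slope \<psi> j * x $ j"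
proof -
  let ?l = "\<lambda>x. \<psi> x - \<psi> 0"
  have lin: "linear ?l" by (rule affine_map_linear[OF assms(1)])
  have "x = x $ i *\<^sub>R axis i 1 + x $ j *\<^sub>R axis j 1"
    using UNIV_two[OF assms(2)] assms(2) by (auto simp: vec_eq_iff axis_def)
  then have "?l x = ?l (x $ i *\<^sub>R axis i 1 + x $ j *\<^sub>R axis j 1)" by simp
  also have "\<dots> = x $ i * ?l (axis i 1) + x $ j * ?l (axis j 1)"
    using linear_add[OF lin, of "x $ i *\<^sub>R axis i 1" "x $ j *\<^sub>R axis j 1"] linear_scale[OF lin, of "x $ i" "axis i 1"] linear_scale[OF lin, of "x $ j" "axis j 1"] by simp
  finally show ?thesis by (simp add: slope_def algebra_simps)
qed

lemma int_nat_iff: "(r::real) \<in> \<int> \<Longrightarrow> 0 \<le> r \<Longrightarrow> r \<in> \<nat>"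
  by (simp add: Nats_altdef2)

lemma nat_product_one: "p \<in> \<nat> \<Longrightarrow> r \<in> \<nat> \<Longrightarrow> p * r = (1::real) \<Longrightarrow> p = 1 \<and> r = 1"
proof (elim Nats_cases)
  fix m n assume "p * r = 1" "p = of_nat m" "r = of_nat n"
  then have "m * n = 1" by (metis of_nat_eq_1_iff of_nat_mult)
  then show "p = 1 \<and> r = 1" using \<open>p = of_nat m\<close> \<open>r = of_nat n\<close> by simp
qed

lemma nat_sum_one: "a \<in> \<nat> \<Longrightarrow> b \<in> \<nat> \<Longrightarrow> a + b = (1::real) \<Longrightarrow> a = 1 \<and> b = 0 \<or> a = 0 \<and> b = 1"
proof (elim Nats_cases)
  fix m n assume "a + b = 1" "a = of_nat m" "b = of_nat n"
  then have "m + n = 1" by (metis of_nat_add of_nat_eq_1_iff)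
  then show ?thesis using \<open>a = of_nat m\<close> \<open>b = of_nat n\<close> by (cases m) auto
qed

lemma nat_ge_0: "a \<in> \<nat> \<Longrightarrow> (0::real) \<le> a"
  by (auto elim!: Nats_cases)

lemma nat_pos_ge_1: "a \<in> \<nat> \<Longrightarrow> 0 < a \<Longrightarrow> (1::real) \<le> a"
  by (auto elim!: Nats_cases)

definition counter :: "(real^'n) set \<Rightarrow> real^'n \<Rightarrow> (real^'n \<Rightarrow> real) \<Rightarrow> bool" where
  "counter E u \<psi> \<longleftrightarrow> jump_counter E u \<psi> \<and> \<psi> u - \<psi> 0 = -1"

lemma normalized_jump_counters_eq: "normalized_jump_counters E S = {\<psi>. \<exists>u\<in>S. counter E u \<psi>}"
  by (simp add: normalized_jump_counters_def counter_def)

lemma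
  assumes "counter E u \<psi>"
  shows counter_affine: "affine_map \<psi>" and counter_nonneg: "x \<in> E \<Longrightarrow> 0 \<le> \<psi> x"
    and counter_jump: "x \<in> E \<Longrightarrow> 0 < \<psi> x \<Longrightarrow> x + u \<in> E"
    and counter_unit: "\<psi> u - \<psi> 0 = -1"
  using assms by (auto simp: counter_def jump_counter_def)

lemma counter_walk:
  assumes c: "counter E u \<psi>" and x: "x \<in> E"
  shows "real k \<le> \<psi> x \<Longrightarrow> x + real k *\<^sub>R u \<in> E"
proof (induction k)
  case (Suc k)
  then have "x + real k *\<^sub>R u \<in> E" by simp
  moreover have "\<psi> (x + real k *\<^sub>R u) = \<psi> x - real k"
    using affine_map_add_scaleR[OF counter_affine[OF c]] counter_unit[OF c] by simp
  ultimately have "x + real k *\<^sub>R u + u \<in> E" using counter_jump[OF c] Suc.prems by simp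
  then show ?case by (simp add: algebra_simps)
qed (simp add: x)

lemma counter_nat:
  assumes c: "counter E u \<psi>" and x: "x \<in> E"
  shows "\<psi> x \<in> \<nat>"
proof -
  define k where "k = nat \<lfloor>\<psi> x\<rfloor>"
  have k: "real k \<le> \<psi> x" "\<psi> x < real k + 1" using counter_nonneg[OF c x] by (auto simp: k_def)
  let ?y = "x + real k *\<^sub>R u"
  have y: "?y \<in> E" by (rule counter_walk[OF c x k(1)])
  have \<psi>y: "\<psi> ?y = \<psi> x - real k"
    using affine_map_add_scaleR[OF counter_affine[OF c]] counter_unit[OF c] by simp
  have "\<not> 0 < \<psi> ?y"
  proof
    assume "0 < \<psi> ?y"
    then have "?y + u \<in> E" by (rule counter_jump[OF c y])
    then have "0 \<le> \<psi> (?y + u)" by (rule counter_nonneg[OF c])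
    then show False using affine_map_add[OF counter_affine[OF c], of ?y u] counter_unit[OF c] \<psi>y k by simp
  qed
  then have "\<psi> x = real k" using \<psi>y k by simp
  then show ?thesis by simp
qed

lemma counter_exhaust:
  assumes c: "counter E u \<psi>" and x: "x \<in> E"
  shows "x + \<psi> x *\<^sub>R u \<in> E"
  using counter_nat[OF c x] counter_walk[OF c x] by (auto elim!: Nats_cases)

text \<open>The expression is the value of \<open>f\<close> at the end of the walk along
  \<open>u\<close> from \<open>x\<close>, where the counter is exhausted.\<close>

lemma counter_le:
  assumes "counter E u \<psi>" "x \<in> E" "affine_map f" "\<And>y. y \<in> E \<Longrightarrow> 0 \<le> f y"
  shows "0 \<le> f x + \<psi> x * (f u - f 0)"
  using assms(4)[OF counter_exhaust[OF assms(1,2)]] affine_map_add_scaleR[OF assms(3)] by simp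

text \<open>Both counters drop by 1 along \<open>u\<close>, so \<open>counter_le\<close>, applied to
  the pair in both orders, gives opposite inequalities on \<open>E\<close>, and \<open>E\<close>
  spans the space.\<close>

lemma counter_unique:
  assumes E: "affine hull E = UNIV" and c: "counter E u \<psi>" "counter E u \<phi>"
  shows "\<psi> = \<phi>"
proof (rule affine_map_eqI[OF counter_affine[OF c(1)] counter_affine[OF c(2)] E])
  fix x assume x: "x \<in> E"
  show "\<psi> x = \<phi> x"
    using counter_le[OF c(1) x counter_affine[OF c(2)] counter_nonneg[OF c(2)]] counter_le[OF c(2) x counter_affine[OF c(1)] counter_nonneg[OF c(1)]]
      counter_unit[OF c(1)] counter_unit[OF c(2)] by simp
qed

lemma counter_pos:
  assumes E: "affine hull E = UNIV" and c: "counter E u \<psi>"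
  shows "\<exists>x\<in>E. 0 < \<psi> x"
proof (rule ccontr)
  assume "\<not> ?thesis"
  then have "\<psi> x = 0" if "x \<in> E" for x using counter_nonneg[OF c that] that by force
  then have "\<psi> = (\<lambda>_. 0)" by (intro affine_map_eqI[OF counter_affine[OF c] _ E]) (auto simp: affine_map_def)
  then show False using counter_unit[OF c] by simp
qed

text \<open>\<open>\<phi>\<close> has integer values on \<open>E\<close>, and \<open>u\<close> joins
  two points of \<open>E\<close>, which gives integrality. If \<open>u\<close> lowered
  \<open>\<phi>\<close>, it would do so by at least 1, and the walk along \<open>u\<close> would
  show \<open>\<psi> \<le> \<phi>\<close> on \<open>E\<close>. Exhausting \<open>\<phi>\<close>
  along \<open>v\<close> from a point with \<open>\<psi> > 0\<close> then brings
  \<open>\<psi>\<close> to 0 too, so \<open>v\<close> lowers \<open>\<psi>\<close>; by symmetry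
  \<open>\<phi> \<le> \<psi>\<close>, and the counters would agree.\<close>

lemma counter_mixed:
  assumes E: "affine hull E = UNIV" and c: "counter E u \<psi>" "counter E v \<phi>" and ne: "\<phi> \<noteq> \<psi>"
  shows "\<phi> u - \<phi> 0 \<in> \<nat>"
proof -
  have int: "\<phi> u - \<phi> 0 \<in> \<int>" if c: "counter E u \<psi>" "counter E v \<phi>" for u v \<psi> \<phi>
  proof -
    obtain z where z: "z \<in> E" "0 < \<psi> z" using counter_pos[OF E c(1)] by blast
    have "\<phi> (z + u) - \<phi> z \<in> \<int>"
      by (intro Ints_diff subsetD[OF Nats_subset_Ints] counter_nat[OF c(2)] counter_jump[OF c(1)] z)
    then show ?thesis using affine_map_add[OF counter_affine[OF c(2)], of z u] by simp
  qed
  have le: "\<psi> x \<le> \<phi> x" if c: "counter E u \<psi>" "counter E v \<phi>" and neg: "\<phi> u - \<phi> 0 < 0" and x: "x \<in> E" for u v \<psi> \<phi> x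
  proof -
    have "- (\<phi> u - \<phi> 0) \<in> \<nat>" using int[OF c] neg by (intro int_nat_iff Ints_minus) auto
    from nat_pos_ge_1[OF this] neg have "\<phi> u - \<phi> 0 \<le> -1" by simp
    then have "\<psi> x * (\<phi> u - \<phi> 0) \<le> \<psi> x * (-1)" by (intro mult_left_mono counter_nonneg[OF c(1) x])
    then show ?thesis using counter_le[OF c(1) x counter_affine[OF c(2)] counter_nonneg[OF c(2)]] by simp
  qed
  have "0 \<le> \<phi> u - \<phi> 0"
  proof (rule ccontr)
    assume "\<not> 0 \<le> \<phi> u - \<phi> 0"
    then have neg: "\<phi> u - \<phi> 0 < 0" by simp
    note le1 = le[OF c neg]
    obtain z where z: "z \<in> E" "0 < \<psi> z" using counter_pos[OF E c(1)] by blast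
    let ?y = "z + \<phi> z *\<^sub>R v"
    have y: "?y \<in> E" by (rule counter_exhaust[OF c(2) z(1)])
    have "\<phi> ?y = 0" using affine_map_add_scaleR[OF counter_affine[OF c(2)]] counter_unit[OF c(2)] by simp
    with le1[OF y] have "\<psi> z + \<phi> z * (\<psi> v - \<psi> 0) \<le> 0" using affine_map_add_scaleR[OF counter_affine[OF c(1)]] by simp
    moreover have "\<psi> v - \<psi> 0 < 0"
    proof (rule ccontr)
      assume "\<not> \<psi> v - \<psi> 0 < 0"
      then have "0 \<le> \<phi> z * (\<psi> v - \<psi> 0)" using counter_nonneg[OF c(2) z(1)] by (intro mult_nonneg_nonneg) auto
      then show False using calculation z(2) by linarith
    qed
    note le2 = le[OF c(2,1) this]
    have "\<phi> = \<psi>" by (rule affine_map_eqI[OF counter_affine[OF c(2)] counter_affine[OF c(1)] E]) (rule antisym[OF le2 le1])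
    with ne show False by simp
  qed
  then show ?thesis by (rule int_nat_iff[OF int[OF c]])
qed

lemma finite_maximizer:
  fixes f :: "'a \<Rightarrow> real"
  assumes "finite E" "E \<noteq> {}"
  obtains x where "x \<in> E" "\<And>y. y \<in> E \<Longrightarrow> f y \<le> f x"
proof -
  have "Max (f ` E) \<in> f ` E" using assms by (intro Max_in) auto
  then obtain x where "x \<in> E" "f x = Max (f ` E)" by auto
  moreover have "f y \<le> Max (f ` E)" if "y \<in> E" for y using assms that by simp
  ultimately show thesis using that by metis
qed

text \<open>At a maximum of \<open>f\<close> over \<open>E\<close> the jump \<open>w\<close> is
  impossible, so \<open>\<phi> = 0\<close> and \<open>\<psi> = c > 0\<close> there. Then
  \<open>u\<close> is possible, keeps \<open>f\<close> maximal and raises \<open>\<phi>\<close> to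
  1, which makes \<open>w\<close> possible after all.\<close>

lemma counter_no_growth:
  fixes f :: "real^'n \<Rightarrow> real"
  assumes fin: "finite E" and E: "affine hull E = UNIV" and c: "counter E u \<psi>" "counter E w \<phi>"
    and f: "affine_map f" "f u = f 0" "f 0 < f w" and sum: "\<And>x. \<phi> x = c - \<psi> x"
  shows False
proof -
  have "E \<noteq> {}" using counter_pos[OF E c(1)] by blast
  then obtain x where x: "x \<in> E" "\<And>y. y \<in> E \<Longrightarrow> f y \<le> f x"
    using finite_maximizer[OF fin, of f] by blast
  have no: "\<not> 0 < \<phi> y" if y: "y \<in> E" "f y = f x" for y
  proof
    assume "0 < \<phi> y"
    from x(2)[OF counter_jump[OF c(2) y(1) this]] show False
      using affine_map_add[OF f(1), of y w] f(3) y(2) by simp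
  qed
  have "\<psi> x = c" using no[OF x(1) refl] counter_nonneg[OF c(2) x(1)] sum[of x] by simp
  moreover obtain z where "z \<in> E" "0 < \<phi> z" using counter_pos[OF E c(2)] by blast
  then have "0 < c" using sum[of z] counter_nonneg[OF c(1), of z] by simp
  ultimately have "x + u \<in> E" using counter_jump[OF c(1) x(1)] by simp
  moreover have "f (x + u) = f x" using affine_map_add[OF f(1), of x u] f(2) by simp
  moreover have "\<psi> (x + u) = c - 1"
    using affine_map_add[OF counter_affine[OF c(1)], of x u] counter_unit[OF c(1)] \<open>\<psi> x = c\<close> by simp
  ultimately show False using no[of "x + u"] sum[of "x + u"] by simp
qed

text \<open>
  Starting from a point of \<open>E\<close> that maximizes the first coordinate, exhaust the first counter and
  then the second one.
\<close>
lemma counter_cycle: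
  fixes E :: "(real^2) set"
  assumes fin: "finite E" and E: "affine hull E = UNIV"
    and c: "counter E u (\<lambda>x. x $ i)" "counter E v (\<lambda>x. x $ j)" and v: "0 \<le> v $ i"
  shows "u $ j * v $ i \<le> 1"
proof -
  have ui: "u $ i = -1" using counter_unit[OF c(1)] by simp
  obtain z where z: "z \<in> E" "0 < z $ i" using counter_pos[OF E c(1)] by blast
  then obtain x where x: "x \<in> E" "\<And>y. y \<in> E \<Longrightarrow> y $ i \<le> x $ i"
    using finite_maximizer[OF fin, of "\<lambda>x. x $ i"] by blast
  have pos: "0 < x $ i" using x(2)[OF z(1)] z(2) by simp
  let ?y = "x + x $ i *\<^sub>R u"
  have y: "?y \<in> E" using counter_exhaust[OF c(1) x(1)] by simp
  have "?y + ?y $ j *\<^sub>R v \<in> E" using counter_exhaust[OF c(2) y] by simp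
  \<comment> \<open>At \<open>?y\<close> coordinate \<open>i\<close> is 0 and coordinate
    \<open>j\<close> is \<open>x $ j + x $ i * u $ j\<close>, which is the number of steps along
    \<open>v\<close>; each step adds \<open>v $ i\<close> to coordinate \<open>i\<close>, and the
    end point cannot exceed the maximum \<open>x $ i\<close>.\<close>
  from x(2)[OF this] have "(x $ j + x $ i * u $ j) * v $ i \<le> x $ i" using ui by simp
  moreover have "0 \<le> x $ j * v $ i" using counter_nonneg[OF c(2) x(1)] v by simp
  ultimately have "x $ i * (u $ j * v $ i) \<le> x $ i * 1" by (simp add: algebra_simps)
  then show ?thesis using pos mult_le_cancel_left_pos by blast
qed

section \<open>Classification of the counters in the plane\<close>

locale planar_counters =
  fixes E S :: "(real^2) set"
  assumes finite_E: "finite E" and hull: "affine hull E = UNIV" and lattice: "E \<subseteq> lattice_points"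
    and counter_ex: "u \<in> S \<Longrightarrow> \<exists>\<psi>. counter E u \<psi>"
    and projection: "(\<lambda>x. x $ k) \<in> normalized_jump_counters E S"
begin

definition down :: "2 \<Rightarrow> real^2 \<Rightarrow> bool" where
  "down k u \<longleftrightarrow> u \<in> S \<and> counter E u (\<lambda>x. x $ k)"

definition other :: "real^2 \<Rightarrow> (real^2 \<Rightarrow> real) \<Rightarrow> bool" where
  "other w \<psi> \<longleftrightarrow> w \<in> S \<and> counter E w \<psi> \<and> (\<forall>k. \<psi> \<noteq> (\<lambda>x. x $ k))"

lemma cases_S: "u \<in> S \<Longrightarrow> (\<exists>k. down k u) \<or> (\<exists>\<psi>. other u \<psi>)"
  using counter_ex by (auto simp: down_def other_def)

lemma down_ex: "\<exists>u. down k u"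
  using projection[of k] by (auto simp: normalized_jump_counters_eq down_def)

lemma projection_neq: "i \<noteq> j \<Longrightarrow> (\<lambda>x::real^2. x $ i) \<noteq> (\<lambda>x. x $ j)"
  using fun_cong[of "\<lambda>x::real^2. x $ i" "\<lambda>x. x $ j" "axis i 1"] by (auto simp: axis_def)

lemma down_nth: "down k u \<Longrightarrow> u $ k = -1"
  using counter_unit[of E u "\<lambda>x. x $ k"] by (simp add: down_def)

lemma down_nat:
  assumes "down i u" "i \<noteq> j"
  shows "u $ j \<in> \<nat>"
proof -
  obtain v where "down j v" using down_ex by blast
  then show ?thesis
    using counter_mixed[OF hull, of u "\<lambda>x. x $ i" v "\<lambda>x. x $ j"] assms projection_neq[OF assms(2)]
    by (auto simp: down_def)
qed

lemma down_cycle: "down i u \<Longrightarrow> down j v \<Longrightarrow> i \<noteq> j \<Longrightarrow> u $ j * v $ i \<le> 1"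
  using counter_cycle[OF finite_E hull, of u i v j] nat_ge_0[OF down_nat[of j v i]] by (auto simp: down_def)

lemma other_nat: "other w \<psi> \<Longrightarrow> w $ k \<in> \<nat>"
  using down_ex[of k] counter_mixed[OF hull, of w \<psi> _ "\<lambda>x. x $ k"] by (fastforce simp: down_def other_def)

lemma other_affine: "other w \<psi> \<Longrightarrow> affine_map \<psi>"
  using counter_affine by (auto simp: other_def)

lemma other_increment:
  assumes "other w \<psi>" "i \<noteq> j"
  shows "\<psi> u - \<psi> 0 = - (slope \<psi> i * u $ i + slope \<psi> j * u $ j)"
  using affine_map_slope[OF other_affine[OF assms(1)] assms(2), of u] by simp

lemma other_unit: "other w \<psi> \<Longrightarrow> i \<noteq> j \<Longrightarrow> slope \<psi> i * w $ i + slope \<psi> j * w $ j = 1"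
  using other_increment[of w \<psi> i j w] counter_unit[of E w \<psi>] by (simp add: other_def)

lemma other_down:
  assumes o: "other w \<psi>" and d: "down i u" and ij: "i \<noteq> j"
  shows "slope \<psi> i - slope \<psi> j * u $ j \<in> \<nat>"
proof -
  have "\<psi> u - \<psi> 0 \<in> \<nat>" using counter_mixed[OF hull, of u "\<lambda>x. x $ i" w \<psi>] o d by (simp add: other_def down_def)
  then show ?thesis unfolding other_increment[OF o ij] down_nth[OF d] by (simp add: algebra_simps)
qed

lemma other_other:
  assumes o: "other w \<psi>" "other w' \<psi>'" and ne: "\<psi>' \<noteq> \<psi>" and ij: "i \<noteq> j"
  shows "slope \<psi> i * w' $ i + slope \<psi> j * w' $ j \<le> 0"
  using nat_ge_0[OF counter_mixed[OF hull, of w' \<psi>' w \<psi>]] o ne other_increment[OF o(1) ij, of w']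
  by (auto simp: other_def)

text \<open>By \<open>other_down\<close> a positive slope forces the other one to be nonnegative. So
  a negative slope would leave both nonpositive, against the unit relation with the nonnegative
  components of \<open>w\<close>.\<close>

lemma slope_nonneg:
  assumes o: "other w \<psi>"
  shows "0 \<le> slope \<psi> k"
proof -
  have less: "0 \<le> slope \<psi> i" if "0 < slope \<psi> j" "i \<noteq> j" for i j
  proof -
    obtain u where u: "down i u" using down_ex by blast
    have "0 \<le> slope \<psi> i - slope \<psi> j * u $ j" using other_down[OF o u that(2)] by (auto elim!: Nats_cases)
    moreover have "0 \<le> slope \<psi> j * u $ j" using that(1) down_nat[OF u that(2)] by (auto elim!: Nats_cases)
    ultimately show ?thesis by simp
  qed
  obtain l :: 2 where l: "k \<noteq> l" using exhaust_2[of k] by (metis zero_neq_one)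
  have "0 \<le> w $ k" "0 \<le> w $ l" by (rule nat_ge_0[OF other_nat[OF o]])+
  show ?thesis
  proof (rule ccontr)
    assume "\<not> 0 \<le> slope \<psi> k"
    then have neg: "slope \<psi> k \<le> 0" by simp
    with less[of l k] l \<open>\<not> 0 \<le> slope \<psi> k\<close> have "\<not> 0 < slope \<psi> l" by blast
    then have "slope \<psi> k * w $ k \<le> 0" "slope \<psi> l * w $ l \<le> 0"
      using neg \<open>0 \<le> w $ k\<close> \<open>0 \<le> w $ l\<close> by (auto intro: mult_nonpos_nonneg)
    then show False using other_unit[OF o l] by simp
  qed
qed

lemma other_form: "other w \<psi> \<Longrightarrow> i \<noteq> j \<Longrightarrow> \<psi> = (\<lambda>x. \<psi> 0 - slope \<psi> i * x $ i - slope \<psi> j * x $ j)"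
  using affine_map_slope[OF other_affine] by blast

lemma vec2_eqI: "x $ i = y $ i \<Longrightarrow> x $ j = y $ j \<Longrightarrow> i \<noteq> j \<Longrightarrow> x = (y :: real^2)"
  using UNIV_two[of i j] by (auto simp: vec_eq_iff)

text \<open>
  \<open>layered i j\<close> yields type (i) without or with a
  swap of coordinates, \<open>sheared\<close> yields type (i) with the map \<open>x \<mapsto> (x\<^sub>1, \<psi> x)\<close>, \<open>split\<close> yields
  type (ii), \<open>simplicial\<close> yields type (iii).
\<close>

definition layered :: "2 \<Rightarrow> 2 \<Rightarrow> bool" where
  "layered i j \<longleftrightarrow> (\<forall>u. down i u \<longrightarrow> u = axis i (-1)) \<and> (\<forall>w \<psi>. other w \<psi> \<longrightarrow> w = axis i 1)"

definition split :: bool where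
  "split \<longleftrightarrow> (\<forall>k u. down k u \<longrightarrow> u = axis k (-1)) \<and>
     (\<forall>w \<psi>. other w \<psi> \<longrightarrow> (\<exists>k. w = axis k 1 \<and> \<psi> = (\<lambda>x. \<psi> 0 - x $ k)))"

definition simplicial :: bool where
  "simplicial \<longleftrightarrow> (\<forall>i j u. i \<noteq> j \<longrightarrow> down i u \<longrightarrow> u $ j \<le> 1) \<and>
     (\<forall>w \<psi>. other w \<psi> \<longrightarrow> (\<forall>k. slope \<psi> k = 1))"

definition sheared :: bool where
  "sheared \<longleftrightarrow> (\<forall>i j u. i \<noteq> j \<longrightarrow> down i u \<longrightarrow> u $ j = 1) \<and>
     (\<exists>w \<psi> c. other w \<psi> \<and> 0 < c \<and> (\<forall>k. slope \<psi> k = c) \<and> (\<forall>w' \<psi>'. other w' \<psi>' \<longrightarrow> \<psi>' = \<psi>))"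

text \<open>As the jumps of coordinate \<open>i\<close> keep coordinate \<open>j\<close>,
  \<open>other_down\<close> makes both slopes natural numbers, and exactly one product in the unit
  relation is 1. The other component of \<open>w\<close> vanishes, since otherwise an affine
  function would violate \<open>counter_no_growth\<close>. The last clause records that a counter
  without dependence on \<open>x $ i\<close> also straightens the jumps of coordinate
  \<open>j\<close>.\<close>

lemma straight_other:
  assumes ij: "i \<noteq> j" and A: "\<And>u. down i u \<Longrightarrow> u $ j = 0" and o: "other w \<psi>"
  shows "w = axis i 1 \<and> slope \<psi> i = 1 \<or>
    w = axis j 1 \<and> slope \<psi> j = 1 \<and> (slope \<psi> i = 0 \<longrightarrow> (\<forall>v. down j v \<longrightarrow> v $ i = 0))"
proof -
  have ji: "j \<noteq> i" using ij by simp
  have ax: "axis i (1::real) $ j = 0" "axis j (1::real) $ i = 0" using ij by (auto simp: axis_def)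
  obtain u where u: "down i u" using down_ex by blast
  obtain v where v: "down j v" using down_ex by blast
  have cu: "counter E u (\<lambda>x. x $ i)" and cv: "counter E v (\<lambda>x. x $ j)" and cw: "counter E w \<psi>"
    using u v o by (auto simp: down_def other_def)
  have vi: "0 \<le> v $ i" using down_nat[OF v ji] by (auto elim!: Nats_cases)
  have p: "slope \<psi> i \<in> \<nat>" using other_down[OF o u ij] A[OF u] by simp
  have "slope \<psi> i * v $ i \<in> \<nat>" by (intro Nats_mult p down_nat[OF v ji])
  from Nats_add[OF other_down[OF o v ji] this] have q: "slope \<psi> j \<in> \<nat>" by simp
  have w: "w $ i \<in> \<nat>" "w $ j \<in> \<nat>" using other_nat[OF o] by auto
  from nat_sum_one[OF Nats_mult[OF p w(1)] Nats_mult[OF q w(2)] other_unit[OF o ij]]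
  show ?thesis
  proof (elim disjE conjE)
    assume 1: "slope \<psi> i * w $ i = 1" and 2: "slope \<psi> j * w $ j = 0"
    have 11: "slope \<psi> i = 1" "w $ i = 1" using nat_product_one[OF p w(1) 1] by auto
    have "w $ j = 0"
    proof (rule ccontr)
      assume wj: "w $ j \<noteq> 0"
      then have q0: "slope \<psi> j = 0" using 2 by simp
      have "0 < w $ j" using w(2) wj by (auto elim!: Nats_cases)
      \<comment> \<open>Here \<open>\<psi>\<close> is a constant minus \<open>x $ i\<close>, while
        \<open>x $ j\<close> is unchanged by \<open>u\<close> and grows along
        \<open>w\<close>.\<close>
      then show False
        using counter_no_growth[OF finite_E hull cu cw affine_map_nth[of j], of "\<psi> 0"] A[OF u] other_form[OF o ij] q0 11 by (auto dest: fun_cong)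
    qed
    then have "w = axis i 1" using 11 ax by (intro vec2_eqI[OF _ _ ij]) (simp_all add: axis_def)
    then show ?thesis using 11 by simp
  next
    assume 1: "slope \<psi> i * w $ i = 0" and 2: "slope \<psi> j * w $ j = 1"
    have 22: "slope \<psi> j = 1" "w $ j = 1" using nat_product_one[OF q w(2) 2] by auto
    have grow: "v' $ i + w $ i = 0" if p0: "slope \<psi> i = 0" and v': "down j v'" for v'
    proof (rule ccontr)
      assume ne: "v' $ i + w $ i \<noteq> 0"
      have "v' $ i \<in> \<nat>" by (rule down_nat[OF v' ji])
      then have pos: "0 < w $ i + v' $ i * w $ j" using ne w(1) 22 by (auto elim!: Nats_cases)
      \<comment> \<open>The weight makes the function constant along \<open>v'\<close>, whose
        component \<open>j\<close> is -1, while it grows along \<open>w\<close>.\<close>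
      have f: "affine_map (\<lambda>x::real^2. x $ i + v' $ i * x $ j)" by (simp add: affine_map_def algebra_simps)
      have cv': "counter E v' (\<lambda>x. x $ j)" using v' by (simp add: down_def)
      show False
        using counter_no_growth[OF finite_E hull cv' cw f, of "\<psi> 0"] pos down_nth[OF v'] other_form[OF o ij] 22 p0 by (auto dest: fun_cong)
    qed
    have "w $ i = 0"
    proof (rule ccontr)
      assume wi: "w $ i \<noteq> 0"
      then have "slope \<psi> i = 0" using 1 by simp
      from grow[OF this v] show False using wi vi w(1) by (auto elim!: Nats_cases)
    qed
    then have "w = axis j 1" using 22 ax by (intro vec2_eqI[OF _ _ ij]) (simp_all add: axis_def)
    moreover have "\<forall>v. down j v \<longrightarrow> v $ i = 0" if "slope \<psi> i = 0" using grow[OF that] \<open>w $ i = 0\<close> by simp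
    ultimately show ?thesis using 22 by simp
  qed
qed

text \<open>If further counters belong to \<open>axis i 1\<close> only, the coordinate
  \<open>j\<close> is never raised. Otherwise \<open>axis j 1\<close> occurs. If the jumps of
  coordinate \<open>j\<close> are straight too, it occurs alone, which is a layer again, or next to
  \<open>axis i 1\<close>, with the same counter (simplex) or a different one (split). If some jump
  of coordinate \<open>j\<close> moves coordinate \<open>i\<close>, the slopes are pinned to 1
  (simplex).\<close>

lemma straight_cases:
  assumes ij: "i \<noteq> j" and A: "\<And>u. down i u \<Longrightarrow> u $ j = 0"
  shows "layered i j \<or> layered j i \<or> split \<or> simplicial"
proof -
  have ji: "j \<noteq> i" using ij by simp
  have ax: "axis i (1::real) $ j = 0" "axis j (1::real) $ i = 0" "axis i (1::real) \<noteq> axis j 1" using ij by (auto simp: axis_def vec_eq_iff)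
  have so: "w = axis i 1 \<and> slope \<psi> i = 1 \<or>
    w = axis j 1 \<and> slope \<psi> j = 1 \<and> (slope \<psi> i = 0 \<longrightarrow> (\<forall>v. down j v \<longrightarrow> v $ i = 0))" if "other w \<psi>" for w \<psi>
    using straight_other[OF ij _ that] A by blast
  have two: "k = i \<or> k = j" for k using UNIV_two[OF ij] by auto
  have di: "u = axis i (-1)" if "down i u" for u
    using A[OF that] down_nth[OF that] ij by (intro vec2_eqI[OF _ _ ij]) (simp_all add: axis_def)
  show ?thesis
  proof (cases "\<forall>w \<psi>. other w \<psi> \<longrightarrow> w = axis i 1")
    case True
    then show ?thesis using di by (auto simp: layered_def)
  next
    case False
    then obtain w \<psi> where o: "other w \<psi>" "w \<noteq> axis i 1" by blast
    with so[OF o(1)] have w: "w = axis j 1" "slope \<psi> j = 1" and p0: "slope \<psi> i = 0 \<Longrightarrow> down j v \<Longrightarrow> v $ i = 0" for v by auto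
    \<comment> \<open>\<open>w = axis j 1\<close> is the jump of \<open>\<psi>\<close> and must not
      lower another counter, so the slope of the latter along \<open>j\<close> is at most 0.\<close>
    have zero: "slope \<psi>' j = 0" if "other w' \<psi>'" "\<psi>' \<noteq> \<psi>" for w' \<psi>'
      using other_other[OF that(1) o(1) that(2)[symmetric] ij] slope_nonneg[OF that(1), of j] w ax by simp
    have dj: "v = axis j (-1)" if "down j v" "v $ i = 0" for v
      using that(2) down_nth[OF that(1)] ij by (intro vec2_eqI[OF _ _ ij]) (simp_all add: axis_def)
    show ?thesis
    proof (cases "\<forall>v. down j v \<longrightarrow> v $ i = 0")
      case B: True
      show ?thesis
      proof (cases "\<forall>w \<psi>. other w \<psi> \<longrightarrow> w = axis j 1")
        case True
        then show ?thesis using dj B by (auto simp: layered_def)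
      next
        case False
        then obtain w' \<psi>' where o': "other w' \<psi>'" "w' \<noteq> axis j 1" by blast
        with so[OF o'(1)] have w': "w' = axis i 1" "slope \<psi>' i = 1" by auto
        show ?thesis
        proof (cases "\<psi>' = \<psi>")
          case True
          have "\<psi>'' = \<psi>" if o'': "other w'' \<psi>''" for w'' \<psi>''
          proof (rule ccontr)
            assume ne: "\<psi>'' \<noteq> \<psi>"
            have "slope \<psi>'' i \<le> 0"
              using other_other[OF o'' o'(1) _ ij] ne True w' ax by simp
            then have "slope \<psi>'' i = 0" using slope_nonneg[OF o'', of i] by simp
            then show False using other_unit[OF o'' ij] zero[OF o'' ne] by simp
          qed
          moreover have "slope \<psi> k = 1" for k using two[of k] w w' True by auto
          moreover have "u $ l \<le> 1" if "k \<noteq> l" "down k u" for k l u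
            using that A B two[of k] two[of l] by force
          ultimately show ?thesis unfolding simplicial_def by metis
        next
          case ne: False
          have q: "slope \<psi>' j = 0" by (rule zero[OF o'(1) ne])
          have p: "slope \<psi> i = 0"
            using other_other[OF o(1) o'(1) ne ij] slope_nonneg[OF o(1), of i] w' ax by simp
          have down: "u = axis k (-1)" if "down k u" for k u using two[of k] di dj B that by auto
          have oth: "\<exists>k. w'' = axis k 1 \<and> \<psi>'' = (\<lambda>x. \<psi>'' 0 - x $ k)" if o'': "other w'' \<psi>''" for w'' \<psi>''
          proof -
            have e: "\<psi>'' = \<psi> \<or> \<psi>'' = \<psi>'"
            proof (rule ccontr)
              assume n: "\<not> ?thesis"
              then have ne': "\<psi>' \<noteq> \<psi>''" by auto
              have "slope \<psi>'' i \<le> 0"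
                using other_other[OF o'' o'(1) ne' ij] w' ax by simp
              then have "slope \<psi>'' i = 0" using slope_nonneg[OF o'', of i] by simp
              then show False using other_unit[OF o'' ij] zero[OF o''] n by simp
            qed
            have form: "\<psi>'' = (\<lambda>x. \<psi>'' 0 - slope \<psi>'' i * x $ i - slope \<psi>'' j * x $ j)" by (rule other_form[OF o'' ij])
            from e show ?thesis
            proof
              assume eq: "\<psi>'' = \<psi>"
              then have "w'' = axis j 1" using so[OF o''] p by auto
              moreover have "\<psi>'' = (\<lambda>x. \<psi>'' 0 - x $ j)" using form eq p w by simp
              ultimately show ?thesis by blast
            next
              assume eq: "\<psi>'' = \<psi>'"
              then have "w'' = axis i 1" using so[OF o''] q by auto
              moreover have "\<psi>'' = (\<lambda>x. \<psi>'' 0 - x $ i)" using form eq q w' by simp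
              ultimately show ?thesis by blast
            qed
          qed
          show ?thesis using down oth by (simp add: split_def)
        qed
      qed
    next
      case False
      then obtain v where v: "down j v" "v $ i \<noteq> 0" by blast
      have bnat: "b \<in> \<nat>" if "down j v'" "b = v' $ i" for v' b using down_nat[OF that(1) ji] that by simp
      have b1: "1 \<le> v $ i" using bnat[OF v(1) refl] v(2) by (intro nat_pos_ge_1) (auto elim!: Nats_cases)
      have p: "slope \<psi> i \<noteq> 0" using p0 v by blast
      obtain u where u: "down i u" using down_ex by blast
      have "slope \<psi> i \<in> \<nat>" using other_down[OF o(1) u ij] A[OF u] by simp
      then have p1: "1 \<le> slope \<psi> i" using p by (intro nat_pos_ge_1) (auto elim!: Nats_cases)
      have le: "slope \<psi>' i * v' $ i \<le> slope \<psi>' j" if "other w' \<psi>'" "down j v'" for w' \<psi>' v'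
        using other_down[OF that ji] by (auto elim!: Nats_cases)
      have "slope \<psi> i * 1 \<le> slope \<psi> i * v $ i" using b1 p1 by (intro mult_left_mono) auto
      \<comment> \<open>\<open>other_down\<close> bounds \<open>slope \<psi> i * v $ i\<close> by
        \<open>slope \<psi> j = 1\<close>, while both factors are at least 1.\<close>
      then have pe: "slope \<psi> i = 1" using le[OF o(1) v(1)] w(2) p1 by linarith
      have "\<psi>' = \<psi>" if o': "other w' \<psi>'" for w' \<psi>'
      proof (rule ccontr)
        assume ne: "\<psi>' \<noteq> \<psi>"
        have q0: "slope \<psi>' j = 0" by (rule zero[OF o' ne])
        have "slope \<psi>' i * 1 \<le> slope \<psi>' i * v $ i" using b1 slope_nonneg[OF o'] by (intro mult_left_mono) auto
        then have "slope \<psi>' i = 0" using le[OF o' v(1)] q0 slope_nonneg[OF o', of i] by linarith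
        then show False using other_unit[OF o' ij] q0 by simp
      qed
      moreover have "slope \<psi> k = 1" for k using two[of k] w pe by auto
      moreover have "u $ l \<le> 1" if kl: "k \<noteq> l" "down k u" for k l u
      proof (cases "k = i")
        case True
        then show ?thesis using A kl two[of l] by force
      next
        case False
        then show ?thesis using le[OF o(1), of u] pe w kl two[of k] two[of l] by auto
      qed
      ultimately show ?thesis unfolding simplicial_def by metis
    qed
  qed
qed

lemma classification: "layered 1 2 \<or> layered 2 1 \<or> split \<or> simplicial \<or> sheared"
proof (cases "\<exists>i j. i \<noteq> j \<and> (\<forall>u. down i u \<longrightarrow> u $ j = 0)")
  case True
  then obtain i j where ij: "i \<noteq> j" and A: "\<And>u. down i u \<Longrightarrow> u $ j = 0" by blast
  have "(i = 1 \<and> j = 2) \<or> (i = 2 \<and> j = 1)" using exhaust_2[of i] exhaust_2[of j] ij by auto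
  then show ?thesis using straight_cases[OF ij A] by auto
next
  case False
  have ex1: "\<exists>u. down i u \<and> 1 \<le> u $ j" if ij: "i \<noteq> j" for i j
  proof -
    obtain u where u: "down i u" "u $ j \<noteq> 0" using False ij by blast
    have "1 \<le> u $ j" using down_nat[OF u(1) ij] u(2) by (intro nat_pos_ge_1) (auto elim!: Nats_cases)
    then show ?thesis using u by blast
  qed
  \<comment> \<open>Each projection has a jump that raises the other coordinate by at least 1, and
    \<open>down_cycle\<close> bounds the product of two opposite increments by 1.\<close>
  have le1: "u $ j \<le> 1" if u: "down i u" and ij: "i \<noteq> j" for i j u
  proof -
    obtain v where v: "down j v" "1 \<le> v $ i" using ex1[of j i] ij by blast
    have "u $ j * 1 \<le> u $ j * v $ i" using v(2) down_nat[OF u ij] by (intro mult_left_mono) (auto elim!: Nats_cases)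
    then show ?thesis using down_cycle[OF u v(1) ij] by simp
  qed
  \<comment> \<open>A jump with \<open>u $ j = 1\<close> turns \<open>other_down\<close> into a
    comparison of the two slopes; exchanging the coordinates gives equality.\<close>
  have sle: "slope \<psi> j \<le> slope \<psi> i" if o: "other w \<psi>" and ij: "i \<noteq> j" for w \<psi> i j
  proof -
    obtain u where u: "down i u" "1 \<le> u $ j" using ex1[OF ij] by blast
    have "u $ j = 1" using le1[OF u(1) ij] u(2) by simp
    then show ?thesis using other_down[OF o u(1) ij] by (auto elim!: Nats_cases)
  qed
  have seq: "slope \<psi> i = slope \<psi> j" if o: "other w \<psi>" for w \<psi> i j
    using sle[OF o, of i j] sle[OF o, of j i] by (cases "i = j") auto
  show ?thesis
  proof (cases "\<forall>w \<psi>. other w \<psi> \<longrightarrow> slope \<psi> 1 = 1")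
    case True
    then have "simplicial" unfolding simplicial_def using le1 seq by metis
    then show ?thesis by simp
  next
    case False
    then obtain w \<psi> where o: "other w \<psi>" and c1: "slope \<psi> 1 \<noteq> 1" by blast
    define c where "c = slope \<psi> 1"
    have sc: "slope \<psi> k = c" for k unfolding c_def by (rule seq[OF o])
    have sum: "c * (w $ i + w $ j) = 1" if "i \<noteq> j" for i j
      using other_unit[OF o that] sc by (simp add: algebra_simps)
    have "0 \<le> c" using slope_nonneg[OF o, of 1] by (simp add: c_def)
    then have c0: "0 < c" using sum[of 1 2] by (cases "c = 0") auto
    \<comment> \<open>\<open>c\<close> times the natural number \<open>w $ 1 + w $ 2\<close> is 1,
      so a natural \<open>c\<close> would be 1.\<close>
    have notnat: "c \<notin> \<nat>"
    proof
      assume "c \<in> \<nat>"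
      then have "c = 1" using nat_product_one[OF _ Nats_add[OF other_nat[OF o] other_nat[OF o]] sum[of 1 2]] by simp
      then show False using c1 by (simp add: c_def)
    qed
    \<comment> \<open>\<open>other_down\<close> requires \<open>c - c * u $ j\<close> to be natural,
      which excludes \<open>u $ j = 0\<close> when \<open>c\<close> is not natural.\<close>
    have down1: "u $ j = 1" if u: "down i u" and ij: "i \<noteq> j" for i j u
    proof -
      have "u $ j \<noteq> 0" using other_down[OF o u ij] notnat sc by auto
      then have "1 \<le> u $ j" using down_nat[OF u ij] by (intro nat_pos_ge_1) (auto elim!: Nats_cases)
      then show ?thesis using le1[OF u ij] by simp
    qed
    \<comment> \<open>The jump of a second counter must not lower \<open>\<psi>\<close>; having
      nonnegative components it would be 0 and could not lower its own counter.\<close>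
    have "\<psi>' = \<psi>" if o': "other w' \<psi>'" for w' \<psi>'
    proof (rule ccontr)
      assume ne: "\<psi>' \<noteq> \<psi>"
      have "c * (w' $ 1 + w' $ 2) \<le> 0" using other_other[OF o o' ne, of 1 2] sc by (simp add: algebra_simps)
      moreover have "0 \<le> w' $ k" for k using other_nat[OF o', of k] by (auto elim!: Nats_cases)
      ultimately have "w' $ 1 + w' $ 2 = 0" using c0 by (metis add_nonneg_nonneg antisym mult_le_0_iff not_less)
      then have "w' $ 1 = 0" "w' $ 2 = 0" using \<open>\<And>k. 0 \<le> w' $ k\<close> by (metis add_nonneg_eq_0_iff)+
      then show False using other_unit[OF o', of 1 2] by simp
    qed
    then have sheared unfolding sheared_def using down1 o c0 sc by metis
    then show ?thesis by simp
  qed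
qed

end

section \<open>Affine processes with finite state space\<close>

lemma compact_lattice_finite:
  fixes E :: "(real^'n) set"
  assumes "compact E" "E \<subseteq> lattice_points"
  shows "finite E"
proof -
  obtain B where B: "\<And>x. x \<in> E \<Longrightarrow> norm x \<le> B"
    using compact_imp_bounded[OF assms(1)] by (auto simp: bounded_iff)
  let ?n = "nat \<lceil>B\<rceil>"
  have "E \<subseteq> (\<lambda>f. \<chi> k. real (f k)) ` (PiE UNIV (\<lambda>_. {..?n}))"
  proof
    fix x assume x: "x \<in> E"
    then have "\<forall>k. \<exists>m. x $ k = real m" using assms(2) by (auto elim!: Nats_cases)
    then obtain f where f: "\<And>k. x $ k = real (f k)" by metis
    have fB: "real (f k) \<le> B" for k using B[OF x] component_le_norm_cart[of x k] f[of k] by simp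
    have "f k \<le> ?n" for k using order_trans[OF fB of_nat_ceiling, of k] by simp
    then have "f \<in> PiE UNIV (\<lambda>_. {..?n})" by (simp add: PiE_UNIV_domain)
    moreover have "x = (\<chi> k. real (f k))" by (simp add: vec_eq_iff f)
    ultimately show "x \<in> (\<lambda>f. \<chi> k. real (f k)) ` (PiE UNIV (\<lambda>_. {..?n}))" by blast
  qed
  then show ?thesis by (rule finite_subset) (intro finite_imageI finite_PiE, auto)
qed

text \<open>The support condition at a state \<open>x\<close> is visible only under
  \<open>P x\<close>, the measure that starts there. As \<open>F\<close> is common to all measures,
  it then holds for the chain under \<open>P x0\<close> as well.\<close>

lemma affine_jump_chain:
  assumes fam: "semimartingale_family M Fi E X P" and aff: "affine_process M Fi E P h E X b c F"
    and E: "finite E" and x0: "x0 \<in> E"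
  shows "jump_chain (P x0) Fi X E F"
proof -
  have sp: "space (P x) = space M" if "x \<in> E" for x
    using fam that by (intro sets_eq_imp_space_eq) (simp add: semimartingale_family_def)
  have char: "finite_state_characteristics (P x) Fi X E F" if x: "x \<in> E" for x
  proof (intro finite_state_characteristics.intro finite_state_kernel.intro finite_state_process.intro filtered_prob_space.intro
      filtered_prob_space_axioms.intro finite_state_process_axioms.intro finite_state_kernel_axioms.intro finite_state_characteristics_axioms.intro)
    have filt: "right_cont_filtration M Fi" and sets: "sets (P x) = sets M"
      using fam x by (auto simp: semimartingale_family_def)
    show "prob_space (P x)" using fam x by (simp add: semimartingale_family_def)
    show "subalgebra (P x) (Fi t)" if "0 \<le> t" for t
      using filt[unfolded right_cont_filtration_def, THEN conjunct1, rule_format, OF that]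
      unfolding subalgebra_def sets sp[OF x] .
    show "sets (Fi s) \<subseteq> sets (Fi t)" if "0 \<le> s" "s \<le> t" for s t
      using filt[unfolded right_cont_filtration_def, THEN conjunct2, THEN conjunct1] that by blast
    have proc: "process_in M Fi E X" using fam by (simp add: semimartingale_family_def)
    then show "adapted Fi X" by (simp add: process_in_def)
    show "finite_path (\<lambda>t. X t \<omega>) E" if "\<omega> \<in> space (P x)" for \<omega>
      using proc that E unfolding process_in_def finite_path_def sp[OF x] by blast
    show "is_positive (F y)" if "y \<in> E" for y
      using aff that by (simp add: affine_process_def affine_triplet_def)
    show "is_compensator (P x) Fi X (\<lambda>\<omega>. kernel_measure F (\<lambda>r. X r \<omega>))"
      using aff x by (simp add: affine_process_def has_characteristics_def)
  qed
  show ?thesis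
  proof (rule jump_chain.intro[OF char[OF x0]], rule jump_chain_axioms.intro)
    fix x assume x: "x \<in> E"
    have "AE \<omega> in P x. X 0 \<omega> = x" using fam x by (simp add: semimartingale_family_def)
    then show "emeasure (measure_from (F x)) (- (\<lambda>y. y - x) ` E) = 0"
      by (rule finite_state_characteristics.jump_law_support[OF char[OF x] x])
  qed
qed

context finite_path begin

text \<open>The path is constant shortly before \<open>t\<close>, so the left limit passes through
  an arbitrary function.\<close>

lemma left_lim_compose:
  fixes f :: "'a \<Rightarrow> 'b::t2_space"
  assumes t: "0 < t"
  shows "left_lim (\<lambda>s. f (y s)) t = f (left_lim y t)"
proof -
  obtain d where d: "d > 0" "\<And>s. t - d < s \<Longrightarrow> s < t \<Longrightarrow> 0 \<le> s \<Longrightarrow> y s = left_lim y t"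
    using left_constant[OF t] by blast
  have "eventually (\<lambda>s. f (left_lim y t) = f (y s)) (at_left t)"
    using d t by (auto simp: eventually_at_left_field intro!: exI[of _ "max 0 (t - d)"])
  then have "((\<lambda>s. f (y s)) \<longlongrightarrow> f (left_lim y t)) (at_left t)"
    by (rule Lim_transform_eventually[OF tendsto_const])
  then have "Lim (at_left t) (\<lambda>s. f (y s)) = f (left_lim y t)"
    by (intro tendsto_Lim) (simp_all add: trivial_limit_at_left_real)
  then show ?thesis using t by (simp add: left_lim_def)
qed

end

text \<open>\<open>monotone_level\<close> for the second coordinate after \<open>T\<close>, where
  \<open>u0\<close> is the jump that keeps lowering it while it is positive. The bound by the
  initial level on the number of downward jumps is relaxed to the maximal level.\<close>

lemma layer_structureI:
  fixes E :: "(real^2) set" and T :: "real^2 \<Rightarrow> real^2"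
  assumes chain: "\<And>x. x \<in> E \<Longrightarrow> jump_chain (P x) Fi X E F"
    and start: "\<And>x. x \<in> E \<Longrightarrow> AE \<omega> in P x. X 0 \<omega> = x"
    and E: "finite E" and T: "affine_map T" "bij T"
    and nat: "\<And>x. x \<in> E \<Longrightarrow> T x $ 2 \<in> \<nat>"
    and steps: "\<And>u. u \<in> jump_sizes E F \<Longrightarrow> (T u - T 0) $ 2 \<in> {0, -1}"
    and u0: "u0 \<in> jump_sizes E F" "(T u0 - T 0) $ 2 = -1" "\<And>x. x \<in> E \<Longrightarrow> 0 < T x $ 2 \<Longrightarrow> 0 < F x {u0}"
  shows "layer_structure (T ` E) ((\<lambda>u. T u - T 0) ` jump_sizes E F) (\<lambda>y. P (inv T y)) (\<lambda>t \<omega>. T (X t \<omega>))"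
proof -
  have add: "T (x + u) $ 2 = T x $ 2 + (T u - T 0) $ 2" for x u using affine_map_add[OF T(1), of x u] by simp
  have inv: "inv T (T x) = x" for x using T(2) by (simp add: bij_is_inj)
  define E0 where "E0 = {x \<in> T ` E. x $ 2 = 0}"
  define N where "N = Max ((\<lambda>x. x $ 2) ` T ` E)"
  have le_N: "T x $ 2 \<le> N" if "x \<in> E" for x unfolding N_def using E that by (intro Max_ge) auto
  have main: "(AE \<omega> in P x. (\<forall>t\<ge>0. X t \<omega> \<in> E) \<and> (\<forall>t\<ge>0. T (X t \<omega>) $ 2 \<le> T x $ 2)) \<and>
    (AE \<omega> in P x. (\<forall>t>0. jump (\<lambda>s. T (X s \<omega>)) t $ 2 \<le> 0) \<and>
      (let D = {t. 0 < t \<and> jump (\<lambda>s. T (X s \<omega>)) t $ 2 < 0} in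
        finite D \<and> real (card D) \<le> N \<and> (\<forall>t\<ge>0. (\<forall>s\<in>D. s \<le> t) \<longrightarrow> T (X t \<omega>) \<in> E0)))" if x: "x \<in> E" for x
  proof -
    interpret jump_chain "P x" Fi X E F by (rule chain[OF x])
    have S: "S = jump_sizes E F" unfolding S_def jump_sizes_eq ..
    have level: "AE \<omega> in P x. (\<forall>t>0. T (X t \<omega>) $ 2 \<le> T (Xm \<omega> t) $ 2) \<and> (\<forall>t\<ge>0. T (X t \<omega>) $ 2 \<le> T (X 0 \<omega>) $ 2) \<and>
      (let D = {t. 0 < t \<and> T (X t \<omega>) $ 2 < T (Xm \<omega> t) $ 2} in finite D \<and> real (card D) \<le> T (X 0 \<omega>) $ 2 \<and>
        (\<forall>t\<ge>0. (\<forall>s\<in>D. s \<le> t) \<longrightarrow> T (X t \<omega>) $ 2 = 0))"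
    proof (rule monotone_level[OF nat])
      show "u0 \<in> U" using u0(1) unfolding jump_sizes_eq by simp
      show "T (x + u) $ 2 = T x $ 2 \<or> T (x + u) $ 2 = T x $ 2 - 1" if "u \<in> S" for x u
        using steps[of u] that unfolding add S by auto
      show "0 < rate u0 x" if "x \<in> E" "0 < T x $ 2" for x using u0(3)[OF that] by (simp add: rate_def)
      show "T (x + u0) $ 2 = T x $ 2 - 1" for x unfolding add u0(2) by simp
    qed
    have jump: "jump (\<lambda>s. T (X s \<omega>)) t $ 2 = T (X t \<omega>) $ 2 - T (Xm \<omega> t) $ 2" if \<omega>: "\<omega> \<in> space (P x)" and t: "0 < t" for \<omega> t
      using finite_path.left_lim_compose[OF paths[OF \<omega>] t, of T] by (simp add: jump_def)
    have range: "X t \<omega> \<in> E" if "\<omega> \<in> space (P x)" "0 \<le> t" for \<omega> t by (rule finite_path.range[OF paths[OF that(1)] that(2)])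
    have sp: "AE \<omega> in P x. \<omega> \<in> space (P x)" by simp
    show ?thesis
    proof
      show "AE \<omega> in P x. (\<forall>t\<ge>0. X t \<omega> \<in> E) \<and> (\<forall>t\<ge>0. T (X t \<omega>) $ 2 \<le> T x $ 2)"
        using level start[OF x] sp
      proof eventually_elim
        case (elim \<omega>)
        show ?case using elim(1) range[OF elim(3)] unfolding elim(2) by blast
      qed
      show "AE \<omega> in P x. (\<forall>t>0. jump (\<lambda>s. T (X s \<omega>)) t $ 2 \<le> 0) \<and>
        (let D = {t. 0 < t \<and> jump (\<lambda>s. T (X s \<omega>)) t $ 2 < 0} in
          finite D \<and> real (card D) \<le> N \<and> (\<forall>t\<ge>0. (\<forall>s\<in>D. s \<le> t) \<longrightarrow> T (X t \<omega>) \<in> E0))"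
        using level start[OF x] sp
      proof eventually_elim
        case (elim \<omega>)
        note j = jump[OF elim(3)]
        have D: "{t. 0 < t \<and> jump (\<lambda>s. T (X s \<omega>)) t $ 2 < 0} = {t. 0 < t \<and> T (X t \<omega>) $ 2 < T (Xm \<omega> t) $ 2}"
          using j by (intro Collect_cong conj_cong refl) simp
        have down: "jump (\<lambda>s. T (X s \<omega>)) t $ 2 \<le> 0" if "0 < t" for t
          using elim(1) j[OF that] that by simp
        note l = elim(1)[THEN conjunct2, THEN conjunct2, unfolded Let_def]
        show ?case unfolding Let_def D
        proof (intro conjI allI impI)
          show "jump (\<lambda>s. T (X s \<omega>)) t $ 2 \<le> 0" if "0 < t" for t by (rule down[OF that])
          show "finite {t. 0 < t \<and> T (X t \<omega>) $ 2 < T (Xm \<omega> t) $ 2}" using l by blast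
          have "real (card {t. 0 < t \<and> T (X t \<omega>) $ 2 < T (Xm \<omega> t) $ 2}) \<le> T (X 0 \<omega>) $ 2" using l by blast
          then show "real (card {t. 0 < t \<and> T (X t \<omega>) $ 2 < T (Xm \<omega> t) $ 2}) \<le> N"
            using le_N[OF x] elim(2) by simp
          fix t :: real assume t: "0 \<le> t" "\<forall>s\<in>{t. 0 < t \<and> T (X t \<omega>) $ 2 < T (Xm \<omega> t) $ 2}. s \<le> t"
          then have "T (X t \<omega>) $ 2 = 0" using l by blast
          then show "T (X t \<omega>) \<in> E0" using range[OF elim(3) t(1)] by (simp add: E0_def)
        qed
      qed
    qed
  qed
  have "stochastically_invariant (\<lambda>y. P (inv T y)) (\<lambda>t \<omega>. T (X t \<omega>)) E0"
    unfolding stochastically_invariant_def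
  proof
    fix y assume "y \<in> E0"
    then obtain x where x: "x \<in> E" "y = T x" "T x $ 2 = 0" by (auto simp: E0_def)
    have "AE \<omega> in P x. \<forall>t\<ge>0. T (X t \<omega>) \<in> E0"
      using main[OF x(1), THEN conjunct1]
    proof eventually_elim
      case (elim \<omega>)
      show ?case
      proof (intro allI impI)
        fix t :: real assume t: "0 \<le> t"
        have E: "X t \<omega> \<in> E" and le: "T (X t \<omega>) $ 2 \<le> 0" using elim t unfolding x(3) by blast+
        from order_antisym[OF le nat_ge_0[OF nat[OF E]]] E show "T (X t \<omega>) \<in> E0" by (simp add: E0_def)
      qed
    qed
    then show "AE \<omega> in P (inv T y). \<forall>t\<ge>0. T (X t \<omega>) \<in> E0" unfolding x(2) inv .
  qed
  moreover have "\<forall>u\<in>(\<lambda>u. T u - T 0) ` jump_sizes E F. u $ 2 \<le> 0" using steps by force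
  moreover have "AE \<omega> in P (inv T y). (\<forall>t>0. jump (\<lambda>s. T (X s \<omega>)) t $ 2 \<le> 0) \<and>
      (let D = {t. 0 < t \<and> jump (\<lambda>s. T (X s \<omega>)) t $ 2 < 0} in
        finite D \<and> real (card D) \<le> N \<and> (\<forall>t\<ge>0. (\<forall>s\<in>D. s \<le> t) \<longrightarrow> T (X t \<omega>) \<in> E0))" if "y \<in> T ` E" for y
  proof -
    from that obtain x where x: "x \<in> E" "y = T x" by blast
    show ?thesis unfolding x(2) inv by (rule main[OF x(1), THEN conjunct2])
  qed
  ultimately show ?thesis
    unfolding layer_structure_def Let_def E0_def[symmetric] N_def[symmetric] by blast
qed

text \<open>A rate that did not decrease along \<open>u\<close> would stay positive on the whole ray
  of multiples of \<open>u\<close> from \<open>x0\<close>, and infinitely many points would lie in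
  \<open>E\<close>. So it decreases, and dividing by the decrease \<open>a\<close> normalizes
  it.\<close>

lemma counter_of_rate:
  fixes r :: "real^'n \<Rightarrow> real"
  assumes fin: "finite E" and r: "affine_map r" "\<And>x. x \<in> E \<Longrightarrow> 0 \<le> r x" "\<And>x. x \<in> E \<Longrightarrow> 0 < r x \<Longrightarrow> x + u \<in> E"
    and ex: "x0 \<in> E" "0 < r x0" and u: "u \<noteq> 0"
  shows "\<exists>\<psi> a. 0 < a \<and> counter E u \<psi> \<and> (\<forall>x. r x = a * \<psi> x)"
proof -
  define a where "a = r 0 - r u"
  have a: "0 < a"
  proof (rule ccontr)
    assume "\<not> 0 < a"
    then have up: "0 \<le> r u - r 0" by (simp add: a_def)
    have "x0 + real k *\<^sub>R u \<in> E" for k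
    proof (induction k)
      case (Suc k)
      have "0 < r (x0 + real k *\<^sub>R u)"
        using affine_map_add_scaleR[OF r(1), of x0 "real k" u] mult_nonneg_nonneg[OF of_nat_0_le_iff up, of k] ex by simp
      from r(3)[OF Suc this] show ?case by (simp add: algebra_simps)
    qed (simp add: ex)
    then have "range (\<lambda>k. x0 + real k *\<^sub>R u) \<subseteq> E" by blast
    moreover have "inj (\<lambda>k. x0 + real k *\<^sub>R u)" using u by (auto simp: inj_def)
    ultimately show False using fin finite_subset range_inj_infinite by blast
  qed
  have "counter E u (\<lambda>x. r x / a)"
    unfolding counter_def jump_counter_def
  proof (intro conjI)
    show "affine_map (\<lambda>x. r x / a)" using r(1) by (simp add: affine_map_def add_divide_distrib)
    have "r u - r 0 = - a" by (simp add: a_def)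
    then show "r u / a - r 0 / a = -1" using a by (simp add: diff_divide_distrib[symmetric])
    show "\<exists>x. r x / a \<noteq> 0" using ex a by (intro exI[of _ x0]) simp
  qed (use r(2,3) a in \<open>auto simp: zero_less_divide_iff\<close>)
  then show ?thesis using a by (intro exI[of _ "\<lambda>x. r x / a"] exI[of _ a]) simp
qed

lemma vector_2_eqI: "x $ 1 = a \<Longrightarrow> x $ 2 = b \<Longrightarrow> (x :: real^2) = vector [a, b]"
  by (simp add: vec_eq_iff forall_2)

lemma affine_map_vector:
  fixes f g :: "real^2 \<Rightarrow> real"
  assumes "affine_map f" "affine_map g"
  shows "affine_map (\<lambda>x. vector [f x, g x] :: real^2)"
  using assms by (simp add: affine_map_def vec_eq_iff forall_2)

section \<open>From the cases of the classification to the three types\<close>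

locale planar_affine = planar_counters E S for E S :: "(real^2) set" +
  fixes F :: "real^2 \<Rightarrow> (real^2) set \<Rightarrow> real"
  assumes S_eq: "S = jump_sizes E F"
    and rate_counter: "u \<in> S \<Longrightarrow> \<exists>\<psi> a. 0 < a \<and> counter E u \<psi> \<and> (\<forall>x. F x {u} = a * \<psi> x)"
begin

lemma rate_of_counter:
  assumes "u \<in> S" "counter E u \<psi>"
  obtains a where "0 < a" "\<And>x. F x {u} = a * \<psi> x"
  using rate_counter[OF assms(1)] counter_unique[OF hull assms(2)] by metis

text \<open>The first alternative of the conclusion, named because three cases of the classification
  end in it. Composing \<open>P\<close> with \<open>inv T\<close> indexes the measures by the new
  starting points.\<close>

definition type_i :: "(real^2 \<Rightarrow> 'w measure) \<Rightarrow> (real \<Rightarrow> 'w \<Rightarrow> real^2) \<Rightarrow> bool" where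
  "type_i P X \<longleftrightarrow> (\<exists>T :: real^2 \<Rightarrow> real^2. affine_map T \<and> bij T \<and> T ` E \<subseteq> lattice_points \<and>
     layer_structure (T ` E) ((\<lambda>u. T u - T 0) ` S) (\<lambda>y. P (inv T y)) (\<lambda>t \<omega>. T (X t \<omega>)) \<and>
     {vector [-1, 0]} \<subseteq> (\<lambda>u. T u - T 0) ` S \<and>
     (\<lambda>u. T u - T 0) ` S \<subseteq> {vector [-1, 0], vector [1, 0]} \<union> {vector [real K, -1] | K :: nat. True})"

lemma type_iI:
  fixes T :: "real^2 \<Rightarrow> real^2" and P :: "real^2 \<Rightarrow> 'w measure"
  assumes chain: "\<And>x. x \<in> E \<Longrightarrow> jump_chain (P x) Fi X E F" "\<And>x. x \<in> E \<Longrightarrow> AE \<omega> in P x. X 0 \<omega> = x"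
    and T: "affine_map T" "bij T" "T ` E \<subseteq> lattice_points"
    and u1: "u1 \<in> S" "T u1 - T 0 = vector [-1, 0]"
    and u0: "u0 \<in> S" "(T u0 - T 0) $ 2 = -1" "\<And>x. x \<in> E \<Longrightarrow> 0 < T x $ 2 \<Longrightarrow> 0 < F x {u0}"
    and steps: "\<And>u. u \<in> S \<Longrightarrow> T u - T 0 \<in> {vector [-1, 0], vector [1, 0]} \<union> {vector [real K, -1] | K :: nat. True}"
  shows "type_i P X"
  unfolding type_i_def
proof (intro exI[of _ T] conjI T)
  have steps2: "(T u - T 0) $ 2 \<in> {0, -1}" if "u \<in> S" for u
    using steps[OF that] by (auto simp del: vector_minus_component)
  have nat: "T x $ 2 \<in> \<nat>" if "x \<in> E" for x using T(3) that by blast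
  show "layer_structure (T ` E) ((\<lambda>u. T u - T 0) ` S) (\<lambda>y. P (inv T y)) (\<lambda>t \<omega>. T (X t \<omega>))"
    unfolding S_eq
    by (rule layer_structureI[OF chain finite_E T(1,2) nat steps2[unfolded S_eq] u0[unfolded S_eq]])
  show "{vector [-1, 0]} \<subseteq> (\<lambda>u. T u - T 0) ` S" using u1 by force
  show "(\<lambda>u. T u - T 0) ` S \<subseteq> {vector [-1, 0], vector [1, 0]} \<union> {vector [real K, -1] | K :: nat. True}"
    using steps by blast
qed

lemma coordinate_nat: "x \<in> E \<Longrightarrow> x $ k \<in> \<nat>"
  using lattice by auto

lemma layered_type_i:
  fixes P :: "real^2 \<Rightarrow> 'w measure"
  assumes chain: "\<And>x. x \<in> E \<Longrightarrow> jump_chain (P x) Fi X E F" "\<And>x. x \<in> E \<Longrightarrow> AE \<omega> in P x. X 0 \<omega> = x"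
    and l: "layered i j" and ij: "i \<noteq> j"
  shows "type_i P X"
proof -
  \<comment> \<open>The identity or the exchange of the coordinates, which puts the level into the
    second place; in either case \<open>T\<close> is its own inverse.\<close>
  define T :: "real^2 \<Rightarrow> real^2" where "T x = vector [x $ i, x $ j]" for x
  have T12: "T x $ 1 = x $ i" "T x $ 2 = x $ j" for x by (simp_all add: T_def)
  have T0: "T u - T 0 = vector [u $ i, u $ j]" for u by (rule vector_2_eqI) (simp_all add: T12)
  obtain u1 where u1: "down i u1" using down_ex by blast
  obtain u0 where u0: "down j u0" using down_ex by blast
  have two: "k = i \<or> k = j" for k using UNIV_two[OF ij] by auto
  have ax: "axis i c $ i = c" "axis i c $ j = (0::real)" for c using ij by (simp_all add: axis_def)
  show ?thesis
  proof (rule type_iI[OF chain, where T=T and ?u1.0=u1 and ?u0.0=u0])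
    show "affine_map T" unfolding T_def[abs_def] by (intro affine_map_vector affine_map_nth)
    have "(i = 1 \<and> j = 2) \<or> (i = 2 \<and> j = 1)" using exhaust_2[of i] exhaust_2[of j] ij by auto
    then have "T (T x) = x" for x by (auto simp: T12 vec_eq_iff forall_2)
    then show "bij T" by (intro o_bij[of T]) (auto simp: fun_eq_iff)
    have "T x $ l \<in> \<nat>" if "x \<in> E" for x l using exhaust_2[of l] coordinate_nat[OF that] T12 by auto
    then show "T ` E \<subseteq> lattice_points" by blast
    show "u1 \<in> S" "u0 \<in> S" using u1 u0 by (simp_all add: down_def)
    have "u1 = axis i (-1)" using l u1 by (simp add: layered_def)
    then show "T u1 - T 0 = vector [-1, 0]" unfolding T0 by (simp add: ax)
    show "(T u0 - T 0) $ 2 = -1" unfolding T0 using down_nth[OF u0] by simp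
    show "0 < F x {u0}" if "x \<in> E" "0 < T x $ 2" for x
      using rate_of_counter[of u0 "\<lambda>x. x $ j"] u0 that unfolding down_def T12 by (metis mult_pos_pos)
    fix u assume "u \<in> S"
    then consider "down i u" | "down j u" | \<psi> where "other u \<psi>" using cases_S two by metis
    then show "T u - T 0 \<in> {vector [-1, 0], vector [1, 0]} \<union> {vector [real K, -1] | K :: nat. True}"
    proof cases
      case 1
      then have "u = axis i (-1)" using l by (simp add: layered_def)
      then show ?thesis unfolding T0 by (simp add: ax)
    next
      case 2
      then obtain K where "u $ i = real K" using down_nat[OF 2, of i] ij by (auto elim!: Nats_cases)
      then show ?thesis unfolding T0 using down_nth[OF 2] by auto
    next
      case 3
      then have "u = axis i 1" using l by (auto simp: layered_def)
      then show ?thesis unfolding T0 by (simp add: ax)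
    qed
  qed
qed

text \<open>The jumps of the projections are \<open>(-1, 1)\<close> and \<open>(1, -1)\<close>. They
  keep \<open>x\<^sub>1 + x\<^sub>2\<close>, hence \<open>\<psi>\<close>, and become horizontal unit
  steps in the coordinates \<open>x\<^sub>1\<close> and \<open>\<psi> x\<close>. All other jumps
  lower \<open>\<psi>\<close>, the new level, by 1.\<close>

lemma sheared_type_i:
  fixes P :: "real^2 \<Rightarrow> 'w measure"
  assumes chain: "\<And>x. x \<in> E \<Longrightarrow> jump_chain (P x) Fi X E F" "\<And>x. x \<in> E \<Longrightarrow> AE \<omega> in P x. X 0 \<omega> = x"
    and s: sheared
  shows "type_i P X"
proof -
  obtain w \<psi> c where o: "other w \<psi>" and c: "0 < c" and slopes: "\<forall>k. slope \<psi> k = c"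
    and unique: "\<forall>w' \<psi>'. other w' \<psi>' \<longrightarrow> \<psi>' = \<psi>" using s unfolding sheared_def by blast
  have sl: "slope \<psi> k = c" for k using slopes by blast
  have uniq: "\<psi>' = \<psi>" if "other w' \<psi>'" for w' \<psi>' using unique that by blast
  have down1: "u $ j = 1" if "down i u" "i \<noteq> j" for i j u using s that unfolding sheared_def by blast
  have form: "\<psi> x = \<psi> 0 - c * x $ 1 - c * x $ 2" for x
    using affine_map_slope[OF other_affine[OF o], of 1 2 x] sl by simp
  have cw: "counter E w \<psi>" and wS: "w \<in> S" using o by (auto simp: other_def)
  define T :: "real^2 \<Rightarrow> real^2" where "T x = vector [x $ 1, \<psi> x]" for x
  define T' :: "real^2 \<Rightarrow> real^2" where "T' y = vector [y $ 1, (\<psi> 0 - y $ 2) / c - y $ 1]" for y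
  have T12: "T x $ 1 = x $ 1" "T x $ 2 = \<psi> x" for x by (simp_all add: T_def)
  have T0: "T u - T 0 = vector [u $ 1, \<psi> u - \<psi> 0]" for u by (rule vector_2_eqI) (simp_all add: T12)
  have inc: "\<psi> u - \<psi> 0 = - c * (u $ 1 + u $ 2)" for u using form[of u] by (simp add: algebra_simps)
  obtain u1 where u1: "down 1 u1" using down_ex by blast
  have lv1: "T u - T 0 = vector [-1, 0]" if "down 1 u" for u
    unfolding T0 inc using down1[OF that, of 2] down_nth[OF that] by simp
  show ?thesis
  proof (rule type_iI[OF chain, where T=T and ?u1.0=u1 and ?u0.0=w])
    show "affine_map T" unfolding T_def[abs_def] by (intro affine_map_vector affine_map_nth other_affine[OF o])
    have "T' (T x) = x" "T (T' x) = x" for x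
    proof -
      show "T' (T x) = x" unfolding T'_def T12 by (rule vector_2_eqI[symmetric]) (use c form[of x] in \<open>simp_all add: field_simps\<close>)
      have "\<psi> (T' x) = x $ 2" unfolding form[of "T' x"] using c by (simp add: T'_def field_simps)
      then show "T (T' x) = x" unfolding T_def by (intro vector_2_eqI[symmetric]) (simp_all add: T'_def)
    qed
    then show "bij T" by (intro o_bij[of T']) (auto simp: fun_eq_iff)
    \<comment> \<open>The new level is integral on \<open>E\<close>, being a counter, although its
      coefficient \<open>c\<close> need not be.\<close>
    have "T x $ l \<in> \<nat>" if "x \<in> E" for x l
      using exhaust_2[of l] coordinate_nat[OF that] counter_nat[OF cw that] T12 by auto
    then show "T ` E \<subseteq> lattice_points" by blast
    show "u1 \<in> S" using u1 by (simp add: down_def)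
    show "w \<in> S" by (rule wS)
    show "T u1 - T 0 = vector [-1, 0]" by (rule lv1[OF u1])
    show "(T w - T 0) $ 2 = -1" unfolding T0 using counter_unit[OF cw] by simp
    show "0 < F x {w}" if "x \<in> E" "0 < T x $ 2" for x
      using rate_of_counter[OF wS cw] that unfolding T12 by (metis mult_pos_pos)
    fix u assume "u \<in> S"
    then consider "down 1 u" | "down 2 u" | \<psi>' where "other u \<psi>'" using cases_S exhaust_2 by metis
    then show "T u - T 0 \<in> {vector [-1, 0], vector [1, 0]} \<union> {vector [real K, -1] | K :: nat. True}"
    proof cases
      case 1
      then show ?thesis using lv1 by simp
    next
      case 2
      then have "T u - T 0 = vector [1, 0]" unfolding T0 inc using down1[OF 2, of 1] down_nth[OF 2] by simp
      then show ?thesis by simp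
    next
      case 3
      then have "counter E u \<psi>" using uniq by (auto simp: other_def)
      moreover obtain K where "u $ 1 = real K" using other_nat[OF 3, of 1] by (auto elim!: Nats_cases)
      ultimately show ?thesis unfolding T0 using counter_unit[of E u \<psi>] by auto
    qed
  qed
qed

lemma counters_eq: "normalized_jump_counters E S = {\<lambda>x. x $ 1, \<lambda>x. x $ 2} \<union> {\<psi>. \<exists>w. other w \<psi>}"
proof -
  have "\<psi> \<in> {\<lambda>x. x $ 1, \<lambda>x. x $ 2} \<union> {\<psi>. \<exists>w. other w \<psi>}" if "u \<in> S" "counter E u \<psi>" for u \<psi>
  proof (cases "\<exists>k. \<psi> = (\<lambda>x. x $ k)")
    case True
    then obtain k where "\<psi> = (\<lambda>x. x $ k)" by blast
    then show ?thesis using exhaust_2[of k] by auto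
  next
    case False
    then show ?thesis using that by (auto simp: other_def)
  qed
  moreover have "other w \<psi> \<Longrightarrow> \<psi> \<in> normalized_jump_counters E S" for w \<psi>
    by (auto simp: normalized_jump_counters_eq other_def)
  ultimately show ?thesis using projection[of 1] projection[of 2] by (auto simp: normalized_jump_counters_eq)
qed

text \<open>At any point of \<open>E\<close> the counter and \<open>l\<close> are natural numbers,
  and the constant is their sum.\<close>

lemma other_const_nat:
  assumes o: "other w \<psi>" and form: "\<And>x. \<psi> x = \<psi> 0 - l x" and l: "\<And>x. x \<in> E \<Longrightarrow> l x \<in> \<nat>"
  obtains N where "\<psi> 0 = real N"
proof -
  have c: "counter E w \<psi>" using o by (simp add: other_def)
  then obtain x where x: "x \<in> E" using counter_pos[OF hull] by blast
  have "\<psi> x + l x \<in> \<nat>" by (intro Nats_add counter_nat[OF c x] l x)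
  then show thesis using form[of x] that by (auto elim!: Nats_cases)
qed

text \<open>Every further counter is a constant minus \<open>x\<^sub>1 + x\<^sub>2\<close>, so the
  jump of a second one would lower the first one too, which \<open>other_other\<close> excludes. A
  jump of a further counter has natural components with sum 1; a jump of a projection pairs -1 with
  0 or 1.\<close>

lemma simplicial_type_iii:
  assumes s: simplicial
  shows "normalized_jump_counters E S = {\<lambda>x. x $ 1, \<lambda>x. x $ 2} \<or>
       (\<exists>N :: nat. normalized_jump_counters E S =
          {\<lambda>x. real N - x $ 1 - x $ 2, \<lambda>x. x $ 1, \<lambda>x. x $ 2})" (is ?counters)
    and "S \<subseteq> {vector [-1, 0], vector [-1, 1], vector [0, -1], vector [0, 1], vector [1, -1], vector [1, 0]}" (is ?sizes)
proof -
  have slope: "slope \<psi> k = 1" if "other w \<psi>" for w \<psi> k using s that by (auto simp: simplicial_def)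
  have unit: "w $ 1 + w $ 2 = 1" if "other w \<psi>" for w \<psi> using other_unit[OF that, of 1 2] slope[OF that] by simp
  show ?counters
  proof (cases "\<exists>w \<psi>. other w \<psi>")
    case True
    then obtain w \<psi> where o: "other w \<psi>" by blast
    have "\<psi>' = \<psi>" if o': "other w' \<psi>'" for w' \<psi>'
    proof (rule ccontr)
      assume "\<psi>' \<noteq> \<psi>"
      from other_other[OF o o' this, of 1 2] show False using slope[OF o] unit[OF o'] by simp
    qed
    then have "{\<psi>. \<exists>w. other w \<psi>} = {\<psi>}" using o by blast
    moreover have form: "\<psi> x = \<psi> 0 - (x $ 1 + x $ 2)" for x
      using affine_map_slope[OF other_affine[OF o], of 1 2 x] slope[OF o] by simp
    moreover obtain N where "\<psi> 0 = real N"
      by (rule other_const_nat[OF o form]) (intro Nats_add coordinate_nat)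
    ultimately have "{\<psi>. \<exists>w. other w \<psi>} = {\<lambda>x. real N - x $ 1 - x $ 2}" by (auto simp: fun_eq_iff)
    then show ?thesis unfolding counters_eq by blast
  qed (simp add: counters_eq)
  show ?sizes
  proof
    fix u assume "u \<in> S"
    then consider k where "down k u" | \<psi> where "other u \<psi>" using cases_S by metis
    then show "u \<in> {vector [-1, 0], vector [-1, 1], vector [0, -1], vector [0, 1], vector [1, -1], vector [1, 0]}"
    proof cases
      case (1 k)
      have le: "u $ l = 0 \<or> u $ l = 1" if l: "k \<noteq> l" for l
      proof -
        have "u $ l \<le> 1" using s 1 l by (auto simp: simplicial_def)
        then show ?thesis using down_nat[OF 1 l] by (auto elim!: Nats_cases)
      qed
      show ?thesis
        using exhaust_2[of k]
      proof
        assume k: "k = 1"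
        then show ?thesis using le[of 2] down_nth[OF 1] vector_2_eqI[of u "-1"] by auto
      next
        assume k: "k = 2"
        then show ?thesis using le[of 1] down_nth[OF 1] vector_2_eqI[of u _ "-1"] by auto
      qed
    next
      case (2 \<psi>)
      then show ?thesis
        using nat_sum_one[OF other_nat[OF 2] other_nat[OF 2] unit[OF 2]] vector_2_eqI[of u] by auto
    qed
  qed
qed

lemma split_sizes:
  assumes split
  shows "{vector [-1, 0], vector [0, -1]} \<subseteq> S" (is ?lower)
    and "S \<subseteq> {vector [-1, 0], vector [0, -1], vector [1, 0], vector [0, 1]}" (is ?upper)
    and "\<forall>\<psi> \<in> normalized_jump_counters E S - {\<lambda>x. x $ 1, \<lambda>x. x $ 2}.
         (\<exists>N :: nat. \<psi> = (\<lambda>x. real N - x $ 1)) \<or> (\<exists>K :: nat. \<psi> = (\<lambda>x. real K - x $ 2))" (is ?counters)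
proof -
  have down: "u = axis k (-1)" if "down k u" for k u using assms that by (auto simp: split_def)
  have oth: "\<exists>k. w = axis k 1 \<and> \<psi> = (\<lambda>x. \<psi> 0 - x $ k)" if "other w \<psi>" for w \<psi> using assms that by (auto simp: split_def)
  have ax: "axis 1 c = (vector [c, 0] :: real^2)" "axis 2 c = (vector [0, c] :: real^2)" for c
    by (rule vector_2_eqI; simp add: axis_def)+
  have "axis k (-1) \<in> S" for k using down_ex[of k] down by (metis down_def)
  then show ?lower using ax(1)[of "-1"] ax(2)[of "-1"] by (metis empty_subsetI insert_subset)
  show ?upper
  proof
    fix u assume "u \<in> S"
    then consider k where "down k u" | \<psi> where "other u \<psi>" using cases_S by metis
    then show "u \<in> {vector [-1, 0], vector [0, -1], vector [1, 0], vector [0, 1]}"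
    proof cases
      case (1 k)
      then show ?thesis using down[OF 1] exhaust_2[of k] ax by auto
    next
      case (2 \<psi>)
      then obtain k where "u = axis k 1" using oth by blast
      then show ?thesis using exhaust_2[of k] ax by auto
    qed
  qed
  show ?counters
  proof
    fix \<psi> assume "\<psi> \<in> normalized_jump_counters E S - {\<lambda>x. x $ 1, \<lambda>x. x $ 2}"
    then obtain w where o: "other w \<psi>" unfolding counters_eq by blast
    then obtain k where k: "\<psi> = (\<lambda>x. \<psi> 0 - x $ k)" using oth by blast
    obtain N where N: "\<psi> 0 = real N"
      by (rule other_const_nat[OF o, of "\<lambda>x. x $ k"]) (use k coordinate_nat in \<open>auto dest: fun_cong\<close>)
    have "\<psi> = (\<lambda>x. real N - x $ k)" using k N by simp
    then show "(\<exists>N :: nat. \<psi> = (\<lambda>x. real N - x $ 1)) \<or> (\<exists>K :: nat. \<psi> = (\<lambda>x. real K - x $ 2))"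
      using exhaust_2[of k] by blast
  qed
qed

text \<open>The rate is a multiple of a counter that depends on coordinate \<open>k\<close> only, so
  it may be read off at the diagonal point whose coordinates all equal \<open>x $ k\<close>.\<close>

lemma split_rate:
  assumes sp: split and u: "axis k s \<in> S" "s \<noteq> 0"
  shows "F x {axis k s} = F (vec (x $ k)) {axis k s}"
  using cases_S[OF u(1)]
proof (elim disjE exE)
  fix l assume d: "down l (axis k s)"
  then have "axis k s = axis l (-1)" using sp by (auto simp: split_def)
  then have l: "l = k" using u(2) by (auto simp: axis_eq_axis)
  show ?thesis using rate_of_counter[of "axis k s" "\<lambda>x. x $ l"] d unfolding l down_def by (metis vec_component)
next
  fix \<psi> assume o: "other (axis k s) \<psi>"
  then obtain l where l: "axis k s = axis l 1" and \<psi>: "\<psi> = (\<lambda>x. \<psi> 0 - x $ l)" using sp unfolding split_def by blast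
  have lk: "l = k" using l u(2) by (auto simp: axis_eq_axis)
  have "\<psi> x = \<psi> (vec (x $ k))" using fun_cong[OF \<psi>, of x] fun_cong[OF \<psi>, of "vec (x $ k)"] lk by simp
  then show ?thesis using rate_of_counter[of "axis k s" \<psi>] o unfolding other_def by metis
qed

end

context planar_affine begin

lemma split_cases:
  assumes split "u \<in> S"
  obtains k s where "s = 1 \<or> s = -1" "u = axis k s"
proof -
  from cases_S[OF assms(2)] have "(\<exists>k. u = axis k (-1)) \<or> (\<exists>k. u = axis k 1)"
    using assms(1) unfolding split_def by blast
  then show thesis using that by blast
qed

text \<open>The rate as a function of one real variable, evaluated on the diagonal. It is 0 off
  \<open>S\<close>, because the results on single coordinates ask for the rates of both unit jumps
  even if only one of them is possible.\<close>

definition split_rate_at :: "real^2 \<Rightarrow> real \<Rightarrow> real" where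
  "split_rate_at u y = (if u \<in> S then F (vec y) {u} else 0)"

lemma affine_split_rate_at:
  assumes "\<And>A. affine_map (\<lambda>x. F x A)"
  shows "affine_map (split_rate_at u)"
proof (cases "u \<in> S")
  case True
  have "vec ((1 - t) *\<^sub>R x + t *\<^sub>R y) = (1 - t) *\<^sub>R (vec x :: real^2) + t *\<^sub>R vec y" for x y t :: real
    by (simp add: vec_eq_iff)
  then show ?thesis using assms[of "{u}"] True by (simp add: affine_map_def split_rate_at_def)
next
  case False
  then show ?thesis by (simp add: affine_map_def split_rate_at_def)
qed

text \<open>\<open>U\<close> contains all nonzero differences of states and is symmetric, so it
  contains \<open>axis k 1\<close> along with the possible jump \<open>axis k (-1)\<close>, whether
  or not the former has positive rate.\<close>

lemma split_chain:
  fixes Q :: "'w measure"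
  assumes chain: "jump_chain Q Fi X E F" and sp: split
  shows "axis k s \<in> jump_chain.U E \<longleftrightarrow> axis k (- s) \<in> jump_chain.U E"
    and "axis k (-1) \<in> jump_chain.U E"
    and "x \<in> E \<Longrightarrow> axis k s \<in> jump_chain.U E \<Longrightarrow> jump_chain.rate F (axis k s) x = split_rate_at (axis k s) (x $ k)"
    and "x \<in> E \<Longrightarrow> u \<in> jump_chain.U E \<Longrightarrow> (\<And>k s. s = 1 \<or> s = -1 \<Longrightarrow> u \<noteq> axis k s) \<Longrightarrow> jump_chain.rate F u x = 0"
proof -
  interpret jump_chain Q Fi X E F by (rule chain)
  have S': "S = {u\<in>U. \<exists>x\<in>E. 0 < rate u x}" unfolding S_eq jump_sizes_eq ..
  have zero: "rate u x = 0" if "x \<in> E" "u \<in> U" "u \<notin> S" for u x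
    using that rate_nonneg[OF that(1), of u] zero_notin_U unfolding S' by (metis (mono_tags, lifting) mem_Collect_eq order_le_less)
  have neg: "- v \<in> U" if "v \<in> U" for v
    using that unfolding U_def by (auto simp: image_iff) (metis minus_diff_eq)
  have am: "axis k (- s) = - axis k s" for s :: real by (simp add: vec_eq_iff axis_def)
  show "axis k s \<in> U \<longleftrightarrow> axis k (- s) \<in> U" using neg[of "axis k s"] neg[of "- axis k s"] unfolding am by auto
  obtain v where "down k v" using down_ex by blast
  then have "axis k (-1) \<in> S" using sp by (auto simp: down_def split_def)
  then show "axis k (-1) \<in> U" unfolding S' by blast
  show "rate (axis k s) x = split_rate_at (axis k s) (x $ k)" if "x \<in> E" "axis k s \<in> U"
  proof (cases "axis k s \<in> S")
    case True
    have "axis k 0 = (0 :: real^2)" by (simp add: vec_eq_iff axis_def)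
    then have "s \<noteq> 0" using that(2) zero_notin_U by metis
    then show ?thesis using split_rate[OF sp True, of x] True by (simp add: rate_def split_rate_at_def)
  next
    case False
    then show ?thesis using zero[OF that False] by (simp add: split_rate_at_def)
  qed
  show "rate u x = 0" if "x \<in> E" "u \<in> U" "\<And>k s. s = 1 \<or> s = -1 \<Longrightarrow> u \<noteq> axis k s"
  proof -
    have "u \<notin> S" using split_cases[OF sp, of u] that(3) by metis
    then show ?thesis by (rule zero[OF that(1,2)])
  qed
qed

lemma split_independent:
  fixes Q :: "'w measure"
  assumes chain: "jump_chain Q Fi X E F" and sp: split and start: "AE \<omega> in Q. X 0 \<omega> = x0"
  shows "independent_processes Q (\<lambda>t \<omega>. X t \<omega> $ 1) (\<lambda>t \<omega>. X t \<omega> $ 2)"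
proof -
  interpret jump_chain Q Fi X E F by (rule chain)
  note c = split_chain[OF chain sp]
  let ?U = "\<lambda>k::2. U \<inter> {axis k 1, axis k (-1)}"
  show ?thesis
  proof (rule independent_coordinates[where ?U1.0="?U 1" and ?U2.0="?U 2" and r=split_rate_at, OF _ _ _ _ _ _ start])
    show "?U 1 \<subseteq> U" "?U 2 \<subseteq> U" by auto
    show "?U 1 \<inter> ?U 2 = {}" by (auto simp: axis_eq_axis)
    show "rate u x = 0" if "x \<in> E" "u \<in> U - ?U 1 - ?U 2" for x u
    proof (rule c(4)[OF that(1)])
      fix k s assume s: "s = (1::real) \<or> s = -1"
      show "u \<noteq> axis k s" using exhaust_2[of k] s that(2) by auto
    qed (use that(2) in blast)
    show "u $ 2 = 0 \<and> rate u x = split_rate_at u (x $ 1)" if "x \<in> E" "u \<in> ?U 1" for x u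
      using that c(3)[OF that(1), of 1 1] c(3)[OF that(1), of 1 "-1"] by (auto simp: axis_def)
    show "u $ 1 = 0 \<and> rate u x = split_rate_at u (x $ 2)" if "x \<in> E" "u \<in> ?U 2" for x u
      using that c(3)[OF that(1), of 2 1] c(3)[OF that(1), of 2 "-1"] by (auto simp: axis_def)
  qed
qed

text \<open>The triplet has to be the same under all measures, so it is fixed before a starting
  point is chosen: atoms at 1 and -1 with masses affine in the coordinate, the mean of the truncated
  jumps as drift, and no diffusion.\<close>

lemma split_coordinate_affine:
  fixes P :: "real^2 \<Rightarrow> 'w measure"
  assumes chain: "\<And>x. x \<in> E \<Longrightarrow> jump_chain (P x) Fi X E F" and sp: split
    and proc: "process_in M Fi E X" and semi: "\<And>x. x \<in> E \<Longrightarrow> semimartingale (P x) Fi X"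
    and F: "\<And>A. affine_map (\<lambda>x. F x A)" and h1: "truncation_function h1"
  shows "\<exists>b1 c1 F1. affine_process M Fi E P h1 (coordinate j ` E) (\<lambda>t \<omega>. coordinate j (X t \<omega>)) b1 c1 F1"
proof -
  define rp where "rp = split_rate_at (axis j 1)"
  define rm where "rm = split_rate_at (axis j (-1))"
  define b1 where "b1 y = rp (y $ 1) *\<^sub>R h1 (vec 1) + rm (y $ 1) *\<^sub>R h1 (vec (-1))" for y :: "real^1"
  define F1 where "F1 y = (\<lambda>A :: (real^1) set. if A \<in> punctured_bounded then rp (y $ 1) * indicator A (vec 1) + rm (y $ 1) * indicator A (vec (-1)) else 0)"
    for y :: "real^1"
  have main: "affine_triplet (coordinate j ` E) b1 (\<lambda>_. 0) F1 \<and> has_characteristics (P x) Fi h1 (\<lambda>t \<omega>. coordinate j (X t \<omega>))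
      (\<lambda>t \<omega>. LBINT s:{0..t}. b1 (left_lim (\<lambda>r. coordinate j (X r \<omega>)) s))
      (\<lambda>t \<omega>. LBINT s:{0..t}. (\<lambda>_. 0 :: real^1^1) (left_lim (\<lambda>r. coordinate j (X r \<omega>)) s))
      (\<lambda>\<omega>. kernel_measure F1 (\<lambda>r. coordinate j (X r \<omega>)))" if x: "x \<in> E" for x
  proof -
    interpret jump_chain "P x" Fi X E F by (rule chain[OF x])
    note c = split_chain[OF chain[OF x] sp]
    have axes: "axis j 1 \<in> U" "axis j (-1) \<in> U" using c(1)[of j 1] c(2)[of j] by auto
    have rates: "rate (axis j 1) x = rp (x $ j)" "rate (axis j (-1)) x = rm (x $ j)" if "x \<in> E" for x
      unfolding rp_def rm_def using c(3)[OF that axes(1)] c(3)[OF that axes(2)] by simp_all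
    have no_other: "rate u x = 0" if "x \<in> E" "u \<in> U" "u $ j \<noteq> 0" "u \<noteq> axis j 1" "u \<noteq> axis j (-1)" for x u
    proof (rule c(4)[OF that(1,2)])
      fix k and s :: real assume s: "s = 1 \<or> s = -1"
      show "u \<noteq> axis k s"
      proof
        assume u: "u = axis k s"
        then have "k = j" using that(3) by (auto simp: axis_def split: if_splits)
        then show False using u s that(4,5) by auto
      qed
    qed
    show ?thesis
    proof
      show "affine_triplet (coordinate j ` E) b1 (\<lambda>_. 0) F1"
        by (rule coordinate_triplet[OF h1 axes rates no_other b1_def F1_def])
          (simp_all add: rp_def rm_def affine_split_rate_at[OF F])
      show "has_characteristics (P x) Fi h1 (\<lambda>t \<omega>. coordinate j (X t \<omega>))
        (\<lambda>t \<omega>. LBINT s:{0..t}. b1 (left_lim (\<lambda>r. coordinate j (X r \<omega>)) s))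
        (\<lambda>t \<omega>. LBINT s:{0..t}. (\<lambda>_. 0 :: real^1^1) (left_lim (\<lambda>r. coordinate j (X r \<omega>)) s))
        (\<lambda>\<omega>. kernel_measure F1 (\<lambda>r. coordinate j (X r \<omega>)))"
        by (rule coordinate_characteristics[OF h1 axes rates no_other b1_def F1_def])
    qed
  qed
  obtain u where "down j u" using down_ex by blast
  then obtain x where x: "x \<in> E" using counter_pos[OF hull] by (auto simp: down_def)
  have "process_in M Fi (coordinate j ` E) (\<lambda>t \<omega>. coordinate j (X t \<omega>))"
    using proc measurable_compose[OF _ coordinate_measurable] cadlag_coordinate
    unfolding process_in_def adapted_def by blast
  then have "affine_process M Fi E P h1 (coordinate j ` E) (\<lambda>t \<omega>. coordinate j (X t \<omega>)) b1 (\<lambda>_. 0) F1"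
    unfolding affine_process_def using main main[OF x] semimartingale_coordinate[OF semi] by blast
  then show ?thesis by blast
qed

end

theorem theorem5p5:
  fixes M :: "'w measure" and Fi :: "real \<Rightarrow> 'w measure"
    and E S :: "(real^2) set" and X :: "real \<Rightarrow> 'w \<Rightarrow> real^2" and P :: "real^2 \<Rightarrow> 'w measure"
    and h b :: "real^2 \<Rightarrow> real^2" and c :: "real^2 \<Rightarrow> real^2^2" and F :: "real^2 \<Rightarrow> (real^2) set \<Rightarrow> real"
  assumes "semimartingale_family M Fi E X P"
    and "truncation_function h"
    and "affine_process M Fi E P h E X b c F"
    and "compact E" and "E \<subseteq> lattice_points" and "affine hull E = UNIV"
    and "S = jump_sizes E F"
    and "(\<lambda>x. x $ 1) \<in> normalized_jump_counters E S"
    and "(\<lambda>x. x $ 2) \<in> normalized_jump_counters E S"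
  shows
    "(\<exists>T :: real^2 \<Rightarrow> real^2. affine_map T \<and> bij T \<and>
        T ` E \<subseteq> lattice_points \<and>
        layer_structure (T ` E) ((\<lambda>u. T u - T 0) ` S) (\<lambda>y. P (inv T y)) (\<lambda>t \<omega>. T (X t \<omega>)) \<and>
        {vector [-1, 0]} \<subseteq> (\<lambda>u. T u - T 0) ` S \<and>
        (\<lambda>u. T u - T 0) ` S \<subseteq>
          {vector [-1, 0], vector [1, 0]} \<union> {vector [real K, -1] | K :: nat. True})
     \<or>
     ((\<forall>j. \<forall>h\<^sub>1. truncation_function h\<^sub>1 \<longrightarrow>
         (\<exists>b\<^sub>1 c\<^sub>1 F\<^sub>1. affine_process M Fi E P h\<^sub>1 (coordinate j ` E) (\<lambda>t \<omega>. coordinate j (X t \<omega>)) b\<^sub>1 c\<^sub>1 F\<^sub>1)) \<and>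
      (\<forall>x\<in>E. independent_processes (P x) (\<lambda>t \<omega>. X t \<omega> $ 1) (\<lambda>t \<omega>. X t \<omega> $ 2)) \<and>
      {vector [-1, 0], vector [0, -1]} \<subseteq> S \<and>
      S \<subseteq> {vector [-1, 0], vector [0, -1], vector [1, 0], vector [0, 1]} \<and>
      (\<forall>\<psi> \<in> normalized_jump_counters E S - {\<lambda>x. x $ 1, \<lambda>x. x $ 2}.
         (\<exists>N :: nat. \<psi> = (\<lambda>x. real N - x $ 1)) \<or> (\<exists>K :: nat. \<psi> = (\<lambda>x. real K - x $ 2))))
     \<or>
     ((normalized_jump_counters E S = {\<lambda>x. x $ 1, \<lambda>x. x $ 2} \<or>
       (\<exists>N :: nat. normalized_jump_counters E S =
          {\<lambda>x. real N - x $ 1 - x $ 2, \<lambda>x. x $ 1, \<lambda>x. x $ 2})) \<and>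
      S \<subseteq> {vector [-1, 0], vector [-1, 1], vector [0, -1], vector [0, 1], vector [1, -1], vector [1, 0]})"
proof -
  have finE: "finite E" by (rule compact_lattice_finite[OF assms(4,5)])
  note chain = affine_jump_chain[OF assms(1,3) finE]
  have start: "AE \<omega> in P x. X 0 \<omega> = x" if "x \<in> E" for x
    using assms(1) that by (simp add: semimartingale_family_def)
  have F: "affine_map (\<lambda>x. F x A)" for A using assms(3) by (simp add: affine_process_def affine_triplet_def)
  have rate_counter: "\<exists>\<psi> a. 0 < a \<and> counter E u \<psi> \<and> (\<forall>x. F x {u} = a * \<psi> x)" if u: "u \<in> S" for u
  proof -
    \<comment> \<open>Any starting point serves, since the rates are given by \<open>F\<close> and
      do not depend on the measure.\<close>
    obtain x where x: "x \<in> E" using assms(1) by (auto simp: semimartingale_family_def)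
    interpret jump_chain "P x" Fi X E F by (rule chain[OF x])
    obtain x0 where x0: "x0 \<in> E" "0 < rate u x0" and "u \<in> U" using u unfolding assms(7) jump_sizes_eq by blast
    then have u0: "u \<noteq> 0" using zero_notin_U by blast
    show ?thesis
      by (rule counter_of_rate[OF finE F _ _ x0(1) x0(2)[unfolded rate_def] u0])
        (use rate_nonneg[OF _ u0] rate_posD[OF _ u0] in \<open>simp_all add: rate_def\<close>)
  qed
  interpret planar_affine E S F
  proof
    show "(\<lambda>x. x $ k) \<in> normalized_jump_counters E S" for k using exhaust_2[of k] assms(8,9) by auto
    show "\<exists>\<psi>. counter E u \<psi>" if "u \<in> S" for u using rate_counter[OF that] by blast
  qed (fact finE assms rate_counter)+
  from classification show ?thesis
  proof (elim disjE)
    assume l: "layered 1 2"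
    have "type_i P X" by (rule layered_type_i[OF chain start l]) simp_all
    then show ?thesis unfolding type_i_def by (rule disjI1)
  next
    assume l: "layered 2 1"
    have "type_i P X" by (rule layered_type_i[OF chain start l]) simp_all
    then show ?thesis unfolding type_i_def by (rule disjI1)
  next
    assume s: sheared
    have "type_i P X" by (rule sheared_type_i[OF chain start s])
    then show ?thesis unfolding type_i_def by (rule disjI1)
  next
    assume simplicial
    note iii = simplicial_type_iii[OF this]
    show ?thesis by (rule disjI2, rule disjI2, rule conjI, rule iii(1), rule iii(2))
  next
    assume sp: split
    have proc: "process_in M Fi E X" and semi: "\<And>x. x \<in> E \<Longrightarrow> semimartingale (P x) Fi X"
      using assms(1) by (simp_all add: semimartingale_family_def)
    show ?thesis
    proof (rule disjI2, rule disjI1, intro conjI allI impI ballI split_sizes(1,2)[OF sp] split_sizes(3)[OF sp, rule_format])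
      show "\<exists>b\<^sub>1 c\<^sub>1 F\<^sub>1. affine_process M Fi E P h\<^sub>1 (coordinate j ` E) (\<lambda>t \<omega>. coordinate j (X t \<omega>)) b\<^sub>1 c\<^sub>1 F\<^sub>1"
        if "truncation_function h\<^sub>1" for j h\<^sub>1
        by (rule split_coordinate_affine[OF chain sp proc semi F that])
      show "independent_processes (P x) (\<lambda>t \<omega>. X t \<omega> $ 1) (\<lambda>t \<omega>. X t \<omega> $ 2)" if "x \<in> E" for x
        by (rule split_independent[OF chain[OF that] sp start[OF that]])
    qed
  qed
qed

end
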